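(* Let $G$ be a compact abelian Lie group, $A$ a unital Fréchet algebra and $(A,G,\alpha)$ a smooth trivial NCP $G$-bundle such that $C_A^G$ is isomorphic to $\mathbb{C}$. Further, let $M$ be a manifold, $(U_i)_{i\in I}$ an open cover of $M$ and $U_{ij}:=U_i\cap U_j$ for $i,j\in I$. If $(g_{ij})_{i,j\in I}$ is a collection of functions $g_{ij}\in C^{\infty}(U_{ij},\operatorname{Aut}_G(A))$ satisfying $$g_{ii}={\bf 1}\quad\text{and}\quad g_{ij}g_{jk}=g_{ik}\ \text{ on }\ U_{ijk}:=U_i\cap U_j\cap U_k,$$ then the smooth dynamical system $(\Gamma\mathbb{A},G,\beta)$ associated with $(g_{ij})$ is a NCP $G$-bundle.
   Context: Manifolds such as $M$ are finite-dimensional, paracompact, second countable and smooth. A (smooth) dynamical system $(A,G,\alpha)$ consists of a unital locally convex $\mathbb{C}$-algebra $A$ (jointly continuous multiplication), the group $G$ and a homomorphism $\alpha:G\to\operatorname{Aut}(A)$ such that $(g,a)\mapsto\alpha(g)(a)$ is continuous (smooth) on $G\times A$. $C_A$ is the center of $A$, $C_A^G$ its $G$-fixed points, and $\operatorname{Aut}_G(A):=\{\varphi\in\operatorname{Aut}(A):\alpha(g)\circ\varphi=\varphi\circ\alpha(g)\ \forall g\in G\}$. Smoothness of $g_{ij}:U_{ij}\to\operatorname{Aut}_G(A)$ means that $U_{ij}\times A\to A$, $(x,a)\mapsto g_{ij}(x).a$ is smooth. The associated system: there is an algebra bundle $(\mathbb{A},M,A,q)$ (a smooth locally trivial bundle of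 unital algebras with fibre $A$) with bundle charts $\varphi_i:U_i\times A\to\mathbb{A}_{U_i}$ satisfying $(\varphi_i^{-1}\circ\varphi_j)(x,a)=(x,g_{ij}(x).a)$, and a smooth action $\sigma:G\times\mathbb{A}\to\mathbb{A}$ by fibrewise algebra automorphisms, $\sigma(g,\varphi_i(x,a_0))=\varphi_i(x,\alpha(g).a_0)$. $\Gamma\mathbb{A}$ is the algebra of smooth sections with the initial topology for the maps $\Gamma\mathbb{A}\to C^\infty(U_i,A)$, $s\mapsto\mathrm{pr}_A\circ\varphi_i^{-1}\circ s|_{U_i}$ (targets with the smooth compact open topology), and $\beta:G\times\Gamma\mathbb{A}\to\Gamma\mathbb{A}$, $\beta(g,s)(m):=\sigma(g,s(m))$, makes $(\Gamma\mathbb{A},G,\beta)$ a smooth dynamical system. Trivial NCP $G$-bundles: write $G\cong\mathbb{T}^n\times\Lambda$ with $\Lambda=C_{n_1}\times\cdots\times C_{n_k}$, $C_m$ the group of $m$-th roots of unity; then $\widehat{G}\cong\mathbb{Z}^n\times\Lambda$. For $\varphi\in\widehat{G}$ let $A_\varphi=\{a\in A:\alpha(g)(a)=\varphi(g)a\ \forall g\in G\}$. A (smooth) dynamical system is a (smooth) trivial NCP $G$-bundle if (G1) each $A_\varphi$ with $\varphi$ in the $\mathbb{Z}^n$-part contains an invertible element of $A$; (G2) for each $i=1,\dots,k$, with $A_i$ the isotypic component for the $i$-th standard generator (the character $(z,(w_1,\dots,w_k))\mapsto w_i$) of the $\Lambda$-part, there are an invertible $a_i\in A_i$ and $b_i\in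 A^G$ with $b_i^{n_i}=a_i^{n_i}$. NCP $G$-bundles: for a dynamical system $(B,G,\beta)$ let $Z:=C_B^G$ ($G$-fixed points in the center) and $\Gamma_Z$ its set of nonzero algebra homomorphisms to $\mathbb{C}$. For $z\in Z$ let $B_{\{z\}}:=C^{\infty}(\mathbb{R},B)/I_z$, $I_z$ the closure (smooth compact open topology) of the two-sided ideal generated by $t\mapsto1_B-tz$, with action $\beta_{\{z\}}(g)[f]:=[\beta(g)\circ f]$. $(B,G,\beta)$ is a NCP $G$-bundle if for each $\chi\in\Gamma_Z$ there is $z\in Z$ with $\chi(z)\neq0$ such that $(B_{\{z\}},G,\beta_{\{z\}})$ is a trivial NCP $G$-bundle. *)

theory Defs
  imports "HOL-Analysis.Analysis" "HOL-Algebra.QuotRing" "HOL-Algebra.Module"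
    "HOL-Algebra.Product_Groups"
begin

section \<open>Locally convex spaces and algebras\<close>

text \<open>
  Spaces and algebras carry an explicit carrier and an explicit topology, since function spaces
  and quotients of algebras have to be formed. One record type serves both for vector spaces
  and for algebras; for a mere vector space the fields \<open>mult\<close> and \<open>one\<close> are meaningless
  (as is usual for the records of HOL-Algebra modules).
\<close>

record ('s, 'v) tmodule = "('s, 'v) module" +
  topol :: "'v topology"

definition scalars :: "('s::real_normed_field, 's) tmodule" where
  "scalars = \<lparr>carrier = UNIV, monoid.mult = (*), one = 1, zero = 0, add = (+),
     smult = (*), topol = euclidean\<rparr>"

definition lc_space :: "('s::real_normed_field, 'v) tmodule \<Rightarrow> bool" where
  "lc_space E \<longleftrightarrow>
     Module.module (scalars :: ('s, 's) tmodule) E \<and>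
     topspace (topol E) = carrier E \<and>
     Hausdorff_space (topol E) \<and>
     continuous_map (prod_topology (topol E) (topol E)) (topol E) (\<lambda>(x, y). x \<oplus>\<^bsub>E\<^esub> y) \<and>
     continuous_map (prod_topology euclidean (topol E)) (topol E) (\<lambda>(c, x). c \<odot>\<^bsub>E\<^esub> x) \<and>
     (\<forall>W. openin (topol E) W \<and> \<zero>\<^bsub>E\<^esub> \<in> W \<longrightarrow>
        (\<exists>V. openin (topol E) V \<and> \<zero>\<^bsub>E\<^esub> \<in> V \<and> V \<subseteq> W \<and>
          (\<forall>x\<in>V. \<forall>y\<in>V. \<forall>t::real. 0 \<le> t \<and> t \<le> 1 \<longrightarrow>
             (of_real (1 - t) \<odot>\<^bsub>E\<^esub> x) \<oplus>\<^bsub>E\<^esub> (of_real t \<odot>\<^bsub>E\<^esub> y) \<in> V)))"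

text \<open>Associative unital complex algebras, not necessarily commutative
  (the locale \<open>algebra\<close> of HOL-Algebra demands commutativity).\<close>

definition complex_algebra :: "(complex, 'a, 'm) module_scheme \<Rightarrow> bool" where
  "complex_algebra A \<longleftrightarrow>
     Module.module (scalars :: (complex, complex) tmodule) A \<and> Ring.ring A \<and>
     (\<forall>c. \<forall>x\<in>carrier A. \<forall>y\<in>carrier A.
        (c \<odot>\<^bsub>A\<^esub> x) \<otimes>\<^bsub>A\<^esub> y = c \<odot>\<^bsub>A\<^esub> (x \<otimes>\<^bsub>A\<^esub> y) \<and>
        x \<otimes>\<^bsub>A\<^esub> (c \<odot>\<^bsub>A\<^esub> y) = c \<odot>\<^bsub>A\<^esub> (x \<otimes>\<^bsub>A\<^esub> y))"

definition lc_algebra :: "(complex, 'a) tmodule \<Rightarrow> bool" where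
  "lc_algebra A \<longleftrightarrow> complex_algebra A \<and> lc_space A \<and>
     continuous_map (prod_topology (topol A) (topol A)) (topol A) (\<lambda>(x, y). x \<otimes>\<^bsub>A\<^esub> y)"

text \<open>Completeness may be tested on sequences because the topology is metrizable.\<close>

definition frechet_algebra :: "(complex, 'a) tmodule \<Rightarrow> bool" where
  "frechet_algebra A \<longleftrightarrow> lc_algebra A \<and> metrizable_space (topol A) \<and>
     (\<forall>x :: nat \<Rightarrow> 'a.
        range x \<subseteq> carrier A \<and>
        (\<forall>W. openin (topol A) W \<and> \<zero>\<^bsub>A\<^esub> \<in> W \<longrightarrow>
           (\<exists>N. \<forall>m\<ge>N. \<forall>n\<ge>N. x m \<ominus>\<^bsub>A\<^esub> x n \<in> W))
        \<longrightarrow> (\<exists>l. limitin (topol A) x l sequentially))"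

definition alg_hom ::
    "(complex, 'a, 'm) module_scheme \<Rightarrow> (complex, 'b, 'n) module_scheme \<Rightarrow> ('a \<Rightarrow> 'b) set" where
  "alg_hom A B = {f \<in> carrier A \<rightarrow> carrier B.
     (\<forall>x\<in>carrier A. \<forall>y\<in>carrier A.
        f (x \<oplus>\<^bsub>A\<^esub> y) = f x \<oplus>\<^bsub>B\<^esub> f y \<and> f (x \<otimes>\<^bsub>A\<^esub> y) = f x \<otimes>\<^bsub>B\<^esub> f y) \<and>
     (\<forall>c. \<forall>x\<in>carrier A. f (c \<odot>\<^bsub>A\<^esub> x) = c \<odot>\<^bsub>B\<^esub> f x)}"

definition alg_iso ::
    "(complex, 'a, 'm) module_scheme \<Rightarrow> (complex, 'b, 'n) module_scheme \<Rightarrow> ('a \<Rightarrow> 'b) set" where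
  "alg_iso A B = {f \<in> alg_hom A B. bij_betw f (carrier A) (carrier B)}"

text \<open>Automorphisms of a locally convex algebra are topological.\<close>

definition alg_aut :: "(complex, 'a) tmodule \<Rightarrow> ('a \<Rightarrow> 'a) set" where
  "alg_aut A = {f \<in> alg_iso A A. homeomorphic_map (topol A) (topol A) f}"

definition realify :: "(complex, 'a) tmodule \<Rightarrow> (real, 'a) tmodule" where
  "realify A = \<lparr>carrier = carrier A, monoid.mult = monoid.mult A, one = one A,
     zero = zero A, add = add A, smult = (\<lambda>r. smult A (complex_of_real r)), topol = topol A\<rparr>"

definition prod_space :: "(real, 'v) tmodule \<Rightarrow> (real, 'w) tmodule \<Rightarrow> (real, 'v \<times> 'w) tmodule" where
  "prod_space E F = \<lparr>carrier = carrier E \<times> carrier F, monoid.mult = undefined, one = undefined,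
     zero = (\<zero>\<^bsub>E\<^esub>, \<zero>\<^bsub>F\<^esub>),
     add = (\<lambda>(x, y) (x', y'). (x \<oplus>\<^bsub>E\<^esub> x', y \<oplus>\<^bsub>F\<^esub> y')),
     smult = (\<lambda>r (x, y). (r \<odot>\<^bsub>E\<^esub> x, r \<odot>\<^bsub>F\<^esub> y)),
     topol = prod_topology (topol E) (topol F)\<rparr>"

text \<open>The space of dimension \<open>d\<close>, including \<open>d = 0\<close> (which the type class
  \<open>euclidean_space\<close> excludes), so that finite groups are Lie groups.\<close>

definition euclid :: "nat \<Rightarrow> (real, nat \<Rightarrow> real) tmodule" where
  "euclid d = \<lparr>carrier = {x. \<forall>i\<ge>d. x i = 0}, monoid.mult = undefined, one = undefined,
     zero = (\<lambda>i. 0), add = (\<lambda>x y i. x i + y i), smult = (\<lambda>r x i. r * x i),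
     topol = Euclidean_space d\<rparr>"


section \<open>Smooth maps between open subsets of locally convex spaces\<close>

text \<open>
  Smoothness is understood in the sense of Michal and Bastiani: all iterated directional
  derivatives \<open>d\<^sup>k f(x)(h\<^sub>0,\<dots>,h\<^sub>k\<^sub>-\<^sub>1)\<close> exist and are jointly continuous in \<open>x\<close> and the \<open>h\<^sub>i\<close>.
\<close>

definition has_dir_deriv ::
    "(real, 'v) tmodule \<Rightarrow> (real, 'w) tmodule \<Rightarrow> ('v \<Rightarrow> 'w) \<Rightarrow> 'v \<Rightarrow> 'v \<Rightarrow> 'w \<Rightarrow> bool" where
  "has_dir_deriv E F f x h l \<longleftrightarrow>
     limitin (topol F)
       (\<lambda>t::real. inverse t \<odot>\<^bsub>F\<^esub> (f (x \<oplus>\<^bsub>E\<^esub> t \<odot>\<^bsub>E\<^esub> h) \<ominus>\<^bsub>F\<^esub> f x)) l (at 0)"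

definition dir_deriv ::
    "(real, 'v) tmodule \<Rightarrow> (real, 'w) tmodule \<Rightarrow> ('v \<Rightarrow> 'w) \<Rightarrow> 'v \<Rightarrow> 'v \<Rightarrow> 'w" where
  "dir_deriv E F f x h = (THE l. has_dir_deriv E F f x h l)"

primrec iter_deriv ::
    "(real, 'v) tmodule \<Rightarrow> (real, 'w) tmodule \<Rightarrow> ('v \<Rightarrow> 'w) \<Rightarrow> nat \<Rightarrow> (nat \<Rightarrow> 'v) \<Rightarrow> 'v \<Rightarrow> 'w" where
  "iter_deriv E F f 0 h x = f x"
| "iter_deriv E F f (Suc k) h x = dir_deriv E F (iter_deriv E F f k h) x (h k)"

definition jet_topology :: "(real, 'v) tmodule \<Rightarrow> 'v set \<Rightarrow> nat \<Rightarrow> ('v \<times> (nat \<Rightarrow> 'v)) topology" where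
  "jet_topology E W k =
     prod_topology (subtopology (topol E) W) (product_topology (\<lambda>_. topol E) {..<k})"

text \<open>Meaningful for open \<open>W\<close> only; all uses below are of this kind.\<close>

definition smooth_on ::
    "(real, 'v) tmodule \<Rightarrow> (real, 'w) tmodule \<Rightarrow> 'v set \<Rightarrow> ('v \<Rightarrow> 'w) \<Rightarrow> bool" where
  "smooth_on E F W f \<longleftrightarrow>
     (\<forall>k. (\<forall>x\<in>W. \<forall>h\<in>{..k} \<rightarrow> carrier E. \<exists>l. has_dir_deriv E F (iter_deriv E F f k h) x (h k) l) \<and>
          continuous_map (jet_topology E W k) (topol F) (\<lambda>(x, h). iter_deriv E F f k h x))"


section \<open>Manifolds modelled on locally convex spaces\<close>

text \<open>An atlas consists of pairs of a chart domain and a chart map; it need not be maximal.\<close>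

record ('p, 'v) mfd =
  model :: "(real, 'v) tmodule"
  mtop :: "'p topology"
  atlas :: "('p set \<times> ('p \<Rightarrow> 'v)) set"

definition smooth_manifold :: "('p, 'v) mfd \<Rightarrow> bool" where
  "smooth_manifold M \<longleftrightarrow>
     lc_space (model M) \<and> Hausdorff_space (mtop M) \<and>
     \<Union> (fst ` atlas M) = topspace (mtop M) \<and>
     (\<forall>(U, \<phi>)\<in>atlas M. openin (mtop M) U \<and> openin (topol (model M)) (\<phi> ` U) \<and>
        homeomorphic_map (subtopology (mtop M) U) (subtopology (topol (model M)) (\<phi> ` U)) \<phi>) \<and>
     (\<forall>(U, \<phi>)\<in>atlas M. \<forall>(V, \<psi>)\<in>atlas M.
        smooth_on (model M) (model M) (\<phi> ` (U \<inter> V)) (\<psi> \<circ> inv_into U \<phi>))"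

text \<open>Paracompactness follows from the conditions below (locally compact, Hausdorff and second
  countable).\<close>

definition fd_manifold :: "('p, nat \<Rightarrow> real) mfd \<Rightarrow> bool" where
  "fd_manifold M \<longleftrightarrow> smooth_manifold M \<and> (\<exists>d. model M = euclid d) \<and> second_countable (mtop M)"

definition smooth_map :: "('p, 'v) mfd \<Rightarrow> ('q, 'w) mfd \<Rightarrow> ('p \<Rightarrow> 'q) \<Rightarrow> bool" where
  "smooth_map M N f \<longleftrightarrow>
     continuous_map (mtop M) (mtop N) f \<and>
     (\<forall>(U, \<phi>)\<in>atlas M. \<forall>(V, \<psi>)\<in>atlas N.
        smooth_on (model M) (model N) (\<phi> ` {x \<in> U. f x \<in> V}) (\<psi> \<circ> f \<circ> inv_into U \<phi>))"

definition diffeomorphism :: "('p, 'v) mfd \<Rightarrow> ('q, 'w) mfd \<Rightarrow> ('p \<Rightarrow> 'q) \<Rightarrow> bool" where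
  "diffeomorphism M N f \<longleftrightarrow>
     bij_betw f (topspace (mtop M)) (topspace (mtop N)) \<and>
     smooth_map M N f \<and> smooth_map N M (inv_into (topspace (mtop M)) f)"

definition space_mfd :: "(real, 'v) tmodule \<Rightarrow> ('v, 'v) mfd" where
  "space_mfd E = \<lparr>model = E, mtop = topol E, atlas = {(carrier E, \<lambda>x. x)}\<rparr>"

abbreviation alg_mfd :: "(complex, 'a) tmodule \<Rightarrow> ('a, 'a) mfd" where
  "alg_mfd A \<equiv> space_mfd (realify A)"

definition real_line :: "(real, real) mfd" where
  "real_line = space_mfd scalars"

definition prod_mfd :: "('p, 'v) mfd \<Rightarrow> ('q, 'w) mfd \<Rightarrow> ('p \<times> 'q, 'v \<times> 'w) mfd" where
  "prod_mfd M N = \<lparr>model = prod_space (model M) (model N),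
     mtop = prod_topology (mtop M) (mtop N),
     atlas = {(U \<times> V, map_prod \<phi> \<psi>) | U \<phi> V \<psi>. (U, \<phi>) \<in> atlas M \<and> (V, \<psi>) \<in> atlas N}\<rparr>"

definition open_submfd :: "('p, 'v) mfd \<Rightarrow> 'p set \<Rightarrow> ('p, 'v) mfd" where
  "open_submfd M W = \<lparr>model = model M, mtop = subtopology (mtop M) W,
     atlas = {(U \<inter> W, \<phi>) | U \<phi>. (U, \<phi>) \<in> atlas M}\<rparr>"


section \<open>The algebra of smooth functions with values in a locally convex algebra\<close>

definition Cinf_carrier :: "('p, 'v) mfd \<Rightarrow> (complex, 'b) tmodule \<Rightarrow> ('p \<Rightarrow> 'b) set" where
  "Cinf_carrier M B = {f \<in> extensional (topspace (mtop M)). smooth_map M (alg_mfd B) f}"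

text \<open>
  The smooth compact open topology is the initial topology for the maps sending \<open>f\<close> to the
  iterated derivatives of its local representatives, where spaces of continuous functions carry
  the compact open topology. The whole carrier is added to the subbasis only to cover
  the empty manifold with empty atlas.
\<close>

definition Cinf_topology :: "('p, 'v) mfd \<Rightarrow> (complex, 'b) tmodule \<Rightarrow> ('p \<Rightarrow> 'b) topology" where
  "Cinf_topology M B = topology_generated_by (insert (Cinf_carrier M B)
     {{f \<in> Cinf_carrier M B.
         \<forall>(x, h)\<in>K. iter_deriv (model M) (realify B) (f \<circ> inv_into U \<phi>) k h x \<in> W}
      | U \<phi> k K W. (U, \<phi>) \<in> atlas M \<and> compactin (jet_topology (model M) (\<phi> ` U) k) K \<and>
          openin (topol B) W})"

definition Cinf :: "('p, 'v) mfd \<Rightarrow> (complex, 'b) tmodule \<Rightarrow> (complex, 'p \<Rightarrow> 'b) tmodule" where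
  "Cinf M B = \<lparr>carrier = Cinf_carrier M B,
     monoid.mult = (\<lambda>f g. \<lambda>x\<in>topspace (mtop M). f x \<otimes>\<^bsub>B\<^esub> g x),
     one = (\<lambda>x\<in>topspace (mtop M). \<one>\<^bsub>B\<^esub>),
     zero = (\<lambda>x\<in>topspace (mtop M). \<zero>\<^bsub>B\<^esub>),
     add = (\<lambda>f g. \<lambda>x\<in>topspace (mtop M). f x \<oplus>\<^bsub>B\<^esub> g x),
     smult = (\<lambda>c f. \<lambda>x\<in>topspace (mtop M). c \<odot>\<^bsub>B\<^esub> f x),
     topol = Cinf_topology M B\<rparr>"


section \<open>Dynamical systems\<close>

record ('g, 'v) lie_group_rec = "'g monoid" +
  mfd_of :: "('g, 'v) mfd"

definition lie_group :: "('g, nat \<Rightarrow> real) lie_group_rec \<Rightarrow> bool" where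
  "lie_group G \<longleftrightarrow> Group.group G \<and> fd_manifold (mfd_of G) \<and>
     topspace (mtop (mfd_of G)) = carrier G \<and>
     smooth_map (prod_mfd (mfd_of G) (mfd_of G)) (mfd_of G) (\<lambda>(g, h). g \<otimes>\<^bsub>G\<^esub> h) \<and>
     smooth_map (mfd_of G) (mfd_of G) (\<lambda>g. inv\<^bsub>G\<^esub> g)"

definition compact_abelian_lie_group :: "('g, nat \<Rightarrow> real) lie_group_rec \<Rightarrow> bool" where
  "compact_abelian_lie_group G \<longleftrightarrow>
     lie_group G \<and> comm_group G \<and> compact_space (mtop (mfd_of G))"

definition dynamical_system ::
    "('g, nat \<Rightarrow> real) lie_group_rec \<Rightarrow> (complex, 'a) tmodule \<Rightarrow> ('g \<Rightarrow> 'a \<Rightarrow> 'a) \<Rightarrow> bool" where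
  "dynamical_system G A \<alpha> \<longleftrightarrow> lc_algebra A \<and>
     (\<forall>g\<in>carrier G. \<alpha> g \<in> alg_aut A) \<and>
     (\<forall>a\<in>carrier A. \<alpha> \<one>\<^bsub>G\<^esub> a = a) \<and>
     (\<forall>g\<in>carrier G. \<forall>h\<in>carrier G. \<forall>a\<in>carrier A. \<alpha> (g \<otimes>\<^bsub>G\<^esub> h) a = \<alpha> g (\<alpha> h a)) \<and>
     continuous_map (prod_topology (mtop (mfd_of G)) (topol A)) (topol A) (\<lambda>(g, a). \<alpha> g a)"

definition smooth_dynamical_system ::
    "('g, nat \<Rightarrow> real) lie_group_rec \<Rightarrow> (complex, 'a) tmodule \<Rightarrow> ('g \<Rightarrow> 'a \<Rightarrow> 'a) \<Rightarrow> bool" where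
  "smooth_dynamical_system G A \<alpha> \<longleftrightarrow> dynamical_system G A \<alpha> \<and>
     smooth_map (prod_mfd (mfd_of G) (alg_mfd A)) (alg_mfd A) (\<lambda>(g, a). \<alpha> g a)"

definition fixed_points ::
    "('g, nat \<Rightarrow> real) lie_group_rec \<Rightarrow> (complex, 'a) tmodule \<Rightarrow> ('g \<Rightarrow> 'a \<Rightarrow> 'a) \<Rightarrow> 'a set" where
  "fixed_points G A \<alpha> = {a \<in> carrier A. \<forall>g\<in>carrier G. \<alpha> g a = a}"

definition alg_center :: "(complex, 'a) tmodule \<Rightarrow> 'a set" where
  "alg_center A = {z \<in> carrier A. \<forall>a\<in>carrier A. z \<otimes>\<^bsub>A\<^esub> a = a \<otimes>\<^bsub>A\<^esub> z}"

definition fixed_center ::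
    "('g, nat \<Rightarrow> real) lie_group_rec \<Rightarrow> (complex, 'a) tmodule \<Rightarrow> ('g \<Rightarrow> 'a \<Rightarrow> 'a) \<Rightarrow>
     (complex, 'a) tmodule" where
  "fixed_center G A \<alpha> =
     A\<lparr>carrier := alg_center A \<inter> fixed_points G A \<alpha>,
       topol := subtopology (topol A) (alg_center A \<inter> fixed_points G A \<alpha>)\<rparr>"

definition alg_aut_equivariant ::
    "('g, nat \<Rightarrow> real) lie_group_rec \<Rightarrow> (complex, 'a) tmodule \<Rightarrow> ('g \<Rightarrow> 'a \<Rightarrow> 'a) \<Rightarrow>
     ('a \<Rightarrow> 'a) set" where
  "alg_aut_equivariant G A \<alpha> =
     {f \<in> alg_aut A. \<forall>g\<in>carrier G. \<forall>a\<in>carrier A. \<alpha> g (f a) = f (\<alpha> g a)}"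


section \<open>Trivial NCP bundles\<close>

text \<open>The group \<open>T\<^sup>n \<times> C\<^sub>m\<^sub>1 \<times> \<dots> \<times> C\<^sub>m\<^sub>k\<close>, where \<open>ns = [m\<^sub>1, \<dots>, m\<^sub>k]\<close>.\<close>

definition circle_group :: "complex monoid" where
  "circle_group = \<lparr>carrier = sphere 0 1, monoid.mult = (*), one = 1\<rparr>"

definition roots_group :: "nat \<Rightarrow> complex monoid" where
  "roots_group m = \<lparr>carrier = {w. w ^ m = 1}, monoid.mult = (*), one = 1\<rparr>"

definition std_group :: "nat \<Rightarrow> nat list \<Rightarrow> ((nat \<Rightarrow> complex) \<times> (nat \<Rightarrow> complex)) monoid" where
  "std_group n ns = product_group {..<n} (\<lambda>_. circle_group) \<times>\<times>
     product_group {..<length ns} (\<lambda>j. roots_group (ns ! j))"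

definition std_topology ::
    "nat \<Rightarrow> nat list \<Rightarrow> ((nat \<Rightarrow> complex) \<times> (nat \<Rightarrow> complex)) topology" where
  "std_topology n ns = prod_topology
     (product_topology (\<lambda>_. top_of_set (carrier circle_group)) {..<n})
     (product_topology (\<lambda>j. top_of_set (carrier (roots_group (ns ! j)))) {..<length ns})"

text \<open>A chosen identification of \<open>G\<close> with the standard group. Continuous homomorphisms of Lie
  groups are smooth, so it is an isomorphism of Lie groups.\<close>

definition std_identification ::
    "('g, nat \<Rightarrow> real) lie_group_rec \<Rightarrow> nat \<Rightarrow> nat list \<Rightarrow>
     ('g \<Rightarrow> (nat \<Rightarrow> complex) \<times> (nat \<Rightarrow> complex)) \<Rightarrow> bool" where
  "std_identification G n ns \<theta> \<longleftrightarrow> (\<forall>m\<in>set ns. m \<ge> 1) \<and> \<theta> \<in> iso G (std_group n ns) \<and>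
     homeomorphic_map (mtop (mfd_of G)) (std_topology n ns) \<theta>"

definition isotypic ::
    "('g, nat \<Rightarrow> real) lie_group_rec \<Rightarrow> (complex, 'a) tmodule \<Rightarrow> ('g \<Rightarrow> 'a \<Rightarrow> 'a) \<Rightarrow>
     ('g \<Rightarrow> complex) \<Rightarrow> 'a set" where
  "isotypic G A \<alpha> \<phi> = {a \<in> carrier A. \<forall>g\<in>carrier G. \<alpha> g a = \<phi> g \<odot>\<^bsub>A\<^esub> a}"

definition torus_character ::
    "nat \<Rightarrow> ('g \<Rightarrow> (nat \<Rightarrow> complex) \<times> (nat \<Rightarrow> complex)) \<Rightarrow> (nat \<Rightarrow> int) \<Rightarrow> 'g \<Rightarrow> complex" where
  "torus_character n \<theta> m g = (\<Prod>i<n. fst (\<theta> g) i powi m i)"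

definition root_character ::
    "('g \<Rightarrow> (nat \<Rightarrow> complex) \<times> (nat \<Rightarrow> complex)) \<Rightarrow> nat \<Rightarrow> 'g \<Rightarrow> complex" where
  "root_character \<theta> j g = snd (\<theta> g) j"

definition ncp_G1 ::
    "('g, nat \<Rightarrow> real) lie_group_rec \<Rightarrow> nat \<Rightarrow>
     ('g \<Rightarrow> (nat \<Rightarrow> complex) \<times> (nat \<Rightarrow> complex)) \<Rightarrow>
     (complex, 'a) tmodule \<Rightarrow> ('g \<Rightarrow> 'a \<Rightarrow> 'a) \<Rightarrow> bool" where
  "ncp_G1 G n \<theta> A \<alpha> \<longleftrightarrow>
     (\<forall>m :: nat \<Rightarrow> int. isotypic G A \<alpha> (torus_character n \<theta> m) \<inter> Units A \<noteq> {})"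

definition ncp_G2 ::
    "('g, nat \<Rightarrow> real) lie_group_rec \<Rightarrow> nat list \<Rightarrow>
     ('g \<Rightarrow> (nat \<Rightarrow> complex) \<times> (nat \<Rightarrow> complex)) \<Rightarrow>
     (complex, 'a) tmodule \<Rightarrow> ('g \<Rightarrow> 'a \<Rightarrow> 'a) \<Rightarrow> bool" where
  "ncp_G2 G ns \<theta> A \<alpha> \<longleftrightarrow>
     (\<forall>j<length ns. \<exists>a \<in> isotypic G A \<alpha> (root_character \<theta> j) \<inter> Units A.
        \<exists>b \<in> fixed_points G A \<alpha>. b [^]\<^bsub>A\<^esub> (ns ! j) = a [^]\<^bsub>A\<^esub> (ns ! j))"

definition trivial_ncp_bundle ::
    "('g, nat \<Rightarrow> real) lie_group_rec \<Rightarrow> nat \<Rightarrow> nat list \<Rightarrow>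
     ('g \<Rightarrow> (nat \<Rightarrow> complex) \<times> (nat \<Rightarrow> complex)) \<Rightarrow>
     (complex, 'a) tmodule \<Rightarrow> ('g \<Rightarrow> 'a \<Rightarrow> 'a) \<Rightarrow> bool" where
  "trivial_ncp_bundle G n ns \<theta> A \<alpha> \<longleftrightarrow>
     dynamical_system G A \<alpha> \<and> ncp_G1 G n \<theta> A \<alpha> \<and> ncp_G2 G ns \<theta> A \<alpha>"

definition smooth_trivial_ncp_bundle ::
    "('g, nat \<Rightarrow> real) lie_group_rec \<Rightarrow> nat \<Rightarrow> nat list \<Rightarrow>
     ('g \<Rightarrow> (nat \<Rightarrow> complex) \<times> (nat \<Rightarrow> complex)) \<Rightarrow>
     (complex, 'a) tmodule \<Rightarrow> ('g \<Rightarrow> 'a \<Rightarrow> 'a) \<Rightarrow> bool" where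
  "smooth_trivial_ncp_bundle G n ns \<theta> A \<alpha> \<longleftrightarrow>
     smooth_dynamical_system G A \<alpha> \<and> ncp_G1 G n \<theta> A \<alpha> \<and> ncp_G2 G ns \<theta> A \<alpha>"


section \<open>Localization and NCP bundles\<close>

text \<open>The quotient of a topological algebra by a two-sided ideal, as a set of cosets with the
  quotient topology.\<close>

definition quot_topology :: "(complex, 'a) tmodule \<Rightarrow> 'a set \<Rightarrow> 'a set topology" where
  "quot_topology A I = topology (\<lambda>W. W \<subseteq> carrier (A Quot I) \<and>
     openin (topol A) {x \<in> topspace (topol A). I +>\<^bsub>A\<^esub> x \<in> W})"

lemma openin_quot_topology:
  "openin (quot_topology A I) W \<longleftrightarrow>
     W \<subseteq> carrier (A Quot I) \<and> openin (topol A) {x \<in> topspace (topol A). I +>\<^bsub>A\<^esub> x \<in> W}"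
proof -
  let ?P = "\<lambda>W. W \<subseteq> carrier (A Quot I) \<and>
     openin (topol A) {x \<in> topspace (topol A). I +>\<^bsub>A\<^esub> x \<in> W}"
  have "istopology ?P"
    unfolding istopology_def
  proof (intro conjI allI impI)
    fix S T assume ST: "?P S" "?P T"
    have "{x \<in> topspace (topol A). I +>\<^bsub>A\<^esub> x \<in> S \<inter> T} =
        {x \<in> topspace (topol A). I +>\<^bsub>A\<^esub> x \<in> S} \<inter> {x \<in> topspace (topol A). I +>\<^bsub>A\<^esub> x \<in> T}"
      by blast
    then show "openin (topol A) {x \<in> topspace (topol A). I +>\<^bsub>A\<^esub> x \<in> S \<inter> T}"
      using ST by (metis (no_types, lifting) openin_Int)
    show "S \<inter> T \<subseteq> carrier (A Quot I)"
      using ST by blast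
  next
    fix \<K> assume K: "\<forall>K\<in>\<K>. ?P K"
    have "{x \<in> topspace (topol A). I +>\<^bsub>A\<^esub> x \<in> \<Union>\<K>} =
        (\<Union>K\<in>\<K>. {x \<in> topspace (topol A). I +>\<^bsub>A\<^esub> x \<in> K})"
      by blast
    moreover have "openin (topol A) (\<Union>K\<in>\<K>. {x \<in> topspace (topol A). I +>\<^bsub>A\<^esub> x \<in> K})"
      using K by (intro openin_Union) auto
    ultimately show "openin (topol A) {x \<in> topspace (topol A). I +>\<^bsub>A\<^esub> x \<in> \<Union>\<K>}"
      by (simp only:)
    show "\<Union>\<K> \<subseteq> carrier (A Quot I)"
      using K by blast
  qed
  then show ?thesis
    unfolding quot_topology_def by (simp add: topology_inverse')
qed

definition quot_algebra :: "(complex, 'a) tmodule \<Rightarrow> 'a set \<Rightarrow> (complex, 'a set) tmodule" where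
  "quot_algebra A I = \<lparr>carrier = carrier (A Quot I), monoid.mult = monoid.mult (A Quot I),
     one = one (A Quot I), zero = zero (A Quot I), add = add (A Quot I),
     smult = (\<lambda>c X. \<Union>x\<in>X. I +>\<^bsub>A\<^esub> (c \<odot>\<^bsub>A\<^esub> x)), topol = quot_topology A I\<rparr>"

definition loc_ideal :: "(complex, 'b) tmodule \<Rightarrow> 'b \<Rightarrow> (real \<Rightarrow> 'b) set" where
  "loc_ideal B z = topol (Cinf real_line B) closure_of
     genideal (Cinf real_line B) {\<lambda>t. \<one>\<^bsub>B\<^esub> \<ominus>\<^bsub>B\<^esub> (complex_of_real t \<odot>\<^bsub>B\<^esub> z)}"

definition localization :: "(complex, 'b) tmodule \<Rightarrow> 'b \<Rightarrow> (complex, (real \<Rightarrow> 'b) set) tmodule" where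
  "localization B z = quot_algebra (Cinf real_line B) (loc_ideal B z)"

text \<open>The union is over the representatives \<open>f\<close> of the class \<open>X\<close>, all of which yield the same
  class when \<open>\<beta>\<close> acts by topological automorphisms fixing \<open>z\<close>.\<close>

definition loc_action ::
    "(complex, 'b) tmodule \<Rightarrow> 'b \<Rightarrow> ('g \<Rightarrow> 'b \<Rightarrow> 'b) \<Rightarrow> 'g \<Rightarrow> (real \<Rightarrow> 'b) set \<Rightarrow> (real \<Rightarrow> 'b) set" where
  "loc_action B z \<beta> g X = (\<Union>f\<in>X. loc_ideal B z +>\<^bsub>Cinf real_line B\<^esub> (\<lambda>t. \<beta> g (f t)))"

definition characters :: "(complex, 'z) tmodule \<Rightarrow> ('z \<Rightarrow> complex) set" where
  "characters Z =
     {\<omega> \<in> alg_hom Z (scalars :: (complex, complex) tmodule). \<exists>z\<in>carrier Z. \<omega> z \<noteq> 0}"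

definition ncp_bundle ::
    "('g, nat \<Rightarrow> real) lie_group_rec \<Rightarrow> nat \<Rightarrow> nat list \<Rightarrow>
     ('g \<Rightarrow> (nat \<Rightarrow> complex) \<times> (nat \<Rightarrow> complex)) \<Rightarrow>
     (complex, 'b) tmodule \<Rightarrow> ('g \<Rightarrow> 'b \<Rightarrow> 'b) \<Rightarrow> bool" where
  "ncp_bundle G n ns \<theta> B \<beta> \<longleftrightarrow> dynamical_system G B \<beta> \<and>
     (\<forall>\<omega> \<in> characters (fixed_center G B \<beta>). \<exists>z \<in> carrier (fixed_center G B \<beta>).
        \<omega> z \<noteq> 0 \<and> trivial_ncp_bundle G n ns \<theta> (localization B z) (loc_action B z \<beta>))"


section \<open>Algebra bundles and their sections\<close>

definition equivariant_cocycle ::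
    "('g, nat \<Rightarrow> real) lie_group_rec \<Rightarrow> (complex, 'a) tmodule \<Rightarrow> ('g \<Rightarrow> 'a \<Rightarrow> 'a) \<Rightarrow>
     ('p, nat \<Rightarrow> real) mfd \<Rightarrow> 'i set \<Rightarrow> ('i \<Rightarrow> 'p set) \<Rightarrow> ('i \<Rightarrow> 'i \<Rightarrow> 'p \<Rightarrow> 'a \<Rightarrow> 'a) \<Rightarrow> bool" where
  "equivariant_cocycle G A \<alpha> M I U g \<longleftrightarrow>
     (\<forall>i\<in>I. \<forall>j\<in>I.
        (\<forall>x\<in>U i \<inter> U j. g i j x \<in> alg_aut_equivariant G A \<alpha>) \<and>
        smooth_map (prod_mfd (open_submfd M (U i \<inter> U j)) (alg_mfd A)) (alg_mfd A)
          (\<lambda>(x, a). g i j x a)) \<and>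
     (\<forall>i\<in>I. \<forall>x\<in>U i. \<forall>a\<in>carrier A. g i i x a = a) \<and>
     (\<forall>i\<in>I. \<forall>j\<in>I. \<forall>k\<in>I. \<forall>x\<in>U i \<inter> U j \<inter> U k. \<forall>a\<in>carrier A.
        g i j x (g j k x a) = g i k x a)"

text \<open>A bundle over a manifold with points of type \<open>'p\<close>: total space, projection, the algebra
  structures of the fibres, and a bundle chart for each index.\<close>

record ('p, 'a, 'e, 'w, 'i) fibre_bundle =
  total :: "('e, 'w) mfd"
  proj :: "'e \<Rightarrow> 'p"
  fibre :: "'p \<Rightarrow> (complex, 'e) module"
  chart :: "'i \<Rightarrow> 'p \<times> 'a \<Rightarrow> 'e"

definition chart_inv ::
    "(complex, 'a) tmodule \<Rightarrow> ('i \<Rightarrow> 'p set) \<Rightarrow> ('p, 'a, 'e, 'w, 'i) fibre_bundle \<Rightarrow> 'i \<Rightarrow> 'e \<Rightarrow> 'p \<times> 'a"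
  where "chart_inv A U E i = inv_into (U i \<times> carrier A) (chart E i)"

definition over :: "('p, 'a, 'e, 'w, 'i) fibre_bundle \<Rightarrow> 'p set \<Rightarrow> 'e set" where
  "over E W = {e \<in> topspace (mtop (total E)). proj E e \<in> W}"

definition algebra_bundle ::
    "(complex, 'a) tmodule \<Rightarrow> ('p, nat \<Rightarrow> real) mfd \<Rightarrow> 'i set \<Rightarrow> ('i \<Rightarrow> 'p set) \<Rightarrow>
     ('p, 'a, 'e, 'w, 'i) fibre_bundle \<Rightarrow> bool" where
  "algebra_bundle A M I U E \<longleftrightarrow>
     smooth_manifold (total E) \<and> smooth_map (total E) M (proj E) \<and>
     (\<forall>x\<in>topspace (mtop M). complex_algebra (fibre E x) \<and> carrier (fibre E x) = over E {x}) \<and>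
     (\<forall>i\<in>I.
        diffeomorphism (prod_mfd (open_submfd M (U i)) (alg_mfd A))
          (open_submfd (total E) (over E (U i))) (chart E i) \<and>
        (\<forall>x\<in>U i. \<forall>a\<in>carrier A. proj E (chart E i (x, a)) = x) \<and>
        (\<forall>x\<in>U i. (\<lambda>a. chart E i (x, a)) \<in> alg_iso A (fibre E x)))"

definition associated_bundle ::
    "(complex, 'a) tmodule \<Rightarrow> ('p, nat \<Rightarrow> real) mfd \<Rightarrow> 'i set \<Rightarrow> ('i \<Rightarrow> 'p set) \<Rightarrow>
     ('i \<Rightarrow> 'i \<Rightarrow> 'p \<Rightarrow> 'a \<Rightarrow> 'a) \<Rightarrow> ('p, 'a, 'e, 'w, 'i) fibre_bundle \<Rightarrow> bool" where
  "associated_bundle A M I U g E \<longleftrightarrow> algebra_bundle A M I U E \<and>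
     (\<forall>i\<in>I. \<forall>j\<in>I. \<forall>x\<in>U i \<inter> U j. \<forall>a\<in>carrier A.
        chart_inv A U E i (chart E j (x, a)) = (x, g i j x a))"

definition associated_action ::
    "('g, nat \<Rightarrow> real) lie_group_rec \<Rightarrow> (complex, 'a) tmodule \<Rightarrow> ('g \<Rightarrow> 'a \<Rightarrow> 'a) \<Rightarrow>
     ('p, nat \<Rightarrow> real) mfd \<Rightarrow> 'i set \<Rightarrow> ('i \<Rightarrow> 'p set) \<Rightarrow>
     ('p, 'a, 'e, 'w, 'i) fibre_bundle \<Rightarrow> ('g \<Rightarrow> 'e \<Rightarrow> 'e) \<Rightarrow> bool" where
  "associated_action G A \<alpha> M I U E \<sigma> \<longleftrightarrow>
     smooth_map (prod_mfd (mfd_of G) (total E)) (total E) (\<lambda>(g, e). \<sigma> g e) \<and>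
     (\<forall>e\<in>topspace (mtop (total E)). \<sigma> \<one>\<^bsub>G\<^esub> e = e \<and>
        (\<forall>g\<in>carrier G. \<forall>h\<in>carrier G. \<sigma> (g \<otimes>\<^bsub>G\<^esub> h) e = \<sigma> g (\<sigma> h e))) \<and>
     (\<forall>g\<in>carrier G. \<forall>x\<in>topspace (mtop M). \<sigma> g \<in> alg_iso (fibre E x) (fibre E x)) \<and>
     (\<forall>g\<in>carrier G. \<forall>i\<in>I. \<forall>x\<in>U i. \<forall>a\<in>carrier A.
        \<sigma> g (chart E i (x, a)) = chart E i (x, \<alpha> g a))"

definition sections :: "('p, nat \<Rightarrow> real) mfd \<Rightarrow> ('p, 'a, 'e, 'w, 'i) fibre_bundle \<Rightarrow> ('p \<Rightarrow> 'e) set" where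
  "sections M E = {s \<in> extensional (topspace (mtop M)).
     smooth_map M (total E) s \<and> (\<forall>x\<in>topspace (mtop M). proj E (s x) = x)}"

definition local_rep ::
    "(complex, 'a) tmodule \<Rightarrow> ('i \<Rightarrow> 'p set) \<Rightarrow> ('p, 'a, 'e, 'w, 'i) fibre_bundle \<Rightarrow>
     'i \<Rightarrow> ('p \<Rightarrow> 'e) \<Rightarrow> 'p \<Rightarrow> 'a" where
  "local_rep A U E i s = (\<lambda>x\<in>U i. snd (chart_inv A U E i (s x)))"

text \<open>The initial topology for the maps \<open>local_rep A U E i\<close>, \<open>i \<in> I\<close>. The whole carrier is added
  to the subbasis only to cover an empty index set.\<close>

definition section_topology ::
    "(complex, 'a) tmodule \<Rightarrow> ('p, nat \<Rightarrow> real) mfd \<Rightarrow> 'i set \<Rightarrow> ('i \<Rightarrow> 'p set) \<Rightarrow>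
     ('p, 'a, 'e, 'w, 'i) fibre_bundle \<Rightarrow> ('p \<Rightarrow> 'e) topology" where
  "section_topology A M I U E = topology_generated_by (insert (sections M E)
     {{s \<in> sections M E. local_rep A U E i s \<in> W} | i W.
        i \<in> I \<and> openin (topol (Cinf (open_submfd M (U i)) A)) W})"

definition section_algebra ::
    "(complex, 'a) tmodule \<Rightarrow> ('p, nat \<Rightarrow> real) mfd \<Rightarrow> 'i set \<Rightarrow> ('i \<Rightarrow> 'p set) \<Rightarrow>
     ('p, 'a, 'e, 'w, 'i) fibre_bundle \<Rightarrow> (complex, 'p \<Rightarrow> 'e) tmodule" where
  "section_algebra A M I U E = \<lparr>carrier = sections M E,
     monoid.mult = (\<lambda>s t. \<lambda>x\<in>topspace (mtop M). s x \<otimes>\<^bsub>fibre E x\<^esub> t x),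
     one = (\<lambda>x\<in>topspace (mtop M). \<one>\<^bsub>fibre E x\<^esub>),
     zero = (\<lambda>x\<in>topspace (mtop M). \<zero>\<^bsub>fibre E x\<^esub>),
     add = (\<lambda>s t. \<lambda>x\<in>topspace (mtop M). s x \<oplus>\<^bsub>fibre E x\<^esub> t x),
     smult = (\<lambda>c s. \<lambda>x\<in>topspace (mtop M). c \<odot>\<^bsub>fibre E x\<^esub> s x),
     topol = section_topology A M I U E\<rparr>"

definition section_action ::
    "('p, nat \<Rightarrow> real) mfd \<Rightarrow> ('g \<Rightarrow> 'e \<Rightarrow> 'e) \<Rightarrow> 'g \<Rightarrow> ('p \<Rightarrow> 'e) \<Rightarrow> 'p \<Rightarrow> 'e" where
  "section_action M \<sigma> g s = (\<lambda>x\<in>topspace (mtop M). \<sigma> g (s x))"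

end

theory Submission
  imports Defs
begin

text \<open>
  Let \<open>Z\<close> be the algebra of fixed central sections. The real smooth functions \<open>f\<close> on the base embed
  into \<open>Z\<close> as the sections \<open>f \<cdot> 1\<close> (\<open>lift\<close>). A character of \<open>Z\<close> maps \<open>f\<close> to one of its values \<open>f x\<close>,
  since \<open>(f - a)\<^sup>2 + b\<^sup>2\<close> is invertible unless \<open>b = 0\<close> and \<open>f\<close> takes the value \<open>a\<close>; in particular it is
  positive. Therefore it does not vanish on every member of a locally finite family of nonnegative
  functions without common zero (\<open>character_detects\<close>). Choosing a family of bump functions
  (\<open>ex_bump_family\<close>) yields a function \<open>f\<close> with support inside a single trivializing set \<open>U i\<close> such
  that the character does not vanish on \<open>z = f \<cdot> 1\<close>. This is the element at which to localize.

  An element \<open>a\<close> of the fibre, multiplied by \<open>f\<close>, extends by zero to a global section \<open>spread i f a\<close>,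
  which is isotypic (or fixed) if \<open>a\<close> is. If \<open>a\<close> is invertible, then the product of the sections that
  belong to \<open>a\<close> and to its inverse is \<open>z z\<close>. As \<open>z\<close> becomes invertible in the localization, so does the
  section of \<open>a\<close>, and \<open>ncp_G1\<close> and \<open>ncp_G2\<close> pass from the fibre to the localization
  (\<open>trivial_localization\<close>, \<open>ncp_bundle_sections\<close>).

  It remains to see that the sections and their localizations form dynamical systems. Smooth
  functions with values in a locally convex algebra form such an algebra again: their topology is
  given by suprema of derivatives over compact sets of jets, and the Leibniz formula estimates these
  seminorms on products (\<open>lc_algebra_C\<close>). A compact group acts equicontinuously, hence continuously on
  smooth functions (\<open>dynamical_system_Cinf\<close>). Both statements pass to initial topologies, thus to
  sections, and to quotients by closed ideals, thus to localizations (\<open>lc_algebra_initial\<close>,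
  \<open>dyn_\<Gamma>\<close>, \<open>lc_algebra_Q\<close>, \<open>dynamical_system_Q\<close>). Smooth maps between locally convex spaces are treated
  by the mean value theorem for seminorms, from which the chain rule follows (\<open>smooth_compose\<close>).
\<close>

text \<open>Operations of a structure named by a single letter carry that letter as a plain subscript.\<close>

syntax "_index" :: "logic => index" ("\<^sub>_" [1000] 1000)

section \<open>Real topological vector spaces with explicit carrier\<close>

lemma scalars_simps [simp]:
 "carrier (scalars :: ('s::real_normed_field, 's) tmodule) = UNIV"
 "monoid.mult (scalars :: ('s::real_normed_field, 's) tmodule) = (*)"
 "one (scalars :: ('s::real_normed_field, 's) tmodule) = 1"
 "zero (scalars :: ('s::real_normed_field, 's) tmodule) = 0"
 "add (scalars :: ('s::real_normed_field, 's) tmodule) = (+)"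
 "smult (scalars :: ('s::real_normed_field, 's) tmodule) = (*)"
 "topol (scalars :: ('s::real_normed_field, 's) tmodule) = euclidean"
 by (simp_all add: scalars_def)

lemma cring_scalars: "cring (scalars :: ('s::real_normed_field, 's) tmodule)"
proof (intro cringI abelian_groupI comm_monoidI)
 fix x :: 's assume "x \<in> carrier (scalars :: ('s, 's) tmodule)"
 show "\<exists>y\<in>carrier (scalars :: ('s, 's) tmodule). y \<oplus>\<^bsub>(scalars :: ('s, 's) tmodule)\<^esub> x = \<zero>\<^bsub>(scalars :: ('s, 's) tmodule)\<^esub>"
  by (auto intro: exI[of _ "- x"])
qed (auto simp: algebra_simps)

text \<open>The module laws over the record \<open>scalars\<close>, restated with ordinary real arithmetic.\<close>

locale rmod = fixes E :: "(real, 'v) tmodule" (structure)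
 assumes mod: "Module.module (scalars :: (real, real) tmodule) E"
begin

sublocale abelian_group E
 using mod by (simp add: module_def)

lemma smul_closed [simp, intro]: "x \<in> carrier E ==> r \<odot> x \<in> carrier E"
 using module.smult_closed[OF mod] by simp

lemma smul_add_left: "x \<in> carrier E ==> (r + s) \<odot> x = r \<odot> x \<oplus> s \<odot> x"
 using module.smult_l_distr[OF mod, of r s x] by simp

lemma smul_add_right: "x \<in> carrier E ==> y \<in> carrier E ==> r \<odot> (x \<oplus> y) = r \<odot> x \<oplus> r \<odot> y"
 using module.smult_r_distr[OF mod, of r x y] by simp

lemma smul_smul [simp]: "x \<in> carrier E ==> r \<odot> (s \<odot> x) = (r * s) \<odot> x"
 using module.smult_assoc1[OF mod, of r s x] by simp

lemma smul_one [simp]: "x \<in> carrier E ==> 1 \<odot> x = x"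
 using module.smult_one[OF mod, of x] by simp

lemma smul_zero_left [simp]: "x \<in> carrier E ==> 0 \<odot> x = \<zero>"
 using module.smult_l_null[OF mod, of x] by simp

lemma smul_zero_right [simp]: "r \<odot> \<zero> = \<zero>"
 using module.smult_r_null[OF mod, of r] by simp

lemma smul_neg_one: "x \<in> carrier E ==> (-1) \<odot> x = \<ominus> x"
proof -
 assume x: "x \<in> carrier E"
 have "(-1) \<odot> x \<oplus> x = (-1 + 1) \<odot> x"
  using x by (simp only: smul_add_left smul_one)
 then show "(-1) \<odot> x = \<ominus> x"
  using x by (intro minus_equality[symmetric]) auto
qed


lemma sub_eq: "x \<in> carrier E ==> y \<in> carrier E ==> x \<ominus> y = x \<oplus> (-1) \<odot> y"
 by (simp add: a_minus_def smul_neg_one)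

lemma smul_sub: "x \<in> carrier E ==> y \<in> carrier E ==> r \<odot> (x \<ominus> y) = r \<odot> x \<ominus> r \<odot> y"
 by (simp add: sub_eq smul_add_right)

lemma sub_add_sub: "x \<in> carrier E ==> y \<in> carrier E ==> z \<in> carrier E ==> (x \<ominus> y) \<oplus> (y \<ominus> z) = x \<ominus> z"
 by (simp add: a_minus_def a_ac r_neg1 r_neg2)

lemma add_cancel_right: "x \<in> carrier E ==> y \<in> carrier E ==> x \<oplus> (y \<oplus> \<ominus> x) = y"
 using a_lcomm[of x y "\<ominus> x"] by (simp add: r_neg)

lemma add_sub_cancel: "x \<in> carrier E ==> y \<in> carrier E ==> (x \<oplus> y) \<ominus> x = y"
 using add_cancel_right[of x y] by (simp add: a_minus_def a_assoc)

lemma add_sub_inverse: "x \<in> carrier E ==> y \<in> carrier E ==> x \<oplus> (y \<ominus> x) = y"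
 using add_cancel_right[of x y] by (simp add: a_minus_def)

lemma sub_self [simp]: "x \<in> carrier E ==> x \<ominus> x = \<zero>"
 by (simp add: a_minus_def r_neg)

lemma sub_zero [simp]: "x \<in> carrier E ==> x \<ominus> \<zero> = x"
 by (simp add: a_minus_def)

lemma minus_sub: "x \<in> carrier E ==> y \<in> carrier E ==> \<ominus> (x \<ominus> y) = y \<ominus> x"
 by (simp add: a_minus_def minus_add a_ac)

lemma add_sub_add: "a \<in> carrier E ==> b \<in> carrier E ==> c \<in> carrier E ==> d \<in> carrier E ==>
  (a \<oplus> b) \<ominus> (c \<oplus> d) = (a \<ominus> c) \<oplus> (b \<ominus> d)"
 by (simp add: a_minus_def minus_add a_ac)

lemma smul_sub_left: "x \<in> carrier E ==> (r - s) \<odot> x = r \<odot> x \<ominus> s \<odot> x"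
 using smul_add_left[of x r "-s"] by (simp add: sub_eq)

end

definition seminorm :: "(real, 'v) tmodule => ('v => real) => bool" where
 "seminorm E p \<longleftrightarrow>
   (\<forall>x\<in>carrier E. \<forall>y\<in>carrier E. p (x \<oplus>\<^sub>E y) \<le> p x + p y) \<and>
   (\<forall>r. \<forall>x\<in>carrier E. p (r \<odot>\<^sub>E x) = \<bar>r\<bar> * p x)"

definition cseminorm :: "(real, 'v) tmodule => ('v => real) => bool" where
 "cseminorm E p \<longleftrightarrow> seminorm E p \<and> continuous_map (topol E) euclideanreal p"

context rmod
begin

lemma seminorm_add: "seminorm E p ==> x \<in> carrier E ==> y \<in> carrier E ==> p (x \<oplus> y) \<le> p x + p y"
 by (simp add: seminorm_def)

lemma seminorm_smul: "seminorm E p ==> x \<in> carrier E ==> p (r \<odot> x) = \<bar>r\<bar> * p x"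
 by (simp add: seminorm_def)

lemma seminorm_zero: "seminorm E p ==> p \<zero> = 0"
 using seminorm_smul[of p \<zero> 0] by simp

lemma seminorm_minus: "seminorm E p ==> x \<in> carrier E ==> p (\<ominus> x) = p x"
 using seminorm_smul[of p x "-1"] by (simp add: smul_neg_one)

lemma seminorm_nonneg: "seminorm E p ==> x \<in> carrier E ==> 0 \<le> p x"
 using seminorm_add[of p x "\<ominus> x"] by (simp add: seminorm_minus seminorm_zero r_neg)

lemma seminorm_sub_commute: "seminorm E p ==> x \<in> carrier E ==> y \<in> carrier E ==> p (x \<ominus> y) = p (y \<ominus> x)"
 using seminorm_minus[of p "y \<ominus> x"] by (simp add: minus_sub)

lemma seminorm_triangle: "seminorm E p ==> x \<in> carrier E ==> y \<in> carrier E ==> z \<in> carrier E ==>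
  p (x \<ominus> z) \<le> p (x \<ominus> y) + p (y \<ominus> z)"
 using seminorm_add[of p "x \<ominus> y" "y \<ominus> z"] by (simp add: sub_add_sub)

lemma seminorm_diff: "seminorm E p ==> x \<in> carrier E ==> y \<in> carrier E ==> \<bar>p x - p y\<bar> \<le> p (x \<ominus> y)"
 using seminorm_triangle[of p x y \<zero>] seminorm_triangle[of p y x \<zero>]
 by (simp add: seminorm_sub_commute[of p x y])

lemma cseminorm_sum:
 assumes "finite F" "\<And>i. i \<in> F ==> cseminorm E (p i)"
 shows "cseminorm E (\<lambda>x. \<Sum>i\<in>F. p i x)"
 using assms unfolding cseminorm_def seminorm_def
 by (auto simp: sum_distrib_left sum.distrib[symmetric] intro!: sum_mono continuous_map_sum)

lemma cseminorm_scale: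
 assumes "cseminorm E p" "0 \<le> c"
 shows "cseminorm E (\<lambda>x. c * p x)"
 using assms unfolding cseminorm_def seminorm_def
 by (auto simp: distrib_left[symmetric] mult_left_mono intro!: continuous_map_real_mult_left)

lemma cseminorm_zero_fun: "cseminorm E (\<lambda>x. 0)"
 by (simp add: cseminorm_def seminorm_def)

end

definition lin_map :: "(real, 'v) tmodule => (real, 'w) tmodule => ('v => 'w) => bool" where
 "lin_map E F L \<longleftrightarrow> L \<in> carrier E \<rightarrow> carrier F \<and>
   (\<forall>x\<in>carrier E. \<forall>y\<in>carrier E. L (x \<oplus>\<^sub>E y) = L x \<oplus>\<^sub>F L y) \<and>
   (\<forall>r. \<forall>x\<in>carrier E. L (r \<odot>\<^sub>E x) = r \<odot>\<^sub>F L x)"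

lemma cseminorm_comp:
 assumes "cseminorm F p" "lin_map E F L" "continuous_map (topol E) (topol F) L"
 shows "cseminorm E (\<lambda>x. p (L x))"
 using assms continuous_map_compose[OF assms(3), of euclideanreal p]
 unfolding cseminorm_def seminorm_def lin_map_def by (auto simp: o_def Pi_iff)

lemma lin_map_sub:
 assumes "rmod E" "rmod F" "lin_map E F L" "x \<in> carrier E" "y \<in> carrier E"
 shows "L (x \<ominus>\<^sub>E y) = L x \<ominus>\<^sub>F L y"
proof -
 interpret E: rmod E by fact
 interpret F: rmod F by fact
 have "L x \<in> carrier F" "L y \<in> carrier F" using assms by (auto simp: lin_map_def)
 then show ?thesis
  using assms by (simp add: E.sub_eq F.sub_eq lin_map_def)
qed

section \<open>Locally convex spaces and their continuous seminorms\<close>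

lemma limitin_compose2:
 assumes "continuous_map (prod_topology X Y) Z (\<lambda>(x, y). f x y)"
  and "limitin X u a F" "limitin Y v b F"
 shows "limitin Z (\<lambda>t. f (u t) (v t)) (f a b) F"
proof -
 have "limitin (prod_topology X Y) (\<lambda>t. (u t, v t)) (a, b) F"
  using assms(2,3) by (simp add: limitin_pairwise o_def)
 from continuous_map_limit[OF assms(1) this] show ?thesis
  by (simp add: o_def)
qed

locale rlc = fixes E :: "(real, 'v) tmodule" (structure)
 assumes lc: "lc_space E"
begin

sublocale rmod E
 by (rule rmod.intro) (use lc in \<open>simp add: lc_space_def\<close>)

lemma topspace_eq [simp]: "topspace (topol E) = carrier E"
 using lc by (simp add: lc_space_def)

lemma Hausdorff: "Hausdorff_space (topol E)"
 using lc by (simp add: lc_space_def)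

lemma cont_add: "continuous_map (prod_topology (topol E) (topol E)) (topol E) (\<lambda>(x, y). x \<oplus> y)"
 using lc by (simp add: lc_space_def)

lemma cont_smul: "continuous_map (prod_topology euclideanreal (topol E)) (topol E) (\<lambda>(c, x). c \<odot> x)"
 using lc by (simp add: lc_space_def)

lemma continuous_add:
 "continuous_map X (topol E) f ==> continuous_map X (topol E) g ==> continuous_map X (topol E) (\<lambda>x. f x \<oplus> g x)"
 using continuous_map_compose[OF _ cont_add, of X "\<lambda>x. (f x, g x)"]
 by (simp add: o_def continuous_map_pairwise)

lemma continuous_smul:
 "continuous_map X euclideanreal f ==> continuous_map X (topol E) g ==> continuous_map X (topol E) (\<lambda>x. f x \<odot> g x)"
 using continuous_map_compose[OF _ cont_smul, of X "\<lambda>x. (f x, g x)"]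
 by (simp add: o_def continuous_map_pairwise)

lemma continuous_closed: "continuous_map X (topol E) f ==> x \<in> topspace X ==> f x \<in> carrier E"
 using continuous_map_image_subset_topspace[of X "topol E" f] by auto

lemma continuous_sub:
 assumes "continuous_map X (topol E) f" "continuous_map X (topol E) g"
 shows "continuous_map X (topol E) (\<lambda>x. f x \<ominus> g x)"
proof -
 have "continuous_map X (topol E) (\<lambda>x. f x \<oplus> (-1) \<odot> g x)"
  by (intro continuous_add continuous_smul assms) auto
 then show ?thesis
  by (rule continuous_map_eq) (simp add: sub_eq continuous_closed[OF assms(1)] continuous_closed[OF assms(2)])
qed

lemma lim_add: "limitin (topol E) u a F ==> limitin (topol E) v b F ==> limitin (topol E) (\<lambda>t. u t \<oplus> v t) (a \<oplus> b) F"
 by (rule limitin_compose2[OF cont_add])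

lemma lim_smul: "(r \<longlongrightarrow> c) F ==> limitin (topol E) v b F ==> limitin (topol E) (\<lambda>t. r t \<odot> v t) (c \<odot> b) F"
 by (rule limitin_compose2[OF cont_smul]) auto

lemma lim_closed: "limitin (topol E) u a F ==> a \<in> carrier E"
 using limitin_topspace[of "topol E" u a F] by simp

lemma lim_eventually: "limitin (topol E) u a F ==> \<forall>\<^sub>F t in F. u t \<in> carrier E"
 using limitinD[of "topol E" u a F "carrier E"] openin_topspace[of "topol E"] lim_closed[of u a F] by simp

lemma lim_unique: "limitin (topol E) u a F ==> limitin (topol E) u b F ==> F \<noteq> bot ==> a = b"
 using limitin_Hausdorff_unique[OF _ _ _ Hausdorff] by blast

lemma continuous_translate: "x \<in> carrier E ==> continuous_map (topol E) (topol E) (\<lambda>y. y \<ominus> x)"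
 by (intro continuous_sub) auto

text \<open>The Minkowski gauge of a symmetric convex open neighbourhood of zero.\<close>

lemma ex_cseminorm_zero:
 assumes "openin (topol E) W" "\<zero> \<in> W"
 shows "\<exists>p. cseminorm E p \<and> (\<forall>x\<in>carrier E. p x < 1 --> x \<in> W)"
proof -
 obtain V where V: "openin (topol E) V" "\<zero> \<in> V" "V \<subseteq> W"
  and conv: "\<And>x y t. x \<in> V ==> y \<in> V ==> 0 \<le> t ==> t \<le> 1 ==> (1 - t) \<odot> x \<oplus> t \<odot> y \<in> V"
  using lc assms unfolding lc_space_def by (auto simp: of_real_def)
 have Vc: "x \<in> carrier E" if "x \<in> V" for x
  using openin_subset[OF V(1)] that by auto
 define S where "S = {x \<in> carrier E. x \<in> V \<and> (-1) \<odot> x \<in> V}"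
 have S_open: "openin (topol E) S"
 proof -
  have "openin (topol E) {x \<in> topspace (topol E). (-1) \<odot> x \<in> V}"
   by (rule openin_continuous_map_preimage[OF _ V(1)]) (intro continuous_smul, auto)
  then have "openin (topol E) (V \<inter> {x \<in> topspace (topol E). (-1) \<odot> x \<in> V})"
   using V(1) by blast
  moreover have "V \<inter> {x \<in> topspace (topol E). (-1) \<odot> x \<in> V} = S"
   using Vc by (auto simp: S_def)
  ultimately show ?thesis by simp
 qed
 have Sc: "x \<in> carrier E" if "x \<in> S" for x using that by (simp add: S_def)
 have S0: "\<zero> \<in> S" using V by (simp add: S_def)
 have Sconv: "(1 - t) \<odot> x \<oplus> t \<odot> y \<in> S" if "x \<in> S" "y \<in> S" "0 \<le> t" "t \<le> 1" for x y t
 proof -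
  have c: "x \<in> carrier E" "y \<in> carrier E" using that Sc by blast+
  have "(-1) \<odot> ((1 - t) \<odot> x \<oplus> t \<odot> y) = (1 - t) \<odot> ((-1) \<odot> x) \<oplus> t \<odot> ((-1) \<odot> y)"
   using c by (simp only: smul_add_right smul_smul smul_closed mult.commute[of "-1"])
  moreover have "(1 - t) \<odot> x \<oplus> t \<odot> y \<in> V" "(1 - t) \<odot> ((-1) \<odot> x) \<oplus> t \<odot> ((-1) \<odot> y) \<in> V"
   by (rule conv; use that in \<open>simp add: S_def\<close>)+
  ultimately show ?thesis using c by (simp only: S_def mem_Collect_eq smul_closed a_closed)
 qed
 have Ssym: "(-1) \<odot> x \<in> S" if "x \<in> S" for x
  using that by (simp add: S_def)
 define A where "A x = {t::real. t > 0 \<and> inverse t \<odot> x \<in> S}" for x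
 define p where "p x = Inf (A x)" for x
 have A_ne: "A x \<noteq> {}" if x: "x \<in> carrier E" for x
 proof -
  have "openin euclideanreal {r \<in> topspace euclideanreal. r \<odot> x \<in> S}"
   by (rule openin_continuous_map_preimage[OF _ S_open]) (intro continuous_smul, auto simp: x)
  then have "open {r. r \<odot> x \<in> S}" by simp
  then obtain e where e: "e > 0" "ball 0 e \<subseteq> {r. r \<odot> x \<in> S}"
   using x S0 openE[of "{r. r \<odot> x \<in> S}" 0] by auto
  have "e / 2 \<in> ball 0 e" using e by auto
  then have "(e / 2) \<odot> x \<in> S" using e(2) by blast
  then have "inverse (2 / e) \<odot> x \<in> S" by (simp only: inverse_divide)
  then show ?thesis using e by (auto simp: A_def intro!: exI[of _ "2 / e"])
 qed
 have A_bdd: "bdd_below (A x)" for x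
  by (rule bdd_belowI[of _ 0]) (auto simp: A_def)
 have A_up: "u \<in> A x" if "t \<in> A x" "t \<le> u" "x \<in> carrier E" for t u x
 proof -
  have t: "t > 0" "inverse t \<odot> x \<in> S" using that by (auto simp: A_def)
  have "(1 - t / u) \<odot> \<zero> \<oplus> (t / u) \<odot> (inverse t \<odot> x) \<in> S"
   by (rule Sconv) (use t that S0 in auto)
  moreover have "t / u * inverse t = inverse u" using t by (simp add: field_simps)
  ultimately show ?thesis
   using t that by (simp add: A_def del: times_divide_eq_left)
 qed
 have A_lt: "t \<in> A x" if "p x < t" "x \<in> carrier E" for x t
 proof -
  have "\<exists>s\<in>A x. s < t"
   by (rule cInf_lessD[OF A_ne[OF that(2)]]) (use that(1) in \<open>simp add: p_def\<close>)
  then show ?thesis using A_up that(2) less_imp_le by blast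
 qed
 have p_le: "p x \<le> t" if "t \<in> A x" for x t
  unfolding p_def by (rule cInf_lower[OF that A_bdd])
 have add: "p (x \<oplus> y) \<le> p x + p y" if x: "x \<in> carrier E" and y: "y \<in> carrier E" for x y
 proof (rule field_le_epsilon)
  fix e :: real assume e: "e > 0"
  define s where "s = p x + e / 2"
  define t where "t = p y + e / 2"
  have st: "s \<in> A x" "t \<in> A y" by (rule A_lt; use e x y in \<open>simp add: s_def t_def\<close>)+
  then have pos: "s > 0" "t > 0" by (auto simp: A_def)
  have "(1 - t / (s + t)) \<odot> (inverse s \<odot> x) \<oplus> (t / (s + t)) \<odot> (inverse t \<odot> y) \<in> S"
   using st pos by (intro Sconv) (auto simp: A_def)
  moreover have "(1 - t / (s + t)) * inverse s = inverse (s + t)"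
   "(t / (s + t)) * inverse t = inverse (s + t)"
   using pos by (auto simp: field_simps)
  ultimately have "inverse (s + t) \<odot> (x \<oplus> y) \<in> S"
   using x y by (simp add: smul_add_right del: times_divide_eq_left)
  then have "s + t \<in> A (x \<oplus> y)" using pos by (simp add: A_def)
  from p_le[OF this] show "p (x \<oplus> y) \<le> p x + p y + e" by (simp add: s_def t_def)
 qed
 have A_zero: "A \<zero> = {0<..}" using S0 by (auto simp: A_def)
 have p_zero: "p \<zero> = 0" by (simp add: p_def A_zero)
 have pos_le: "p (r \<odot> x) \<le> r * p x" if r: "r > 0" and x: "x \<in> carrier E" for r x
 proof (rule field_le_epsilon)
  fix e :: real assume e: "e > 0"
  have "p x + e / r \<in> A x" by (rule A_lt) (use e r x in simp_all)
  moreover have "inverse (r * (p x + e / r)) * r = inverse (p x + e / r)"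
   using r by simp
  ultimately have "r * (p x + e / r) \<in> A (r \<odot> x)"
   using r x by (simp add: A_def del: inverse_mult_distrib)
  from p_le[OF this] have "p (r \<odot> x) \<le> r * (p x + e / r)" .
  also have "\<dots> = r * p x + e" using r by (simp add: distrib_left)
  finally show "p (r \<odot> x) \<le> r * p x + e" .
 qed
 have pos_eq: "p (r \<odot> x) = r * p x" if r: "r > 0" and x: "x \<in> carrier E" for r x
 proof (rule antisym[OF pos_le[OF r x]])
  have "p x \<le> inverse r * p (r \<odot> x)"
   using pos_le[of "inverse r" "r \<odot> x"] r x by simp
  then show "r * p x \<le> p (r \<odot> x)" using r by (simp add: field_simps)
 qed
 have neg: "p ((-1) \<odot> x) = p x" if x: "x \<in> carrier E" for x
 proof -
  have "A ((-1) \<odot> x) = A x"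
   using x Ssym[of "inverse t \<odot> x" for t] Ssym[of "inverse t \<odot> ((-1) \<odot> x)" for t] by (auto simp: A_def)
  then show ?thesis by (simp add: p_def)
 qed
 have smul: "p (r \<odot> x) = \<bar>r\<bar> * p x" if x: "x \<in> carrier E" for r x
 proof (cases r "0::real" rule: linorder_cases)
  case less
  have "r \<odot> x = (-1) \<odot> ((-r) \<odot> x)" using x by simp
  then show ?thesis using less x pos_eq[of "-r" x] neg[of "(-r) \<odot> x"] by (simp del: smul_smul)
 next
  case equal then show ?thesis using x p_zero by simp
 next
  case greater then show ?thesis using x pos_eq by simp
 qed
 have sn: "seminorm E p" using add smul by (simp add: seminorm_def)
 have "continuous_map (topol E) euclideanreal p"
  unfolding continuous_map
 proof (intro conjI allI impI)
  fix Q :: "real set" assume Q: "openin euclideanreal Q"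
  show "openin (topol E) {x \<in> topspace (topol E). p x \<in> Q}"
  proof (subst openin_subopen, intro ballI)
   fix x assume "x \<in> {x \<in> topspace (topol E). p x \<in> Q}"
   then have x: "x \<in> carrier E" "p x \<in> Q" by auto
   then obtain e where e: "e > 0" "ball (p x) e \<subseteq> Q"
    using Q openE[of Q "p x"] by auto
   let ?T = "{y \<in> topspace (topol E). inverse (e / 2) \<odot> (y \<ominus> x) \<in> S}"
   have "openin (topol E) ?T"
    by (rule openin_continuous_map_preimage[OF _ S_open])
     (intro continuous_smul continuous_translate x(1), auto)
   moreover have "x \<in> ?T" using x S0 by simp
   moreover have "?T \<subseteq> {x \<in> topspace (topol E). p x \<in> Q}"
   proof
    fix y assume y: "y \<in> ?T"
    then have yc: "y \<in> carrier E" by simp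
    have "e / 2 \<in> A (y \<ominus> x)" using y e by (simp add: A_def)
    then have "p (y \<ominus> x) \<le> e / 2" by (rule p_le)
    then have "\<bar>p y - p x\<bar> < e" using seminorm_diff[OF sn yc x(1)] e by simp
    then have "p y \<in> Q" using e by (auto simp: dist_real_def abs_minus_commute)
    then show "y \<in> {x \<in> topspace (topol E). p x \<in> Q}" using yc by simp
   qed
   ultimately show "\<exists>T. openin (topol E) T \<and> x \<in> T \<and> T \<subseteq> {x \<in> topspace (topol E). p x \<in> Q}"
    by blast
  qed
 qed auto
 moreover have "x \<in> W" if "x \<in> carrier E" "p x < 1" for x
 proof -
  have "1 \<in> A x" by (rule A_lt) (use that in auto)
  then have "x \<in> S" using that by (simp add: A_def)
  then show ?thesis using V by (auto simp: S_def)
 qed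
 ultimately show ?thesis using sn by (auto simp: cseminorm_def)
qed

lemma ex_cseminorm:
 assumes "openin (topol E) W" "x \<in> W"
 shows "\<exists>p. cseminorm E p \<and> (\<forall>y\<in>carrier E. p (y \<ominus> x) < 1 --> y \<in> W)"
proof -
 have x: "x \<in> carrier E" using openin_subset[OF assms(1)] assms(2) by auto
 have "openin (topol E) {v \<in> topspace (topol E). x \<oplus> v \<in> W}"
  by (rule openin_continuous_map_preimage[OF _ assms(1)]) (intro continuous_add, auto simp: x)
 moreover have "\<zero> \<in> {v \<in> topspace (topol E). x \<oplus> v \<in> W}" using x assms by simp
 ultimately obtain p where p: "cseminorm E p" 
  "\<forall>v\<in>carrier E. p v < 1 --> v \<in> {v \<in> topspace (topol E). x \<oplus> v \<in> W}"
  using ex_cseminorm_zero by blast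
 have "y \<in> W" if "y \<in> carrier E" "p (y \<ominus> x) < 1" for y
  using p(2)[rule_format, of "y \<ominus> x"] that x by (simp add: add_sub_inverse)
 then show ?thesis using p(1) by blast
qed

lemma cseminorm_ball_open:
 assumes "cseminorm E p" "x \<in> carrier E"
 shows "openin (topol E) {y \<in> carrier E. p (y \<ominus> x) < e}"
proof -
 have "continuous_map (topol E) euclideanreal (\<lambda>y. p (y \<ominus> x))"
  using continuous_map_compose[OF continuous_translate[OF assms(2)], of euclideanreal p] assms(1)
  by (simp add: cseminorm_def o_def)
 from openin_continuous_map_preimage[OF this, of "{..<e}"] show ?thesis
  by simp
qed

lemma limitin_cseminorm:
 "limitin (topol E) u l F \<longleftrightarrow> l \<in> carrier E \<and> (\<forall>\<^sub>F t in F. u t \<in> carrier E) \<and>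
   (\<forall>p. cseminorm E p --> (\<forall>e>0. \<forall>\<^sub>F t in F. p (u t \<ominus> l) < e))" (is "?L \<longleftrightarrow> ?R")
proof
 assume L: ?L
 have l: "l \<in> carrier E" by (rule lim_closed[OF L])
 have "\<forall>\<^sub>F t in F. p (u t \<ominus> l) < e" if p: "cseminorm E p" and e: "e > 0" for p e
 proof -
  have sn: "seminorm E p" using p by (simp add: cseminorm_def)
  have "\<forall>\<^sub>F t in F. u t \<in> {y \<in> carrier E. p (y \<ominus> l) < e}"
   by (rule limitinD[OF L cseminorm_ball_open[OF p l]]) (use l e seminorm_zero[OF sn] in simp)
  then show ?thesis by (rule eventually_mono) simp
 qed
 then show ?R using l lim_eventually[OF L] by blast
next
 assume R: ?R
 show ?L unfolding limitin_def
 proof (intro conjI allI impI)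
  fix U assume U: "openin (topol E) U \<and> l \<in> U"
  then obtain p where p: "cseminorm E p" "\<forall>y\<in>carrier E. p (y \<ominus> l) < 1 --> y \<in> U"
   using ex_cseminorm by blast
  have "\<forall>\<^sub>F t in F. u t \<in> carrier E" "\<forall>\<^sub>F t in F. p (u t \<ominus> l) < 1"
   using R p(1) zero_less_one by blast+
  then show "\<forall>\<^sub>F t in F. u t \<in> U"
   by eventually_elim (use p(2) in blast)
 qed (simp add: conjunct1[OF R])
qed

text \<open>Compactness turns the seminorms that separate the single points of \<open>C\<close> from the
  complement of \<open>W\<close> into a single one.\<close>

lemma compact_cseminorm:
 assumes "compactin (topol E) C" "openin (topol E) W" "C \<subseteq> W"
 shows "\<exists>p. cseminorm E p \<and> (\<forall>x\<in>C. \<forall>y\<in>carrier E. p (y \<ominus> x) < 1 --> y \<in> W)"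
proof -
 have Cc: "C \<subseteq> carrier E" using compactin_subset_topspace[OF assms(1)] by simp
 have "\<exists>p. cseminorm E p \<and> (\<forall>y\<in>carrier E. p (y \<ominus> x) < 1 --> y \<in> W)" if "x \<in> C" for x
  using ex_cseminorm[OF assms(2)] that assms(3) by blast
 then obtain q where q: "\<And>x. x \<in> C ==> cseminorm E (q x)"
  "\<And>x y. x \<in> C ==> y \<in> carrier E ==> q x (y \<ominus> x) < 1 ==> y \<in> W"
  by metis
 let ?B = "\<lambda>x. {y \<in> carrier E. q x (y \<ominus> x) < 1/2}"
 have "\<forall>U\<in>?B ` C. openin (topol E) U" using q(1) Cc cseminorm_ball_open by blast
 moreover have "C \<subseteq> \<Union> (?B ` C)"
 proof
  fix x assume x: "x \<in> C"
  then have xc: "x \<in> carrier E" using Cc by blast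
  have "x \<in> ?B x" using q(1)[OF x] xc seminorm_zero[of "q x"] by (simp add: cseminorm_def)
  then show "x \<in> \<Union> (?B ` C)" using x by blast
 qed
 ultimately obtain \<F> where \<F>: "finite \<F>" "\<F> \<subseteq> ?B ` C" "C \<subseteq> \<Union>\<F>"
  using assms(1) unfolding compactin_def by meson
 then obtain F where F: "finite F" "F \<subseteq> C" "\<F> = ?B ` F"
  by (meson finite_subset_image)
 define p where "p y = 2 * (\<Sum>x\<in>F. q x y)" for y
 have "cseminorm E p"
  unfolding p_def by (intro cseminorm_scale cseminorm_sum) (use F q(1) in auto)
 moreover have "y \<in> W" if "x \<in> C" "y \<in> carrier E" "p (y \<ominus> x) < 1" for x y
 proof -
  obtain z where z: "z \<in> F" "q z (x \<ominus> z) < 1/2"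
   using \<F>(3) F(3) \<open>x \<in> C\<close> by blast
  have sn: "seminorm E (q x)" if "x \<in> F" for x using q(1) F(2) that by (auto simp: cseminorm_def)
  have c: "x \<in> carrier E" "z \<in> carrier E" using \<open>x \<in> C\<close> z(1) F(2) Cc by auto
  have "q z (y \<ominus> x) \<le> (\<Sum>w\<in>F. q w (y \<ominus> x))"
   by (rule member_le_sum[OF z(1)]) (use F(1) sn seminorm_nonneg that c in auto)
  then have "q z (y \<ominus> x) < 1/2" using that(3) by (simp add: p_def)
  then have "q z (y \<ominus> z) < 1"
   using seminorm_triangle[OF sn[OF z(1)] that(2) c] z(2) by simp
  then show "y \<in> W" using q(2) z(1) F(2) that(2) by blast
 qed
 ultimately show ?thesis by blast
qed

end


lemma realify_simps [simp]:
 "carrier (realify A) = carrier A" "zero (realify A) = zero A" "add (realify A) = add A"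
 "monoid.mult (realify A) = monoid.mult A" "one (realify A) = one A"
 "smult (realify A) r = smult A (complex_of_real r)" "topol (realify A) = topol A"
 by (simp_all add: realify_def)

lemma realify_a_inv [simp]: "a_inv (realify A) x = a_inv A x"
 by (simp add: a_inv_def m_inv_def)

lemma realify_minus [simp]: "x \<ominus>\<^bsub>realify A\<^esub> y = x \<ominus>\<^sub>A y"
 by (simp add: a_minus_def)

text \<open>As for real modules, the laws are restated with ordinary complex arithmetic.\<close>

locale calg = fixes A :: "(complex, 'a, 'm) module_scheme" (structure)
 assumes alg: "complex_algebra A"
begin

sublocale ring A
 using alg by (simp add: complex_algebra_def)

lemma cmod: "Module.module (scalars :: (complex, complex) tmodule) A"
 using alg by (simp add: complex_algebra_def)

lemma csmul_closed [simp, intro]: "x \<in> carrier A ==> c \<odot> x \<in> carrier A"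
 using module.smult_closed[OF cmod] by simp

lemma csmul_add_left: "x \<in> carrier A ==> (c + d) \<odot> x = c \<odot> x \<oplus> d \<odot> x"
 using module.smult_l_distr[OF cmod, of c d x] by simp

lemma csmul_add_right: "x \<in> carrier A ==> y \<in> carrier A ==> c \<odot> (x \<oplus> y) = c \<odot> x \<oplus> c \<odot> y"
 using module.smult_r_distr[OF cmod, of c x y] by simp

lemma csmul_csmul: "x \<in> carrier A ==> c \<odot> (d \<odot> x) = (c * d) \<odot> x"
 using module.smult_assoc1[OF cmod, of c d x] by simp

lemma csmul_one [simp]: "x \<in> carrier A ==> 1 \<odot> x = x"
 using module.smult_one[OF cmod, of x] by simp

lemma csmul_zero_left [simp]: "x \<in> carrier A ==> 0 \<odot> x = \<zero>"
 using module.smult_l_null[OF cmod, of x] by simp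

lemma csmul_zero_right [simp]: "c \<odot> \<zero> = \<zero>"
 using module.smult_r_null[OF cmod, of c] by simp

lemma csmul_mult_left: "x \<in> carrier A ==> y \<in> carrier A ==> (c \<odot> x) \<otimes> y = c \<odot> (x \<otimes> y)"
 using alg by (simp add: complex_algebra_def)

lemma csmul_mult_right: "x \<in> carrier A ==> y \<in> carrier A ==> x \<otimes> (c \<odot> y) = c \<odot> (x \<otimes> y)"
 using alg by (simp add: complex_algebra_def)

lemma csmul_neg_one: assumes x: "x \<in> carrier A" shows "(-1) \<odot> x = \<ominus> x"
proof -
 have "(-1) \<odot> x \<oplus> x = (-1 + 1) \<odot> x"
  using x by (simp only: csmul_add_left csmul_one)
 then show ?thesis
  using x by (intro minus_equality[symmetric]) auto
qed

lemma csub_eq: "x \<in> carrier A ==> y \<in> carrier A ==> x \<ominus> y = x \<oplus> (-1) \<odot> y"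
 by (simp add: a_minus_def csmul_neg_one)

lemma csmul_sub: "x \<in> carrier A ==> y \<in> carrier A ==> c \<odot> (x \<ominus> y) = c \<odot> x \<ominus> c \<odot> y"
 by (simp add: csub_eq csmul_add_right csmul_csmul mult.commute[of c])

end

lemma rmod_realify:
 fixes A :: "(complex, 'a) tmodule"
 assumes "complex_algebra A" shows "rmod (realify A)"
proof -
 interpret A: calg A using assms by (rule calg.intro)
 have "abelian_group (realify A)"
  by (rule abelian_groupI) (auto simp: A.a_ac intro: A.a_inv_closed A.l_neg bexI[of _ "\<ominus>\<^sub>A x" for x])
 then show ?thesis
  by (intro rmod.intro moduleI cring_scalars)
   (auto simp: A.csmul_add_left A.csmul_add_right A.csmul_csmul)
qed

lemma rlc_realify:
 assumes "lc_algebra A" shows "rlc (realify A)"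
proof -
 have alg: "complex_algebra A" and lc: "lc_space A" using assms by (auto simp: lc_algebra_def)
 have sm: "continuous_map (prod_topology euclideanreal (topol A)) (topol A) (\<lambda>(r, x). complex_of_real r \<odot>\<^sub>A x)"
 proof -
  have "continuous_map (prod_topology euclideanreal (topol A)) (prod_topology euclidean (topol A))
    (\<lambda>z. (complex_of_real (fst z), snd z))"
   by (intro continuous_map_paired[THEN iffD2] conjI continuous_map_snd)
    (auto intro!: continuous_map_compose[OF continuous_map_fst, unfolded o_def] continuous_intros)
  from continuous_map_compose[OF this, of "topol A" "\<lambda>(c, x). c \<odot>\<^sub>A x"] show ?thesis
   using lc by (simp add: lc_space_def o_def case_prod_unfold)
 qed
 have "lc_space (realify A)"
  using lc sm rmod_realify[OF alg] by (simp only: lc_space_def rmod_def realify_simps of_real_eq_id id_apply) blast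
 then show ?thesis by (rule rlc.intro)
qed

text \<open>Seminorms all of whose balls are neighbourhoods of their centres. Before the vector space
 operations are known to be continuous, this is stronger than being continuous.\<close>

definition nbhd_seminorm :: "(complex, 'a) tmodule => ('a => real) => bool" where
 "nbhd_seminorm A p \<longleftrightarrow> seminorm (realify A) p \<and>
   (\<forall>x\<in>carrier A. \<forall>e>0. \<exists>T. openin (topol A) T \<and> x \<in> T \<and> (\<forall>y\<in>T. p (y \<ominus>\<^sub>A x) < e))"

lemma nbhd_seminorm_sum:
 assumes A: "complex_algebra A" and "topspace (topol A) = carrier A"
  and F: "finite F" "\<And>i. i \<in> F ==> nbhd_seminorm A (p i)"
 shows "nbhd_seminorm A (\<lambda>x. \<Sum>i\<in>F. p i x)"
 unfolding nbhd_seminorm_def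
proof (intro conjI ballI allI impI)
 show "seminorm (realify A) (\<lambda>x. \<Sum>i\<in>F. p i x)"
  using F unfolding nbhd_seminorm_def seminorm_def
  by (auto simp: sum_distrib_left sum.distrib[symmetric] intro!: sum_mono)
 fix x and e :: real assume x: "x \<in> carrier A" and e: "e > 0"
 show "\<exists>T. openin (topol A) T \<and> x \<in> T \<and> (\<forall>y\<in>T. (\<Sum>i\<in>F. p i (y \<ominus>\<^sub>A x)) < e)"
  using F e
 proof (induction F arbitrary: e rule: finite_induct)
  case empty
  then show ?case using x assms(2) by (auto intro!: exI[of _ "carrier A"] simp: openin_topspace[of "topol A", simplified assms(2)])
 next
  case (insert i F)
  obtain T where T: "openin (topol A) T" "x \<in> T" "\<forall>y\<in>T. (\<Sum>i\<in>F. p i (y \<ominus>\<^sub>A x)) < e / 2"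
   using insert.IH[of "e / 2"] insert.prems by auto
  obtain T' where T': "openin (topol A) T'" "x \<in> T'" "\<forall>y\<in>T'. p i (y \<ominus>\<^sub>A x) < e / 2"
   using insert.prems(1)[of i] x insert.prems(2) unfolding nbhd_seminorm_def by (meson half_gt_zero insertI1)
  have "\<forall>y\<in>T \<inter> T'. (\<Sum>i\<in>insert i F. p i (y \<ominus>\<^sub>A x)) < e"
   using T(3) T'(3) insert.hyps by fastforce
  then show ?case using T T' by (intro exI[of _ "T \<inter> T'"]) auto
 qed
qed

text \<open>Continuity of the multiplication follows from an estimate by a possibly larger seminorm.
  Multiplication by \<open>\<i>\<close> is a separate condition since the seminorms are homogeneous over the
  reals only.\<close>

lemma lc_algebraI:
 fixes A :: "(complex, 'a) tmodule" (structure)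
 assumes alg: "complex_algebra A" and top: "topspace (topol A) = carrier A"
  and P: "\<And>p. p \<in> P ==> nbhd_seminorm A p"
  and nb: "\<And>W x. openin (topol A) W ==> x \<in> W ==> \<exists>p\<in>P. \<forall>y\<in>carrier A. p (y \<ominus> x) < 1 --> y \<in> W"
  and sep: "\<And>x. x \<in> carrier A ==> x \<noteq> \<zero> ==> \<exists>p\<in>P. p x \<noteq> 0"
  and J: "\<And>p. p \<in> P ==> nbhd_seminorm A (\<lambda>x. p (\<i> \<odot> x))"
  and mult: "\<And>p. p \<in> P ==> \<exists>q. nbhd_seminorm A q \<and> (\<forall>x\<in>carrier A. \<forall>y\<in>carrier A. p (x \<otimes> y) \<le> q x * q y)"
 shows "lc_algebra A"
proof -
 interpret A: calg A using alg by (rule calg.intro)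
 interpret R: rmod "realify A" using alg by (rule rmod_realify)
 have openc: "T \<subseteq> carrier A" if "openin (topol A) T" for T
  using openin_subset[OF that] top by simp
 have sn: "seminorm (realify A) p" if "nbhd_seminorm A p" for p
  using that by (simp add: nbhd_seminorm_def)
 have nbE: "\<exists>T. openin (topol A) T \<and> x \<in> T \<and> (\<forall>y\<in>T. p (y \<ominus> x) < e)"
  if "nbhd_seminorm A p" "x \<in> carrier A" "e > 0" for p x e
  using that unfolding nbhd_seminorm_def by blast
 have tri: "p (x \<oplus> y) \<le> p x + p y" if "nbhd_seminorm A p" "x \<in> carrier A" "y \<in> carrier A" for p x y
  using R.seminorm_add[OF sn, of p x y] that by simp
 have nn: "0 \<le> p x" if "nbhd_seminorm A p" "x \<in> carrier A" for p x
  using R.seminorm_nonneg[OF sn, of p x] that by simp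
 have contI: "continuous_map X (topol A) f"
  if f: "\<And>x. x \<in> topspace X ==> f x \<in> carrier A"
   and *: "\<And>p x. p \<in> P ==> x \<in> topspace X ==> \<exists>T. openin X T \<and> x \<in> T \<and> (\<forall>y\<in>T. p (f y \<ominus> f x) < 1)"
  for X :: "'x topology" and f
  unfolding continuous_map
 proof (intro conjI allI impI)
  show "f ` topspace X \<subseteq> topspace (topol A)" using f top by auto
  fix W assume W: "openin (topol A) W"
  show "openin X {x \<in> topspace X. f x \<in> W}"
  proof (subst openin_subopen, intro ballI)
   fix x assume "x \<in> {x \<in> topspace X. f x \<in> W}"
   then obtain p where p: "p \<in> P" "\<forall>y\<in>carrier A. p (y \<ominus> f x) < 1 --> y \<in> W" and x: "x \<in> topspace X"
    using nb[OF W] by blast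
   obtain T where T: "openin X T" "x \<in> T" "\<forall>y\<in>T. p (f y \<ominus> f x) < 1"
    using *[OF p(1) x] by blast
   have "T \<subseteq> topspace X" using openin_subset[OF T(1)] .
   then have "T \<subseteq> {x \<in> topspace X. f x \<in> W}" using T(3) p(2) f by blast
   then show "\<exists>T. openin X T \<and> x \<in> T \<and> T \<subseteq> {x \<in> topspace X. f x \<in> W}"
    using T by blast
  qed
 qed
 have add: "continuous_map (prod_topology (topol A) (topol A)) (topol A) (\<lambda>(x, y). x \<oplus> y)"
 proof (rule contI)
  fix p z assume p: "p \<in> P" and "z \<in> topspace (prod_topology (topol A) (topol A))"
  then obtain x y where z: "z = (x, y)" "x \<in> carrier A" "y \<in> carrier A" using top by auto
  obtain S where S: "openin (topol A) S" "x \<in> S" "\<forall>w\<in>S. p (w \<ominus> x) < 1/2"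
   using nbE[OF P[OF p] z(2), of "1/2"] by auto
  obtain T where T: "openin (topol A) T" "y \<in> T" "\<forall>w\<in>T. p (w \<ominus> y) < 1/2"
   using nbE[OF P[OF p] z(3), of "1/2"] by auto
  have "p ((a \<oplus> b) \<ominus> (x \<oplus> y)) < 1" if "a \<in> S" "b \<in> T" for a b
  proof -
   have c: "a \<in> carrier A" "b \<in> carrier A" using that openc S T by blast+
   have "(a \<oplus> b) \<ominus> (x \<oplus> y) = (a \<ominus> x) \<oplus> (b \<ominus> y)"
    using R.add_sub_add[of a b x y] c z by simp
   then show ?thesis using tri[OF P[OF p], of "a \<ominus> x" "b \<ominus> y"] c z S(3) T(3) that by fastforce
  qed
  then show "\<exists>T. openin (prod_topology (topol A) (topol A)) T \<and> z \<in> T \<and>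
    (\<forall>y\<in>T. p ((case y of (x, y) => x \<oplus> y) \<ominus> (case z of (x, y) => x \<oplus> y)) < 1)"
   using S T z by (intro exI[of _ "S \<times> T"]) (auto simp: openin_prod_Times_iff)
 qed (auto simp: top)
 have smul: "continuous_map (prod_topology euclidean (topol A)) (topol A) (\<lambda>(c, x). c \<odot> x)"
 proof (rule contI)
  fix p z assume p: "p \<in> P" and "z \<in> topspace (prod_topology (euclidean :: complex topology) (topol A))"
  then obtain c x where z: "z = (c, x)" "x \<in> carrier A" using top by auto
  \<comment> \<open>This seminorm also controls the imaginary parts of scalars.\<close>
  define r where "r = (\<lambda>v. \<Sum>b\<in>UNIV. (if b then p v else p (\<i> \<odot> v)))"
  have r: "nbhd_seminorm A r" unfolding r_def
  proof (rule nbhd_seminorm_sum[OF alg top])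
   show "nbhd_seminorm A (\<lambda>v. if b then p v else p (\<i> \<odot> v))" for b
    using P[OF p] J[OF p] by (cases b) simp_all
  qed simp
  have pr: "p (d \<odot> v) \<le> cmod d * r v" if v: "v \<in> carrier A" for d v
  proof -
   have "d \<odot> v = complex_of_real (Re d) \<odot> v \<oplus> complex_of_real (Im d) \<odot> (\<i> \<odot> v)"
    using v by (simp only: A.csmul_csmul A.csmul_add_left[symmetric] complex_eq[of d, symmetric] mult.commute[of _ "\<i>"])
   also have "p \<dots> \<le> p (complex_of_real (Re d) \<odot> v) + p (complex_of_real (Im d) \<odot> (\<i> \<odot> v))"
    by (rule tri[OF P[OF p]]) (use v in auto)
   also have "\<dots> = \<bar>Re d\<bar> * p v + \<bar>Im d\<bar> * p (\<i> \<odot> v)"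
    using R.seminorm_smul[OF sn[OF P[OF p]], of v "Re d"] R.seminorm_smul[OF sn[OF P[OF p]], of "\<i> \<odot> v" "Im d"] v by simp
   also have "\<dots> \<le> cmod d * p v + cmod d * p (\<i> \<odot> v)"
    by (intro add_mono mult_right_mono abs_Re_le_cmod abs_Im_le_cmod nn[OF P[OF p]]) (use v in auto)
   also have "\<dots> = cmod d * r v" by (simp add: r_def UNIV_bool distrib_left)
   finally show ?thesis .
  qed
  have r0: "0 \<le> r x" using nn[OF r z(2)] .
  define e where "e = 1 / (2 * (cmod c + 1))"
  define d where "d = min 1 (1 / (2 * (r x + 1)))"
  have e: "e > 0" by (simp add: e_def add_nonneg_pos)
  have d: "d > 0" using r0 by (simp add: d_def)
  obtain S where S: "openin (topol A) S" "x \<in> S" "\<forall>w\<in>S. r (w \<ominus> x) < e"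
   using nbE[OF r z(2) e] by auto
  have "p ((c' \<odot> y) \<ominus> (c \<odot> x)) < 1" if "c' \<in> ball c d" "y \<in> S" for c' y
  proof -
   have y: "y \<in> carrier A" using that openc S by blast
   have c': "cmod (c' - c) < d" using that by (simp add: dist_norm norm_minus_commute)
   have "(c' \<odot> y) \<ominus> (c \<odot> x) = (c' \<odot> y \<ominus> c' \<odot> x) \<oplus> (c' \<odot> x \<ominus> c \<odot> x)"
    using R.sub_add_sub[of "c' \<odot> y" "c' \<odot> x" "c \<odot> x"] y z by simp
   also have "c' \<odot> y \<ominus> c' \<odot> x = c' \<odot> (y \<ominus> x)" using y z by (simp add: A.csmul_sub)
   also have "c' \<odot> x \<ominus> c \<odot> x = (c' - c) \<odot> x"
    using A.csmul_add_left[of x c' "-c"] z by (simp add: A.csub_eq A.csmul_csmul)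
   finally have "p ((c' \<odot> y) \<ominus> (c \<odot> x)) \<le> p (c' \<odot> (y \<ominus> x)) + p ((c' - c) \<odot> x)"
    using tri[OF P[OF p]] y z by simp
   also have "\<dots> \<le> cmod c' * r (y \<ominus> x) + cmod (c' - c) * r x"
    by (intro add_mono pr) (use y z in auto)
   also have "\<dots> < 1"
   proof -
    have "cmod c' \<le> cmod c + 1"
     using norm_triangle_sub[of c' c] c' by (simp add: d_def)
    then have "cmod c' * r (y \<ominus> x) \<le> (cmod c + 1) * r (y \<ominus> x)"
     by (rule mult_right_mono) (rule nn[OF r], use y z in auto)
    also have "\<dots> < (cmod c + 1) * e"
     using S(3) that by (intro mult_strict_left_mono) (auto simp: add_nonneg_pos)
    also have "\<dots> = 1/2" unfolding e_def using norm_ge_zero[of c] by (simp add: field_simps add_nonneg_eq_0_iff)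
    finally have 1: "cmod c' * r (y \<ominus> x) < 1/2" .
    have "cmod (c' - c) * r x \<le> d * r x" using c' r0 by (intro mult_right_mono) auto
    also have "\<dots> \<le> 1 / (2 * (r x + 1)) * r x" using r0 by (intro mult_right_mono) (auto simp: d_def)
    also have "\<dots> \<le> 1/2" using r0 by (simp add: field_simps)
    finally show ?thesis using 1 by simp
   qed
   finally show ?thesis .
  qed
  then show "\<exists>T. openin (prod_topology euclidean (topol A)) T \<and> z \<in> T \<and>
    (\<forall>y\<in>T. p ((case y of (c, x) => c \<odot> x) \<ominus> (case z of (c, x) => c \<odot> x)) < 1)"
   using S z d by (intro exI[of _ "ball c d \<times> S"]) (auto simp: openin_prod_Times_iff)
 qed (auto simp: top)
 have mul: "continuous_map (prod_topology (topol A) (topol A)) (topol A) (\<lambda>(x, y). x \<otimes> y)"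
 proof (rule contI)
  fix p z assume p: "p \<in> P" and "z \<in> topspace (prod_topology (topol A) (topol A))"
  then obtain x y where z: "z = (x, y)" "x \<in> carrier A" "y \<in> carrier A" using top by auto
  obtain q where q: "nbhd_seminorm A q" and pq: "\<And>x y. x \<in> carrier A ==> y \<in> carrier A ==> p (x \<otimes> y) \<le> q x * q y"
   using mult[OF p] by blast
  define e where "e = min 1 (1 / (2 * (q x + q y + 1)))"
  have qx: "0 \<le> q x" "0 \<le> q y" using nn[OF q] z by auto
  have e: "e > 0" using qx by (simp add: e_def)
  obtain S where S: "openin (topol A) S" "x \<in> S" "\<forall>w\<in>S. q (w \<ominus> x) < e"
   using nbE[OF q z(2) e] by auto
  obtain T where T: "openin (topol A) T" "y \<in> T" "\<forall>w\<in>T. q (w \<ominus> y) < e"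
   using nbE[OF q z(3) e] by auto
  have "p ((a \<otimes> b) \<ominus> (x \<otimes> y)) < 1" if "a \<in> S" "b \<in> T" for a b
  proof -
   have c: "a \<in> carrier A" "b \<in> carrier A" using that openc S T by blast+
   have "(a \<otimes> b) \<ominus> (x \<otimes> y) = (a \<otimes> b \<ominus> a \<otimes> y) \<oplus> (a \<otimes> y \<ominus> x \<otimes> y)"
    using R.sub_add_sub[of "a \<otimes> b" "a \<otimes> y" "x \<otimes> y"] c z by simp
   also have "a \<otimes> b \<ominus> a \<otimes> y = a \<otimes> (b \<ominus> y)"
    using c z by (simp add: a_minus_def A.r_distr A.r_minus)
   also have "a \<otimes> y \<ominus> x \<otimes> y = (a \<ominus> x) \<otimes> y"
    using c z by (simp add: a_minus_def A.l_distr A.l_minus)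
   finally have "p ((a \<otimes> b) \<ominus> (x \<otimes> y)) \<le> p (a \<otimes> (b \<ominus> y)) + p ((a \<ominus> x) \<otimes> y)"
    using tri[OF P[OF p]] c z by simp
   also have "\<dots> \<le> q a * q (b \<ominus> y) + q (a \<ominus> x) * q y"
    by (intro add_mono pq) (use c z in auto)
   also have "\<dots> \<le> (q x + 1) * e + e * q y"
   proof -
    have "q a \<le> q (a \<ominus> x) + q x"
     using R.seminorm_triangle[OF sn[OF q], of a x \<zero>] c z by (simp add: a_minus_def)
    then have "q a \<le> q x + 1" using S(3) that by (fastforce simp: e_def)
    then show ?thesis
     using S(3) T(3) that qx e nn[OF q, of a] nn[OF q, of "a \<ominus> x"] nn[OF q, of "b \<ominus> y"] c z
     by (intro add_mono mult_mono) auto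
   qed
   also have "\<dots> = e * (q x + q y + 1)" by (simp add: algebra_simps)
   also have "\<dots> \<le> 1 / (2 * (q x + q y + 1)) * (q x + q y + 1)"
    using qx by (intro mult_right_mono) (auto simp: e_def)
   also have "\<dots> < 1" using qx by (simp add: field_simps)
   finally show ?thesis .
  qed
  then show "\<exists>T. openin (prod_topology (topol A) (topol A)) T \<and> z \<in> T \<and>
    (\<forall>y\<in>T. p ((case y of (x, y) => x \<otimes> y) \<ominus> (case z of (x, y) => x \<otimes> y)) < 1)"
   using S T z by (intro exI[of _ "S \<times> T"]) (auto simp: openin_prod_Times_iff)
 qed (auto simp: top)
 have haus: "Hausdorff_space (topol A)"
  unfolding Hausdorff_space_def
 proof (intro allI impI)
  fix x y assume "x \<in> topspace (topol A) \<and> y \<in> topspace (topol A) \<and> x \<noteq> y"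
  then have xy: "x \<in> carrier A" "y \<in> carrier A" "x \<noteq> y" using top by auto
  then have "x \<ominus> y \<noteq> \<zero>" using R.add_sub_inverse[of y x] by auto
  then obtain p where p: "p \<in> P" "p (x \<ominus> y) \<noteq> 0" using sep[of "x \<ominus> y"] xy by auto
  then have pos: "p (x \<ominus> y) > 0" using nn[OF P[OF p(1)], of "x \<ominus> y"] xy by simp
  obtain S where S: "openin (topol A) S" "x \<in> S" "\<forall>w\<in>S. p (w \<ominus> x) < p (x \<ominus> y) / 2"
   using nbE[OF P[OF p(1)] xy(1), of "p (x \<ominus> y) / 2"] pos by auto
  obtain T where T: "openin (topol A) T" "y \<in> T" "\<forall>w\<in>T. p (w \<ominus> y) < p (x \<ominus> y) / 2"
   using nbE[OF P[OF p(1)] xy(2), of "p (x \<ominus> y) / 2"] pos by auto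
  have "disjnt S T" unfolding disjnt_iff
  proof (intro allI notI)
   fix w assume w: "w \<in> S \<and> w \<in> T"
   then have wc: "w \<in> carrier A" using openc S by blast
   have "p (x \<ominus> y) \<le> p (w \<ominus> x) + p (w \<ominus> y)"
    using R.seminorm_triangle[OF sn[OF P[OF p(1)]], of x w y] R.seminorm_sub_commute[OF sn[OF P[OF p(1)]], of x w] xy wc by simp
   then show False using S(3) T(3) w by fastforce
  qed
  then show "\<exists>U V. openin (topol A) U \<and> openin (topol A) V \<and> x \<in> U \<and> y \<in> V \<and> disjnt U V"
   using S T by blast
 qed
 have conv: "\<exists>V. openin (topol A) V \<and> \<zero> \<in> V \<and> V \<subseteq> W \<and>
     (\<forall>x\<in>V. \<forall>y\<in>V. \<forall>t::real. 0 \<le> t \<and> t \<le> 1 -->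
       (of_real (1 - t) \<odot> x) \<oplus> (of_real t \<odot> y) \<in> V)"
  if W: "openin (topol A) W" "\<zero> \<in> W" for W
 proof -
  obtain p where p: "p \<in> P" "\<forall>y\<in>carrier A. p (y \<ominus> \<zero>) < 1 --> y \<in> W" using nb[OF W] by blast
  note ps = sn[OF P[OF p(1)]]
  let ?V = "{x \<in> carrier A. p x < 1}"
  have "openin (topol A) ?V"
  proof (subst openin_subopen, intro ballI)
   fix x assume x: "x \<in> ?V"
   then obtain T where T: "openin (topol A) T" "x \<in> T" "\<forall>y\<in>T. p (y \<ominus> x) < 1 - p x"
    using nbE[OF P[OF p(1)], of x "1 - p x"] by auto
   have "T \<subseteq> ?V"
   proof
    fix y assume y: "y \<in> T"
    then have yc: "y \<in> carrier A" using openc T by blast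
    have "p y - p x \<le> p (y \<ominus> x)" using R.seminorm_diff[OF ps, of y x] yc x by simp
    then show "y \<in> ?V" using T(3) y yc by fastforce
   qed
   then show "\<exists>T. openin (topol A) T \<and> x \<in> T \<and> T \<subseteq> ?V" using T by blast
  qed
  moreover have "\<zero> \<in> ?V" using R.seminorm_zero[OF ps] by simp
  moreover have "?V \<subseteq> W" using p(2) by (auto simp: a_minus_def)
  moreover have "(of_real (1 - t) \<odot> x) \<oplus> (of_real t \<odot> y) \<in> ?V"
   if xy: "x \<in> ?V" "y \<in> ?V" and t: "0 \<le> t" "t \<le> 1" for x y and t :: real
  proof -
   have "p (of_real (1 - t) \<odot> x \<oplus> of_real t \<odot> y) \<le> p (of_real (1 - t) \<odot> x) + p (of_real t \<odot> y)"
    using tri[OF P[OF p(1)]] xy by simp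
   also have "\<dots> = (1 - t) * p x + t * p y"
    using R.seminorm_smul[OF ps, of x "1 - t"] R.seminorm_smul[OF ps, of y t] xy t by simp
   also have "\<dots> < 1"
   proof (cases "t = 0")
    case True then show ?thesis using xy by simp
   next
    case False
    then have "t * p y < t * 1" using xy t by (intro mult_strict_left_mono) auto
    moreover have "(1 - t) * p x \<le> (1 - t) * 1" using xy t by (intro mult_left_mono) auto
    ultimately show ?thesis by simp
   qed
   finally show ?thesis using xy by simp
  qed
  ultimately show ?thesis by (intro exI[of _ ?V]) blast
 qed
 have "lc_space A"
  unfolding lc_space_def using A.cmod top haus add smul conv by blast
 then show ?thesis unfolding lc_algebra_def using alg mul by blast
qed

section \<open>Directional derivatives of curves\<close>

lemma (in rmod) sub_sub_swap: "a \<in> carrier E ==> b \<in> carrier E ==> c \<in> carrier E ==> d \<in> carrier E ==>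
  (a \<ominus> b) \<ominus> (c \<ominus> d) = (a \<ominus> c) \<ominus> (b \<ominus> d)"
 by (simp add: a_minus_def minus_add a_ac)

definition lsum :: "(real, 'v) tmodule => 'v list => 'v" where
 "lsum E xs = foldr (\<lambda>x y. x \<oplus>\<^sub>E y) xs \<zero>\<^sub>E"

lemma lsum_simps [simp]: "lsum E [] = \<zero>\<^sub>E" "lsum E (x # xs) = x \<oplus>\<^sub>E lsum E xs"
 by (simp_all add: lsum_def)

lemma (in rmod) lsum_closed [simp]: "set xs \<subseteq> carrier E ==> lsum E xs \<in> carrier E"
 by (induction xs) auto

lemma (in rmod) lsum_append: "set xs \<subseteq> carrier E ==> set ys \<subseteq> carrier E ==> lsum E (xs @ ys) = lsum E xs \<oplus> lsum E ys"
 by (induction xs) (auto simp: a_assoc)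

lemma (in rmod) lsum_concat:
 "(\<And>t. t \<in> set ts ==> set (f t) \<subseteq> carrier E) ==> lsum E (concat (map f ts)) = lsum E (map (\<lambda>t. lsum E (f t)) ts)"
 by (induction ts) (auto simp: lsum_append UN_subset_iff)

text \<open>Derivatives at the parameter 0, of curves that have to stay in the carrier only near 0:
  this is what difference quotients along \<open>x + t h\<close> inside an open set provide.\<close>

definition curve_deriv :: "(real, 'v) tmodule => (real => 'v) => 'v => bool" where
 "curve_deriv E c l \<longleftrightarrow> c 0 \<in> carrier E \<and> (\<forall>\<^sub>F t in at 0. c t \<in> carrier E) \<and>
   limitin (topol E) (\<lambda>t. inverse t \<odot>\<^sub>E (c t \<ominus>\<^sub>E c 0)) l (at 0)"

context rlc
begin

lemma lim_cseminormD: "limitin (topol E) u l F ==> cseminorm E p ==> e > 0 ==> \<forall>\<^sub>F t in F. p (u t \<ominus> l) < e"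
 unfolding limitin_cseminorm by blast

text \<open>After subtracting the line with direction \<open>v\<close>, increments over short intervals are at most
  \<open>K + e\<close> times the length; bisection extends this to the whole interval.\<close>

lemma mean_value:
 assumes p: "cseminorm E p" and ab: "a \<le> b"
  and c: "\<And>s. a \<le> s ==> s \<le> b ==> c s \<in> carrier E"
  and d: "\<And>s. a \<le> s ==> s \<le> b ==> limitin (topol E) (\<lambda>t. inverse t \<odot> (c (s + t) \<ominus> c s)) (c' s) (at 0)"
  and v: "v \<in> carrier E" and K: "\<And>s. a \<le> s ==> s \<le> b ==> p (c' s \<ominus> v) \<le> K"
 shows "p ((c b \<ominus> c a) \<ominus> (b - a) \<odot> v) \<le> K * (b - a)"
proof -
 have sn: "seminorm E p" using p by (simp add: cseminorm_def)
 define u where "u s = c s \<ominus> s \<odot> v" for s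
 have uc: "u s \<in> carrier E" if "a \<le> s" "s \<le> b" for s
  using c[OF that] v by (simp add: u_def)
 have u_diff: "u y \<ominus> u x = (c y \<ominus> c x) \<ominus> (y - x) \<odot> v" if "a \<le> x" "x \<le> b" "a \<le> y" "y \<le> b" for x y
  using c[of x] c[of y] that v by (simp add: u_def sub_sub_swap[of "c y"] smul_sub_left)
 have step: "p (u b \<ominus> u a) \<le> (K + e) * (b - a)" if e: "e > 0" for e
 proof -
  have "a \<le> a \<and> b \<le> b --> p (u b \<ominus> u a) \<le> (K + e) * (b - a)"
  proof (rule Bolzano[OF ab, where P = "\<lambda>x y. a \<le> x \<and> y \<le> b --> p (u y \<ominus> u x) \<le> (K + e) * (y - x)"])
   fix x y z assume xy: "a \<le> x \<and> y \<le> b --> p (u y \<ominus> u x) \<le> (K + e) * (y - x)"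
    and yz: "a \<le> y \<and> z \<le> b --> p (u z \<ominus> u y) \<le> (K + e) * (z - y)" and o: "x \<le> y" "y \<le> z"
   show "a \<le> x \<and> z \<le> b --> p (u z \<ominus> u x) \<le> (K + e) * (z - x)"
   proof
    assume "a \<le> x \<and> z \<le> b"
    then have "p (u z \<ominus> u x) \<le> p (u z \<ominus> u y) + p (u y \<ominus> u x)"
     using o by (intro seminorm_triangle[OF sn] uc) auto
    also have "\<dots> \<le> (K + e) * (z - y) + (K + e) * (y - x)"
     using xy yz o \<open>a \<le> x \<and> z \<le> b\<close> by (intro add_mono) auto
    also have "\<dots> = (K + e) * (z - x)" by (simp add: algebra_simps)
    finally show "p (u z \<ominus> u x) \<le> (K + e) * (z - x)" .
   qed
  next
   fix s assume s: "a \<le> s" "s \<le> b"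
   note ds = d[OF s]
   have c's: "c' s \<in> carrier E" by (rule lim_closed[OF ds])
   have "\<forall>\<^sub>F t in at 0. p (inverse t \<odot> (c (s + t) \<ominus> c s) \<ominus> c' s) < e"
    using ds p e unfolding limitin_cseminorm by blast
   then obtain r where r: "r > 0" "\<And>t. t \<noteq> 0 ==> \<bar>t\<bar> < r ==> p (inverse t \<odot> (c (s + t) \<ominus> c s) \<ominus> c' s) < e"
    unfolding eventually_at by (auto simp: dist_real_def)
   have near: "p (u y \<ominus> u s) \<le> (K + e) * \<bar>y - s\<bar>" if y: "a \<le> y" "y \<le> b" "\<bar>y - s\<bar> < r" for y
   proof (cases "y = s")
    case True
    then show ?thesis using uc[OF s] seminorm_zero[OF sn] by simp
   next
    case False
    let ?t = "y - s" and ?q = "inverse (y - s) \<odot> (c y \<ominus> c s)"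
    have cc: "c y \<in> carrier E" "c s \<in> carrier E" using c y s by auto
    have "u y \<ominus> u s = ?t \<odot> (?q \<ominus> v)"
     using cc v False u_diff[OF s y(1,2)] by (simp add: smul_sub[of ?q v])
    then have "p (u y \<ominus> u s) = \<bar>?t\<bar> * p (?q \<ominus> v)"
     using cc v seminorm_smul[OF sn] by simp
    also have "\<dots> \<le> \<bar>?t\<bar> * (K + e)"
    proof (rule mult_left_mono)
     have "p (?q \<ominus> v) \<le> p (?q \<ominus> c' s) + p (c' s \<ominus> v)"
      using cc v c's by (intro seminorm_triangle[OF sn]) auto
     then show "p (?q \<ominus> v) \<le> K + e" using r(2)[of ?t] K[OF s] y False by simp
    qed simp
    finally show ?thesis by (simp add: mult.commute)
   qed
   show "\<exists>d>0. \<forall>x y. x \<le> s \<and> s \<le> y \<and> y - x < d --> a \<le> x \<and> y \<le> b --> p (u y \<ominus> u x) \<le> (K + e) * (y - x)"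
   proof (intro exI[of _ r] conjI allI impI r(1))
    fix x y assume xy: "x \<le> s \<and> s \<le> y \<and> y - x < r" "a \<le> x \<and> y \<le> b"
    then have "p (u y \<ominus> u x) \<le> p (u y \<ominus> u s) + p (u s \<ominus> u x)"
     using s by (intro seminorm_triangle[OF sn] uc) auto
    also have "p (u s \<ominus> u x) = p (u x \<ominus> u s)"
     using s xy by (intro seminorm_sub_commute[OF sn] uc) auto
    also have "p (u y \<ominus> u s) + p (u x \<ominus> u s) \<le> (K + e) * \<bar>y - s\<bar> + (K + e) * \<bar>x - s\<bar>"
     using xy s by (intro add_mono near) auto
    also have "\<dots> = (K + e) * (y - x)" using xy by (simp add: algebra_simps)
    finally show "p (u y \<ominus> u x) \<le> (K + e) * (y - x)" .
   qed
  qed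
  then show ?thesis by simp
 qed
 have "p (u b \<ominus> u a) \<le> K * (b - a)"
 proof (cases "a = b")
  case True then show ?thesis using step[of 1] by simp
 next
  case False
  show ?thesis
  proof (rule field_le_epsilon)
   fix e :: real assume "e > 0"
   then have "p (u b \<ominus> u a) \<le> (K + e / (b - a)) * (b - a)"
    using False ab by (intro step) simp
   also have "\<dots> = K * (b - a) + e" using False by (simp add: distrib_right)
   finally show "p (u b \<ominus> u a) \<le> K * (b - a) + e" .
  qed
 qed
 then show ?thesis using u_diff[of a b] ab by simp
qed

lemma mean_value_segment:
 assumes p: "cseminorm E p"
  and c: "\<And>s. s \<in> closed_segment 0 t ==> c s \<in> carrier E"
  and d: "\<And>s. s \<in> closed_segment 0 t ==> limitin (topol E) (\<lambda>r. inverse r \<odot> (c (s + r) \<ominus> c s)) (c' s) (at 0)"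
  and v: "v \<in> carrier E" and K: "\<And>s. s \<in> closed_segment 0 t ==> p (c' s \<ominus> v) \<le> K"
 shows "p ((c t \<ominus> c 0) \<ominus> t \<odot> v) \<le> K * \<bar>t\<bar>"
proof (cases "t \<ge> 0")
 case True
 then have "closed_segment 0 t = {0..t}" by (simp add: closed_segment_eq_real_ivl)
 then show ?thesis using mean_value[OF p True, of c c' v K] c d v K True by simp
next
 case False
 then have seg: "closed_segment 0 t = {t..0}" by (simp add: closed_segment_eq_real_ivl)
 have sn: "seminorm E p" using p by (simp add: cseminorm_def)
 have cc: "c t \<in> carrier E" "c 0 \<in> carrier E" using c by auto
 have "p ((c 0 \<ominus> c t) \<ominus> (0 - t) \<odot> v) \<le> K * (0 - t)"
  using mean_value[OF p, of t 0 c c' v K] c d v K False seg by simp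
 moreover have "(c 0 \<ominus> c t) \<ominus> (0 - t) \<odot> v = \<ominus> ((c t \<ominus> c 0) \<ominus> t \<odot> v)"
 proof -
  have "\<ominus> ((c t \<ominus> c 0) \<ominus> t \<odot> v) = t \<odot> v \<ominus> (c t \<ominus> c 0)" using cc v by (simp add: minus_sub)
  also have "\<dots> = (c 0 \<ominus> c t) \<ominus> (\<ominus> (t \<odot> v))"
   using cc v by (simp add: a_minus_def minus_add a_ac)
  also have "\<ominus> (t \<odot> v) = (0 - t) \<odot> v" using smul_neg_one[of "t \<odot> v"] v by simp
  finally show ?thesis by simp
 qed
 ultimately show ?thesis using seminorm_minus[OF sn, of "(c t \<ominus> c 0) \<ominus> t \<odot> v"] cc v False by simp
qed

lemma lim_cong:
 assumes "limitin (topol E) u l F" "\<forall>\<^sub>F t in F. u t = w t" "l = l'"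
 shows "limitin (topol E) w l' F"
 using limitin_transform_eventually[OF assms(2,1)] assms(3) by simp

lemma curve_continuous:
 assumes "curve_deriv E c l"
 shows "limitin (topol E) c (c 0) (at 0)"
proof -
 have c0: "c 0 \<in> carrier E" and ev: "\<forall>\<^sub>F t in at 0. c t \<in> carrier E"
  and l: "limitin (topol E) (\<lambda>t. inverse t \<odot> (c t \<ominus> c 0)) l (at 0)"
  using assms by (auto simp: curve_deriv_def)
 have "limitin (topol E) (\<lambda>t. c 0 \<oplus> t \<odot> (inverse t \<odot> (c t \<ominus> c 0))) (c 0 \<oplus> 0 \<odot> l) (at 0)"
  by (intro lim_add lim_smul l tendsto_ident_at) (simp add: c0)
 then show ?thesis
 proof (rule lim_cong)
  show "\<forall>\<^sub>F t in at 0. c 0 \<oplus> t \<odot> (inverse t \<odot> (c t \<ominus> c 0)) = c t"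
   using ev eventually_neq_at_within[of 0 0 UNIV]
   by eventually_elim (use c0 in \<open>simp add: add_sub_inverse\<close>)
 qed (use c0 lim_closed[OF l] in simp)
qed

end

text \<open>The mean value theorem bounds the error by the oscillation of the derivative near the limit
  point; this is where local convexity enters. Base points and directions are allowed to move since
  additivity of derivatives and the product rule along curves need it.\<close>

lemma diff_quotient_limit:
 assumes E: "rlc E" and F: "rlc F" and W: "openin (topol E) W"
  and x: "limitin (topol E) x x0 (at 0)" "x0 \<in> W" and h: "limitin (topol E) h h0 (at 0)"
  and l: "l \<in> carrier F"
  and der: "\<forall>\<^sub>F t in at (0::real). \<forall>y\<in>W. \<phi> t y \<in> carrier F \<and> has_dir_deriv E F (\<phi> t) y (h t) (\<phi>' t y)"
  and cont: "\<And>p e. cseminorm F p ==> e > 0 ==>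
    \<exists>q. cseminorm E q \<and> (\<forall>\<^sub>F t in at 0. \<forall>y\<in>carrier E. q (y \<ominus>\<^sub>E x0) < 1 --> p (\<phi>' t y \<ominus>\<^sub>F l) < e)"
 shows "limitin (topol F) (\<lambda>t. inverse t \<odot>\<^sub>F (\<phi> t (x t \<oplus>\<^sub>E t \<odot>\<^sub>E h t) \<ominus>\<^sub>F \<phi> t (x t))) l (at 0)"
proof -
 interpret E: rlc E by fact
 interpret F: rlc F by fact
 have x0: "x0 \<in> carrier E" by (rule E.lim_closed[OF x(1)])
 have h0: "h0 \<in> carrier E" by (rule E.lim_closed[OF h])
 obtain q' where q': "cseminorm E q'" "\<forall>y\<in>carrier E. q' (y \<ominus>\<^sub>E x0) < 1 --> y \<in> W"
  using E.ex_cseminorm[OF W x(2)] by blast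
 have main: "\<forall>\<^sub>F t in at 0. \<phi> t (x t \<oplus>\<^sub>E t \<odot>\<^sub>E h t) \<in> carrier F \<and> \<phi> t (x t) \<in> carrier F \<and>
   p (inverse t \<odot>\<^sub>F (\<phi> t (x t \<oplus>\<^sub>E t \<odot>\<^sub>E h t) \<ominus>\<^sub>F \<phi> t (x t)) \<ominus>\<^sub>F l) < e"
  if p: "cseminorm F p" and e: "e > 0" for p e
 proof -
  have ps: "seminorm F p" using p by (simp add: cseminorm_def)
  obtain q where q: "cseminorm E q"
   and qb: "\<forall>\<^sub>F t in at 0. \<forall>y\<in>carrier E. q (y \<ominus>\<^sub>E x0) < 1 --> p (\<phi>' t y \<ominus>\<^sub>F l) < e / 2"
   using cont[OF p, of "e / 2"] e by auto
  define Q where "Q y = (\<Sum>b\<in>(UNIV::bool set). (if b then q else q') y)" for y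
  have Q: "cseminorm E Q" unfolding Q_def by (rule E.cseminorm_sum) (use q q' in \<open>auto split: if_split\<close>)
  have Qs: "seminorm E Q" and qs: "seminorm E q" "seminorm E q'" using Q q q'(1) by (auto simp: cseminorm_def)
  have Qq: "q y \<le> Q y" "q' y \<le> Q y" if "y \<in> carrier E" for y
   using E.seminorm_nonneg[OF qs(1) that] E.seminorm_nonneg[OF qs(2) that] by (auto simp: Q_def UNIV_bool)
  have Qh0: "0 \<le> Q h0" by (rule E.seminorm_nonneg[OF Qs h0])
  define r where "r = 1 / (2 * (Q h0 + 1))"
  have r: "r > 0" using Qh0 by (simp add: r_def)
  have "\<forall>\<^sub>F t in at 0. Q (x t \<ominus>\<^sub>E x0) < 1/2" "\<forall>\<^sub>F t in at 0. Q (h t \<ominus>\<^sub>E h0) < 1"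
   by (rule E.lim_cseminormD; use x(1) h Q in simp)+
  moreover have "\<forall>\<^sub>F t in at 0. x t \<in> carrier E" "\<forall>\<^sub>F t in at 0. h t \<in> carrier E"
   using E.lim_eventually x(1) h by blast+
  moreover have "\<forall>\<^sub>F t::real in at 0. \<bar>t\<bar> < r"
   unfolding eventually_at using r by (intro exI[of _ r]) (auto simp: dist_real_def)
  moreover have "\<forall>\<^sub>F t::real in at 0. t \<noteq> 0" by (rule eventually_neq_at_within)
  ultimately show ?thesis using der qb
  proof eventually_elim
   case (elim t)
   have xc: "x t \<in> carrier E" and hc: "h t \<in> carrier E" using elim by auto
   let ?y = "\<lambda>s. x t \<oplus>\<^sub>E s \<odot>\<^sub>E h t"
   have yc: "?y s \<in> carrier E" for s using xc hc by simp
   have Qy: "Q (?y s \<ominus>\<^sub>E x0) < 1" if s: "s \<in> closed_segment 0 t" for s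
   proof -
    have "\<bar>s\<bar> \<le> \<bar>t\<bar>" using s by (auto simp: closed_segment_eq_real_ivl split: if_splits)
    have "Q (h t) \<le> Q (h t \<ominus>\<^sub>E h0) + Q h0"
     using E.seminorm_triangle[OF Qs hc h0, of "\<zero>\<^sub>E"] hc h0 by simp
    then have Qh: "Q (h t) \<le> Q h0 + 1" using elim by simp
    have "?y s \<ominus>\<^sub>E x0 = (x t \<ominus>\<^sub>E x0) \<oplus>\<^sub>E s \<odot>\<^sub>E h t"
     using E.add_sub_add[OF xc _ x0, of "s \<odot>\<^sub>E h t" "\<zero>\<^sub>E"] x0 hc by simp
    then have "Q (?y s \<ominus>\<^sub>E x0) \<le> Q (x t \<ominus>\<^sub>E x0) + \<bar>s\<bar> * Q (h t)"
     using E.seminorm_add[OF Qs, of "x t \<ominus>\<^sub>E x0" "s \<odot>\<^sub>E h t"] E.seminorm_smul[OF Qs hc, of s] xc hc x0 by simp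
    also have "\<bar>s\<bar> * Q (h t) \<le> r * (Q h0 + 1)"
     using \<open>\<bar>s\<bar> \<le> \<bar>t\<bar>\<close> elim Qh E.seminorm_nonneg[OF Qs hc] r by (intro mult_mono) auto
    also have "r * (Q h0 + 1) = 1/2" using Qh0 by (simp add: r_def)
    finally show ?thesis using elim by simp
   qed
   have yW: "?y s \<in> W" if "s \<in> closed_segment 0 t" for s
    using q'(2) Qq(2)[of "?y s \<ominus>\<^sub>E x0"] Qy[OF that] yc[of s] x0 by auto
   have mv: "p ((\<phi> t (?y t) \<ominus>\<^sub>F \<phi> t (?y 0)) \<ominus>\<^sub>F t \<odot>\<^sub>F l) \<le> e / 2 * \<bar>t\<bar>"
   proof (rule F.mean_value_segment[OF p, where c' = "\<lambda>s. \<phi>' t (?y s)"])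
    fix s assume s: "s \<in> closed_segment 0 t"
    show "\<phi> t (?y s) \<in> carrier F" using elim yW[OF s] by blast
    have eq: "?y s \<oplus>\<^sub>E r \<odot>\<^sub>E h t = ?y (s + r)" for r
     using xc hc by (simp add: E.smul_add_left E.a_assoc)
    show "limitin (topol F) (\<lambda>r. inverse r \<odot>\<^sub>F (\<phi> t (?y (s + r)) \<ominus>\<^sub>F \<phi> t (?y s))) (\<phi>' t (?y s)) (at 0)"
     using elim yW[OF s] unfolding has_dir_deriv_def eq[symmetric] by blast
    show "p (\<phi>' t (?y s) \<ominus>\<^sub>F l) \<le> e / 2"
     using elim Qq(1)[of "?y s \<ominus>\<^sub>E x0"] Qy[OF s] yc[of s] x0 by (intro less_imp_le) auto
   qed (rule l)
   have y0: "?y 0 = x t" using xc hc by simp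
   moreover have fc: "\<phi> t (?y t) \<in> carrier F" "\<phi> t (x t) \<in> carrier F"
    using elim yW[of t] yW[of 0] y0 by auto
   moreover have "inverse t \<odot>\<^sub>F (\<phi> t (?y t) \<ominus>\<^sub>F \<phi> t (x t)) \<ominus>\<^sub>F l
     = inverse t \<odot>\<^sub>F ((\<phi> t (?y t) \<ominus>\<^sub>F \<phi> t (x t)) \<ominus>\<^sub>F t \<odot>\<^sub>F l)"
    using fc l elim by (simp add: F.smul_sub)
   ultimately have "p (inverse t \<odot>\<^sub>F (\<phi> t (?y t) \<ominus>\<^sub>F \<phi> t (x t)) \<ominus>\<^sub>F l)
     = \<bar>inverse t\<bar> * p ((\<phi> t (?y t) \<ominus>\<^sub>F \<phi> t (?y 0)) \<ominus>\<^sub>F t \<odot>\<^sub>F l)"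
    using F.seminorm_smul[OF ps] l by simp
   also have "\<dots> \<le> \<bar>inverse t\<bar> * (e / 2 * \<bar>t\<bar>)"
    by (rule mult_left_mono[OF mv]) simp
   also have "\<dots> < e" using elim e by simp
   finally show ?case using fc by simp
  qed
 qed
 have zero: "cseminorm F (\<lambda>_. 0)" by (rule F.cseminorm_zero_fun)
 show ?thesis
  unfolding F.limitin_cseminorm
 proof (intro conjI allI impI)
  show "\<forall>\<^sub>F t in at 0. inverse t \<odot>\<^sub>F (\<phi> t (x t \<oplus>\<^sub>E t \<odot>\<^sub>E h t) \<ominus>\<^sub>F \<phi> t (x t)) \<in> carrier F"
   using main[OF zero zero_less_one] by (rule eventually_mono) simp
  show "\<forall>\<^sub>F t in at 0. p (inverse t \<odot>\<^sub>F (\<phi> t (x t \<oplus>\<^sub>E t \<odot>\<^sub>E h t) \<ominus>\<^sub>F \<phi> t (x t)) \<ominus>\<^sub>F l) < e"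
   if "cseminorm F p" "0 < e" for p e
   using main[OF that] by (rule eventually_mono) simp
 qed (rule l)
qed

section \<open>Iterated directional derivatives\<close>

lemma iter_deriv_cong_h:
 "(\<And>j. j < k ==> h j = h' j) ==> iter_deriv E F f k h = iter_deriv E F f k h'"
proof (induction k)
 case (Suc k)
 then have "iter_deriv E F f k h = iter_deriv E F f k h'" "h k = h' k" by simp_all
 then show ?case by (intro ext) simp
qed auto

lemma has_dir_deriv_local:
 assumes E: "rlc E" and W: "openin (topol E) W" "x \<in> W" and h: "h \<in> carrier E"
  and eq: "\<And>y. y \<in> W ==> f y = g y" and d: "has_dir_deriv E F f x h l"
 shows "has_dir_deriv E F g x h l"
proof -
 interpret E: rlc E by fact
 have x: "x \<in> carrier E" using openin_subset[OF W(1)] W(2) by auto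
 have "limitin (topol E) (\<lambda>t. x \<oplus>\<^sub>E t \<odot>\<^sub>E h) (x \<oplus>\<^sub>E 0 \<odot>\<^sub>E h) (at 0)"
  by (intro E.lim_add E.lim_smul tendsto_ident_at) (use x h in auto)
 then have "limitin (topol E) (\<lambda>t. x \<oplus>\<^sub>E t \<odot>\<^sub>E h) x (at 0)" using x h by simp
 from limitinD[OF this W] have "\<forall>\<^sub>F t in at 0. x \<oplus>\<^sub>E t \<odot>\<^sub>E h \<in> W" .
 then have "\<forall>\<^sub>F t in at 0. inverse t \<odot>\<^sub>F (f (x \<oplus>\<^sub>E t \<odot>\<^sub>E h) \<ominus>\<^sub>F f x)
   = inverse t \<odot>\<^sub>F (g (x \<oplus>\<^sub>E t \<odot>\<^sub>E h) \<ominus>\<^sub>F g x)"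
  by (rule eventually_mono) (simp add: eq W(2))
 from limitin_transform_eventually[OF this] d show ?thesis
  unfolding has_dir_deriv_def by blast
qed

lemma dir_deriv_local:
 assumes E: "rlc E" and W: "openin (topol E) W" "x \<in> W" and h: "h \<in> carrier E"
  and eq: "\<And>y. y \<in> W ==> f y = g y"
 shows "dir_deriv E F f x h = dir_deriv E F g x h"
proof -
 have "has_dir_deriv E F f x h = has_dir_deriv E F g x h"
 proof (intro ext iffI)
  show "has_dir_deriv E F g x h l" if "has_dir_deriv E F f x h l" for l
   using has_dir_deriv_local[OF E W h _ that] eq by blast
  show "has_dir_deriv E F f x h l" if "has_dir_deriv E F g x h l" for l
   using has_dir_deriv_local[OF E W h _ that] eq by metis
 qed
 then show ?thesis by (simp add: dir_deriv_def)
qed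

lemma iter_deriv_local:
 assumes E: "rlc E" and W: "openin (topol E) W" and h: "h \<in> {..<k} \<rightarrow> carrier E"
  and eq: "\<And>y. y \<in> W ==> f y = g y" and x: "x \<in> W"
 shows "iter_deriv E F f k h x = iter_deriv E F g k h x"
 using h x
proof (induction k arbitrary: x)
 case (Suc k)
 then have "h k \<in> carrier E" "h \<in> {..<k} \<rightarrow> carrier E" by auto
 then show ?case
  using dir_deriv_local[OF E W Suc.prems(2), of "h k" "iter_deriv E F f k h" "iter_deriv E F g k h"] Suc.IH by simp
qed (use eq in simp)

lemma dir_derivI:
 assumes "rlc F" "has_dir_deriv E F f x h l"
 shows "dir_deriv E F f x h = l"
proof -
 interpret F: rlc F by fact
 show ?thesis unfolding dir_deriv_def
  using assms(2) unfolding has_dir_deriv_def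
  by (intro the_equality) (auto intro: F.lim_unique[OF _ _ at_neq_bot])
qed

lemma topspace_jet:
 assumes "rlc E" "W \<subseteq> carrier E"
 shows "topspace (jet_topology E W k) = W \<times> PiE {..<k} (\<lambda>_. carrier E)"
proof -
 interpret E: rlc E by fact
 show ?thesis using assms(2) by (auto simp: jet_topology_def)
qed

locale smooth_fun = E: rlc E + F: rlc F
 for E :: "(real, 'v) tmodule" and F :: "(real, 'w) tmodule" +
 fixes W and f
 assumes W: "openin (topol E) W" and smooth: "smooth_on E F W f"
begin

abbreviation D where "D \<equiv> iter_deriv E F f"

lemma W_sub: "x \<in> W ==> x \<in> carrier E"
 using openin_subset[OF W] by auto

lemma D_cont: "continuous_map (jet_topology E W k) (topol F) (\<lambda>(x, h). D k h x)"
 using smooth by (simp add: smooth_on_def)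

lemma jet_top: "topspace (jet_topology E W k) = W \<times> PiE {..<k} (\<lambda>_. carrier E)"
 using topspace_jet[of E W k] E.rlc_axioms W_sub by blast

lemma D_restrict: "D k (restrict h {..<k}) = D k h"
 by (rule iter_deriv_cong_h) simp

lemma D_closed: "x \<in> W ==> h \<in> {..<k} \<rightarrow> carrier E ==> D k h x \<in> carrier F"
 using F.continuous_closed[OF D_cont, of "(x, restrict h {..<k})" k] by (simp add: jet_top D_restrict Pi_iff)

lemma f_closed: "x \<in> W ==> f x \<in> carrier F"
 using D_closed[of x "\<lambda>_. \<zero>\<^sub>E" 0] by simp

lemma D_deriv:
 assumes "x \<in> W" "h \<in> {..k} \<rightarrow> carrier E"
 shows "has_dir_deriv E F (D k h) x (h k) (D (Suc k) h x)"
proof -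
 obtain l where l: "has_dir_deriv E F (D k h) x (h k) l"
  using smooth assms unfolding smooth_on_def by blast
 then have "D (Suc k) h x = l" using dir_derivI[OF F.rlc_axioms l] by simp
 then show ?thesis using l by simp
qed

lemma D_nbhd:
 assumes x: "x \<in> W" and h: "h \<in> {..<k} \<rightarrow> carrier E"
  and lim: "\<And>j. j < k ==> limitin (topol E) (\<lambda>t. hs t j) (h j) \<F>"
  and p: "cseminorm F p" and e: "e > 0"
 shows "\<exists>q. cseminorm E q \<and> (\<forall>\<^sub>F t in \<F>. \<forall>y\<in>carrier E. q (y \<ominus>\<^sub>E x) < 1 -->
  y \<in> W \<and> p (D k (hs t) y \<ominus>\<^sub>F D k h x) < e)"
proof -
 have ps: "seminorm F p" using p by (simp add: cseminorm_def)
 let ?T = "{z \<in> topspace (jet_topology E W k). (case z of (y, h) => D k h y) \<in> {w \<in> carrier F. p (w \<ominus>\<^sub>F D k h x) < e}}"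
 have "openin (jet_topology E W k) ?T"
  by (rule openin_continuous_map_preimage[OF D_cont]) (intro F.cseminorm_ball_open p D_closed x h)
 moreover have "(x, restrict h {..<k}) \<in> ?T"
  using x h D_closed[OF x h] e F.seminorm_zero[OF ps] by (auto simp: jet_top D_restrict Pi_iff)
 ultimately obtain U V where UV: "openin (subtopology (topol E) W) U" "openin (product_topology (\<lambda>_. topol E) {..<k}) V"
  "x \<in> U" "restrict h {..<k} \<in> V" "U \<times> V \<subseteq> ?T"
  unfolding jet_topology_def openin_prod_topology_alt by meson
 have U: "openin (topol E) U" using UV(1) W by (simp add: openin_open_subtopology)
 obtain q where q: "cseminorm E q" "\<forall>y\<in>carrier E. q (y \<ominus>\<^sub>E x) < 1 --> y \<in> U"
  using E.ex_cseminorm[OF U UV(3)] by blast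
 have ev: "\<forall>\<^sub>F t in \<F>. \<forall>j\<in>{..<k}. hs t j \<in> carrier E"
  using lim E.lim_eventually by (intro eventually_ball_finite) auto
 have "limitin (product_topology (\<lambda>_. topol E) {..<k}) (\<lambda>t. restrict (hs t) {..<k}) (restrict h {..<k}) \<F>"
  unfolding limitin_componentwise
 proof (intro conjI ballI)
  show "\<forall>\<^sub>F t in \<F>. restrict (hs t) {..<k} \<in> topspace (product_topology (\<lambda>_. topol E) {..<k})"
   using ev by (rule eventually_mono) (simp add: Pi_iff)
  show "limitin (topol E) (\<lambda>t. restrict (hs t) {..<k} j) (restrict h {..<k} j) \<F>" if "j \<in> {..<k}" for j
   using lim that by simp
 qed simp
 then have "\<forall>\<^sub>F t in \<F>. restrict (hs t) {..<k} \<in> V" using UV(2,4) by (rule limitinD)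
 then have "\<forall>\<^sub>F t in \<F>. \<forall>y\<in>carrier E. q (y \<ominus>\<^sub>E x) < 1 -->
  y \<in> W \<and> p (D k (hs t) y \<ominus>\<^sub>F D k h x) < e"
 proof (rule eventually_mono, intro ballI impI)
  fix t y assume "restrict (hs t) {..<k} \<in> V" "y \<in> carrier E" "q (y \<ominus>\<^sub>E x) < 1"
  then have "(y, restrict (hs t) {..<k}) \<in> ?T" using q(2) UV(5) by blast
  then show "y \<in> W \<and> p (D k (hs t) y \<ominus>\<^sub>F D k h x) < e" by (simp add: jet_top D_restrict)
 qed
 then show ?thesis using q(1) by blast
qed

lemma D_lim:
 assumes x: "x \<in> W" and h: "h \<in> {..<k} \<rightarrow> carrier E"
  and lim: "\<And>j. j < k ==> limitin (topol E) (\<lambda>t. hs t j) (h j) \<F>"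
 shows "limitin (topol F) (\<lambda>t. D k (hs t) x) (D k h x) \<F>"
 unfolding F.limitin_cseminorm
proof (intro conjI allI impI D_closed x h)
 have "\<forall>\<^sub>F t in \<F>. \<forall>j\<in>{..<k}. hs t j \<in> carrier E"
  using lim E.lim_eventually by (intro eventually_ball_finite) auto
 then show "\<forall>\<^sub>F t in \<F>. D k (hs t) x \<in> carrier F"
  by (rule eventually_mono) (intro D_closed x, auto)
 fix p and e :: real assume p: "cseminorm F p" and e: "0 < e"
 obtain q where q: "cseminorm E q" "\<forall>\<^sub>F t in \<F>. \<forall>y\<in>carrier E. q (y \<ominus>\<^sub>E x) < 1 -->
  y \<in> W \<and> p (D k (hs t) y \<ominus>\<^sub>F D k h x) < e"
  using D_nbhd[OF x h lim p e] by blast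
 have "q (x \<ominus>\<^sub>E x) < 1" using q(1) W_sub[OF x] E.seminorm_zero[of q] by (simp add: cseminorm_def)
 then show "\<forall>\<^sub>F t in \<F>. p (D k (hs t) x \<ominus>\<^sub>F D k h x) < e"
  using q(2) by (rule_tac eventually_mono[OF q(2)]) (use W_sub[OF x] in blast)
qed

lemma D_quotient:
 assumes x: "limitin (topol E) x x0 (at 0)" "x0 \<in> W" and h: "h \<in> {..<k} \<rightarrow> carrier E"
  and lim: "\<And>j. j < k ==> limitin (topol E) (\<lambda>t. hs t j) (h j) (at 0)"
  and v: "limitin (topol E) v v0 (at 0)"
 shows "limitin (topol F) (\<lambda>t. inverse t \<odot>\<^sub>F (D k (hs t) (x t \<oplus>\<^sub>E t \<odot>\<^sub>E v t) \<ominus>\<^sub>F D k (hs t) (x t)))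
  (D (Suc k) (h(k := v0)) x0) (at 0)"
proof (rule diff_quotient_limit[OF E.rlc_axioms F.rlc_axioms W x v, where \<phi>' = "\<lambda>t. D (Suc k) ((hs t)(k := v t))"])
 have v0: "v0 \<in> carrier E" by (rule E.lim_closed[OF v])
 have hk: "h(k := v0) \<in> {..<Suc k} \<rightarrow> carrier E" using h v0 by (auto simp: less_Suc_eq)
 show "D (Suc k) (h(k := v0)) x0 \<in> carrier F" by (rule D_closed[OF x(2) hk])
 have "\<forall>\<^sub>F t in at 0. \<forall>j\<in>{..<k}. hs t j \<in> carrier E"
  using lim E.lim_eventually by (intro eventually_ball_finite) auto
 then show "\<forall>\<^sub>F t in at 0. \<forall>y\<in>W. D k (hs t) y \<in> carrier F \<and>
   has_dir_deriv E F (D k (hs t)) y (v t) (D (Suc k) ((hs t)(k := v t)) y)"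
  using E.lim_eventually[OF v]
 proof eventually_elim
  case (elim t)
  show ?case
  proof (intro ballI conjI D_closed)
   fix y assume y: "y \<in> W"
   show "has_dir_deriv E F (D k (hs t)) y (v t) (D (Suc k) ((hs t)(k := v t)) y)"
    using D_deriv[OF y, of "(hs t)(k := v t)" k] elim iter_deriv_cong_h[of k "(hs t)(k := v t)" "hs t" E F f]
    by (simp add: Pi_iff)
  qed (use elim in auto)
 qed
 fix p and e :: real assume p: "cseminorm F p" and e: "0 < e"
 have "limitin (topol E) (\<lambda>t. ((hs t)(k := v t)) j) ((h(k := v0)) j) (at 0)" if "j < Suc k" for j
  using that lim v by (auto simp: less_Suc_eq)
 from D_nbhd[OF x(2) hk this p e] obtain q where q: "cseminorm E q"
  "\<forall>\<^sub>F t in at 0. \<forall>y\<in>carrier E. q (y \<ominus>\<^sub>E x0) < 1 -->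
   y \<in> W \<and> p (D (Suc k) ((hs t)(k := v t)) y \<ominus>\<^sub>F D (Suc k) (h(k := v0)) x0) < e" by blast
 show "\<exists>q. cseminorm E q \<and> (\<forall>\<^sub>F t in at 0. \<forall>y\<in>carrier E. q (y \<ominus>\<^sub>E x0) < 1 -->
   p (D (Suc k) ((hs t)(k := v t)) y \<ominus>\<^sub>F D (Suc k) (h(k := v0)) x0) < e)"
  using q(1) eventually_mono[OF q(2)] by (intro exI[of _ q]) auto
qed

lemma D_direction:
 assumes x: "x \<in> W" and h: "h \<in> {..<k} \<rightarrow> carrier E" and a: "a \<in> carrier E"
 shows "limitin (topol F) (\<lambda>t. inverse t \<odot>\<^sub>F (D k h (x \<oplus>\<^sub>E t \<odot>\<^sub>E a) \<ominus>\<^sub>F D k h x))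
  (D (Suc k) (h(k := a)) x) (at 0)"
 by (rule D_quotient) (use x h a W_sub in \<open>auto simp: Pi_iff\<close>)

lemma lim_line:
 assumes x: "x \<in> W" and a: "a \<in> carrier E"
 shows "limitin (topol E) (\<lambda>t. x \<oplus>\<^sub>E t \<odot>\<^sub>E a) x (at 0)" "\<forall>\<^sub>F t in at 0. x \<oplus>\<^sub>E t \<odot>\<^sub>E a \<in> W"
proof -
 have "limitin (topol E) (\<lambda>t. x \<oplus>\<^sub>E t \<odot>\<^sub>E a) (x \<oplus>\<^sub>E 0 \<odot>\<^sub>E a) (at 0)"
  by (intro E.lim_add E.lim_smul tendsto_ident_at) (use x a W_sub in auto)
 then show *: "limitin (topol E) (\<lambda>t. x \<oplus>\<^sub>E t \<odot>\<^sub>E a) x (at 0)" using W_sub[OF x] a by simp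
 show "\<forall>\<^sub>F t in at 0. x \<oplus>\<^sub>E t \<odot>\<^sub>E a \<in> W" by (rule limitinD[OF * W x])
qed

text \<open>The difference quotient in the direction \<open>a + b\<close> splits at an intermediate point, and
  difference quotients with moving base point converge as well.\<close>

lemma D_add_last:
 assumes x: "x \<in> W" and h: "h \<in> {..<k} \<rightarrow> carrier E" and a: "a \<in> carrier E" and b: "b \<in> carrier E"
 shows "D (Suc k) (h(k := a \<oplus>\<^sub>E b)) x = D (Suc k) (h(k := a)) x \<oplus>\<^sub>F D (Suc k) (h(k := b)) x"
proof (rule F.lim_unique)
 have xc: "x \<in> carrier E" by (rule W_sub[OF x])
 show "limitin (topol F) (\<lambda>t. inverse t \<odot>\<^sub>F (D k h (x \<oplus>\<^sub>E t \<odot>\<^sub>E (a \<oplus>\<^sub>E b)) \<ominus>\<^sub>F D k h x))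
  (D (Suc k) (h(k := a \<oplus>\<^sub>E b)) x) (at 0)"
  by (rule D_direction) (use x h a b in auto)
 have "limitin (topol F) (\<lambda>t. inverse t \<odot>\<^sub>F (D k h ((x \<oplus>\<^sub>E t \<odot>\<^sub>E a) \<oplus>\<^sub>E t \<odot>\<^sub>E b) \<ominus>\<^sub>F D k h (x \<oplus>\<^sub>E t \<odot>\<^sub>E a)))
  (D (Suc k) (h(k := b)) x) (at 0)"
  by (rule D_quotient) (use x h b lim_line[OF x a] in \<open>auto simp: Pi_iff\<close>)
 with D_direction[OF x h a]
 have "limitin (topol F) (\<lambda>t. inverse t \<odot>\<^sub>F (D k h (x \<oplus>\<^sub>E t \<odot>\<^sub>E a) \<ominus>\<^sub>F D k h x) \<oplus>\<^sub>F
   inverse t \<odot>\<^sub>F (D k h ((x \<oplus>\<^sub>E t \<odot>\<^sub>E a) \<oplus>\<^sub>E t \<odot>\<^sub>E b) \<ominus>\<^sub>F D k h (x \<oplus>\<^sub>E t \<odot>\<^sub>E a)))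
  (D (Suc k) (h(k := a)) x \<oplus>\<^sub>F D (Suc k) (h(k := b)) x) (at 0)" by (rule F.lim_add)
 then show "limitin (topol F) (\<lambda>t. inverse t \<odot>\<^sub>F (D k h (x \<oplus>\<^sub>E t \<odot>\<^sub>E (a \<oplus>\<^sub>E b)) \<ominus>\<^sub>F D k h x))
  (D (Suc k) (h(k := a)) x \<oplus>\<^sub>F D (Suc k) (h(k := b)) x) (at 0)"
 proof (rule F.lim_cong)
  show "\<forall>\<^sub>F t in at 0. inverse t \<odot>\<^sub>F (D k h (x \<oplus>\<^sub>E t \<odot>\<^sub>E a) \<ominus>\<^sub>F D k h x) \<oplus>\<^sub>F
   inverse t \<odot>\<^sub>F (D k h ((x \<oplus>\<^sub>E t \<odot>\<^sub>E a) \<oplus>\<^sub>E t \<odot>\<^sub>E b) \<ominus>\<^sub>F D k h (x \<oplus>\<^sub>E t \<odot>\<^sub>E a))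
   = inverse t \<odot>\<^sub>F (D k h (x \<oplus>\<^sub>E t \<odot>\<^sub>E (a \<oplus>\<^sub>E b)) \<ominus>\<^sub>F D k h x)"
   using lim_line(2)[OF x a] lim_line(2)[OF x E.a_closed[OF a b]]
  proof eventually_elim
   case (elim t)
   have eq: "(x \<oplus>\<^sub>E t \<odot>\<^sub>E a) \<oplus>\<^sub>E t \<odot>\<^sub>E b = x \<oplus>\<^sub>E t \<odot>\<^sub>E (a \<oplus>\<^sub>E b)"
    using xc a b by (simp add: E.smul_add_right E.a_assoc)
   show ?case unfolding eq
    using D_closed[OF elim(1) h] D_closed[OF elim(2) h] D_closed[OF x h]
    by (simp add: F.smul_add_right[symmetric] F.sub_add_sub F.a_comm[of "D k h (x \<oplus>\<^sub>E t \<odot>\<^sub>E a) \<ominus>\<^sub>F D k h x"])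
  qed
 qed simp
qed simp

lemma D_smul_last:
 assumes x: "x \<in> W" and h: "h \<in> {..<k} \<rightarrow> carrier E" and a: "a \<in> carrier E"
 shows "D (Suc k) (h(k := r \<odot>\<^sub>E a)) x = r \<odot>\<^sub>F D (Suc k) (h(k := a)) x"
proof (rule F.lim_unique)
 have xc: "x \<in> carrier E" by (rule W_sub[OF x])
 let ?q = "\<lambda>a t. inverse t \<odot>\<^sub>F (D k h (x \<oplus>\<^sub>E t \<odot>\<^sub>E a) \<ominus>\<^sub>F D k h x)"
 show "limitin (topol F) (?q (r \<odot>\<^sub>E a)) (D (Suc k) (h(k := r \<odot>\<^sub>E a)) x) (at 0)"
  by (rule D_direction) (use x h a in auto)
 have l: "limitin (topol F) (?q a) (D (Suc k) (h(k := a)) x) (at 0)"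
  by (rule D_direction) (use x h a in auto)
 have lc: "D (Suc k) (h(k := a)) x \<in> carrier F" by (rule F.lim_closed[OF l])
 show "limitin (topol F) (?q (r \<odot>\<^sub>E a)) (r \<odot>\<^sub>F D (Suc k) (h(k := a)) x) (at 0)"
 proof (cases "r = 0")
  case True
  have "?q (r \<odot>\<^sub>E a) = (\<lambda>t. \<zero>\<^sub>F)" using True xc a D_closed[OF x h] by auto
  then show ?thesis using True lc by simp
 next
  case False
  have fl: "filterlim (\<lambda>t. t * r) (at 0) (at (0::real))"
   unfolding filterlim_at using False
   by (auto intro!: tendsto_eq_intros eventually_neq_at_within[THEN eventually_mono])
  have cancel: "inverse t * inverse r * r = inverse t" for t using False by simp
  have "limitin (topol F) (\<lambda>t. ?q a (t * r)) (D (Suc k) (h(k := a)) x) (at 0)"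
   unfolding limitin_def
  proof (intro conjI allI impI)
   fix U assume U: "openin (topol F) U \<and> D (Suc k) (h(k := a)) x \<in> U"
   then have "\<forall>\<^sub>F s in at 0. ?q a s \<in> U" using l by (auto simp: limitin_def)
   then show "\<forall>\<^sub>F t in at 0. ?q a (t * r) \<in> U" by (rule eventually_compose_filterlim[OF _ fl])
  qed (use lc in simp)
  then have "limitin (topol F) (\<lambda>t. r \<odot>\<^sub>F ?q a (t * r)) (r \<odot>\<^sub>F D (Suc k) (h(k := a)) x) (at 0)"
   by (intro F.lim_smul tendsto_const)
  then show ?thesis
  proof (rule F.lim_cong)
   show "\<forall>\<^sub>F t in at 0. r \<odot>\<^sub>F ?q a (t * r) = ?q (r \<odot>\<^sub>E a) t"
    using lim_line(2)[OF x E.smul_closed[OF a], of r]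
    by eventually_elim (use D_closed[OF _ h] x a False in \<open>simp add: mult.commute[of r] cancel\<close>)
  qed simp
 qed
qed simp

lemma D_add:
 assumes "x \<in> W" "h \<in> {..<k} \<rightarrow> carrier E" "a \<in> carrier E" "b \<in> carrier E" "i < k"
 shows "D k (h(i := a \<oplus>\<^sub>E b)) x = D k (h(i := a)) x \<oplus>\<^sub>F D k (h(i := b)) x"
 using assms
proof (induction k arbitrary: x)
 case (Suc k)
 have h: "h \<in> {..<k} \<rightarrow> carrier E" "h k \<in> carrier E" using Suc.prems by auto
 show ?case
 proof (cases "i = k")
  case True then show ?thesis using D_add_last[OF Suc.prems(1) h(1) Suc.prems(3,4)] by (simp only: True)
 next
  case False
  then have i: "i < k" using Suc.prems by simp
  note x = Suc.prems(1) and ab = Suc.prems(3,4)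
  have hi: "h(i := c) \<in> {..<k} \<rightarrow> carrier E" if "c \<in> carrier E" for c using h that by auto
  have d: "limitin (topol F) (\<lambda>t. inverse t \<odot>\<^sub>F (D k (h(i := c)) (x \<oplus>\<^sub>E t \<odot>\<^sub>E h k) \<ominus>\<^sub>F D k (h(i := c)) x))
    (D (Suc k) (h(i := c)) x) (at 0)" if "c \<in> carrier E" for c
  proof -
   have "(h(i := c))(k := h k) = h(i := c)" using False by auto
   then show ?thesis using D_direction[OF x hi[OF that] h(2)] by (simp only:)
  qed
  show ?thesis
  proof (rule F.lim_unique[OF d[OF E.a_closed[OF ab]]])
   show "limitin (topol F) (\<lambda>t. inverse t \<odot>\<^sub>F (D k (h(i := a \<oplus>\<^sub>E b)) (x \<oplus>\<^sub>E t \<odot>\<^sub>E h k) \<ominus>\<^sub>F D k (h(i := a \<oplus>\<^sub>E b)) x))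
     (D (Suc k) (h(i := a)) x \<oplus>\<^sub>F D (Suc k) (h(i := b)) x) (at 0)"
    by (rule F.lim_cong[OF F.lim_add[OF d[OF ab(1)] d[OF ab(2)]]], rule eventually_mono[OF lim_line(2)[OF x h(2)]])
     (use Suc.IH[OF _ h(1) ab i] x D_closed[OF _ hi[OF ab(1)]] D_closed[OF _ hi[OF ab(2)]] in
      \<open>simp_all add: F.smul_add_right[symmetric] F.add_sub_add[symmetric] del: fun_upd_apply\<close>)
  qed simp
 qed
qed simp

lemma D_smul:
 assumes "x \<in> W" "h \<in> {..<k} \<rightarrow> carrier E" "a \<in> carrier E" "i < k"
 shows "D k (h(i := r \<odot>\<^sub>E a)) x = r \<odot>\<^sub>F D k (h(i := a)) x"
 using assms
proof (induction k arbitrary: x)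
 case (Suc k)
 have h: "h \<in> {..<k} \<rightarrow> carrier E" "h k \<in> carrier E" using Suc.prems by auto
 show ?case
 proof (cases "i = k")
  case True then show ?thesis using D_smul_last[OF Suc.prems(1) h(1) Suc.prems(3)] by (simp only: True)
 next
  case False
  then have i: "i < k" using Suc.prems by simp
  note x = Suc.prems(1) and a = Suc.prems(3)
  have hi: "h(i := c) \<in> {..<k} \<rightarrow> carrier E" if "c \<in> carrier E" for c using h that by auto
  have d: "limitin (topol F) (\<lambda>t. inverse t \<odot>\<^sub>F (D k (h(i := c)) (x \<oplus>\<^sub>E t \<odot>\<^sub>E h k) \<ominus>\<^sub>F D k (h(i := c)) x))
    (D (Suc k) (h(i := c)) x) (at 0)" if "c \<in> carrier E" for c
  proof -
   have "(h(i := c))(k := h k) = h(i := c)" using False by auto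
   then show ?thesis using D_direction[OF x hi[OF that] h(2)] by (simp only:)
  qed
  show ?thesis
  proof (rule F.lim_unique[OF d[OF E.smul_closed[OF a]]])
   show "limitin (topol F) (\<lambda>t. inverse t \<odot>\<^sub>F (D k (h(i := r \<odot>\<^sub>E a)) (x \<oplus>\<^sub>E t \<odot>\<^sub>E h k) \<ominus>\<^sub>F D k (h(i := r \<odot>\<^sub>E a)) x))
     (r \<odot>\<^sub>F D (Suc k) (h(i := a)) x) (at 0)"
    by (rule F.lim_cong[OF F.lim_smul[OF tendsto_const d[OF a]]], rule eventually_mono[OF lim_line(2)[OF x h(2)]])
     (use Suc.IH[OF _ h(1) a i] x D_closed[OF _ hi[OF a]] in
      \<open>simp_all add: F.smul_sub mult.commute del: fun_upd_apply\<close>)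
  qed simp
 qed
qed simp

lemma D_sub:
 assumes x: "x \<in> W" and h: "h \<in> {..<k} \<rightarrow> carrier E" and a: "a \<in> carrier E" and b: "b \<in> carrier E" and i: "i < k"
 shows "D k (h(i := a \<ominus>\<^sub>E b)) x = D k (h(i := a)) x \<ominus>\<^sub>F D k (h(i := b)) x"
proof -
 have c: "D k (h(i := a)) x \<in> carrier F" "D k (h(i := b)) x \<in> carrier F"
  by (rule D_closed[OF x]; use h a b in auto)+
 show ?thesis
  using D_add[OF x h a E.smul_closed[OF b, of "-1"] i] D_smul[OF x h b i, of "-1"] c a b
  by (simp add: E.sub_eq F.sub_eq)
qed

text \<open>The base point and all directions move along curves; by multilinearity each of them
  contributes one summand. The derivative of the base point becomes a new last direction.\<close>

lemma D_curve:
 assumes c: "curve_deriv E c c'" "c 0 \<in> W"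
  and v: "\<And>i. i < m ==> curve_deriv E (v i) (v' i)"
 shows "curve_deriv F (\<lambda>t. D m (\<lambda>i. v i t) (c t))
   (D (Suc m) ((\<lambda>i. v i 0)(m := c')) (c 0) \<oplus>\<^sub>F
   lsum F (map (\<lambda>i. D m ((\<lambda>i. v i 0)(i := v' i)) (c 0)) [0..<m]))"
proof -
 define x where "x = c 0"
 have x: "x \<in> W" and xc: "x \<in> carrier E" using c W_sub by (auto simp: x_def)
 have clim: "limitin (topol E) c x (at 0)" unfolding x_def by (rule E.curve_continuous[OF c(1)])
 have cW: "\<forall>\<^sub>F t in at 0. c t \<in> W" by (rule limitinD[OF clim W x])
 have v0: "v i 0 \<in> carrier E" if "i < m" for i using v[OF that] by (simp add: curve_deriv_def)
 have vlim: "limitin (topol E) (v i) (v i 0) (at 0)" if "i < m" for i by (rule E.curve_continuous[OF v[OF that]])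
 have vq: "limitin (topol E) (\<lambda>t. inverse t \<odot>\<^sub>E (v i t \<ominus>\<^sub>E v i 0)) (v' i) (at 0)" if "i < m" for i
  using v[OF that] by (simp add: curve_deriv_def)
 have v'c: "v' i \<in> carrier E" if "i < m" for i by (rule E.lim_closed[OF vq[OF that]])
 have cq: "limitin (topol E) (\<lambda>t. inverse t \<odot>\<^sub>E (c t \<ominus>\<^sub>E x)) c' (at 0)"
  using c(1) by (simp add: curve_deriv_def x_def)
 have h0: "(\<lambda>i. v i 0) \<in> {..<m} \<rightarrow> carrier E" using v0 by auto
 have vc: "\<forall>\<^sub>F t in at 0. \<forall>i\<in>{..<m}. v i t \<in> carrier E"
  using vlim E.lim_eventually by (intro eventually_ball_finite) auto
 have nz: "\<forall>\<^sub>F t::real in at 0. t \<noteq> 0" by (rule eventually_neq_at_within)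
 have part1: "limitin (topol F) (\<lambda>t. inverse t \<odot>\<^sub>F (D m (\<lambda>i. v i t) (c t) \<ominus>\<^sub>F D m (\<lambda>i. v i t) x))
   (D (Suc m) ((\<lambda>i. v i 0)(m := c')) x) (at 0)"
 proof (rule F.lim_cong[OF D_quotient[where x = "\<lambda>_. x" and hs = "\<lambda>t i. v i t", OF _ x h0 _ cq]])
  show "\<forall>\<^sub>F t in at 0. inverse t \<odot>\<^sub>F (D m (\<lambda>i. v i t) (x \<oplus>\<^sub>E t \<odot>\<^sub>E (inverse t \<odot>\<^sub>E (c t \<ominus>\<^sub>E x))) \<ominus>\<^sub>F D m (\<lambda>i. v i t) x)
    = inverse t \<odot>\<^sub>F (D m (\<lambda>i. v i t) (c t) \<ominus>\<^sub>F D m (\<lambda>i. v i t) x)"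
   using cW nz by eventually_elim (use xc W_sub in \<open>simp add: E.add_sub_inverse\<close>)
 qed (use xc vlim in auto)
 define w where "w j t i = (if i < j then v i t else v i 0)" for j t i
 let ?L = "\<lambda>j. lsum F (map (\<lambda>i. D m ((\<lambda>i. v i 0)(i := v' i)) x) [0..<j])"
 have Lc: "D m ((\<lambda>i. v i 0)(i := v' i)) x \<in> carrier F" if "i < m" for i
  by (rule D_closed[OF x]) (use h0 v'c that in auto)
 have part2: "limitin (topol F) (\<lambda>t. inverse t \<odot>\<^sub>F (D m (w j t) x \<ominus>\<^sub>F D m (\<lambda>i. v i 0) x)) (?L j) (at 0)"
  if "j \<le> m" for j
  using that
 proof (induction j)
  case 0
  then show ?case using D_closed[OF x h0] by (simp add: w_def)
 next
  case (Suc j)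
  then have j: "j < m" by simp
  have new: "limitin (topol F) (\<lambda>t. D m ((w j t)(j := inverse t \<odot>\<^sub>E (v j t \<ominus>\<^sub>E v j 0))) x)
    (D m ((\<lambda>i. v i 0)(j := v' j)) x) (at 0)"
  proof (rule D_lim[OF x])
   show "(\<lambda>i. v i 0)(j := v' j) \<in> {..<m} \<rightarrow> carrier E" using h0 v'c[OF j] by auto
   show "limitin (topol E) (\<lambda>t. ((w j t)(j := inverse t \<odot>\<^sub>E (v j t \<ominus>\<^sub>E v j 0))) i)
     (((\<lambda>i. v i 0)(j := v' j)) i) (at 0)" if "i < m" for i
    using vq[OF j] vlim[OF that] v0[OF that] by (cases "i = j"; cases "i < j") (auto simp: w_def)
  qed
  have eqL: "?L (Suc j) = ?L j \<oplus>\<^sub>F D m ((\<lambda>i. v i 0)(j := v' j)) x"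
   using j Lc by (subst upt_Suc_append) (auto simp: image_subset_iff F.lsum_append)
  have lim: "limitin (topol F) (\<lambda>t. inverse t \<odot>\<^sub>F (D m (w j t) x \<ominus>\<^sub>F D m (\<lambda>i. v i 0) x) \<oplus>\<^sub>F
    D m ((w j t)(j := inverse t \<odot>\<^sub>E (v j t \<ominus>\<^sub>E v j 0))) x)
    (?L j \<oplus>\<^sub>F D m ((\<lambda>i. v i 0)(j := v' j)) x) (at 0)"
   by (rule F.lim_add[OF Suc.IH[OF Suc_leD[OF Suc.prems]] new])
  have ev: "\<forall>\<^sub>F t in at 0. inverse t \<odot>\<^sub>F (D m (w j t) x \<ominus>\<^sub>F D m (\<lambda>i. v i 0) x) \<oplus>\<^sub>F
    D m ((w j t)(j := inverse t \<odot>\<^sub>E (v j t \<ominus>\<^sub>E v j 0))) x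
    = inverse t \<odot>\<^sub>F (D m (w (Suc j) t) x \<ominus>\<^sub>F D m (\<lambda>i. v i 0) x)"
   using vc
  proof eventually_elim
   case (elim t)
   have wc: "w i t \<in> {..<m} \<rightarrow> carrier E" for i using elim v0 by (auto simp: w_def)
   have vjc: "v j t \<in> carrier E" "v j 0 \<in> carrier E" using elim v0 j by auto
   have w1: "(w j t)(j := v j t) = w (Suc j) t" "(w j t)(j := v j 0) = w j t"
    by (auto simp: w_def fun_eq_iff less_Suc_eq)
   have "D m ((w j t)(j := inverse t \<odot>\<^sub>E (v j t \<ominus>\<^sub>E v j 0))) x = inverse t \<odot>\<^sub>F (D m (w (Suc j) t) x \<ominus>\<^sub>F D m (w j t) x)"
    using D_smul[OF x wc _ j, of "v j t \<ominus>\<^sub>E v j 0" j "inverse t"] D_sub[OF x wc vjc j, of j] vjc w1 by simp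
   then show ?case
    using D_closed[OF x wc] D_closed[OF x h0]
    by (simp add: F.smul_add_right[symmetric] F.sub_add_sub
      F.a_comm[of "D m (w j t) x \<ominus>\<^sub>F D m (\<lambda>i. v i 0) x"])
  qed
  show ?case by (rule F.lim_cong[OF lim ev eqL[symmetric]])
 qed
 have wm: "D m (w m t) = D m (\<lambda>i. v i t)" for t
  by (rule iter_deriv_cong_h) (simp add: w_def)
 have "limitin (topol F) (\<lambda>t. inverse t \<odot>\<^sub>F (D m (\<lambda>i. v i t) (c t) \<ominus>\<^sub>F D m (\<lambda>i. v i t) x) \<oplus>\<^sub>F
   inverse t \<odot>\<^sub>F (D m (\<lambda>i. v i t) x \<ominus>\<^sub>F D m (\<lambda>i. v i 0) x))
   (D (Suc m) ((\<lambda>i. v i 0)(m := c')) x \<oplus>\<^sub>F ?L m) (at 0)"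
  using F.lim_add[OF part1 part2[OF order_refl]] by (simp add: wm)
 then have "limitin (topol F) (\<lambda>t. inverse t \<odot>\<^sub>F (D m (\<lambda>i. v i t) (c t) \<ominus>\<^sub>F D m (\<lambda>i. v i 0) x))
   (D (Suc m) ((\<lambda>i. v i 0)(m := c')) x \<oplus>\<^sub>F ?L m) (at 0)"
 proof (rule F.lim_cong)
  show "\<forall>\<^sub>F t in at 0. inverse t \<odot>\<^sub>F (D m (\<lambda>i. v i t) (c t) \<ominus>\<^sub>F D m (\<lambda>i. v i t) x) \<oplus>\<^sub>F
   inverse t \<odot>\<^sub>F (D m (\<lambda>i. v i t) x \<ominus>\<^sub>F D m (\<lambda>i. v i 0) x)
   = inverse t \<odot>\<^sub>F (D m (\<lambda>i. v i t) (c t) \<ominus>\<^sub>F D m (\<lambda>i. v i 0) x)"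
   using vc cW
  proof eventually_elim
   case (elim t)
   then have h: "(\<lambda>i. v i t) \<in> {..<m} \<rightarrow> carrier E" by auto
   show ?case
    using D_closed[OF elim(2) h] D_closed[OF x h] D_closed[OF x h0]
    by (simp add: F.smul_add_right[symmetric] F.sub_add_sub)
  qed
 qed simp
 moreover have "\<forall>\<^sub>F t in at 0. D m (\<lambda>i. v i t) (c t) \<in> carrier F"
  using vc cW by eventually_elim (auto intro!: D_closed)
 ultimately show ?thesis
  unfolding curve_deriv_def using D_closed[OF x h0] by (simp add: x_def)
qed

end

section \<open>Iterated derivatives as sums of terms\<close>

text \<open>The Leibniz rule and the chain rule for iterated derivatives are both instances of a
 rewriting process: each term of the \<open>k\<close>-th derivative is replaced by a list of terms when
 one more derivative, in the direction with index \<open>k\<close>, is taken.\<close>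

primrec dterms :: "(nat => 't => 't list) => 't => nat => 't list" where
 "dterms step \<tau> 0 = [\<tau>]"
| "dterms step \<tau> (Suc k) = concat (map (step k) (dterms step \<tau> k))"

lemma jet_continuous_pair:
 assumes "continuous_map X (topol E) f" "f ` topspace X \<subseteq> W"
  and "\<And>j. j < k ==> continuous_map X (topol E) (\<lambda>z. g z j)"
 shows "continuous_map X (jet_topology E W k) (\<lambda>z. (f z, \<lambda>j\<in>{..<k}. g z j))"
 unfolding jet_topology_def continuous_map_pairwise o_def fst_conv snd_conv
 using assms by (auto simp: continuous_map_in_subtopology continuous_map_componentwise)

lemma jet_fst: "continuous_map (jet_topology E W k) (topol E) fst"
proof -
 have "continuous_map (jet_topology E W k) (subtopology (topol E) W) fst"
  unfolding jet_topology_def by (rule continuous_map_fst)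
 then show ?thesis by (rule continuous_map_into_fulltopology)
qed

lemma jet_fst_in: "z \<in> topspace (jet_topology E W k) ==> fst z \<in> W"
 unfolding jet_topology_def topspace_prod_topology topspace_subtopology mem_Times_iff by blast

lemma jet_Pair_in: "(x, h) \<in> topspace (jet_topology E W k) ==> x \<in> W"
 using jet_fst_in[of "(x, h)"] by simp

lemma jet_snd: "j < k ==> continuous_map (jet_topology E W k) (topol E) (\<lambda>z. snd z j)"
 unfolding jet_topology_def
 by (rule continuous_map_compose[OF continuous_map_snd continuous_map_product_projection, unfolded o_def]) simp

lemma jet_reindex:
 assumes "\<And>j. j < m ==> e j < k"
 shows "continuous_map (jet_topology E W k) (jet_topology E W m) (\<lambda>(x, h). (x, \<lambda>j\<in>{..<m}. h (e j)))"
 unfolding case_prod_unfold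
 by (intro jet_continuous_pair jet_fst jet_snd assms) (auto dest: jet_Pair_in)

lemma (in smooth_fun) D_reindex_cont:
 assumes "\<And>j. j < m ==> e j < k"
 shows "continuous_map (jet_topology E W k) (topol F) (\<lambda>(x, h). D m (\<lambda>j. h (e j)) x)"
proof -
 have eq: "D m (\<lambda>j\<in>{..<m}. h (e j)) = D m (\<lambda>j. h (e j))" for h
  by (rule iter_deriv_cong_h) simp
 show ?thesis
  using continuous_map_compose[OF jet_reindex[of m e k E W, OF assms] D_cont[of m]]
  by (simp add: o_def case_prod_unfold eq)
qed

lemma iter_deriv_zero: "iter_deriv E F f 0 h = f"
 by (intro ext) simp

lemma has_dir_deriv_curve:
 assumes E: "rlc E" and F: "rlc F" and W: "openin (topol E) W" "x \<in> W" and h: "h \<in> carrier E"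
  and u: "\<And>y. y \<in> W ==> u y \<in> carrier F"
 shows "has_dir_deriv E F u x h l \<longleftrightarrow> curve_deriv F (\<lambda>t. u (x \<oplus>\<^sub>E t \<odot>\<^sub>E h)) l"
proof -
 interpret E: rlc E by fact
 interpret F: rlc F by fact
 have x: "x \<in> carrier E" using openin_subset[OF W(1)] W(2) by auto
 have "limitin (topol E) (\<lambda>t. x \<oplus>\<^sub>E t \<odot>\<^sub>E h) (x \<oplus>\<^sub>E 0 \<odot>\<^sub>E h) (at 0)"
  by (intro E.lim_add E.lim_smul tendsto_ident_at) (use x h in auto)
 then have "limitin (topol E) (\<lambda>t. x \<oplus>\<^sub>E t \<odot>\<^sub>E h) x (at 0)" using x h by simp
 from limitinD[OF this W] have "\<forall>\<^sub>F t in at 0. u (x \<oplus>\<^sub>E t \<odot>\<^sub>E h) \<in> carrier F"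
  by (rule eventually_mono) (rule u)
 then show ?thesis
  unfolding has_dir_deriv_def curve_deriv_def using x h u[OF W(2)] by simp
qed

lemma (in rlc) curve_add:
 assumes "curve_deriv E c a" "curve_deriv E d b"
 shows "curve_deriv E (\<lambda>t. c t \<oplus> d t) (a \<oplus> b)"
proof -
 have c0: "c 0 \<in> carrier E" "d 0 \<in> carrier E" and
  ev: "\<forall>\<^sub>F t in at 0. c t \<in> carrier E" "\<forall>\<^sub>F t in at 0. d t \<in> carrier E" and
  l: "limitin (topol E) (\<lambda>t. inverse t \<odot> (c t \<ominus> c 0)) a (at 0)"
   "limitin (topol E) (\<lambda>t. inverse t \<odot> (d t \<ominus> d 0)) b (at 0)"
  using assms by (auto simp: curve_deriv_def)
 have "\<forall>\<^sub>F t in at 0. c t \<oplus> d t \<in> carrier E" using ev by eventually_elim simp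
 moreover have "limitin (topol E) (\<lambda>t. inverse t \<odot> (c t \<oplus> d t \<ominus> (c 0 \<oplus> d 0))) (a \<oplus> b) (at 0)"
 proof (rule lim_cong[OF lim_add[OF l]])
  show "\<forall>\<^sub>F t in at 0. inverse t \<odot> (c t \<ominus> c 0) \<oplus> inverse t \<odot> (d t \<ominus> d 0)
    = inverse t \<odot> (c t \<oplus> d t \<ominus> (c 0 \<oplus> d 0))"
   using ev by eventually_elim (use c0 in \<open>simp add: add_sub_add smul_add_right\<close>)
 qed simp
 ultimately show ?thesis using c0 by (simp add: curve_deriv_def)
qed

lemma (in rlc) curve_const: "a \<in> carrier E ==> curve_deriv E (\<lambda>t. a) \<zero>"
 by (simp add: curve_deriv_def)

text \<open>The value of a term \<open>\<tau>\<close> with directions \<open>h\<close> at the point \<open>x\<close> is \<open>val \<tau> h x\<close>, and \<open>ok k \<tau>\<close> means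
  that \<open>\<tau>\<close> mentions only directions with index below \<open>k\<close>.\<close>

locale term_scheme = E: rlc E + F: rlc F
 for E :: "(real, 'v) tmodule" and F :: "(real, 'w) tmodule" +
 fixes W :: "'v set" and val :: "'t => (nat => 'v) => 'v => 'w"
  and step :: "nat => 't => 't list" and ok :: "nat => 't => bool"
 assumes W: "openin (topol E) W"
  and ok_step: "\<And>k \<tau> \<sigma>. ok k \<tau> ==> \<sigma> \<in> set (step k \<tau>) ==> ok (Suc k) \<sigma>"
  and loc: "\<And>k \<tau> h h' x. ok k \<tau> ==> (\<And>j. j < k ==> h j = h' j) ==> x \<in> W ==> val \<tau> h x = val \<tau> h' x"
  and cont: "\<And>k \<tau>. ok k \<tau> ==> continuous_map (jet_topology E W k) (topol F) (\<lambda>(x, h). val \<tau> h x)"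
  and der: "\<And>k \<tau> x h. ok k \<tau> ==> x \<in> W ==> h \<in> {..k} \<rightarrow> carrier E ==>
    has_dir_deriv E F (val \<tau> h) x (h k) (lsum F (map (\<lambda>\<sigma>. val \<sigma> h x) (step k \<tau>)))"
begin

lemma W_sub: "x \<in> W ==> x \<in> carrier E"
 using openin_subset[OF W] by auto

lemma val_closed: "ok k \<tau> ==> x \<in> W ==> h \<in> {..<k} \<rightarrow> carrier E ==> val \<tau> h x \<in> carrier F"
proof -
 assume a: "ok k \<tau>" "x \<in> W" "h \<in> {..<k} \<rightarrow> carrier E"
 have "(x, restrict h {..<k}) \<in> topspace (jet_topology E W k)"
  using a W_sub topspace_jet[of E W k] E.rlc_axioms by (auto simp: Pi_iff subset_iff)
 from F.continuous_closed[OF cont[OF a(1)] this] show ?thesis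
  using loc[OF a(1), of h "restrict h {..<k}" x] a(2) by simp
qed

lemma dterms_ok: "ok 0 \<tau> ==> \<sigma> \<in> set (dterms step \<tau> k) ==> ok k \<sigma>"
 by (induction k arbitrary: \<sigma>) (auto intro: ok_step)

lemma lsum_deriv:
 assumes "\<And>\<tau>. \<tau> \<in> set ts ==> ok k \<tau>" and x: "x \<in> W" and h: "h \<in> {..k} \<rightarrow> carrier E"
 shows "has_dir_deriv E F (\<lambda>y. lsum F (map (\<lambda>\<tau>. val \<tau> h y) ts)) x (h k)
   (lsum F (map (\<lambda>\<tau>. lsum F (map (\<lambda>\<sigma>. val \<sigma> h x) (step k \<tau>))) ts))"
 using assms(1)
proof (induction ts)
 case Nil
 then show ?case by (simp add: has_dir_deriv_def)
next
 case (Cons \<tau> ts)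
 have hk: "h k \<in> carrier E" "h \<in> {..<k} \<rightarrow> carrier E" using h by auto
 note eq = has_dir_deriv_curve[OF E.rlc_axioms F.rlc_axioms W x hk(1)]
 have "curve_deriv F (\<lambda>t. val \<tau> h (x \<oplus>\<^sub>E t \<odot>\<^sub>E h k)) (lsum F (map (\<lambda>\<sigma>. val \<sigma> h x) (step k \<tau>)))"
  using der[OF Cons.prems[of \<tau>] x h] by (subst eq[symmetric]) (auto intro!: val_closed[OF Cons.prems[of \<tau>]] hk(2))
 moreover have "curve_deriv F (\<lambda>t. lsum F (map (\<lambda>\<tau>. val \<tau> h (x \<oplus>\<^sub>E t \<odot>\<^sub>E h k)) ts))
   (lsum F (map (\<lambda>\<tau>. lsum F (map (\<lambda>\<sigma>. val \<sigma> h x) (step k \<tau>))) ts))"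
  using Cons.IH Cons.prems by (subst eq[symmetric]) (auto intro!: F.lsum_closed val_closed[where k = k] hk(2))
 ultimately have "curve_deriv F (\<lambda>t. val \<tau> h (x \<oplus>\<^sub>E t \<odot>\<^sub>E h k) \<oplus>\<^sub>F lsum F (map (\<lambda>\<tau>. val \<tau> h (x \<oplus>\<^sub>E t \<odot>\<^sub>E h k)) ts))
   (lsum F (map (\<lambda>\<sigma>. val \<sigma> h x) (step k \<tau>)) \<oplus>\<^sub>F lsum F (map (\<lambda>\<tau>. lsum F (map (\<lambda>\<sigma>. val \<sigma> h x) (step k \<tau>))) ts))"
  by (rule F.curve_add)
 then have "has_dir_deriv E F (\<lambda>y. val \<tau> h y \<oplus>\<^sub>F lsum F (map (\<lambda>\<tau>. val \<tau> h y) ts)) x (h k)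
   (lsum F (map (\<lambda>\<sigma>. val \<sigma> h x) (step k \<tau>)) \<oplus>\<^sub>F lsum F (map (\<lambda>\<tau>. lsum F (map (\<lambda>\<sigma>. val \<sigma> h x) (step k \<tau>))) ts))"
  by (subst eq) (use Cons.prems in \<open>auto intro!: F.a_closed val_closed[OF Cons.prems[of \<tau>]] F.lsum_closed val_closed[where k = k] hk(2)\<close>)
 then show ?case by simp
qed

context
 fixes f \<tau>
 assumes ok0: "ok 0 \<tau>" and f: "\<And>y h. y \<in> W ==> f y = val \<tau> h y"
begin

lemma deriv_step:
 assumes "h \<in> {..k} \<rightarrow> carrier E" "x \<in> W"
 shows "has_dir_deriv E F (\<lambda>y. lsum F (map (\<lambda>\<sigma>. val \<sigma> h y) (dterms step \<tau> k))) x (h k)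
   (lsum F (map (\<lambda>\<sigma>. val \<sigma> h x) (dterms step \<tau> (Suc k))))"
proof -
 have h: "h \<in> {..<Suc k} \<rightarrow> carrier E" using assms(1) by auto
 have "lsum F (map (\<lambda>\<sigma>. val \<sigma> h x) (dterms step \<tau> (Suc k)))
   = lsum F (map (\<lambda>\<tau>. lsum F (map (\<lambda>\<sigma>. val \<sigma> h x) (step k \<tau>))) (dterms step \<tau> k))"
  using F.lsum_concat[of "dterms step \<tau> k" "\<lambda>\<tau>. map (\<lambda>\<sigma>. val \<sigma> h x) (step k \<tau>)"]
   val_closed[OF ok_step[OF dterms_ok[OF ok0]] assms(2) h]
  by (simp add: map_concat o_def image_subset_iff)
 then show ?thesis using lsum_deriv[OF dterms_ok[OF ok0] assms(2,1)] by simp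
qed

lemma iter_deriv_eq:
 assumes "h \<in> {..<k} \<rightarrow> carrier E" "x \<in> W"
 shows "iter_deriv E F f k h x = lsum F (map (\<lambda>\<sigma>. val \<sigma> h x) (dterms step \<tau> k))"
 using assms
proof (induction k arbitrary: x)
 case 0
 then show ?case using f val_closed[OF ok0, of x h] by simp
next
 case (Suc k)
 have h: "h \<in> {..<k} \<rightarrow> carrier E" "h k \<in> carrier E" "h \<in> {..k} \<rightarrow> carrier E" using Suc.prems by auto
 have "dir_deriv E F (iter_deriv E F f k h) x (h k)
   = dir_deriv E F (\<lambda>y. lsum F (map (\<lambda>\<sigma>. val \<sigma> h y) (dterms step \<tau> k))) x (h k)"
  by (rule dir_deriv_local[OF E.rlc_axioms W Suc.prems(2) h(2)]) (rule Suc.IH[OF h(1)])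
 also have "\<dots> = lsum F (map (\<lambda>\<sigma>. val \<sigma> h x) (dterms step \<tau> (Suc k)))"
  by (rule dir_derivI[OF F.rlc_axioms deriv_step[OF h(3) Suc.prems(2)]])
 finally show ?case by simp
qed

lemma smooth: "smooth_on E F W f"
 unfolding smooth_on_def
proof (intro allI conjI ballI)
 fix k :: nat and x h assume x: "x \<in> W" and h: "h \<in> {..k} \<rightarrow> carrier E"
 then have h': "h \<in> {..<k} \<rightarrow> carrier E" "h k \<in> carrier E" by auto
 have "has_dir_deriv E F (iter_deriv E F f k h) x (h k) (lsum F (map (\<lambda>\<sigma>. val \<sigma> h x) (dterms step \<tau> (Suc k))))"
  by (rule has_dir_deriv_local[OF E.rlc_axioms W x h'(2) _ deriv_step[OF h x]])
   (rule iter_deriv_eq[OF h'(1), symmetric])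
 then show "\<exists>l. has_dir_deriv E F (iter_deriv E F f k h) x (h k) l" by blast
next
 fix k
 have "continuous_map (jet_topology E W k) (topol F) (\<lambda>z. lsum F (map (\<lambda>\<sigma>. val \<sigma> (snd z) (fst z)) ts))"
  if "\<And>\<sigma>. \<sigma> \<in> set ts ==> ok k \<sigma>" for ts
  using that
  by (induction ts) (auto intro!: F.continuous_add cont[unfolded case_prod_unfold])
 from this[OF dterms_ok[OF ok0]]
 have "continuous_map (jet_topology E W k) (topol F) (\<lambda>z. lsum F (map (\<lambda>\<sigma>. val \<sigma> (snd z) (fst z)) (dterms step \<tau> k)))" .
 then show "continuous_map (jet_topology E W k) (topol F) (\<lambda>(x, h). iter_deriv E F f k h x)"
  unfolding case_prod_unfold
 proof (rule continuous_map_eq)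
  fix z assume "z \<in> topspace (jet_topology E W k)"
  then have "fst z \<in> W" "snd z \<in> {..<k} \<rightarrow> carrier E"
   using topspace_jet[of E W k] E.rlc_axioms W_sub by (auto simp: subset_iff)
  then show "lsum F (map (\<lambda>\<sigma>. val \<sigma> (snd z) (fst z)) (dterms step \<tau> k)) = iter_deriv E F f k (snd z) (fst z)"
   by (simp add: iter_deriv_eq)
 qed
qed

end

end

text \<open>The special case of a single term at each order.\<close>

lemma smooth_sequence:
 fixes E :: "(real, 'v) tmodule" and F :: "(real, 'w) tmodule"
 assumes E: "rlc E" and F: "rlc F" and W: "openin (topol E) W"
  and loc: "\<And>k h h' x. (\<And>j. j < k ==> h j = h' j) ==> x \<in> W ==> \<phi> k h x = \<phi> k h' x"
  and cont: "\<And>k. continuous_map (jet_topology E W k) (topol F) (\<lambda>(x, h). \<phi> k h x)"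
  and der: "\<And>k x h. x \<in> W ==> h \<in> {..k} \<rightarrow> carrier E ==> has_dir_deriv E F (\<phi> k h) x (h k) (\<phi> (Suc k) h x)"
  and f: "\<And>y h. y \<in> W ==> f y = \<phi> 0 h y"
 shows "smooth_on E F W f"
  and "\<And>h k x. h \<in> {..<k} \<rightarrow> carrier E ==> x \<in> W ==> iter_deriv E F f k h x = \<phi> k h x"
proof -
 interpret E: rlc E by fact
 interpret F: rlc F by fact
 have closed: "\<phi> k h x \<in> carrier F" if "x \<in> W" "h \<in> {..<k} \<rightarrow> carrier E" for k h x
 proof -
  have "(x, restrict h {..<k}) \<in> topspace (jet_topology E W k)"
   using that openin_subset[OF W] topspace_jet[of E W k] E by (auto simp: Pi_iff)
  from F.continuous_closed[OF cont this] show ?thesis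
   using loc[of k h "restrict h {..<k}" x] that by simp
 qed
 interpret S: term_scheme E F W \<phi> "\<lambda>k n. [Suc n]" "\<lambda>k n. n = k"
 proof unfold_locales
  fix k n :: nat and x h assume "n = k" "x \<in> W" "h \<in> {..k} \<rightarrow> carrier E"
  then show "has_dir_deriv E F (\<phi> n h) x (h k) (lsum F (map (\<lambda>\<sigma>. \<phi> \<sigma> h x) [Suc n]))"
   using der[of x h k] closed[of x h "Suc k"] by (simp add: lessThan_Suc_atMost)
 next
  fix k n :: nat and h h' :: "nat => 'v" and x assume "n = k" "\<And>j. j < k ==> h j = h' j" "x \<in> W"
  then show "\<phi> n h x = \<phi> n h' x" using loc[of k h h' x] by blast
 next
  fix k n :: nat assume "n = k"
  then show "continuous_map (jet_topology E W k) (topol F) (\<lambda>(x, h). \<phi> n h x)" using cont[of k] by blast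
 qed (use W in auto)
 have dt: "dterms (\<lambda>k n. [Suc n]) 0 k = [k]" for k by (induction k) auto
 show "smooth_on E F W f" by (rule S.smooth[of 0]) (simp_all add: f)
 show "iter_deriv E F f k h x = \<phi> k h x" if "h \<in> {..<k} \<rightarrow> carrier E" "x \<in> W" for h k x
  using S.iter_deriv_eq[of 0 f h k x] that closed[of x h k] f by (simp add: dt)
qed

lemma smooth_const:
 assumes E: "rlc E" and F: "rlc F" and W: "openin (topol E) W" and c: "c \<in> carrier F"
 shows "smooth_on E F W (\<lambda>x. c)"
proof -
 interpret F: rlc F by fact
 show ?thesis
 proof (rule smooth_sequence(1)[OF E F W, where \<phi> = "\<lambda>n h x. if n = 0 then c else \<zero>\<^sub>F"])
  show "has_dir_deriv E F (\<lambda>x. if k = 0 then c else \<zero>\<^sub>F) x (h k) (if Suc k = 0 then c else \<zero>\<^sub>F)" for k h x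
   using c by (auto simp: has_dir_deriv_def)
 qed (use c in \<open>auto simp: case_prod_unfold\<close>)
qed

lemma smooth_id:
 assumes E: "rlc E" and W: "openin (topol E) W"
 shows "smooth_on E E W (\<lambda>x. x)"
proof -
 interpret E: rlc E by fact
 have Wc: "x \<in> carrier E" if "x \<in> W" for x using openin_subset[OF W] that by auto
 show ?thesis
 proof (rule smooth_sequence(1)[OF E E W, where \<phi> = "\<lambda>n h x. if n = 0 then x else if n = 1 then h 0 else \<zero>\<^sub>E"])
  fix k :: nat and x h assume x: "x \<in> W" and h: "h \<in> {..k} \<rightarrow> carrier E"
  show "has_dir_deriv E E (\<lambda>x. if k = 0 then x else if k = 1 then h 0 else \<zero>\<^sub>E) x (h k)
    (if Suc k = 0 then x else if Suc k = 1 then h 0 else \<zero>\<^sub>E)"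
  proof (cases k)
   case 0
   have h0: "h 0 \<in> carrier E" using h by auto
   have "\<forall>\<^sub>F t::real in at 0. t \<noteq> 0" by (rule eventually_neq_at_within)
   then have ev: "\<forall>\<^sub>F t::real in at 0. h 0 = inverse t \<odot>\<^sub>E (x \<oplus>\<^sub>E t \<odot>\<^sub>E h 0 \<ominus>\<^sub>E x)"
    by eventually_elim (use Wc[OF x] h0 in \<open>simp add: E.add_sub_cancel\<close>)
   have l: "limitin (topol E) (\<lambda>t::real. h 0) (h 0) (at 0)"
    using h0 by (simp add: limitin_def)
   have "limitin (topol E) (\<lambda>t. inverse t \<odot>\<^sub>E (x \<oplus>\<^sub>E t \<odot>\<^sub>E h 0 \<ominus>\<^sub>E x)) (h 0) (at 0)"
    by (rule E.lim_cong[OF l ev refl])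
   then show ?thesis using 0 by (simp add: has_dir_deriv_def)
  next
   case (Suc n)
   have "h 0 \<in> carrier E" using h by auto
   then show ?thesis using Suc by (auto simp: has_dir_deriv_def)
  qed
 next
  fix k
  show "continuous_map (jet_topology E W k) (topol E) (\<lambda>(x, h). if k = 0 then x else if k = 1 then h 0 else \<zero>\<^sub>E)"
   using jet_fst[of E W k] jet_snd[of 0 k E W] unfolding case_prod_unfold by (auto simp: fst_def[symmetric])
 qed auto
qed

lemma (in smooth_fun) smooth_lin:
 assumes G: "rlc G" and L: "lin_map F G L" "continuous_map (topol F) (topol G) L"
 shows "smooth_on E G W (\<lambda>x. L (f x))"
  and "\<And>h k x. h \<in> {..<k} \<rightarrow> carrier E ==> x \<in> W ==> iter_deriv E G (\<lambda>x. L (f x)) k h x = L (D k h x)"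
proof -
 interpret G: rlc G by fact
 have loc: "L (D k h x) = L (D k h' x)" if "\<And>j. j < k ==> h j = h' j" for k h h' x
 proof -
  have "D k h = D k h'" by (rule iter_deriv_cong_h) (rule that)
  then show ?thesis by simp
 qed
 have cont: "continuous_map (jet_topology E W k) (topol G) (\<lambda>(x, h). L (D k h x))" for k
  using continuous_map_compose[OF D_cont L(2)] by (simp add: o_def case_prod_unfold)
 have der: "has_dir_deriv E G (\<lambda>y. L (D k h y)) x (h k) (L (D (Suc k) h x))"
  if x: "x \<in> W" and h: "h \<in> {..k} \<rightarrow> carrier E" for k x h
 proof -
  have hk: "h k \<in> carrier E" "h \<in> {..<k} \<rightarrow> carrier E" using h by auto
  have "limitin (topol G) (L \<circ> (\<lambda>t. inverse t \<odot>\<^sub>F (D k h (x \<oplus>\<^sub>E t \<odot>\<^sub>E h k) \<ominus>\<^sub>F D k h x))) (L (D (Suc k) h x)) (at 0)"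
   using D_deriv[OF x h] unfolding has_dir_deriv_def by (rule continuous_map_limit[OF L(2)])
  then show ?thesis unfolding has_dir_deriv_def
  proof (rule G.lim_cong)
   show "\<forall>\<^sub>F t in at 0. (L \<circ> (\<lambda>t. inverse t \<odot>\<^sub>F (D k h (x \<oplus>\<^sub>E t \<odot>\<^sub>E h k) \<ominus>\<^sub>F D k h x))) t
     = inverse t \<odot>\<^sub>G (L (D k h (x \<oplus>\<^sub>E t \<odot>\<^sub>E h k)) \<ominus>\<^sub>G L (D k h x))"
    using lim_line(2)[OF x hk(1)]
   proof eventually_elim
    case (elim t)
    have c: "D k h (x \<oplus>\<^sub>E t \<odot>\<^sub>E h k) \<in> carrier F" "D k h x \<in> carrier F"
     using D_closed[OF elim hk(2)] D_closed[OF x hk(2)] by auto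
    show ?case
     using c L(1) lin_map_sub[OF F.rmod_axioms G.rmod_axioms L(1) c] by (simp add: lin_map_def)
   qed
  qed simp
 qed
 show "smooth_on E G W (\<lambda>x. L (f x))"
  by (rule smooth_sequence(1)[OF E.rlc_axioms G W loc cont der]) simp_all
 show "iter_deriv E G (\<lambda>x. L (f x)) k h x = L (D k h x)" if "h \<in> {..<k} \<rightarrow> carrier E" "x \<in> W" for h k x
  by (rule smooth_sequence(2)[OF E.rlc_axioms G W loc cont der _ that]) simp_all
qed

section \<open>Product rule\<close>

definition bilin :: "(real, 'u) tmodule => (real, 'v) tmodule => (real, 'w) tmodule => ('u => 'v => 'w) => bool" where
 "bilin E1 E2 F b \<longleftrightarrow>
   (\<forall>x\<in>carrier E1. lin_map E2 F (b x)) \<and> (\<forall>y\<in>carrier E2. lin_map E1 F (\<lambda>x. b x y)) \<and>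
   continuous_map (prod_topology (topol E1) (topol E2)) (topol F) (\<lambda>(x, y). b x y)"

text \<open>A term is a pair of lists: the indices of the directions in which the first and the second
  factor are differentiated.\<close>

definition leibniz_step :: "nat => nat list \<times> nat list => (nat list \<times> nat list) list" where
 "leibniz_step k \<tau> = [(fst \<tau> @ [k], snd \<tau>), (fst \<tau>, snd \<tau> @ [k])]"

lemma curve_bilin:
 assumes E1: "rlc E1" and E2: "rlc E2" and F: "rlc F" and b: "bilin E1 E2 F b"
  and c: "curve_deriv E1 c c'" and d: "curve_deriv E2 d d'"
 shows "curve_deriv F (\<lambda>t. b (c t) (d t)) (b c' (d 0) \<oplus>\<^sub>F b (c 0) d')"
proof -
 interpret E1: rlc E1 by fact
 interpret E2: rlc E2 by fact
 interpret F: rlc F by fact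
 have bc: "b x y \<in> carrier F" if "x \<in> carrier E1" "y \<in> carrier E2" for x y
  using b that by (auto simp: bilin_def lin_map_def)
 have c0: "c 0 \<in> carrier E1" and cev: "\<forall>\<^sub>F t in at 0. c t \<in> carrier E1"
  and cl: "limitin (topol E1) (\<lambda>t. inverse t \<odot>\<^bsub>E1\<^esub> (c t \<ominus>\<^bsub>E1\<^esub> c 0)) c' (at 0)"
  using c by (auto simp: curve_deriv_def)
 have d0: "d 0 \<in> carrier E2" and dev: "\<forall>\<^sub>F t in at 0. d t \<in> carrier E2"
  and dl: "limitin (topol E2) (\<lambda>t. inverse t \<odot>\<^bsub>E2\<^esub> (d t \<ominus>\<^bsub>E2\<^esub> d 0)) d' (at 0)"
  using d by (auto simp: curve_deriv_def)
 have bcont: "continuous_map (prod_topology (topol E1) (topol E2)) (topol F) (\<lambda>(x, y). b x y)"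
  using b by (simp add: bilin_def)
 have "limitin (topol F) (\<lambda>t. b (inverse t \<odot>\<^bsub>E1\<^esub> (c t \<ominus>\<^bsub>E1\<^esub> c 0)) (d t)) (b c' (d 0)) (at 0)"
  by (rule limitin_compose2[OF bcont cl E2.curve_continuous[OF d]])
 moreover have "limitin (topol F) (\<lambda>t. b (c 0) (inverse t \<odot>\<^bsub>E2\<^esub> (d t \<ominus>\<^bsub>E2\<^esub> d 0))) (b (c 0) d') (at 0)"
  by (rule limitin_compose2[OF bcont _ dl]) (simp add: c0)
 ultimately have "limitin (topol F) (\<lambda>t. b (inverse t \<odot>\<^bsub>E1\<^esub> (c t \<ominus>\<^bsub>E1\<^esub> c 0)) (d t) \<oplus>\<^sub>F
   b (c 0) (inverse t \<odot>\<^bsub>E2\<^esub> (d t \<ominus>\<^bsub>E2\<^esub> d 0))) (b c' (d 0) \<oplus>\<^sub>F b (c 0) d') (at 0)"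
  by (rule F.lim_add)
 then have "limitin (topol F) (\<lambda>t. inverse t \<odot>\<^sub>F (b (c t) (d t) \<ominus>\<^sub>F b (c 0) (d 0))) (b c' (d 0) \<oplus>\<^sub>F b (c 0) d') (at 0)"
 proof (rule F.lim_cong)
  show "\<forall>\<^sub>F t in at 0. b (inverse t \<odot>\<^bsub>E1\<^esub> (c t \<ominus>\<^bsub>E1\<^esub> c 0)) (d t) \<oplus>\<^sub>F
    b (c 0) (inverse t \<odot>\<^bsub>E2\<^esub> (d t \<ominus>\<^bsub>E2\<^esub> d 0)) = inverse t \<odot>\<^sub>F (b (c t) (d t) \<ominus>\<^sub>F b (c 0) (d 0))"
   using cev dev
  proof eventually_elim
   case (elim t)
   have l1: "lin_map E1 F (\<lambda>x. b x (d t))" "lin_map E2 F (b (c 0))"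
    using b elim c0 by (auto simp: bilin_def)
   have "b (inverse t \<odot>\<^bsub>E1\<^esub> (c t \<ominus>\<^bsub>E1\<^esub> c 0)) (d t) = inverse t \<odot>\<^sub>F (b (c t) (d t) \<ominus>\<^sub>F b (c 0) (d t))"
    using l1(1) lin_map_sub[OF E1.rmod_axioms F.rmod_axioms l1(1) elim(1) c0] elim(1) c0 by (simp add: lin_map_def)
   moreover have "b (c 0) (inverse t \<odot>\<^bsub>E2\<^esub> (d t \<ominus>\<^bsub>E2\<^esub> d 0)) = inverse t \<odot>\<^sub>F (b (c 0) (d t) \<ominus>\<^sub>F b (c 0) (d 0))"
    using l1(2) lin_map_sub[OF E2.rmod_axioms F.rmod_axioms l1(2) elim(2) d0] elim(2) d0 by (simp add: lin_map_def)
   ultimately show ?case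
    using bc elim c0 d0 by (simp add: F.smul_add_right[symmetric] F.sub_add_sub)
  qed
 qed simp
 moreover have "\<forall>\<^sub>F t in at 0. b (c t) (d t) \<in> carrier F" using cev dev by eventually_elim (rule bc)
 ultimately show ?thesis using bc[OF c0 d0] by (simp add: curve_deriv_def)
qed

definition leibniz_terms :: "nat => (nat list \<times> nat list) list" where
 "leibniz_terms = dterms leibniz_step ([], [])"

lemma leibniz_terms_less: "(xs, ys) \<in> set (leibniz_terms k) ==> j \<in> set xs \<union> set ys ==> j < k"
 unfolding leibniz_terms_def
 by (induction k arbitrary: xs ys) (fastforce simp: leibniz_step_def less_Suc_eq)+

text \<open>Besides smoothness, the Leibniz formula itself is kept, for it yields the estimate of the
  seminorms of a product.\<close>

lemma smooth_bilin:
 fixes E :: "(real, 'v) tmodule"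
 assumes u: "smooth_fun E E1 W u" and v: "smooth_fun E E2 W v" and F: "rlc F" and b: "bilin E1 E2 F b"
 shows "smooth_on E F W (\<lambda>x. b (u x) (v x))"
  and "\<And>h k x. h \<in> {..<k} \<rightarrow> carrier E ==> x \<in> W ==> iter_deriv E F (\<lambda>x. b (u x) (v x)) k h x =
   lsum F (map (\<lambda>(xs, ys). b (iter_deriv E E1 u (length xs) (\<lambda>j. h (xs ! j)) x)
    (iter_deriv E E2 v (length ys) (\<lambda>j. h (ys ! j)) x)) (leibniz_terms k))"
proof -
 interpret u: smooth_fun E E1 W u by fact
 interpret v: smooth_fun E E2 W v by fact
 interpret F: rlc F by fact
 define val where "val \<tau> h x = b (iter_deriv E E1 u (length (fst \<tau>)) (\<lambda>j. h (fst \<tau> ! j)) x)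
    (iter_deriv E E2 v (length (snd \<tau>)) (\<lambda>j. h (snd \<tau> ! j)) x)" for \<tau> :: "nat list \<times> nat list" and h x
 have bcont: "continuous_map (prod_topology (topol E1) (topol E2)) (topol F) (\<lambda>(x, y). b x y)"
  using b by (simp add: bilin_def)
 have bc: "b x y \<in> carrier F" if "x \<in> carrier E1" "y \<in> carrier E2" for x y
  using b that by (auto simp: bilin_def lin_map_def)
 interpret S: term_scheme E F W val leibniz_step "\<lambda>k \<tau>. \<forall>j\<in>set (fst \<tau>) \<union> set (snd \<tau>). j < k"
 proof
  show "openin (topol E) W" by (rule u.W)
 next
  fix k \<tau> \<sigma> assume "\<forall>j\<in>set (fst \<tau>) \<union> set (snd \<tau>). j < k" "\<sigma> \<in> set (leibniz_step k \<tau>)"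
  then show "\<forall>j\<in>set (fst \<sigma>) \<union> set (snd \<sigma>). j < Suc k"
   by (auto simp: leibniz_step_def less_Suc_eq)
 next
  fix k \<tau> x and h h' :: "nat => 'v" assume o: "\<forall>j\<in>set (fst \<tau>) \<union> set (snd \<tau>). j < k" and eq: "\<And>j. j < k ==> h j = h' j"
  have "iter_deriv E E1 u (length (fst \<tau>)) (\<lambda>j. h (fst \<tau> ! j)) = iter_deriv E E1 u (length (fst \<tau>)) (\<lambda>j. h' (fst \<tau> ! j))"
   "iter_deriv E E2 v (length (snd \<tau>)) (\<lambda>j. h (snd \<tau> ! j)) = iter_deriv E E2 v (length (snd \<tau>)) (\<lambda>j. h' (snd \<tau> ! j))"
   by (intro iter_deriv_cong_h eq; use o in auto)+
  then show "val \<tau> h x = val \<tau> h' x" by (simp add: val_def)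
 next
  fix k :: nat and \<tau> assume o: "\<forall>j\<in>set (fst \<tau>) \<union> set (snd \<tau>). j < k"
  have "continuous_map (jet_topology E W k) (prod_topology (topol E1) (topol E2))
    (\<lambda>z. (iter_deriv E E1 u (length (fst \<tau>)) (\<lambda>j. snd z (fst \<tau> ! j)) (fst z),
       iter_deriv E E2 v (length (snd \<tau>)) (\<lambda>j. snd z (snd \<tau> ! j)) (fst z)))"
   unfolding continuous_map_pairwise o_def fst_conv snd_conv
   using o by (intro conjI u.D_reindex_cont[unfolded case_prod_unfold] v.D_reindex_cont[unfolded case_prod_unfold]) auto
  from continuous_map_compose[OF this bcont]
  show "continuous_map (jet_topology E W k) (topol F) (\<lambda>(x, h). val \<tau> h x)"
   by (simp add: val_def o_def case_prod_unfold)
 next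
  fix k :: nat and \<tau> x h assume o: "\<forall>j\<in>set (fst \<tau>) \<union> set (snd \<tau>). j < k" and x: "x \<in> W" and h: "h \<in> {..k} \<rightarrow> carrier E"
  obtain xs ys where \<tau>: "\<tau> = (xs, ys)" by (cases \<tau>)
  have lt: "j < k" if "j \<in> set xs \<union> set ys" for j using o that \<tau> by auto
  have hk: "h k \<in> carrier E" using h by auto
  have hc: "(\<lambda>j. h (zs ! j)) \<in> {..<length zs} \<rightarrow> carrier E" if "zs = xs \<or> zs = ys" for zs
  proof
   fix i assume "i \<in> {..<length zs}"
   then have "zs ! i \<in> set xs \<union> set ys" using that by auto
   from lt[OF this] show "h (zs ! i) \<in> carrier E" using h by auto
  qed
  have hc': "(\<lambda>j. h ((zs @ [k]) ! j)) \<in> {..length zs} \<rightarrow> carrier E" if "zs = xs \<or> zs = ys" for zs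
   using hc[OF that] hk by (auto simp: Pi_iff nth_append le_less)
  have cong: "iter_deriv E E' w (length zs) (\<lambda>j. h ((zs @ [k]) ! j)) = iter_deriv E E' w (length zs) (\<lambda>j. h (zs ! j))"
   for E' :: "(real, 'z) tmodule" and w zs
   by (rule iter_deriv_cong_h) (simp add: nth_append)
  have du: "curve_deriv E1 (\<lambda>t. u.D (length xs) (\<lambda>j. h (xs ! j)) (x \<oplus>\<^sub>E t \<odot>\<^sub>E h k))
    (u.D (length (xs @ [k])) (\<lambda>j. h ((xs @ [k]) ! j)) x)"
   using u.D_deriv[OF x hc'[of xs]] cong[of E1 u xs]
   by (subst has_dir_deriv_curve[OF u.E.rlc_axioms u.F.rlc_axioms u.W x hk u.D_closed[OF _ hc], symmetric]) auto
  have dv: "curve_deriv E2 (\<lambda>t. v.D (length ys) (\<lambda>j. h (ys ! j)) (x \<oplus>\<^sub>E t \<odot>\<^sub>E h k))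
    (v.D (length (ys @ [k])) (\<lambda>j. h ((ys @ [k]) ! j)) x)"
   using v.D_deriv[OF x hc'[of ys]] cong[of E2 v ys]
   by (subst has_dir_deriv_curve[OF u.E.rlc_axioms v.F.rlc_axioms v.W x hk v.D_closed[OF _ hc], symmetric]) auto
  have x0: "x \<oplus>\<^sub>E 0 \<odot>\<^sub>E h k = x" using u.W_sub[OF x] hk by simp
  have c: "u.D (length xs) (\<lambda>j. h (xs ! j)) x \<in> carrier E1" "v.D (length ys) (\<lambda>j. h (ys ! j)) x \<in> carrier E2"
   by (rule u.D_closed[OF x hc] v.D_closed[OF x hc]; simp)+
  have c': "u.D (length (xs @ [k])) (\<lambda>j. h ((xs @ [k]) ! j)) x \<in> carrier E1"
   "v.D (length (ys @ [k])) (\<lambda>j. h ((ys @ [k]) ! j)) x \<in> carrier E2"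
   by (rule u.D_closed[OF x] v.D_closed[OF x]; use hc' in \<open>simp add: lessThan_Suc_atMost del: iter_deriv.simps\<close>)+
  note fin = bc[OF c'(1) c(2)] bc[OF c(1) c'(2)]
  have "curve_deriv F (\<lambda>t. val \<tau> h (x \<oplus>\<^sub>E t \<odot>\<^sub>E h k)) (lsum F (map (\<lambda>\<sigma>. val \<sigma> h x) (leibniz_step k \<tau>)))"
   using curve_bilin[OF u.F.rlc_axioms v.F.rlc_axioms F b du dv] fin
   unfolding x0 by (simp add: val_def \<tau> leibniz_step_def del: iter_deriv.simps)
  then show "has_dir_deriv E F (val \<tau> h) x (h k) (lsum F (map (\<lambda>\<sigma>. val \<sigma> h x) (leibniz_step k \<tau>)))"
   by (subst has_dir_deriv_curve[OF u.E.rlc_axioms F u.W x hk])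
    (auto simp: val_def \<tau> intro!: bc u.D_closed v.D_closed hc)
 qed
 have val0: "b (u y) (v y) = val ([], []) h y" for h y by (simp add: val_def)
 show "smooth_on E F W (\<lambda>x. b (u x) (v x))" by (rule S.smooth[of "([], [])"]) (simp_all add: val0)
 show "iter_deriv E F (\<lambda>x. b (u x) (v x)) k h x =
   lsum F (map (\<lambda>(xs, ys). b (iter_deriv E E1 u (length xs) (\<lambda>j. h (xs ! j)) x)
    (iter_deriv E E2 v (length ys) (\<lambda>j. h (ys ! j)) x)) (leibniz_terms k))"
  if "h \<in> {..<k} \<rightarrow> carrier E" "x \<in> W" for h k x
  using S.iter_deriv_eq[of "([], [])" "\<lambda>x. b (u x) (v x)" h k x] that
  by (simp add: val0 leibniz_terms_def) (simp add: val_def case_prod_unfold)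
qed

section \<open>Chain rule\<close>

text \<open>A term of the \<open>k\<close>-th derivative of a composite map (Faa di Bruno) is a list of blocks of
 indices of directions.\<close>

definition chain_step :: "nat => nat list list => nat list list list" where
 "chain_step k B = (B @ [[k]]) # map (\<lambda>i. B[i := B ! i @ [k]]) [0..<length B]"

text \<open>One more derivative of a term either hits the outer function, which creates a new block, or
  one of the inner derivatives, which extends its block.\<close>

lemma smooth_compose:
 fixes E :: "(real, 'v) tmodule"
 assumes f: "smooth_fun F G V f" and g: "smooth_fun E F W g" and gV: "\<And>x. x \<in> W ==> g x \<in> V"
 shows "smooth_on E G W (\<lambda>x. f (g x))"
proof -
 interpret f: smooth_fun F G V f by fact
 interpret g: smooth_fun E F W g by fact
 define w where "w B h x i = g.D (length (B ! i)) (\<lambda>j. h (B ! i ! j)) x" for B :: "nat list list" and h x i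
 define val where "val B h x = f.D (length B) (w B h x) (g x)" for B :: "nat list list" and h x
 define ok where "ok k B \<longleftrightarrow> (\<forall>b\<in>set B. \<forall>j\<in>set b. j < k)" for k :: nat and B
 have okD: "B ! i ! j < k" if "ok k B" "i < length B" "j < length (B ! i)" for k B i j
  using that by (meson nth_mem ok_def)
 have wc: "w B h x i \<in> carrier F" if "ok k B" "i < length B" "x \<in> W" "h \<in> {..<k} \<rightarrow> carrier E" for k B h x i
  unfolding w_def by (rule g.D_closed[OF that(3)]) (use okD[OF that(1,2)] that(4) in auto)
 have valc: "val B h x \<in> carrier G" if "ok k B" "x \<in> W" "h \<in> {..<k} \<rightarrow> carrier E" for k B h x
  unfolding val_def by (rule f.D_closed[OF gV[OF that(2)]]) (use wc[OF that(1) _ that(2,3)] in auto)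
 have ok_app: "ok (Suc k) (B @ [[k]])" if "ok k B" for k B
  using that by (auto simp: ok_def less_Suc_eq)
 have ok_upd: "ok (Suc k) (B[i := B ! i @ [k]])" if "ok k B" "i < length B" for k B i
  unfolding ok_def
 proof (intro ballI)
  fix b j assume "b \<in> set (B[i := B ! i @ [k]])" "j \<in> set b"
  then have "b = B ! i @ [k] \<or> b \<in> set B" using set_update_subset_insert[of B i] by blast
  moreover have "B ! i \<in> set B" using that(2) by simp
  ultimately show "j < Suc k"
   using \<open>j \<in> set b\<close> that(1) unfolding ok_def by (auto simp: less_Suc_eq)
 qed
 interpret S: term_scheme E G W val chain_step ok
 proof
  show "openin (topol E) W" by (rule g.W)
 next
  fix k B \<sigma> assume "ok k B" "\<sigma> \<in> set (chain_step k B)"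
  then show "ok (Suc k) \<sigma>" using ok_app ok_upd by (auto simp: chain_step_def)
 next
  fix k B x and h h' :: "nat => 'v" assume o: "ok k B" and eq: "\<And>j. j < k ==> h j = h' j"
  have "w B h x i = w B h' x i" if "i < length B" for i
   unfolding w_def by (rule iter_deriv_cong_h[THEN fun_cong]) (use okD[OF o that] eq in auto)
  then have "f.D (length B) (w B h x) = f.D (length B) (w B h' x)" by (rule iter_deriv_cong_h)
  then show "val B h x = val B h' x" by (simp add: val_def)
 next
  fix k B assume o: "ok k B"
  have gc: "continuous_map (jet_topology E W k) (topol F) (\<lambda>z. g (fst z))"
   using g.D_reindex_cont[of 0 "\<lambda>j. j" k] by (simp add: case_prod_unfold)
  have wcont: "continuous_map (jet_topology E W k) (topol F) (\<lambda>z. w B (snd z) (fst z) i)" if "i < length B" for i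
   unfolding w_def using g.D_reindex_cont[of "length (B ! i)" "\<lambda>j. B ! i ! j" k] okD[OF o that]
   by (simp add: case_prod_unfold)
  have "continuous_map (jet_topology E W k) (jet_topology F V (length B))
    (\<lambda>z. (g (fst z), \<lambda>i\<in>{..<length B}. w B (snd z) (fst z) i))"
   by (intro jet_continuous_pair gc wcont) (auto dest!: jet_fst_in intro: gV)
  from continuous_map_compose[OF this f.D_cont]
  show "continuous_map (jet_topology E W k) (topol G) (\<lambda>(x, h). val B h x)"
   by (simp add: val_def o_def case_prod_unfold f.D_restrict)
 next
  fix k B x h assume o: "ok k B" and x: "x \<in> W" and h: "h \<in> {..k} \<rightarrow> carrier E"
  have hk: "h k \<in> carrier E" "h \<in> {..<k} \<rightarrow> carrier E" using h by auto
  have xc: "x \<in> carrier E" by (rule g.W_sub[OF x])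
  have x0: "x \<oplus>\<^sub>E 0 \<odot>\<^sub>E h k = x" using xc hk by simp
  note eq = has_dir_deriv_curve[OF g.E.rlc_axioms f.E.rlc_axioms g.W x hk(1)]
  have D0: "g.D 0 (\<lambda>_. h k) = g" by (intro ext) simp
  have dg: "curve_deriv F (\<lambda>t. g (x \<oplus>\<^sub>E t \<odot>\<^sub>E h k)) (g.D 1 (\<lambda>_. h k) x)"
   using g.D_deriv[of x "\<lambda>_. h k" 0] hk x unfolding D0 by (subst eq[symmetric]) (auto intro: g.f_closed)
  define w' where "w' i = g.D (length (B ! i @ [k])) (\<lambda>j. h ((B ! i @ [k]) ! j)) x" for i
  have dw: "curve_deriv F (\<lambda>t. w B h (x \<oplus>\<^sub>E t \<odot>\<^sub>E h k) i) (w' i)" if i: "i < length B" for i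
  proof -
   let ?h = "\<lambda>j. h ((B ! i @ [k]) ! j)"
   have hc: "?h \<in> {..length (B ! i)} \<rightarrow> carrier E"
    using hk okD[OF o i] by (auto simp: Pi_iff nth_append le_less)
   have "g.D (length (B ! i)) ?h = g.D (length (B ! i)) (\<lambda>j. h (B ! i ! j))"
    by (rule iter_deriv_cong_h) (simp add: nth_append)
   then have "has_dir_deriv E F (\<lambda>y. w B h y i) x (h k) (w' i)"
    using g.D_deriv[OF x hc] by (simp add: w_def w'_def del: iter_deriv.simps)
   then show ?thesis by (subst eq[symmetric]) (auto intro: wc[OF o i _ hk(2)])
  qed
  have cd: "curve_deriv G (\<lambda>t. val B h (x \<oplus>\<^sub>E t \<odot>\<^sub>E h k))
   (f.D (Suc (length B)) ((\<lambda>i. w B h x i)(length B := g.D 1 (\<lambda>_. h k) x)) (g x) \<oplus>\<^sub>G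
    lsum G (map (\<lambda>i. f.D (length B) ((\<lambda>i. w B h x i)(i := w' i)) (g x)) [0..<length B]))"
   using f.D_curve[OF dg _ dw, of "length B"] gV[OF x] unfolding x0 val_def by simp
  have eq1: "f.D (Suc (length B)) ((\<lambda>i. w B h x i)(length B := g.D 1 (\<lambda>_. h k) x)) = f.D (length (B @ [[k]])) (w (B @ [[k]]) h x)"
   unfolding length_append list.size by (simp only: add_0 add_Suc_right add_0_right One_nat_def, rule iter_deriv_cong_h)
    (auto simp: w_def nth_append less_Suc_eq iter_deriv_zero)
  have eq2: "f.D (length B) ((\<lambda>i. w B h x i)(i := w' i)) = f.D (length (B[i := B ! i @ [k]])) (w (B[i := B ! i @ [k]]) h x)"
   if "i < length B" for i
   unfolding length_list_update by (rule iter_deriv_cong_h) (use that in \<open>auto simp: w_def w'_def nth_list_update simp del: iter_deriv.simps\<close>)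
  have m: "map (\<lambda>i. f.D (length B) ((\<lambda>i. w B h x i)(i := w' i)) (g x)) [0..<length B]
    = map (\<lambda>i. val (B[i := B ! i @ [k]]) h x) [0..<length B]"
   by (rule map_cong[OF refl]) (simp add: val_def eq2 del: iter_deriv.simps)
  have "f.D (Suc (length B)) ((\<lambda>i. w B h x i)(length B := g.D 1 (\<lambda>_. h k) x)) (g x) \<oplus>\<^sub>G
    lsum G (map (\<lambda>i. f.D (length B) ((\<lambda>i. w B h x i)(i := w' i)) (g x)) [0..<length B])
    = lsum G (map (\<lambda>\<sigma>. val \<sigma> h x) (chain_step k B))"
   unfolding m eq1 val_def[of "B @ [[k]]", symmetric] by (simp add: chain_step_def o_def)
  then show "has_dir_deriv E G (val B h) x (h k) (lsum G (map (\<lambda>\<sigma>. val \<sigma> h x) (chain_step k B)))"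
   using cd by (subst has_dir_deriv_curve[OF g.E.rlc_axioms f.F.rlc_axioms g.W x hk(1) valc[OF o _ hk(2)]]) simp_all
 qed
 have "f (g y) = val [] h y" for h y by (simp add: val_def)
 then show ?thesis by (intro S.smooth[of "[]"]) (simp_all add: ok_def)
qed

section \<open>The real line and products as locally convex spaces\<close>

lemma prod_topology_euclidean_eq: "prod_topology (euclidean :: 'a::topological_space topology) (euclidean :: 'b::topological_space topology) = euclidean"
 using prod_topology_subtopology_eu[of UNIV UNIV] by simp

lemma rlc_scalars: "rlc (scalars :: (real, real) tmodule)"
proof -
 have "Module.module (scalars :: (real, real) tmodule) (scalars :: (real, real) tmodule)"
  using cring_scalars[where 's = real] by (intro moduleI) (auto simp: algebra_simps cring_def ring_def)
 moreover have "Hausdorff_space euclideanreal" by (rule Hausdorff_space_euclidean)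
 moreover have "continuous_map (prod_topology euclideanreal euclideanreal) euclideanreal (\<lambda>(x, y). x + y)"
  "continuous_map (prod_topology euclideanreal euclideanreal) euclideanreal (\<lambda>(x, y). x * y)"
  unfolding prod_topology_euclidean_eq case_prod_unfold continuous_map_iff_continuous2
  by (intro continuous_intros)+
 moreover have "\<exists>V. open V \<and> (0::real) \<in> V \<and> V \<subseteq> W \<and>
   (\<forall>x\<in>V. \<forall>y\<in>V. \<forall>t. 0 \<le> t \<and> t \<le> 1 --> (1 - t) * x + t * y \<in> V)"
  if W: "open W" "0 \<in> W" for W :: "real set"
 proof -
  obtain e where e: "e > 0" "ball 0 e \<subseteq> W" using openE[OF W] by blast
  have "(1 - t) * x + t * y \<in> ball 0 e" if "x \<in> ball 0 e" "y \<in> ball 0 e" "0 \<le> t" "t \<le> 1" for x y t :: real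
   using convex_ball[of "0::real" e] that unfolding convex_alt real_scaleR_def by blast
  then show ?thesis using e by (intro exI[of _ "ball 0 e"]) auto
 qed
 ultimately have "lc_space (scalars :: (real, real) tmodule)"
  by (simp add: lc_space_def)
 then show ?thesis by (rule rlc.intro)
qed

lemma scalars_minus [simp]: "x \<ominus>\<^bsub>(scalars :: (real, real) tmodule)\<^esub> y = x - y"
proof -
 interpret rlc "scalars :: (real, real) tmodule" by (rule rlc_scalars)
 show ?thesis using sub_eq[of x y] by simp
qed

lemma prod_space_simps [simp]:
 "carrier (prod_space E F) = carrier E \<times> carrier F" "zero (prod_space E F) = (\<zero>\<^sub>E, \<zero>\<^sub>F)"
 "add (prod_space E F) (x, y) (x', y') = (x \<oplus>\<^sub>E x', y \<oplus>\<^sub>F y')"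
 "smult (prod_space E F) r (x, y) = (r \<odot>\<^sub>E x, r \<odot>\<^sub>F y)"
 "topol (prod_space E F) = prod_topology (topol E) (topol F)"
 by (simp_all add: prod_space_def)

lemma prod_space_split:
 "z \<oplus>\<^bsub>prod_space E F\<^esub> z' = (fst z \<oplus>\<^sub>E fst z', snd z \<oplus>\<^sub>F snd z')"
 "r \<odot>\<^bsub>prod_space E F\<^esub> z = (r \<odot>\<^sub>E fst z, r \<odot>\<^sub>F snd z)"
 by (simp_all add: prod_space_def case_prod_unfold)

lemma rlc_prod_space:
 assumes E: "rlc E" and F: "rlc F" shows "rlc (prod_space E F)"
proof -
 interpret E: rlc E by fact
 interpret F: rlc F by fact
 let ?P = "prod_space E F"
 have ag: "abelian_group ?P"
 proof (rule abelian_groupI)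
  fix z assume "z \<in> carrier ?P"
  then show "\<exists>y\<in>carrier ?P. y \<oplus>\<^bsub>?P\<^esub> z = \<zero>\<^bsub>?P\<^esub>"
   by (auto intro!: bexI[of _ "(\<ominus>\<^sub>E fst z, \<ominus>\<^sub>F snd z)"] simp: E.l_neg F.l_neg)
 qed (auto simp: E.a_ac F.a_ac)
 have mod: "Module.module (scalars :: (real, real) tmodule) ?P"
  by (intro moduleI cring_scalars ag)
   (auto simp: E.smul_add_left E.smul_add_right F.smul_add_left F.smul_add_right)
 have haus: "Hausdorff_space (prod_topology (topol E) (topol F))"
  using E.Hausdorff F.Hausdorff by (simp add: Hausdorff_space_prod_topology)
 have c: "continuous_map (prod_topology (prod_topology (topol E) (topol F)) (prod_topology (topol E) (topol F))) (topol E) (\<lambda>z. fst (fst z))"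
  "continuous_map (prod_topology (prod_topology (topol E) (topol F)) (prod_topology (topol E) (topol F))) (topol E) (\<lambda>z. fst (snd z))"
  "continuous_map (prod_topology (prod_topology (topol E) (topol F)) (prod_topology (topol E) (topol F))) (topol F) (\<lambda>z. snd (fst z))"
  "continuous_map (prod_topology (prod_topology (topol E) (topol F)) (prod_topology (topol E) (topol F))) (topol F) (\<lambda>z. snd (snd z))"
  "continuous_map (prod_topology euclideanreal (prod_topology (topol E) (topol F))) (topol E) (\<lambda>z. fst (snd z))"
  "continuous_map (prod_topology euclideanreal (prod_topology (topol E) (topol F))) (topol F) (\<lambda>z. snd (snd z))"
  by (rule continuous_map_compose[OF continuous_map_fst continuous_map_fst, unfolded o_def]
    continuous_map_compose[OF continuous_map_snd continuous_map_fst, unfolded o_def]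
    continuous_map_compose[OF continuous_map_fst continuous_map_snd, unfolded o_def]
    continuous_map_compose[OF continuous_map_snd continuous_map_snd, unfolded o_def])+
 have add: "continuous_map (prod_topology (topol ?P) (topol ?P)) (topol ?P) (\<lambda>(x, y). x \<oplus>\<^bsub>?P\<^esub> y)"
  unfolding case_prod_unfold prod_space_split prod_space_simps continuous_map_pairwise o_def fst_conv snd_conv
  by (intro conjI E.continuous_add F.continuous_add c)
 have smul: "continuous_map (prod_topology euclideanreal (topol ?P)) (topol ?P) (\<lambda>(c, x). c \<odot>\<^bsub>?P\<^esub> x)"
  unfolding case_prod_unfold prod_space_split prod_space_simps continuous_map_pairwise o_def fst_conv snd_conv
  by (intro conjI E.continuous_smul F.continuous_smul c continuous_map_fst)
 have conv: "\<exists>V. openin (topol ?P) V \<and> \<zero>\<^bsub>?P\<^esub> \<in> V \<and> V \<subseteq> W \<and>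
   (\<forall>x\<in>V. \<forall>y\<in>V. \<forall>t::real. 0 \<le> t \<and> t \<le> 1 --> ((1 - t) \<odot>\<^bsub>?P\<^esub> x) \<oplus>\<^bsub>?P\<^esub> (t \<odot>\<^bsub>?P\<^esub> y) \<in> V)"
  if W: "openin (topol ?P) W" "\<zero>\<^bsub>?P\<^esub> \<in> W" for W
 proof -
  obtain S T where ST: "openin (topol E) S" "openin (topol F) T" "\<zero>\<^sub>E \<in> S" "\<zero>\<^sub>F \<in> T" "S \<times> T \<subseteq> W"
   using W unfolding prod_space_simps openin_prod_topology_alt by meson
  obtain S' where S': "openin (topol E) S'" "\<zero>\<^sub>E \<in> S'" "S' \<subseteq> S"
   "\<forall>x\<in>S'. \<forall>y\<in>S'. \<forall>t::real. 0 \<le> t \<and> t \<le> 1 --> ((1 - t) \<odot>\<^sub>E x) \<oplus>\<^sub>E (t \<odot>\<^sub>E y) \<in> S'"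
   using E.lc ST(1,3) unfolding lc_space_def of_real_eq_id id_apply by meson
  obtain T' where T': "openin (topol F) T'" "\<zero>\<^sub>F \<in> T'" "T' \<subseteq> T"
   "\<forall>x\<in>T'. \<forall>y\<in>T'. \<forall>t::real. 0 \<le> t \<and> t \<le> 1 --> ((1 - t) \<odot>\<^sub>F x) \<oplus>\<^sub>F (t \<odot>\<^sub>F y) \<in> T'"
   using F.lc ST(2,4) unfolding lc_space_def of_real_eq_id id_apply by meson
  show ?thesis
   using S' T' ST(5) by (intro exI[of _ "S' \<times> T'"]) (auto simp: openin_prod_Times_iff)
 qed
 have "lc_space ?P"
  unfolding lc_space_def of_real_eq_id id_apply
  using mod haus add smul conv by simp
 then show ?thesis by (rule rlc.intro)
qed

lemma prod_space_minus:
 assumes "rlc E" "rlc F" "z \<in> carrier (prod_space E F)" "z' \<in> carrier (prod_space E F)"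
 shows "z \<ominus>\<^bsub>prod_space E F\<^esub> z' = (fst z \<ominus>\<^sub>E fst z', snd z \<ominus>\<^sub>F snd z')"
proof -
 interpret E: rlc E by fact
 interpret F: rlc F by fact
 interpret P: rlc "prod_space E F" using assms(1,2) by (rule rlc_prod_space)
 have "fst z \<in> carrier E" "fst z' \<in> carrier E" "snd z \<in> carrier F" "snd z' \<in> carrier F"
  using assms(3,4) unfolding prod_space_simps mem_Times_iff by blast+
 then show ?thesis
  unfolding P.sub_eq[OF assms(3,4)] prod_space_split fst_conv snd_conv by (simp only: E.sub_eq F.sub_eq)
qed

lemma smooth_pair:
 fixes E :: "(real, 'v) tmodule"
 assumes f: "smooth_fun E F W f" and g: "smooth_fun E G W g"
 shows "smooth_on E (prod_space F G) W (\<lambda>x. (f x, g x))"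
proof -
 interpret f: smooth_fun E F W f by fact
 interpret g: smooth_fun E G W g by fact
 interpret P: rlc "prod_space F G" using f.F.rlc_axioms g.F.rlc_axioms by (rule rlc_prod_space)
 show ?thesis
 proof (rule smooth_sequence(1)[OF f.E.rlc_axioms P.rlc_axioms f.W, where \<phi> = "\<lambda>k h x. (f.D k h x, g.D k h x)"])
  fix k x and h h' :: "nat => 'v" assume "\<And>j. j < k ==> h j = h' j"
  then have "f.D k h = f.D k h'" "g.D k h = g.D k h'" by (auto intro: iter_deriv_cong_h)
  then show "(f.D k h x, g.D k h x) = (f.D k h' x, g.D k h' x)" by simp
 next
  fix k
  show "continuous_map (jet_topology E W k) (topol (prod_space F G)) (\<lambda>(x, h). (f.D k h x, g.D k h x))"
   using f.D_cont[of k] g.D_cont[of k] by (simp add: case_prod_unfold continuous_map_pairwise o_def)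
 next
  fix k :: nat and x h assume x: "x \<in> W" and h: "h \<in> {..k} \<rightarrow> carrier E"
  have hk: "h k \<in> carrier E" "h \<in> {..<k} \<rightarrow> carrier E" using h by auto
  let ?q = "\<lambda>t. (inverse t \<odot>\<^sub>F (f.D k h (x \<oplus>\<^sub>E t \<odot>\<^sub>E h k) \<ominus>\<^sub>F f.D k h x),
    inverse t \<odot>\<^sub>G (g.D k h (x \<oplus>\<^sub>E t \<odot>\<^sub>E h k) \<ominus>\<^sub>G g.D k h x))"
  have "limitin (topol (prod_space F G)) ?q (f.D (Suc k) h x, g.D (Suc k) h x) (at 0)"
   using f.D_deriv[OF x h] g.D_deriv[OF x h] unfolding has_dir_deriv_def by (simp add: limitin_pairwise o_def)
  then show "has_dir_deriv E (prod_space F G) (\<lambda>x. (f.D k h x, g.D k h x)) x (h k) (f.D (Suc k) h x, g.D (Suc k) h x)"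
   unfolding has_dir_deriv_def
  proof (rule P.lim_cong[OF _ _ refl])
   show "\<forall>\<^sub>F t in at 0. ?q t = inverse t \<odot>\<^bsub>prod_space F G\<^esub> ((f.D k h (x \<oplus>\<^sub>E t \<odot>\<^sub>E h k), g.D k h (x \<oplus>\<^sub>E t \<odot>\<^sub>E h k))
      \<ominus>\<^bsub>prod_space F G\<^esub> (f.D k h x, g.D k h x))"
    using f.lim_line(2)[OF x hk(1)]
    by eventually_elim (use f.D_closed[OF _ hk(2)] g.D_closed[OF _ hk(2)] x in
      \<open>simp add: prod_space_minus[OF f.F.rlc_axioms g.F.rlc_axioms]\<close>)
  qed
 qed simp
qed

text \<open>The derivative of order \<open>k\<close> at \<open>x\<close> is \<open>\<phi> k x\<close> times the product of the directions.\<close>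

lemma smooth_real:
 fixes \<phi> :: "nat => real => real"
 assumes W: "open W" and d: "\<And>n x. x \<in> W ==> (\<phi> n has_real_derivative \<phi> (Suc n) x) (at x)"
 shows "smooth_on (scalars :: (real, real) tmodule) (scalars :: (real, real) tmodule) W (\<phi> 0)"
proof -
 let ?R = "scalars :: (real, real) tmodule"
 note R = rlc_scalars
 have W': "openin (topol ?R) W" using W by simp
 show ?thesis
 proof (rule smooth_sequence(1)[OF R R W', where \<phi> = "\<lambda>k h x. \<phi> k x * (\<Prod>j<k. h j)"])
  fix k x and h h' :: "nat => real" assume "\<And>j. j < k ==> h j = h' j"
  then show "\<phi> k x * (\<Prod>j<k. h j) = \<phi> k x * (\<Prod>j<k. h' j)" by simp
 next
  fix k
  have "continuous_on W (\<phi> k)"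
   using d by (auto intro!: continuous_at_imp_continuous_on DERIV_isCont)
  then have c: "continuous_map (subtopology euclideanreal W) euclideanreal (\<phi> k)" by simp
  have "continuous_map (jet_topology ?R W k) (subtopology euclideanreal W) fst"
   unfolding jet_topology_def scalars_simps by (rule continuous_map_fst)
  from continuous_map_compose[OF this c]
  have "continuous_map (jet_topology ?R W k) euclideanreal (\<lambda>z. \<phi> k (fst z))" by (simp add: o_def)
  moreover have "continuous_map (jet_topology ?R W k) euclideanreal (\<lambda>z. \<Prod>j<k. snd z j)"
   using jet_snd[of _ k ?R W] by (intro continuous_map_prod) auto
  ultimately show "continuous_map (jet_topology ?R W k) (topol ?R) (\<lambda>(x, h). \<phi> k x * (\<Prod>j<k. h j))"
   by (simp add: case_prod_unfold continuous_map_real_mult)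
 next
  fix k :: nat and x and h :: "nat => real" assume x: "x \<in> W"
  define F where "F = (\<lambda>y. \<phi> k y * (\<Prod>j<k. h j))"
  have "((\<lambda>t. x + t * h k) has_real_derivative h k) (at 0)"
   by (auto intro!: derivative_eq_intros)
  moreover have "(\<phi> k has_real_derivative \<phi> (Suc k) x) (at (x + 0 * h k))" using d[OF x] by simp
  ultimately have "((\<lambda>t. \<phi> k (x + t * h k)) has_real_derivative \<phi> (Suc k) x * h k) (at 0)"
   by (rule DERIV_chain2[rotated])
  then have "((\<lambda>t. F (x + t * h k)) has_real_derivative \<phi> (Suc k) x * h k * (\<Prod>j<k. h j)) (at 0)"
   unfolding F_def by (rule DERIV_cmult_right)
  then have "((\<lambda>t. (F (x + t * h k) - F x) / t) \<longlongrightarrow> \<phi> (Suc k) x * h k * (\<Prod>j<k. h j)) (at 0)"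
   by (simp add: DERIV_def)
  then show "has_dir_deriv ?R ?R (\<lambda>y. \<phi> k y * (\<Prod>j<k. h j)) x (h k) (\<phi> (Suc k) x * (\<Prod>j<Suc k. h j))"
   by (simp add: has_dir_deriv_def F_def divide_inverse mult_ac)
 qed simp
qed

section \<open>Locality of smoothness\<close>

lemma jet_subtopology:
 assumes "W' \<subseteq> W"
 shows "jet_topology E W' k = subtopology (jet_topology E W k) (W' \<times> UNIV)"
 using assms by (simp add: jet_topology_def subtopology_Times subtopology_subtopology Int_absorb1)

lemma smooth_on_subset_cong:
 assumes E: "rlc E" and F: "rlc F" and W: "smooth_on E F W f" and W': "openin (topol E) W'" "W' \<subseteq> W"
  and eq: "\<And>x. x \<in> W' ==> f x = g x"
 shows "smooth_on E F W' g"
 unfolding smooth_on_def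
proof (intro allI conjI ballI)
 fix k :: nat and x h assume x: "x \<in> W'" and h: "h \<in> {..k} \<rightarrow> carrier E"
 then have hk: "h k \<in> carrier E" "h \<in> {..<k} \<rightarrow> carrier E" by auto
 obtain l where "has_dir_deriv E F (iter_deriv E F f k h) x (h k) l"
  using W x W'(2) h unfolding smooth_on_def by blast
 then have "has_dir_deriv E F (iter_deriv E F g k h) x (h k) l"
  by (rule has_dir_deriv_local[OF E W'(1) x hk(1), rotated]) (rule iter_deriv_local[OF E W'(1) hk(2) eq])
 then show "\<exists>l. has_dir_deriv E F (iter_deriv E F g k h) x (h k) l" by blast
next
 fix k
 interpret E: rlc E by fact
 have sub: "W' \<subseteq> carrier E" using openin_subset[OF W'(1)] by simp
 have "continuous_map (jet_topology E W' k) (topol F) (\<lambda>(x, h). iter_deriv E F f k h x)"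
  using W unfolding jet_subtopology[OF W'(2)] smooth_on_def by (simp add: continuous_map_from_subtopology)
 then show "continuous_map (jet_topology E W' k) (topol F) (\<lambda>(x, h). iter_deriv E F g k h x)"
 proof (rule continuous_map_eq)
  fix z assume "z \<in> topspace (jet_topology E W' k)"
  then have "fst z \<in> W'" "snd z \<in> {..<k} \<rightarrow> carrier E" using topspace_jet[OF E sub, of k] by auto
  from iter_deriv_local[OF E W'(1) this(2) eq this(1)]
  show "(case z of (x, h) => iter_deriv E F f k h x) = (case z of (x, h) => iter_deriv E F g k h x)"
   by (simp add: case_prod_unfold)
 qed
qed

text \<open>Difference quotients at \<open>x\<close> only involve points near \<open>x\<close>.\<close>

lemma smooth_on_local:
 assumes E: "rlc E" and F: "rlc F"
  and loc: "\<And>x. x \<in> W ==> \<exists>W'. openin (topol E) W' \<and> x \<in> W' \<and> W' \<subseteq> W \<and> smooth_on E F W' f"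
 shows "smooth_on E F W f"
 unfolding smooth_on_def
proof (intro allI conjI ballI)
 fix k :: nat and x h assume x: "x \<in> W" and h: "h \<in> {..k} \<rightarrow> carrier E"
 then show "\<exists>l. has_dir_deriv E F (iter_deriv E F f k h) x (h k) l"
  using loc[OF x] unfolding smooth_on_def by blast
next
 fix k
 obtain N where N: "\<And>x. x \<in> W ==> openin (topol E) (N x)" "\<And>x. x \<in> W ==> x \<in> N x"
  "\<And>x. x \<in> W ==> N x \<subseteq> W" "\<And>x. x \<in> W ==> smooth_on E F (N x) f"
  using loc by metis
 let ?J = "jet_topology E W k" and ?g = "\<lambda>(x, h). iter_deriv E F f k h x"
 have fc: "continuous_map ?J (subtopology (topol E) W) fst"
  unfolding jet_topology_def by (rule continuous_map_fst)
 show "continuous_map ?J (topol F) ?g"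
 proof (rule pasting_lemma[where I = W and T = "\<lambda>x. {z \<in> topspace ?J. fst z \<in> N x}" and f = "\<lambda>_. ?g"])
  fix x assume x: "x \<in> W"
  show "openin ?J {z \<in> topspace ?J. fst z \<in> N x}"
   by (rule openin_continuous_map_preimage[OF jet_fst N(1)[OF x]])
  have "subtopology ?J {z \<in> topspace ?J. fst z \<in> N x} = subtopology ?J (topspace ?J \<inter> (N x \<times> UNIV))"
   by (rule arg_cong[of _ _ "subtopology ?J"]) auto
  also have "\<dots> = jet_topology E (N x) k"
   by (simp add: jet_subtopology[OF N(3)[OF x]] subtopology_restrict)
  finally show "continuous_map (subtopology ?J {z \<in> topspace ?J. fst z \<in> N x}) (topol F) ?g"
   using N(4)[OF x] by (simp add: smooth_on_def)
 next
  fix z assume z: "z \<in> topspace ?J"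
  then have "fst z \<in> W" by (rule jet_fst_in)
  then show "\<exists>x. x \<in> W \<and> z \<in> {z \<in> topspace ?J. fst z \<in> N x} \<and> ?g z = ?g z" using N(2) z by blast
 qed simp
qed

lemma (in smooth_fun) continuous: "continuous_map (subtopology (topol E) W) (topol F) f"
proof -
 have "continuous_map (subtopology (topol E) W) (jet_topology E W 0) (\<lambda>z. (z, \<lambda>j\<in>{..<0}. \<zero>\<^sub>E))"
  by (rule jet_continuous_pair) auto
 from continuous_map_compose[OF this D_cont] show ?thesis by (simp add: o_def)
qed

section \<open>Smooth maps of manifolds\<close>

text \<open>Composition and localization of smooth maps use charts as homeomorphisms onto open sets that
  cover the space. This weaker notion passes to open subsets and products without chart changes.\<close>

definition charted :: "('p, 'v) mfd => bool" where
 "charted M \<longleftrightarrow> rlc (model M) \<and> \<Union> (fst ` atlas M) = topspace (mtop M) \<and>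
   (\<forall>(U, \<phi>)\<in>atlas M. openin (mtop M) U \<and> openin (topol (model M)) (\<phi> ` U) \<and>
    homeomorphic_map (subtopology (mtop M) U) (subtopology (topol (model M)) (\<phi> ` U)) \<phi>)"

lemma charted_smooth_manifold: "smooth_manifold M ==> charted M"
 by (auto simp: smooth_manifold_def charted_def rlc_def)

locale cmfd =
 fixes M :: "('p, 'v) mfd"
 assumes charted: "charted M"
begin

sublocale rlc "model M" using charted by (simp add: charted_def)

lemma chart_open: "(U, \<phi>) \<in> atlas M ==> openin (mtop M) U"
 and chart_image_open: "(U, \<phi>) \<in> atlas M ==> openin (topol (model M)) (\<phi> ` U)"
 and chart_homeo: "(U, \<phi>) \<in> atlas M ==>
   homeomorphic_map (subtopology (mtop M) U) (subtopology (topol (model M)) (\<phi> ` U)) \<phi>"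
 using charted by (auto simp: charted_def)

lemma chart_ex: "x \<in> topspace (mtop M) ==> \<exists>U \<phi>. (U, \<phi>) \<in> atlas M \<and> x \<in> U"
proof -
 assume "x \<in> topspace (mtop M)"
 moreover have "\<Union> (fst ` atlas M) = topspace (mtop M)"
  using charted unfolding charted_def by (elim conjE)
 ultimately obtain c where "c \<in> atlas M" "x \<in> fst c" by blast
 then show "\<exists>U \<phi>. (U, \<phi>) \<in> atlas M \<and> x \<in> U" by (cases c) auto
qed

lemma chart_sub: "(U, \<phi>) \<in> atlas M ==> x \<in> U ==> x \<in> topspace (mtop M)"
 using openin_subset[OF chart_open] by blast

lemma chart_topspace: "(U, \<phi>) \<in> atlas M ==> topspace (subtopology (mtop M) U) = U"
 using openin_subset[OF chart_open] by auto

lemma chart_inj: "(U, \<phi>) \<in> atlas M ==> inj_on \<phi> U"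
 using homeomorphic_imp_injective_map[OF chart_homeo] chart_topspace by metis

lemma chart_inverse: "(U, \<phi>) \<in> atlas M ==> x \<in> U ==> inv_into U \<phi> (\<phi> x) = x"
 by (simp add: chart_inj)

lemma chart_sub_image_open:
 assumes c: "(U, \<phi>) \<in> atlas M" and S: "openin (mtop M) S" "S \<subseteq> U"
 shows "openin (topol (model M)) (\<phi> ` S)"
proof -
 have "openin (subtopology (mtop M) U) S"
  using S openin_subtopology_Int2[of "mtop M" S U] by (simp add: Int_absorb1)
 then have "openin (subtopology (topol (model M)) (\<phi> ` U)) (\<phi> ` S)"
  using homeomorphic_map_openness[OF chart_homeo[OF c], of S] S chart_topspace[OF c] openin_subset[OF S(1)] by simp
 then show ?thesis using chart_image_open[OF c] openin_trans_full by blast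
qed

lemma inv_into_sub:
 "(U, \<phi>) \<in> atlas M ==> S \<subseteq> U ==> y \<in> \<phi> ` S ==> inv_into S \<phi> y = inv_into U \<phi> y"
 using chart_inj[of U \<phi>] by (auto simp: inj_on_subset subsetD)

end

lemma charted_open_submfd:
 assumes "charted M" "openin (mtop M) W"
 shows "charted (open_submfd M W)"
proof -
 interpret M: cmfd M using assms(1) by (rule cmfd.intro)
 have W: "W \<subseteq> topspace (mtop M)" using openin_subset[OF assms(2)] .
 have hm: "homeomorphic_map (subtopology (subtopology (mtop M) W) (U \<inter> W)) (subtopology (topol (model M)) (\<phi> ` (U \<inter> W))) \<phi>"
  if c: "(U, \<phi>) \<in> atlas M" for U \<phi>
 proof -
  have "\<phi> ` U \<subseteq> carrier (model M)" using openin_subset[OF M.chart_image_open[OF c]] by simp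
  then have "homeomorphic_map (subtopology (subtopology (mtop M) U) W)
    (subtopology (subtopology (topol (model M)) (\<phi> ` U)) (\<phi> ` (U \<inter> W))) \<phi>"
   by (intro homeomorphic_map_subtopologies[OF M.chart_homeo[OF c]]) (use M.chart_topspace[OF c] in auto)
  moreover have "\<phi> ` U \<inter> \<phi> ` (U \<inter> W) = \<phi> ` (U \<inter> W)" "W \<inter> (U \<inter> W) = U \<inter> W" by auto
  ultimately show ?thesis by (simp add: subtopology_subtopology Int_commute)
 qed
 have o1: "openin (subtopology (mtop M) W) (U \<inter> W)" if "(U, \<phi>) \<in> atlas M" for U \<phi>
  using M.chart_open[OF that] by (rule openin_subtopology_Int)
 have o2: "openin (topol (model M)) (\<phi> ` (U \<inter> W))" if c: "(U, \<phi>) \<in> atlas M" for U \<phi>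
  using M.chart_sub_image_open[OF c] M.chart_open[OF c] assms(2) by blast
 have un: "(\<Union>x\<in>{(U \<inter> W, \<phi>) |U \<phi>. (U, \<phi>) \<in> atlas M}. fst x) = topspace (mtop M) \<inter> W"
 proof (intro equalityI subsetI)
  fix x assume "x \<in> topspace (mtop M) \<inter> W"
  moreover then obtain U \<phi> where "(U, \<phi>) \<in> atlas M" "x \<in> U" using M.chart_ex by blast
  ultimately have "(U \<inter> W, \<phi>) \<in> {(U \<inter> W, \<phi>) |U \<phi>. (U, \<phi>) \<in> atlas M}" "x \<in> fst (U \<inter> W, \<phi>)" by auto
  then show "x \<in> (\<Union>x\<in>{(U \<inter> W, \<phi>) |U \<phi>. (U, \<phi>) \<in> atlas M}. fst x)" by blast
 qed (auto dest: M.chart_sub)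
 show ?thesis
  unfolding charted_def
 proof (intro conjI ballI)
  fix c assume "c \<in> atlas (open_submfd M W)"
  then obtain U \<phi> where c: "c = (U \<inter> W, \<phi>)" "(U, \<phi>) \<in> atlas M" by (auto simp: open_submfd_def)
  show "case c of (U, \<phi>) => openin (mtop (open_submfd M W)) U \<and> openin (topol (model (open_submfd M W))) (\<phi> ` U) \<and>
    homeomorphic_map (subtopology (mtop (open_submfd M W)) U) (subtopology (topol (model (open_submfd M W))) (\<phi> ` U)) \<phi>"
   using o1[OF c(2)] o2[OF c(2)] hm[OF c(2)] by (simp add: open_submfd_def c(1))
 next
  show "rlc (model (open_submfd M W))" using M.rlc_axioms by (simp add: open_submfd_def)
  show "\<Union> (fst ` atlas (open_submfd M W)) = topspace (mtop (open_submfd M W))"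
   using un by (simp only: open_submfd_def mfd.simps topspace_subtopology)
 qed
qed

lemma charted_space_mfd: assumes "rlc E" shows "charted (space_mfd E)"
proof -
 interpret E: rlc E by fact
 have "openin (topol E) (carrier E)" using openin_topspace[of "topol E"] by simp
 moreover have "homeomorphic_map (topol E) (topol E) (\<lambda>x. x)"
  by (rule homeomorphic_map_id[THEN iffD2, unfolded id_def]) simp
 moreover have "subtopology (topol E) (carrier E) = topol E"
  using subtopology_topspace[of "topol E"] by simp
 ultimately show ?thesis
  using E.rlc_axioms E.topspace_eq
  by (simp only: charted_def space_mfd_def mfd.simps image_insert image_empty fst_conv Union_insert Union_empty
    Un_empty_right ball_simps prod.case image_ident simp_thms)
qed

lemma charted_prod_mfd:
 assumes "charted M" "charted N" shows "charted (prod_mfd M N)"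
proof -
 interpret M: cmfd M using assms(1) by (rule cmfd.intro)
 interpret N: cmfd N using assms(2) by (rule cmfd.intro)
 have "homeomorphic_map (prod_topology X Y) (prod_topology X' Y') (map_prod f g)"
  if fg: "homeomorphic_map X X' f" "homeomorphic_map Y Y' g"
  for X :: "'a topology" and Y :: "'c topology" and X' :: "'b topology" and Y' :: "'d topology" and f g
 proof -
  obtain f' g' where h: "homeomorphic_maps X X' f f'" "homeomorphic_maps Y Y' g g'"
   using fg by (auto simp: homeomorphic_map_maps)
  have "homeomorphic_maps (prod_topology X Y) (prod_topology X' Y') (\<lambda>(x, y). (f x, g y)) (\<lambda>(x, y). (f' x, g' y))"
   using h unfolding homeomorphic_maps_def by (auto simp: continuous_map_prod_top)
  then show ?thesis by (auto simp: homeomorphic_map_maps map_prod_def)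
 qed
 from this[OF M.chart_homeo N.chart_homeo]
 have hm: "homeomorphic_map (subtopology (prod_topology (mtop M) (mtop N)) (U \<times> V))
   (subtopology (prod_topology (topol (model M)) (topol (model N))) (\<phi> ` U \<times> \<psi> ` V)) (map_prod \<phi> \<psi>)"
  if "(U, \<phi>) \<in> atlas M" "(V, \<psi>) \<in> atlas N" for U \<phi> V \<psi>
  using that by (simp add: subtopology_Times)
 have im: "map_prod \<phi> \<psi> ` (U \<times> V) = \<phi> ` U \<times> \<psi> ` V" for \<phi> \<psi> U V by auto
 have un: "(\<Union>x\<in>{(U \<times> V, map_prod \<phi> \<psi>) |U \<phi> V \<psi>. (U, \<phi>) \<in> atlas M \<and> (V, \<psi>) \<in> atlas N}. fst x)
   = topspace (mtop M) \<times> topspace (mtop N)"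
 proof (intro equalityI subsetI)
  fix z assume "z \<in> topspace (mtop M) \<times> topspace (mtop N)"
  then obtain x y where z: "z = (x, y)" "x \<in> topspace (mtop M)" "y \<in> topspace (mtop N)" by auto
  obtain U \<phi> V \<psi> where "(U, \<phi>) \<in> atlas M" "x \<in> U" "(V, \<psi>) \<in> atlas N" "y \<in> V"
   using M.chart_ex[OF z(2)] N.chart_ex[OF z(3)] by blast
  then have "(U \<times> V, map_prod \<phi> \<psi>) \<in> {(U \<times> V, map_prod \<phi> \<psi>) |U \<phi> V \<psi>. (U, \<phi>) \<in> atlas M \<and> (V, \<psi>) \<in> atlas N}" "z \<in> fst (U \<times> V, map_prod \<phi> \<psi>)"
   using z by auto
  then show "z \<in> (\<Union>x\<in>{(U \<times> V, map_prod \<phi> \<psi>) |U \<phi> V \<psi>. (U, \<phi>) \<in> atlas M \<and> (V, \<psi>) \<in> atlas N}. fst x)" by (rule UN_I)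
 next
  fix z assume "z \<in> (\<Union>x\<in>{(U \<times> V, map_prod \<phi> \<psi>) |U \<phi> V \<psi>. (U, \<phi>) \<in> atlas M \<and> (V, \<psi>) \<in> atlas N}. fst x)"
  then obtain U \<phi> V \<psi> where *: "(U, \<phi>) \<in> atlas M" "(V, \<psi>) \<in> atlas N" and z: "z \<in> U \<times> V" by auto
  have "U \<subseteq> topspace (mtop M)" "V \<subseteq> topspace (mtop N)" using * M.chart_sub N.chart_sub by blast+
  then show "z \<in> topspace (mtop M) \<times> topspace (mtop N)" using z by (rule subsetD[OF Sigma_mono])
 qed
 show ?thesis
  unfolding charted_def
 proof (intro conjI ballI)
  fix c assume "c \<in> atlas (prod_mfd M N)"
  then obtain U \<phi> V \<psi> where c: "c = (U \<times> V, map_prod \<phi> \<psi>)" "(U, \<phi>) \<in> atlas M" "(V, \<psi>) \<in> atlas N"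
   by (auto simp: prod_mfd_def)
  show "case c of (U, \<phi>) => openin (mtop (prod_mfd M N)) U \<and> openin (topol (model (prod_mfd M N))) (\<phi> ` U) \<and>
    homeomorphic_map (subtopology (mtop (prod_mfd M N)) U) (subtopology (topol (model (prod_mfd M N))) (\<phi> ` U)) \<phi>"
   using hm[OF c(2,3)] M.chart_open[OF c(2)] N.chart_open[OF c(3)] M.chart_image_open[OF c(2)] N.chart_image_open[OF c(3)]
   by (simp add: prod_mfd_def c(1) im openin_prod_Times_iff)
 next
  show "rlc (model (prod_mfd M N))"
   using rlc_prod_space[OF M.rlc_axioms N.rlc_axioms] by (simp add: prod_mfd_def)
  show "\<Union> (fst ` atlas (prod_mfd M N)) = topspace (mtop (prod_mfd M N))"
   using un by (simp only: prod_mfd_def mfd.simps topspace_prod_topology)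
 qed
qed

lemma smooth_mapI:
 assumes "continuous_map (mtop M) (mtop N) f"
  and "\<And>U \<phi> V \<psi>. (U, \<phi>) \<in> atlas M ==> (V, \<psi>) \<in> atlas N ==>
   smooth_on (model M) (model N) (\<phi> ` {x \<in> U. f x \<in> V}) (\<psi> \<circ> f \<circ> inv_into U \<phi>)"
 shows "smooth_map M N f"
 unfolding smooth_map_def
proof (intro conjI ballI assms(1))
 fix c assume c: "c \<in> atlas M"
 obtain U \<phi> where c': "c = (U, \<phi>)" by (cases c)
 show "case c of (U, \<phi>) => \<forall>(V, \<psi>)\<in>atlas N. smooth_on (model M) (model N) (\<phi> ` {x \<in> U. f x \<in> V}) (\<psi> \<circ> f \<circ> inv_into U \<phi>)"
  unfolding c' prod.case
 proof (intro ballI)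
  fix d assume d: "d \<in> atlas N"
  obtain V \<psi> where d': "d = (V, \<psi>)" by (cases d)
  show "case d of (V, \<psi>) => smooth_on (model M) (model N) (\<phi> ` {x \<in> U. f x \<in> V}) (\<psi> \<circ> f \<circ> inv_into U \<phi>)"
   unfolding d' prod.case by (rule assms(2)[OF c[unfolded c'] d[unfolded d']])
 qed
qed

lemma smooth_mapD:
 assumes "smooth_map M N f"
 shows "continuous_map (mtop M) (mtop N) f"
  and "\<And>U \<phi> V \<psi>. (U, \<phi>) \<in> atlas M ==> (V, \<psi>) \<in> atlas N ==>
   smooth_on (model M) (model N) (\<phi> ` {x \<in> U. f x \<in> V}) (\<psi> \<circ> f \<circ> inv_into U \<phi>)"
proof -
 show "continuous_map (mtop M) (mtop N) f" using assms unfolding smooth_map_def by (rule conjunct1)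
 fix U \<phi> V \<psi> assume c: "(U, \<phi>) \<in> atlas M" and d: "(V, \<psi>) \<in> atlas N"
 note * = bspec[OF conjunct2[OF assms[unfolded smooth_map_def]] c, unfolded prod.case]
 show "smooth_on (model M) (model N) (\<phi> ` {x \<in> U. f x \<in> V}) (\<psi> \<circ> f \<circ> inv_into U \<phi>)"
  using bspec[OF * d] unfolding prod.case .
qed

lemma smooth_map_chart:
 assumes M: "charted M" and N: "charted N" and f: "smooth_map M N f"
  and c: "(U, \<phi>) \<in> atlas M" and d: "(V, \<psi>) \<in> atlas N"
 shows "smooth_fun (model M) (model N) (\<phi> ` {x \<in> U. f x \<in> V}) (\<lambda>y. \<psi> (f (inv_into U \<phi> y)))"
  and "openin (mtop M) {x \<in> U. f x \<in> V}"
proof -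
 interpret M: cmfd M using M by (rule cmfd.intro)
 interpret N: cmfd N using N by (rule cmfd.intro)
 have "openin (mtop M) ({x \<in> topspace (mtop M). f x \<in> V} \<inter> U)"
  by (intro openin_Int M.chart_open[OF c] openin_continuous_map_preimage[OF _ N.chart_open[OF d]])
   (use f in \<open>simp add: smooth_map_def\<close>)
 moreover have "{x \<in> topspace (mtop M). f x \<in> V} \<inter> U = {x \<in> U. f x \<in> V}" using M.chart_sub[OF c] by auto
 ultimately show o: "openin (mtop M) {x \<in> U. f x \<in> V}" by simp
 have "smooth_on (model M) (model N) (\<phi> ` {x \<in> U. f x \<in> V}) (\<psi> \<circ> f \<circ> inv_into U \<phi>)"
  by (rule smooth_mapD(2)[OF f c d])
 then show "smooth_fun (model M) (model N) (\<phi> ` {x \<in> U. f x \<in> V}) (\<lambda>y. \<psi> (f (inv_into U \<phi> y)))"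
  using M.chart_sub_image_open[OF c o] by unfold_locales (auto simp: o_def)
qed

lemma smooth_map_cong:
 assumes M: "charted M" and N: "charted N" and f: "smooth_map M N f"
  and eq: "\<And>x. x \<in> topspace (mtop M) ==> f x = g x"
 shows "smooth_map M N g"
proof -
 interpret M: cmfd M using M by (rule cmfd.intro)
 interpret N: cmfd N using N by (rule cmfd.intro)
 have "smooth_on (model M) (model N) (\<phi> ` {x \<in> U. g x \<in> V}) (\<psi> \<circ> g \<circ> inv_into U \<phi>)"
  if c: "(U, \<phi>) \<in> atlas M" and d: "(V, \<psi>) \<in> atlas N" for U \<phi> V \<psi>
 proof -
  interpret f: smooth_fun "model M" "model N" "\<phi> ` {x \<in> U. f x \<in> V}" "\<lambda>y. \<psi> (f (inv_into U \<phi> y))"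
   by (rule smooth_map_chart[OF M N f c d])
  have S: "{x \<in> U. g x \<in> V} = {x \<in> U. f x \<in> V}" using eq M.chart_sub[OF c] by auto
  show ?thesis unfolding S
   by (rule smooth_on_subset_cong[OF M.rlc_axioms N.rlc_axioms f.smooth f.W order_refl])
    (auto simp: M.chart_inverse[OF c] eq M.chart_sub[OF c])
 qed
 moreover have "continuous_map (mtop M) (mtop N) g"
  by (rule continuous_map_eq[OF smooth_mapD(1)[OF f] eq])
 ultimately show ?thesis by (intro smooth_mapI)
qed

lemma open_submfd_simps [simp]:
 "model (open_submfd M W) = model M" "mtop (open_submfd M W) = subtopology (mtop M) W"
 "atlas (open_submfd M W) = {(U \<inter> W, \<phi>) |U \<phi>. (U, \<phi>) \<in> atlas M}"
 by (simp_all add: open_submfd_def)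

lemma smooth_map_restrict:
 assumes M: "charted M" and N: "charted N" and f: "smooth_map M N f" and W: "openin (mtop M) W"
 shows "smooth_map (open_submfd M W) N f"
proof -
 interpret M: cmfd M using M by (rule cmfd.intro)
 interpret N: cmfd N using N by (rule cmfd.intro)
 have "smooth_on (model M) (model N) (\<phi> ` {x \<in> U \<inter> W. f x \<in> V}) (\<psi> \<circ> f \<circ> inv_into (U \<inter> W) \<phi>)"
  if c: "(U, \<phi>) \<in> atlas M" and d: "(V, \<psi>) \<in> atlas N" for U \<phi> V \<psi>
 proof -
  interpret f: smooth_fun "model M" "model N" "\<phi> ` {x \<in> U. f x \<in> V}" "\<lambda>y. \<psi> (f (inv_into U \<phi> y))"
   by (rule smooth_map_chart[OF M N f c d])
  have "{x \<in> U \<inter> W. f x \<in> V} = {x \<in> U. f x \<in> V} \<inter> W" by auto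
  then have "openin (mtop M) {x \<in> U \<inter> W. f x \<in> V}"
   using smooth_map_chart(2)[OF M N f c d] W by auto
  then have "openin (topol (model M)) (\<phi> ` {x \<in> U \<inter> W. f x \<in> V})"
   by (rule M.chart_sub_image_open[OF c]) auto
  then show ?thesis
   by (rule smooth_on_subset_cong[OF M.rlc_axioms N.rlc_axioms f.smooth])
    (auto simp: M.chart_inverse[OF c] M.inv_into_sub[OF c] inj_on_subset[OF M.chart_inj[OF c]])
 qed
 moreover have "continuous_map (mtop (open_submfd M W)) (mtop N) f"
  using continuous_map_from_subtopology[OF smooth_mapD(1)[OF f]] by simp
 ultimately show ?thesis by (intro smooth_mapI) (auto simp: open_submfd_def)
qed

lemma smooth_map_local:
 assumes M: "charted M" and N: "charted N"
  and loc: "\<And>x. x \<in> topspace (mtop M) ==> \<exists>W. openin (mtop M) W \<and> x \<in> W \<and> smooth_map (open_submfd M W) N f"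
 shows "smooth_map M N f"
proof -
 interpret M: cmfd M using M by (rule cmfd.intro)
 interpret N: cmfd N using N by (rule cmfd.intro)
 obtain W where W: "\<And>x. x \<in> topspace (mtop M) ==> openin (mtop M) (W x)" "\<And>x. x \<in> topspace (mtop M) ==> x \<in> W x"
  "\<And>x. x \<in> topspace (mtop M) ==> smooth_map (open_submfd M (W x)) N f"
  using loc by metis
 have cont: "continuous_map (mtop M) (mtop N) f"
  by (rule pasting_lemma[where I = "topspace (mtop M)" and T = W and f = "\<lambda>_. f"])
   (use W smooth_mapD(1)[OF W(3)] in auto)
 have "smooth_on (model M) (model N) (\<phi> ` {x \<in> U. f x \<in> V}) (\<psi> \<circ> f \<circ> inv_into U \<phi>)"
  if c: "(U, \<phi>) \<in> atlas M" and d: "(V, \<psi>) \<in> atlas N" for U \<phi> V \<psi>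
 proof (rule smooth_on_local[OF M.rlc_axioms N.rlc_axioms])
  fix y assume "y \<in> \<phi> ` {x \<in> U. f x \<in> V}"
  then obtain x where x: "x \<in> U" "f x \<in> V" "y = \<phi> x" by auto
  have xM: "x \<in> topspace (mtop M)" by (rule M.chart_sub[OF c x(1)])
  note M' = charted_open_submfd[OF M W(1)[OF xM]]
  have c': "(U \<inter> W x, \<phi>) \<in> atlas (open_submfd M (W x))" using c by auto
  interpret f: smooth_fun "model M" "model N" "\<phi> ` {z \<in> U \<inter> W x. f z \<in> V}" "\<lambda>y. \<psi> (f (inv_into (U \<inter> W x) \<phi> y))"
   using smooth_map_chart(1)[OF M' N W(3)[OF xM] c' d] by simp
  have "smooth_on (model M) (model N) (\<phi> ` {z \<in> U \<inter> W x. f z \<in> V}) (\<psi> \<circ> f \<circ> inv_into U \<phi>)"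
   by (rule smooth_on_subset_cong[OF M.rlc_axioms N.rlc_axioms f.smooth f.W order_refl])
    (auto simp: M.chart_inverse[OF c] inj_on_subset[OF M.chart_inj[OF c]])
  then show "\<exists>W'. openin (topol (model M)) W' \<and> y \<in> W' \<and> W' \<subseteq> \<phi> ` {x \<in> U. f x \<in> V} \<and>
    smooth_on (model M) (model N) W' (\<psi> \<circ> f \<circ> inv_into U \<phi>)"
   using f.W x W(2)[OF xM] by (intro exI[of _ "\<phi> ` {z \<in> U \<inter> W x. f z \<in> V}"]) auto
 qed
 with cont show ?thesis by (intro smooth_mapI)
qed

text \<open>The chain rule applies on the sets where the inner map takes values in a chart domain.\<close>

lemma smooth_map_compose:
 assumes M: "charted M" and N: "charted N" and P: "charted P"
  and g: "smooth_map M N g" and f: "smooth_map N P f"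
 shows "smooth_map M P (\<lambda>x. f (g x))"
proof -
 interpret M: cmfd M using M by (rule cmfd.intro)
 interpret N: cmfd N using N by (rule cmfd.intro)
 interpret P: cmfd P using P by (rule cmfd.intro)
 note gc = smooth_mapD(1)[OF g] and fc = smooth_mapD(1)[OF f]
 have cont: "continuous_map (mtop M) (mtop P) (\<lambda>x. f (g x))"
  using continuous_map_compose[OF gc fc] by (simp add: o_def)
 have "smooth_on (model M) (model P) (\<phi> ` {x \<in> U. f (g x) \<in> V}) ((\<psi> \<circ> (\<lambda>x. f (g x))) \<circ> inv_into U \<phi>)"
  if c: "(U, \<phi>) \<in> atlas M" and d: "(V, \<psi>) \<in> atlas P" for U \<phi> V \<psi>
 proof (rule smooth_on_local[OF M.rlc_axioms P.rlc_axioms])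
  fix y assume "y \<in> \<phi> ` {x \<in> U. f (g x) \<in> V}"
  then obtain x where x: "x \<in> U" "f (g x) \<in> V" "y = \<phi> x" by auto
  have "g x \<in> topspace (mtop N)"
   using gc M.chart_sub[OF c x(1)] by (auto simp: continuous_map_def)
  then obtain T \<kappa> where e: "(T, \<kappa>) \<in> atlas N" "g x \<in> T" using N.chart_ex by blast
  interpret f: smooth_fun "model N" "model P" "\<kappa> ` {z \<in> T. f z \<in> V}" "\<lambda>y. \<psi> (f (inv_into T \<kappa> y))"
   by (rule smooth_map_chart[OF N P f e(1) d])
  interpret g: smooth_fun "model M" "model N" "\<phi> ` {z \<in> U. g z \<in> T}" "\<lambda>y. \<kappa> (g (inv_into U \<phi> y))"
   by (rule smooth_map_chart[OF M N g c e(1)])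
  let ?S = "{z \<in> U. g z \<in> {w \<in> T. f w \<in> V}}"
  have "openin (mtop M) ({z \<in> topspace (mtop M). g z \<in> {w \<in> T. f w \<in> V}} \<inter> U)"
   by (intro openin_Int M.chart_open[OF c] openin_continuous_map_preimage[OF gc]
     smooth_map_chart(2)[OF N P f e(1) d])
  moreover have "{z \<in> topspace (mtop M). g z \<in> {w \<in> T. f w \<in> V}} \<inter> U = ?S"
   using M.chart_sub[OF c] by auto
  ultimately have "openin (mtop M) ?S" by simp
  then have S: "openin (topol (model M)) (\<phi> ` ?S)" by (rule M.chart_sub_image_open[OF c]) auto
  have g': "smooth_fun (model M) (model N) (\<phi> ` ?S) (\<lambda>y. \<kappa> (g (inv_into U \<phi> y)))"
  proof
   show "openin (topol (model M)) (\<phi> ` ?S)" by (rule S)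
   show "smooth_on (model M) (model N) (\<phi> ` ?S) (\<lambda>y. \<kappa> (g (inv_into U \<phi> y)))"
    by (rule smooth_on_subset_cong[OF M.rlc_axioms N.rlc_axioms g.smooth S _ refl]) auto
  qed
  have "smooth_on (model M) (model P) (\<phi> ` ?S) (\<lambda>y. \<psi> (f (inv_into T \<kappa> (\<kappa> (g (inv_into U \<phi> y))))))"
   by (rule smooth_compose[OF f.smooth_fun_axioms g']) (auto simp: M.chart_inverse[OF c])
  then have "smooth_on (model M) (model P) (\<phi> ` ?S) ((\<psi> \<circ> (\<lambda>x. f (g x))) \<circ> inv_into U \<phi>)"
   by (rule smooth_on_subset_cong[OF M.rlc_axioms P.rlc_axioms _ S order_refl])
    (auto simp: M.chart_inverse[OF c] N.chart_inverse[OF e(1)])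
  then show "\<exists>W'. openin (topol (model M)) W' \<and> y \<in> W' \<and> W' \<subseteq> \<phi> ` {x \<in> U. f (g x) \<in> V} \<and>
    smooth_on (model M) (model P) W' ((\<psi> \<circ> (\<lambda>x. f (g x))) \<circ> inv_into U \<phi>)"
   using S x e by (intro exI[of _ "\<phi> ` ?S"]) auto
 qed
 with cont show ?thesis by (intro smooth_mapI)
qed

lemma smooth_map_into_submfd:
 assumes M: "charted M" and N: "charted N" and W: "openin (mtop N) W"
  and f: "smooth_map M N f" and sub: "\<And>x. x \<in> topspace (mtop M) ==> f x \<in> W"
 shows "smooth_map M (open_submfd N W) f"
proof -
 interpret M: cmfd M using M by (rule cmfd.intro)
 have "smooth_on (model M) (model N) (\<phi> ` {x \<in> U. f x \<in> V \<inter> W}) (\<psi> \<circ> f \<circ> inv_into U \<phi>)"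
  if c: "(U, \<phi>) \<in> atlas M" and d: "(V, \<psi>) \<in> atlas N" for U \<phi> V \<psi>
 proof -
  have "{x \<in> U. f x \<in> V \<inter> W} = {x \<in> U. f x \<in> V}" using sub M.chart_sub[OF c] by auto
  then show ?thesis using smooth_mapD(2)[OF f c d] by simp
 qed
 moreover have "continuous_map (mtop M) (mtop (open_submfd N W)) f"
  using smooth_mapD(1)[OF f] sub by (auto simp: continuous_map_in_subtopology)
 ultimately show ?thesis by (intro smooth_mapI) (auto simp: open_submfd_def)
qed

lemma smooth_map_from_submfd:
 assumes M: "charted M" and f: "smooth_map M (open_submfd N W) f"
 shows "smooth_map M N f"
proof -
 interpret M: cmfd M using M by (rule cmfd.intro)
 have fc: "continuous_map (mtop M) (subtopology (mtop N) W) f" using smooth_mapD(1)[OF f] by simp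
 have "smooth_on (model M) (model N) (\<phi> ` {x \<in> U. f x \<in> V}) (\<psi> \<circ> f \<circ> inv_into U \<phi>)"
  if c: "(U, \<phi>) \<in> atlas M" and d: "(V, \<psi>) \<in> atlas N" for U \<phi> V \<psi>
 proof -
  have "{x \<in> U. f x \<in> V \<inter> W} = {x \<in> U. f x \<in> V}"
   using fc M.chart_sub[OF c] by (auto simp: continuous_map_def)
  moreover have d': "(V \<inter> W, \<psi>) \<in> atlas (open_submfd N W)" using d by auto
  moreover have "smooth_on (model M) (model (open_submfd N W)) (\<phi> ` {x \<in> U. f x \<in> V \<inter> W}) (\<psi> \<circ> f \<circ> inv_into U \<phi>)"
   by (rule smooth_mapD(2)[OF f c d'])
  ultimately show ?thesis by simp
 qed
 with continuous_map_into_fulltopology[OF fc] show ?thesis by (intro smooth_mapI)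
qed


section \<open>Smooth maps into locally convex spaces\<close>

lemma space_mfd_simps [simp]:
 "model (space_mfd E) = E" "mtop (space_mfd E) = topol E" "atlas (space_mfd E) = {(carrier E, \<lambda>x. x)}"
 by (simp_all add: space_mfd_def)

lemma smooth_map_spaceI:
 assumes M: "charted M" and F: "rlc F"
  and fc: "\<And>x. x \<in> topspace (mtop M) ==> f x \<in> carrier F"
  and sm: "\<And>U \<phi>. (U, \<phi>) \<in> atlas M ==> smooth_on (model M) F (\<phi> ` U) (\<lambda>y. f (inv_into U \<phi> y))"
 shows "smooth_map M (space_mfd F) f"
proof (rule smooth_mapI)
 interpret M: cmfd M using M by (rule cmfd.intro)
 interpret F: rlc F by fact
 have "continuous_map (subtopology (mtop M) U) (topol F) f" if c: "(U, \<phi>) \<in> atlas M" for U \<phi>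
 proof -
  have sf: "smooth_fun (model M) F (\<phi> ` U) (\<lambda>y. f (inv_into U \<phi> y))"
   using sm[OF c] M.chart_image_open[OF c] by unfold_locales
  from continuous_map_compose[OF homeomorphic_imp_continuous_map[OF M.chart_homeo[OF c]] smooth_fun.continuous[OF sf]]
  show ?thesis
   by (rule continuous_map_eq) (use M.chart_topspace[OF c] M.chart_inverse[OF c] in simp)
 qed
 note ctsU = this
 have "continuous_map (mtop M) (topol F) f"
 proof (rule pasting_lemma[where I = "atlas M" and T = fst and f = "\<lambda>_. f"])
  show "openin (mtop M) (fst c)" if "c \<in> atlas M" for c using M.chart_open[of "fst c" "snd c"] that by simp
  show "continuous_map (subtopology (mtop M) (fst c)) (topol F) f" if "c \<in> atlas M" for c
   using ctsU[of "fst c" "snd c"] that by simp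
  show "\<exists>c. c \<in> atlas M \<and> x \<in> fst c \<and> f x = f x" if x: "x \<in> topspace (mtop M)" for x
  proof -
   obtain U \<phi> where "(U, \<phi>) \<in> atlas M" "x \<in> U" using M.chart_ex[OF x] by blast
   then show ?thesis by (intro exI[of _ "(U, \<phi>)"]) simp
  qed
 qed simp
 then show "continuous_map (mtop M) (mtop (space_mfd F)) f" by simp
 fix U \<phi> V \<psi> assume c: "(U, \<phi>) \<in> atlas M" and "(V, \<psi>) \<in> atlas (space_mfd F)"
 then have d: "V = carrier F" "\<psi> = (\<lambda>x. x)" by auto
 have "{x \<in> U. f x \<in> V} = U" using fc M.chart_sub[OF c] d by auto
 then show "smooth_on (model M) (model (space_mfd F)) (\<phi> ` {x \<in> U. f x \<in> V}) (\<psi> \<circ> f \<circ> inv_into U \<phi>)"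
  using sm[OF c] d by (simp add: o_def)
qed

lemma smooth_map_spaceD:
 assumes M: "charted M" and F: "rlc F" and f: "smooth_map M (space_mfd F) f"
 shows "\<And>x. x \<in> topspace (mtop M) ==> f x \<in> carrier F"
  and "\<And>U \<phi>. (U, \<phi>) \<in> atlas M ==> smooth_fun (model M) F (\<phi> ` U) (\<lambda>y. f (inv_into U \<phi> y))"
proof -
 interpret M: cmfd M using M by (rule cmfd.intro)
 interpret F: rlc F by fact
 show fc: "f x \<in> carrier F" if "x \<in> topspace (mtop M)" for x
  using F.continuous_closed smooth_mapD(1)[OF f] that by simp
 show "smooth_fun (model M) F (\<phi> ` U) (\<lambda>y. f (inv_into U \<phi> y))" if c: "(U, \<phi>) \<in> atlas M" for U \<phi>
 proof -
  have "{x \<in> U. f x \<in> carrier F} = U" using fc M.chart_sub[OF c] by auto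
  then show ?thesis
   using smooth_map_chart(1)[OF M charted_space_mfd[OF F] f c, of "carrier F" "\<lambda>x. x"] by simp
 qed
qed

lemma smooth_map_const:
 assumes M: "charted M" and F: "rlc F" and c: "c \<in> carrier F"
 shows "smooth_map M (space_mfd F) (\<lambda>x. c)"
proof (rule smooth_map_spaceI[OF M F])
 interpret M: cmfd M using M by (rule cmfd.intro)
 show "smooth_on (model M) F (\<phi> ` U) (\<lambda>y. c)" if "(U, \<phi>) \<in> atlas M" for U \<phi>
  by (rule smooth_const[OF M.rlc_axioms F M.chart_image_open[OF that] c])
qed (rule c)

lemma smooth_map_lin:
 assumes M: "charted M" and F: "rlc F" and G: "rlc G" and f: "smooth_map M (space_mfd F) f"
  and L: "lin_map F G L" "continuous_map (topol F) (topol G) L"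
 shows "smooth_map M (space_mfd G) (\<lambda>x. L (f x))"
 by (rule smooth_map_spaceI[OF M G])
  (use smooth_map_spaceD[OF M F f] L smooth_fun.smooth_lin(1)[OF smooth_map_spaceD(2)[OF M F f] G L] in \<open>auto simp: lin_map_def\<close>)

lemma smooth_map_bilin:
 assumes M: "charted M" and E1: "rlc E1" and E2: "rlc E2" and F: "rlc F"
  and u: "smooth_map M (space_mfd E1) u" and v: "smooth_map M (space_mfd E2) v" and b: "bilin E1 E2 F b"
 shows "smooth_map M (space_mfd F) (\<lambda>x. b (u x) (v x))"
proof (rule smooth_map_spaceI[OF M F])
 show "b (u x) (v x) \<in> carrier F" if "x \<in> topspace (mtop M)" for x
  using b smooth_map_spaceD(1)[OF M E1 u that] smooth_map_spaceD(1)[OF M E2 v that]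
  unfolding bilin_def lin_map_def by blast
 show "smooth_on (model M) F (\<phi> ` U) (\<lambda>y. b (u (inv_into U \<phi> y)) (v (inv_into U \<phi> y)))" if "(U, \<phi>) \<in> atlas M" for U \<phi>
  by (rule smooth_bilin(1)[OF smooth_map_spaceD(2)[OF M E1 u that] smooth_map_spaceD(2)[OF M E2 v that] F b])
qed

lemma smooth_map_post:
 assumes M: "charted M" and E: "rlc E" and F: "rlc F" and u: "smooth_map M (space_mfd E) u"
  and W: "openin (topol E) W" "\<And>x. x \<in> topspace (mtop M) ==> u x \<in> W" and f: "smooth_on E F W f"
 shows "smooth_map M (space_mfd F) (\<lambda>x. f (u x))"
proof -
 interpret f: smooth_fun E F W f using E F W f by (simp add: smooth_fun_def smooth_fun_axioms_def)
 interpret M: cmfd M using M by (rule cmfd.intro)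
 show ?thesis
 proof (rule smooth_map_spaceI[OF M F])
  show "f (u x) \<in> carrier F" if "x \<in> topspace (mtop M)" for x
   by (rule f.f_closed[OF W(2)[OF that]])
  show "smooth_on (model M) F (\<phi> ` U) (\<lambda>y. f (u (inv_into U \<phi> y)))" if c: "(U, \<phi>) \<in> atlas M" for U \<phi>
  proof (rule smooth_compose[OF f.smooth_fun_axioms smooth_map_spaceD(2)[OF M E u c]])
   fix y assume "y \<in> \<phi> ` U"
   then show "u (inv_into U \<phi> y) \<in> W" using W(2) M.chart_sub[OF c] by (auto simp: M.chart_inverse[OF c])
  qed
 qed
qed

lemma smooth_map_pair:
 assumes M: "charted M" and N: "charted N" and P: "charted P"
  and f: "smooth_map M N f" and g: "smooth_map M P g"
 shows "smooth_map M (prod_mfd N P) (\<lambda>x. (f x, g x))"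
proof (rule smooth_mapI)
 interpret M: cmfd M using M by (rule cmfd.intro)
 interpret N: cmfd N using N by (rule cmfd.intro)
 interpret P: cmfd P using P by (rule cmfd.intro)
 have Q: "rlc (prod_space (model N) (model P))" using N.rlc_axioms P.rlc_axioms by (rule rlc_prod_space)
 show "continuous_map (mtop M) (mtop (prod_mfd N P)) (\<lambda>x. (f x, g x))"
  using smooth_mapD(1)[OF f] smooth_mapD(1)[OF g] by (simp add: prod_mfd_def continuous_map_pairwise o_def)
 fix U \<phi> V' \<psi>' assume c: "(U, \<phi>) \<in> atlas M" and "(V', \<psi>') \<in> atlas (prod_mfd N P)"
 then obtain V \<psi> T \<kappa> where d: "V' = V \<times> T" "\<psi>' = map_prod \<psi> \<kappa>" "(V, \<psi>) \<in> atlas N" "(T, \<kappa>) \<in> atlas P"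
  by (auto simp: prod_mfd_def)
 interpret f: smooth_fun "model M" "model N" "\<phi> ` {x \<in> U. f x \<in> V}" "\<lambda>y. \<psi> (f (inv_into U \<phi> y))"
  by (rule smooth_map_chart[OF M N f c d(3)])
 interpret g: smooth_fun "model M" "model P" "\<phi> ` {x \<in> U. g x \<in> T}" "\<lambda>y. \<kappa> (g (inv_into U \<phi> y))"
  by (rule smooth_map_chart[OF M P g c d(4)])
 let ?S = "{x \<in> U. f x \<in> V \<and> g x \<in> T}"
 have "openin (mtop M) ({x \<in> U. f x \<in> V} \<inter> {x \<in> U. g x \<in> T})"
  by (intro openin_Int smooth_map_chart(2)[OF M N f c d(3)] smooth_map_chart(2)[OF M P g c d(4)])
 moreover have "{x \<in> U. f x \<in> V} \<inter> {x \<in> U. g x \<in> T} = ?S" by auto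
 ultimately have "openin (mtop M) ?S" by simp
 then have S: "openin (topol (model M)) (\<phi> ` ?S)" by (rule M.chart_sub_image_open[OF c]) auto
 have "smooth_fun (model M) (model N) (\<phi> ` ?S) (\<lambda>y. \<psi> (f (inv_into U \<phi> y)))"
 proof
  show "smooth_on (model M) (model N) (\<phi> ` ?S) (\<lambda>y. \<psi> (f (inv_into U \<phi> y)))"
   by (rule smooth_on_subset_cong[OF M.rlc_axioms N.rlc_axioms f.smooth S _ refl]) auto
 qed (rule S)
 moreover have "smooth_fun (model M) (model P) (\<phi> ` ?S) (\<lambda>y. \<kappa> (g (inv_into U \<phi> y)))"
 proof
  show "smooth_on (model M) (model P) (\<phi> ` ?S) (\<lambda>y. \<kappa> (g (inv_into U \<phi> y)))"
   by (rule smooth_on_subset_cong[OF M.rlc_axioms P.rlc_axioms g.smooth S _ refl]) auto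
 qed (rule S)
 ultimately have "smooth_on (model M) (prod_space (model N) (model P)) (\<phi> ` ?S)
   (\<lambda>y. (\<psi> (f (inv_into U \<phi> y)), \<kappa> (g (inv_into U \<phi> y))))" by (rule smooth_pair)
 moreover have "{x \<in> U. (f x, g x) \<in> V'} = ?S" using d by auto
 ultimately show "smooth_on (model M) (model (prod_mfd N P)) (\<phi> ` {x \<in> U. (f x, g x) \<in> V'}) (\<psi>' \<circ> (\<lambda>x. (f x, g x)) \<circ> inv_into U \<phi>)"
  by (simp add: prod_mfd_def d(2) o_def)
qed

text \<open>In product charts the second component is a coordinate, hence continuous and linear.\<close>

lemma smooth_map_snd:
 assumes M: "charted M" and N: "charted N" and F: "rlc F"
  and f: "smooth_map M (prod_mfd N (space_mfd F)) f"
 shows "smooth_map M (space_mfd F) (\<lambda>x. snd (f x))"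
proof -
 interpret M: cmfd M using M by (rule cmfd.intro)
 interpret N: cmfd N using N by (rule cmfd.intro)
 interpret F: rlc F by fact
 note Q = charted_prod_mfd[OF N charted_space_mfd[OF F]]
 have P: "rlc (prod_space (model N) F)" using N.rlc_axioms F by (rule rlc_prod_space)
 have fc: "f x \<in> topspace (mtop N) \<times> carrier F" if "x \<in> topspace (mtop M)" for x
  using continuous_map_image_subset_topspace[OF smooth_mapD(1)[OF f]] that
  unfolding prod_mfd_def mfd.simps topspace_prod_topology space_mfd_simps F.topspace_eq by blast
 show ?thesis
 proof (rule smooth_map_spaceI[OF M F])
  fix x assume "x \<in> topspace (mtop M)"
  from fc[OF this] show "snd (f x) \<in> carrier F" unfolding mem_Times_iff by blast
 next
  fix U \<phi> assume c: "(U, \<phi>) \<in> atlas M"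
  show "smooth_on (model M) F (\<phi> ` U) (\<lambda>y. snd (f (inv_into U \<phi> y)))"
  proof (rule smooth_on_local[OF M.rlc_axioms F])
   fix y assume "y \<in> \<phi> ` U"
   then obtain x where x: "x \<in> U" "y = \<phi> x" by auto
   have fx: "fst (f x) \<in> topspace (mtop N)" using fc[OF M.chart_sub[OF c x(1)]] unfolding mem_Times_iff by blast
   obtain V \<psi> where d: "(V, \<psi>) \<in> atlas N" "fst (f x) \<in> V" using N.chart_ex[OF fx] by blast
   have d': "(V \<times> carrier F, map_prod \<psi> (\<lambda>x. x)) \<in> atlas (prod_mfd N (space_mfd F))"
    using d(1) by (auto simp: prod_mfd_def)
   let ?S = "{x \<in> U. f x \<in> V \<times> carrier F}"
   have xS: "x \<in> ?S" using fc[OF M.chart_sub[OF c x(1)]] x(1) d(2) unfolding mem_Times_iff mem_Collect_eq by blast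
   interpret f: smooth_fun "model M" "prod_space (model N) F" "\<phi> ` ?S" "\<lambda>y. map_prod \<psi> (\<lambda>x. x) (f (inv_into U \<phi> y))"
    using smooth_map_chart(1)[OF M Q f c d'] by (simp add: prod_mfd_def)
   have L: "lin_map (prod_space (model N) F) F snd"
    by (auto simp: lin_map_def)
   have "smooth_on (model M) F (\<phi> ` ?S) (\<lambda>y. snd (map_prod \<psi> (\<lambda>x. x) (f (inv_into U \<phi> y))))"
    by (rule f.smooth_lin(1)[OF F L]) (simp add: continuous_map_snd)
   then have "smooth_on (model M) F (\<phi> ` ?S) (\<lambda>y. snd (f (inv_into U \<phi> y)))" by simp
   moreover have "?S \<subseteq> U" by blast
   ultimately show "\<exists>W'. openin (topol (model M)) W' \<and> y \<in> W' \<and> W' \<subseteq> \<phi> ` U \<and>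
     smooth_on (model M) F W' (\<lambda>y. snd (f (inv_into U \<phi> y)))"
    using f.W xS x(2) by (intro exI[of _ "\<phi> ` ?S"]) (simp only: image_mono imageI simp_thms)
  qed
 qed
qed

text \<open>A chart, read in another chart, is a chart change.\<close>

lemma smooth_map_chart_map:
 assumes M: "smooth_manifold M" and c: "(U, \<phi>) \<in> atlas M"
 shows "smooth_map (open_submfd M U) (space_mfd (model M)) \<phi>"
proof -
 note ch = charted_smooth_manifold[OF M]
 interpret M: cmfd M using ch by (rule cmfd.intro)
 show ?thesis
 proof (rule smooth_map_spaceI[OF charted_open_submfd[OF ch M.chart_open[OF c]] M.rlc_axioms])
  fix x assume "x \<in> topspace (mtop (open_submfd M U))"
  then show "\<phi> x \<in> carrier (model M)"
   using openin_subset[OF M.chart_image_open[OF c]] by auto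
 next
  fix V' \<psi> assume "(V', \<psi>) \<in> atlas (open_submfd M U)"
  then obtain V where d: "V' = V \<inter> U" "(V, \<psi>) \<in> atlas M" by auto
  have "openin (mtop M) (V \<inter> U)" using M.chart_open[OF c] M.chart_open[OF d(2)] by blast
  then have o: "openin (topol (model M)) (\<psi> ` (V \<inter> U))" by (rule M.chart_sub_image_open[OF d(2)]) blast
  have "smooth_on (model M) (model M) (\<psi> ` (V \<inter> U)) (\<phi> \<circ> inv_into V \<psi>)"
   using M c d(2) unfolding smooth_manifold_def by (elim conjE) (drule (1) bspec, drule (1) bspec, fastforce)
  then have "smooth_on (model M) (model M) (\<psi> ` (V \<inter> U)) (\<lambda>y. \<phi> (inv_into (V \<inter> U) \<psi> y))"
   by (rule smooth_on_subset_cong[OF M.rlc_axioms M.rlc_axioms _ o order_refl])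
    (auto simp: M.chart_inverse[OF d(2)] inj_on_subset[OF M.chart_inj[OF d(2)]])
  then show "smooth_on (model (open_submfd M U)) (model M) (\<psi> ` V') (\<lambda>y. \<phi> (inv_into V' \<psi> y))"
   by (simp add: d(1))
 qed
qed

section \<open>Algebras of functions with pointwise operations\<close>

text \<open>The algebra may vary with the point, so that sections of algebra bundles are covered.\<close>

lemma complex_algebra_pointwise:
 fixes A :: "(complex, 'p => 'e) tmodule" and F :: "'p => (complex, 'e, 'm) module_scheme"
 assumes F: "\<And>x. x \<in> S ==> complex_algebra (F x)"
  and ext: "\<And>f. f \<in> carrier A ==> f \<in> extensional S"
  and val: "\<And>f x. f \<in> carrier A ==> x \<in> S ==> f x \<in> carrier (F x)"
  and add: "\<And>f g. f \<oplus>\<^sub>A g = (\<lambda>x\<in>S. f x \<oplus>\<^bsub>F x\<^esub> g x)"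
  and mult: "\<And>f g. f \<otimes>\<^sub>A g = (\<lambda>x\<in>S. f x \<otimes>\<^bsub>F x\<^esub> g x)"
  and smult: "\<And>c f. c \<odot>\<^sub>A f = (\<lambda>x\<in>S. c \<odot>\<^bsub>F x\<^esub> f x)"
  and zero: "\<zero>\<^sub>A = (\<lambda>x\<in>S. \<zero>\<^bsub>F x\<^esub>)" and one: "\<one>\<^sub>A = (\<lambda>x\<in>S. \<one>\<^bsub>F x\<^esub>)"
  and closed: "\<zero>\<^sub>A \<in> carrier A" "\<one>\<^sub>A \<in> carrier A"
   "\<And>f g. f \<in> carrier A ==> g \<in> carrier A ==> f \<oplus>\<^sub>A g \<in> carrier A"
   "\<And>f g. f \<in> carrier A ==> g \<in> carrier A ==> f \<otimes>\<^sub>A g \<in> carrier A"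
   "\<And>c f. f \<in> carrier A ==> c \<odot>\<^sub>A f \<in> carrier A"
 shows "complex_algebra A"
proof -
 have calg: "calg (F x)" if "x \<in> S" for x using F[OF that] by (rule calg.intro)
 then have ring: "ring (F x)" if "x \<in> S" for x using that unfolding calg_def complex_algebra_def by blast
 then have mon: "Group.monoid (F x)" if "x \<in> S" for x using that unfolding ring_def by blast
 note rules = ring.ring_simprules[OF ring] monoid.r_one[OF mon] calg.csmul_add_left[OF calg] calg.csmul_add_right[OF calg] calg.csmul_csmul[OF calg]
  calg.csmul_one[OF calg] calg.csmul_mult_left[OF calg] calg.csmul_mult_right[OF calg] calg.csmul_neg_one[OF calg]
  calg.csmul_closed[OF calg]
 have eqI: "f = g" if "f \<in> extensional S" "g \<in> extensional S" "\<And>x. x \<in> S ==> f x = g x" for f g :: "'p => 'e"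
  using extensionalityI that by blast
 note ops = add mult smult zero one
 have ag: "abelian_group A"
 proof (rule abelian_groupI)
  fix f assume f: "f \<in> carrier A"
  have "((-1) \<odot>\<^sub>A f) \<oplus>\<^sub>A f = \<zero>\<^sub>A" by (rule eqI) (simp_all add: ops rules val f)
  then show "\<exists>g\<in>carrier A. g \<oplus>\<^sub>A f = \<zero>\<^sub>A" using closed(5)[OF f] by blast
 qed (auto intro!: eqI simp: ops rules val ext closed[unfolded ops])
 have ring: "ring A"
  by (intro ringI[OF ag] monoidI; (rule closed; assumption)?; (rule eqI)?; simp add: ops rules val ext)
 have mod: "Module.module (scalars :: (complex, complex) tmodule) A"
  by (intro moduleI cring_scalars ag; simp add: closed(5); (rule eqI)?; simp add: ops rules val ext)
 have "(c \<odot>\<^sub>A f) \<otimes>\<^sub>A g = c \<odot>\<^sub>A (f \<otimes>\<^sub>A g) \<and> f \<otimes>\<^sub>A (c \<odot>\<^sub>A g) = c \<odot>\<^sub>A (f \<otimes>\<^sub>A g)"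
  if "f \<in> carrier A" "g \<in> carrier A" for c f g
  by (intro conjI eqI) (simp_all add: ops rules val that)
 then show ?thesis using mod ring by (simp add: complex_algebra_def)
qed

section \<open>Multiplication in locally convex algebras\<close>

locale lcalg = fixes B :: "(complex, 'b) tmodule" (structure)
 assumes lca: "lc_algebra B"
begin

sublocale calg B by (rule calg.intro) (use lca in \<open>simp add: lc_algebra_def\<close>)

sublocale R: rlc "realify B" by (rule rlc_realify[OF lca])

lemma cont_mult: "continuous_map (prod_topology (topol B) (topol B)) (topol B) (\<lambda>(x, y). x \<otimes> y)"
 using lca by (simp add: lc_algebra_def)

lemma cont_csmul: "continuous_map (prod_topology euclidean (topol B)) (topol B) (\<lambda>(c, x). c \<odot> x)"
 using lca by (simp add: lc_algebra_def lc_space_def)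

lemma topspace_B: "topspace (topol B) = carrier B"
 using R.topspace_eq by simp

lemma continuous_csmul_const: "continuous_map (topol B) (topol B) (\<lambda>x. c \<odot> x)"
proof -
 have "continuous_map (topol B) (prod_topology euclidean (topol B)) (\<lambda>x. (c, x))"
  by (simp add: continuous_map_pairwise o_def)
 from continuous_map_compose[OF this cont_csmul] show ?thesis by (simp add: o_def)
qed

lemma lin_map_csmul: "lin_map (realify B) (realify B) (\<lambda>x. c \<odot> x)"
 by (auto simp: lin_map_def csmul_add_right csmul_csmul mult.commute)

lemma bilin_mult: "bilin (realify B) (realify B) (realify B) (\<otimes>)"
 using cont_mult
 by (auto simp: bilin_def lin_map_def r_distr l_distr csmul_mult_left csmul_mult_right)

text \<open>Continuity of the multiplication at zero, rescaled.\<close>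

lemma mult_cseminorm:
 assumes p: "cseminorm (realify B) p"
 shows "\<exists>q. cseminorm (realify B) q \<and> (\<forall>x\<in>carrier B. \<forall>y\<in>carrier B. p (x \<otimes> y) \<le> q x * q y)"
proof -
 have ps: "seminorm (realify B) p" using p by (simp add: cseminorm_def)
 let ?W = "{x \<in> carrier B. p x < 1}"
 have "openin (topol B) ?W"
  using R.cseminorm_ball_open[OF p, of \<zero> 1] by (simp add: a_minus_def cong: conj_cong)
 then have "openin (prod_topology (topol B) (topol B))
   {z \<in> topspace (prod_topology (topol B) (topol B)). (case z of (x, y) => x \<otimes> y) \<in> ?W}"
  by (rule openin_continuous_map_preimage[OF cont_mult])
 moreover have "(\<zero>, \<zero>) \<in> {z \<in> topspace (prod_topology (topol B) (topol B)). (case z of (x, y) => x \<otimes> y) \<in> ?W}"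
  using R.seminorm_zero[OF ps] by (simp add: topspace_B)
 ultimately obtain S T where ST: "openin (topol B) S" "openin (topol B) T" "\<zero> \<in> S" "\<zero> \<in> T"
  "S \<times> T \<subseteq> {z \<in> topspace (prod_topology (topol B) (topol B)). (case z of (x, y) => x \<otimes> y) \<in> ?W}"
  unfolding openin_prod_topology_alt by meson
 obtain q1 where q1: "cseminorm (realify B) q1" "\<forall>x\<in>carrier B. q1 x < 1 --> x \<in> S"
  using R.ex_cseminorm_zero[of S] ST by auto
 obtain q2 where q2: "cseminorm (realify B) q2" "\<forall>x\<in>carrier B. q2 x < 1 --> x \<in> T"
  using R.ex_cseminorm_zero[of T] ST by auto
 define q where "q x = (\<Sum>b\<in>(UNIV::bool set). (if b then q1 else q2) x)" for x
 have q: "cseminorm (realify B) q"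
  unfolding q_def by (rule R.cseminorm_sum) (use q1(1) q2(1) in \<open>auto split: if_split\<close>)
 have qs: "seminorm (realify B) q" and q1s: "seminorm (realify B) q1" and q2s: "seminorm (realify B) q2"
  using q q1(1) q2(1) by (auto simp: cseminorm_def)
 have le: "q1 x \<le> q x" "q2 x \<le> q x" if "x \<in> carrier B" for x
  using R.seminorm_nonneg[OF q1s, of x] R.seminorm_nonneg[OF q2s, of x] that by (auto simp: q_def UNIV_bool)
 have small: "p (x \<otimes> y) < 1" if "x \<in> carrier B" "y \<in> carrier B" "q x < 1" "q y < 1" for x y
 proof -
  have "x \<in> S" "y \<in> T" using q1(2) q2(2) le that by fastforce+
  then have "(x, y) \<in> S \<times> T" by (rule SigmaI)
  from subsetD[OF ST(5) this] show ?thesis by simp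
 qed
 have "p (x \<otimes> y) \<le> q x * q y" if xy: "x \<in> carrier B" "y \<in> carrier B" for x y
 proof -
  have strict: "p (x \<otimes> y) \<le> s * t" if st: "q x < s" "q y < t" for s t
  proof -
   have pos: "s > 0" "t > 0" using st R.seminorm_nonneg[OF qs, of x] R.seminorm_nonneg[OF qs, of y] xy by auto
   let ?x = "complex_of_real (inverse s) \<odot> x" and ?y = "complex_of_real (inverse t) \<odot> y"
   have qe: "q ?x = inverse s * q x" "q ?y = inverse t * q y"
    using R.seminorm_smul[OF qs, of x "inverse s"] R.seminorm_smul[OF qs, of y "inverse t"] xy pos by simp_all
   have "inverse s * q x < 1" "inverse t * q y < 1" using st pos by (simp_all add: field_simps)
   then have "q ?x < 1" "q ?y < 1" by (simp_all only: qe)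
   then have "p (?x \<otimes> ?y) < 1" using xy by (intro small) auto
   moreover have "?x \<otimes> ?y = complex_of_real (inverse s * inverse t) \<odot> (x \<otimes> y)"
    using xy by (simp add: csmul_mult_left csmul_mult_right csmul_csmul mult.commute)
   moreover have "p (complex_of_real (inverse s * inverse t) \<odot> (x \<otimes> y)) = inverse s * inverse t * p (x \<otimes> y)"
    using R.seminorm_smul[OF ps, of "x \<otimes> y" "inverse s * inverse t"] xy pos by simp
   ultimately have "inverse s * inverse t * p (x \<otimes> y) < 1" by simp
   then show ?thesis using pos by (simp add: field_simps)
  qed
  have lim: "((\<lambda>e. (q x + e) * (q y + e)) \<longlongrightarrow> (q x + 0) * (q y + 0)) (at_right 0)"
   by (intro tendsto_intros)
  have "p (x \<otimes> y) \<le> (q x + 0) * (q y + 0)"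
  proof (rule tendsto_lowerbound[OF lim])
   show "\<forall>\<^sub>F e in at_right 0. p (x \<otimes> y) \<le> (q x + e) * (q y + e)"
    using eventually_at_right_less[of "0::real"] by eventually_elim (rule strict, auto)
  qed simp
  then show ?thesis by simp
 qed
 then show ?thesis using q by blast
qed

lemma nonzero_cseminorm:
 assumes "v \<in> carrier B" "v \<noteq> \<zero>"
 shows "\<exists>p. cseminorm (realify B) p \<and> p v \<noteq> 0"
proof -
 have "openin (topol B) (carrier B - {v})"
  using Hausdorff_imp_t1_space[OF R.Hausdorff] assms(1) topspace_B
  by (metis closedin_t1_singleton openin_diff openin_topspace realify_simps(7))
 then obtain p where "cseminorm (realify B) p" "\<forall>x\<in>carrier B. p x < 1 --> x \<in> carrier B - {v}"
  using R.ex_cseminorm_zero[of "carrier B - {v}"] assms by auto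
 then show ?thesis using assms(1) by (intro exI[of _ p]) force
qed

end

lemma smooth_add:
 assumes f: "smooth_fun E F W f" and g: "smooth_fun E F W g"
 shows "smooth_on E F W (\<lambda>x. f x \<oplus>\<^sub>F g x)"
  and "\<And>h k x. h \<in> {..<k} \<rightarrow> carrier E ==> x \<in> W ==>
   iter_deriv E F (\<lambda>x. f x \<oplus>\<^sub>F g x) k h x = iter_deriv E F f k h x \<oplus>\<^sub>F iter_deriv E F g k h x"
proof -
 interpret f: smooth_fun E F W f by fact
 interpret g: smooth_fun E F W g by fact
 have loc: "f.D k h x \<oplus>\<^sub>F g.D k h x = f.D k h' x \<oplus>\<^sub>F g.D k h' x" if "\<And>j. j < k ==> h j = h' j" for k h h' x
 proof -
  have "f.D k h = f.D k h'" "g.D k h = g.D k h'" by (rule iter_deriv_cong_h, erule that)+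
  then show ?thesis by simp
 qed
 have cont: "continuous_map (jet_topology E W k) (topol F) (\<lambda>(x, h). f.D k h x \<oplus>\<^sub>F g.D k h x)" for k
  using f.F.continuous_add[OF f.D_cont[of k] g.D_cont[of k]] by (simp add: case_prod_unfold)
 have der: "has_dir_deriv E F (\<lambda>y. f.D k h y \<oplus>\<^sub>F g.D k h y) x (h k) (f.D (Suc k) h x \<oplus>\<^sub>F g.D (Suc k) h x)"
  if x: "x \<in> W" and h: "h \<in> {..k} \<rightarrow> carrier E" for k x h
 proof -
  have hk: "h k \<in> carrier E" "h \<in> {..<k} \<rightarrow> carrier E" using h by auto
  note eq = has_dir_deriv_curve[OF f.E.rlc_axioms f.F.rlc_axioms f.W x hk(1)]
  have "curve_deriv F (\<lambda>t. f.D k h (x \<oplus>\<^sub>E t \<odot>\<^sub>E h k)) (f.D (Suc k) h x)"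
   using f.D_deriv[OF x h] by (subst eq[symmetric]) (auto intro: f.D_closed[OF _ hk(2)])
  moreover have "curve_deriv F (\<lambda>t. g.D k h (x \<oplus>\<^sub>E t \<odot>\<^sub>E h k)) (g.D (Suc k) h x)"
   using g.D_deriv[OF x h] by (subst eq[symmetric]) (auto intro: g.D_closed[OF _ hk(2)])
  ultimately show ?thesis
   by (subst eq) (auto intro: f.F.curve_add f.F.a_closed f.D_closed[OF _ hk(2)] g.D_closed[OF _ hk(2)])
 qed
 show "smooth_on E F W (\<lambda>x. f x \<oplus>\<^sub>F g x)"
  by (rule smooth_sequence(1)[OF f.E.rlc_axioms f.F.rlc_axioms f.W loc cont der]) simp_all
 show "iter_deriv E F (\<lambda>x. f x \<oplus>\<^sub>F g x) k h x = f.D k h x \<oplus>\<^sub>F g.D k h x"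
  if "h \<in> {..<k} \<rightarrow> carrier E" "x \<in> W" for h k x
  by (rule smooth_sequence(2)[OF f.E.rlc_axioms f.F.rlc_axioms f.W loc cont der _ that]) simp_all
qed

lemma smooth_map_add:
 assumes M: "charted M" and F: "rlc F" and f: "smooth_map M (space_mfd F) f" and g: "smooth_map M (space_mfd F) g"
 shows "smooth_map M (space_mfd F) (\<lambda>x. f x \<oplus>\<^sub>F g x)"
proof (rule smooth_map_spaceI[OF M F])
 interpret F: rlc F by fact
 show "f x \<oplus>\<^sub>F g x \<in> carrier F" if "x \<in> topspace (mtop M)" for x
  using smooth_map_spaceD(1)[OF M F f that] smooth_map_spaceD(1)[OF M F g that] by simp
 show "smooth_on (model M) F (\<phi> ` U) (\<lambda>y. f (inv_into U \<phi> y) \<oplus>\<^sub>F g (inv_into U \<phi> y))" if "(U, \<phi>) \<in> atlas M" for U \<phi>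
  by (rule smooth_add(1)[OF smooth_map_spaceD(2)[OF M F f that] smooth_map_spaceD(2)[OF M F g that]])
qed

section \<open>The algebra of smooth functions is locally convex\<close>

type_synonym ('p, 'v, 'b) jet_index = "('p set \<times> ('p => 'v)) \<times> nat \<times> ('v \<times> (nat => 'v)) set \<times> ('b => real)"

locale smooth_functions = N: cmfd N + B: lcalg B
 for N :: "('p, 'v) mfd" and B :: "(complex, 'b) tmodule"
begin

abbreviation C where "C \<equiv> Cinf N B"
abbreviation E where "E \<equiv> model N"
abbreviation F where "F \<equiv> realify B"

lemma Cinf_simps:
 "carrier C = Cinf_carrier N B" "topol C = Cinf_topology N B"
 "f \<oplus>\<^sub>C g = (\<lambda>x\<in>topspace (mtop N). f x \<oplus>\<^sub>B g x)"
 "f \<otimes>\<^sub>C g = (\<lambda>x\<in>topspace (mtop N). f x \<otimes>\<^sub>B g x)"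
 "c \<odot>\<^sub>C f = (\<lambda>x\<in>topspace (mtop N). c \<odot>\<^sub>B f x)"
 "\<zero>\<^sub>C = (\<lambda>x\<in>topspace (mtop N). \<zero>\<^sub>B)" "\<one>\<^sub>C = (\<lambda>x\<in>topspace (mtop N). \<one>\<^sub>B)"
 by (simp_all add: Cinf_def)

lemma in_C: "f \<in> carrier C \<longleftrightarrow> f \<in> extensional (topspace (mtop N)) \<and> smooth_map N (space_mfd F) f"
 by (simp add: Cinf_def Cinf_carrier_def)

lemma restrict_in_C: "smooth_map N (space_mfd F) f ==> restrict f (topspace (mtop N)) \<in> carrier C"
 using smooth_map_cong[OF N.charted charted_space_mfd[OF B.R.rlc_axioms], of f "restrict f (topspace (mtop N))"]
 by (simp add: in_C)

lemma C_val: "f \<in> carrier C ==> x \<in> topspace (mtop N) ==> f x \<in> carrier B"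
 using smooth_map_spaceD(1)[OF N.charted B.R.rlc_axioms] by (simp add: in_C)

lemma C_closed:
 shows "\<zero>\<^sub>C \<in> carrier C" "\<one>\<^sub>C \<in> carrier C"
  "f \<in> carrier C ==> g \<in> carrier C ==> f \<oplus>\<^sub>C g \<in> carrier C"
  "f \<in> carrier C ==> g \<in> carrier C ==> f \<otimes>\<^sub>C g \<in> carrier C"
  "f \<in> carrier C ==> c \<odot>\<^sub>C f \<in> carrier C"
proof -
 note F = B.R.rlc_axioms and ch = N.charted
 have const: "restrict (\<lambda>x. b) (topspace (mtop N)) \<in> carrier C" if "b \<in> carrier B" for b
  by (rule restrict_in_C) (rule smooth_map_const[OF ch F], simp add: that)
 show "\<zero>\<^sub>C \<in> carrier C" "\<one>\<^sub>C \<in> carrier C" unfolding Cinf_simps(6,7) by (rule const, simp)+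
 show "f \<oplus>\<^sub>C g \<in> carrier C" if "f \<in> carrier C" "g \<in> carrier C"
  unfolding Cinf_simps(3) using smooth_map_add[OF ch F, of f g] that by (intro restrict_in_C) (simp add: in_C)
 show "f \<otimes>\<^sub>C g \<in> carrier C" if "f \<in> carrier C" "g \<in> carrier C"
  unfolding Cinf_simps(4) using smooth_map_bilin[OF ch F F F _ _ B.bilin_mult, of f g] that
  by (intro restrict_in_C) (simp add: in_C)
 show "c \<odot>\<^sub>C f \<in> carrier C" if "f \<in> carrier C"
  unfolding Cinf_simps(5) using smooth_map_lin[OF ch F F _ B.lin_map_csmul, of f c] that B.continuous_csmul_const
  by (intro restrict_in_C) (simp add: in_C)
qed

lemma C_alg: "complex_algebra C"
 by (rule complex_algebra_pointwise[where S = "topspace (mtop N)" and F = "\<lambda>_. B"])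
  (use B.alg C_val C_closed in \<open>auto simp: Cinf_simps(3-7) in_C\<close>)

sublocale C: calg C using C_alg by (rule calg.intro)

sublocale CR: rmod "realify C" using C_alg by (rule rmod_realify)

text \<open>A point and directions form a single argument, a jet, as required by the compact open
  topology.\<close>

definition dd :: "'p set \<times> ('p => 'v) => nat => ('p => 'b) => 'v \<times> (nat => 'v) => 'b" where
 "dd c k f z = iter_deriv E F (\<lambda>y. f (inv_into (fst c) (snd c) y)) k (snd z) (fst z)"

abbreviation J where "J c k \<equiv> jet_topology E (snd c ` fst c) k"

lemma local_smooth: "f \<in> carrier C ==> c \<in> atlas N ==> smooth_fun E F (snd c ` fst c) (\<lambda>y. f (inv_into (fst c) (snd c) y))"
 using smooth_map_spaceD(2)[OF N.charted B.R.rlc_axioms, of f "fst c" "snd c"] by (simp add: in_C)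

lemma chart_open': "c \<in> atlas N ==> openin (topol E) (snd c ` fst c)"
 using N.chart_image_open[of "fst c" "snd c"] by simp

lemma J_top: "c \<in> atlas N ==> z \<in> topspace (J c k) ==> fst z \<in> snd c ` fst c \<and> snd z \<in> {..<k} \<rightarrow> carrier E"
 using topspace_jet[OF N.rlc_axioms, of "snd c ` fst c" k] openin_subset[OF chart_open'[of c]]
 by (simp add: mem_Times_iff PiE_iff Pi_iff)

lemma inv_in: "c \<in> atlas N ==> y \<in> snd c ` fst c ==> inv_into (fst c) (snd c) y \<in> topspace (mtop N)"
 using N.chart_sub[of "fst c" "snd c"] inv_into_into[of y "snd c" "fst c"] by simp

lemma dd_cont: "f \<in> carrier C ==> c \<in> atlas N ==> continuous_map (J c k) (topol B) (dd c k f)"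
 using smooth_fun.D_cont[OF local_smooth, of f c k] by (simp add: dd_def[abs_def] case_prod_unfold)

lemma dd_closed: "f \<in> carrier C ==> c \<in> atlas N ==> z \<in> topspace (J c k) ==> dd c k f z \<in> carrier B"
 using continuous_map_image_subset_topspace[OF dd_cont, of f c k] B.topspace_B by blast

lemma dd_local:
 assumes "c \<in> atlas N" "z \<in> topspace (J c k)" "\<And>y. y \<in> topspace (mtop N) ==> f y = g y"
 shows "dd c k f z = dd c k g z"
 unfolding dd_def
 by (rule iter_deriv_local[OF N.rlc_axioms chart_open'[OF assms(1)]])
  (use J_top[OF assms(1,2)] assms(3) inv_in[OF assms(1)] in auto)

lemma dd_add:
 assumes f: "f \<in> carrier C" and g: "g \<in> carrier C" and c: "c \<in> atlas N" and z: "z \<in> topspace (J c k)"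
 shows "dd c k (f \<oplus>\<^sub>C g) z = dd c k f z \<oplus>\<^sub>B dd c k g z"
proof -
 have "dd c k (f \<oplus>\<^sub>C g) z = dd c k (\<lambda>x. f x \<oplus>\<^sub>B g x) z"
  by (rule dd_local[OF c z]) (simp add: Cinf_simps)
 also have "\<dots> = dd c k f z \<oplus>\<^sub>B dd c k g z"
  using smooth_add(2)[OF local_smooth[OF f c] local_smooth[OF g c], of "snd z" k "fst z"] J_top[OF c z]
  by (simp add: dd_def)
 finally show ?thesis .
qed

lemma dd_lin:
 assumes f: "f \<in> carrier C" and c: "c \<in> atlas N" and z: "z \<in> topspace (J c k)"
  and L: "lin_map F F L" "continuous_map (topol B) (topol B) L"
 shows "dd c k (\<lambda>x\<in>topspace (mtop N). L (f x)) z = L (dd c k f z)"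
proof -
 have "dd c k (\<lambda>x\<in>topspace (mtop N). L (f x)) z = dd c k (\<lambda>x. L (f x)) z"
  by (rule dd_local[OF c z]) simp
 also have "\<dots> = L (dd c k f z)"
  using smooth_fun.smooth_lin(2)[OF local_smooth[OF f c] B.R.rlc_axioms L(1), of "snd z" k "fst z"] L(2) J_top[OF c z]
  by (simp add: dd_def)
 finally show ?thesis .
qed

lemma dd_smul:
 assumes f: "f \<in> carrier C" and c: "c \<in> atlas N" and z: "z \<in> topspace (J c k)"
 shows "dd c k (a \<odot>\<^sub>C f) z = a \<odot>\<^sub>B dd c k f z"
 unfolding Cinf_simps(5) by (rule dd_lin[OF f c z B.lin_map_csmul B.continuous_csmul_const])

lemma dd_sub:
 assumes f: "f \<in> carrier C" and g: "g \<in> carrier C" and c: "c \<in> atlas N" and z: "z \<in> topspace (J c k)"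
 shows "dd c k (f \<ominus>\<^sub>C g) z = dd c k f z \<ominus>\<^sub>B dd c k g z"
 using dd_add[OF f C_closed(5)[OF g, of "-1"] c z] dd_smul[OF g c z, of "-1"] dd_closed[OF f c z] dd_closed[OF g c z] f g
 by (simp add: C.csub_eq B.csub_eq)

definition reindex :: "nat list => 'v \<times> (nat => 'v) => 'v \<times> (nat => 'v)" where
 "reindex xs z = (fst z, \<lambda>j\<in>{..<length xs}. snd z (xs ! j))"

lemma reindex_cont: "(\<And>j. j \<in> set xs ==> j < k) ==> continuous_map (J c k) (J c (length xs)) (reindex xs)"
 using jet_reindex[of "length xs" "\<lambda>j. xs ! j" k E "snd c ` fst c"] by (simp add: reindex_def[abs_def] case_prod_unfold)

lemma dd_mult:
 assumes f: "f \<in> carrier C" and g: "g \<in> carrier C" and c: "c \<in> atlas N" and z: "z \<in> topspace (J c k)"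
 shows "dd c k (f \<otimes>\<^sub>C g) z = lsum F (map (\<lambda>(xs, ys).
   dd c (length xs) f (reindex xs z) \<otimes>\<^sub>B dd c (length ys) g (reindex ys z)) (leibniz_terms k))"
proof -
 have *: "iter_deriv E F u (length xs) (\<lambda>j. snd z (xs ! j)) (fst z)
   = iter_deriv E F u (length xs) (snd (reindex xs z)) (fst (reindex xs z))" for u and xs :: "nat list"
  unfolding reindex_def fst_conv snd_conv by (rule fun_cong[OF iter_deriv_cong_h]) simp
 have "dd c k (f \<otimes>\<^sub>C g) z = dd c k (\<lambda>x. f x \<otimes>\<^sub>B g x) z"
  by (rule dd_local[OF c z]) (simp add: Cinf_simps)
 also have "\<dots> = lsum F (map (\<lambda>(xs, ys).
   dd c (length xs) f (reindex xs z) \<otimes>\<^sub>B dd c (length ys) g (reindex ys z)) (leibniz_terms k))"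
  using smooth_bilin(2)[OF local_smooth[OF f c] local_smooth[OF g c] B.R.rlc_axioms B.bilin_mult, of "snd z" k "fst z"] J_top[OF c z]
  unfolding dd_def * by simp
 finally show ?thesis .
qed

text \<open>The seminorms that define the topology are suprema of derivatives over compact sets of jets.
  Zero is inserted because of the empty compact set.\<close>

definition jet_idx :: "('p, 'v, 'b) jet_index set" where
 "jet_idx = {(c, k, K, p). c \<in> atlas N \<and> compactin (J c k) K \<and> cseminorm F p}"

definition jet_sup :: "('p, 'v, 'b) jet_index => ('p => 'b) => real" where
 "jet_sup i f = (case i of (c, k, K, p) => Sup (insert 0 ((\<lambda>z. p (dd c k f z)) ` K)))"

lemma jet_bdd:
 assumes f: "f \<in> carrier C" and i: "(c, k, K, p) \<in> jet_idx"
 shows "bdd_above (insert 0 ((\<lambda>z. p (dd c k f z)) ` K))"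
proof -
 have c: "c \<in> atlas N" and K: "compactin (J c k) K" and p: "cseminorm F p" using i by (auto simp: jet_idx_def)
 have "continuous_map (J c k) euclideanreal (\<lambda>z. p (dd c k f z))"
  using continuous_map_compose[OF dd_cont[OF f c], of euclideanreal p] p by (simp add: o_def cseminorm_def)
 from image_compactin[OF K this] have "compact ((\<lambda>z. p (dd c k f z)) ` K)" by simp
 then show ?thesis using bounded_imp_bdd_above[OF compact_imp_bounded] by simp
qed

lemma jet_sup_ge:
 assumes "f \<in> carrier C" "(c, k, K, p) \<in> jet_idx" "z \<in> K"
 shows "p (dd c k f z) \<le> jet_sup (c, k, K, p) f"
 unfolding jet_sup_def prod.case by (rule cSup_upper[OF _ jet_bdd[OF assms(1,2)]]) (use assms(3) in blast)

lemma jet_sup_le: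
 assumes "0 \<le> a" "\<And>z. z \<in> K ==> p (dd c k f z) \<le> a"
 shows "jet_sup (c, k, K, p) f \<le> a"
 unfolding jet_sup_def prod.case by (rule cSup_least) (use assms in auto)

lemma jet_sup_nonneg:
 assumes "f \<in> carrier C" "(c, k, K, p) \<in> jet_idx"
 shows "0 \<le> jet_sup (c, k, K, p) f"
 unfolding jet_sup_def prod.case by (rule cSup_upper[OF _ jet_bdd[OF assms]]) simp

lemma jet_K: "(c, k, K, p) \<in> jet_idx ==> z \<in> K ==> z \<in> topspace (J c k)"
 using compactin_subset_topspace by (fastforce simp: jet_idx_def)

lemma jet_seminorm:
 assumes i: "(c, k, K, p) \<in> jet_idx"
 shows "seminorm (realify C) (jet_sup (c, k, K, p))"
proof -
 have c: "c \<in> atlas N" and p: "cseminorm F p" using i by (auto simp: jet_idx_def)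
 have ps: "seminorm F p" using p by (simp add: cseminorm_def)
 have smul_le: "jet_sup (c, k, K, p) (complex_of_real r \<odot>\<^sub>C f) \<le> \<bar>r\<bar> * jet_sup (c, k, K, p) f"
  if f: "f \<in> carrier C" for r f
 proof (rule jet_sup_le)
  show "0 \<le> \<bar>r\<bar> * jet_sup (c, k, K, p) f" using jet_sup_nonneg[OF f i] by simp
  fix z assume z: "z \<in> K"
  have "p (dd c k (complex_of_real r \<odot>\<^sub>C f) z) = \<bar>r\<bar> * p (dd c k f z)"
   using dd_smul[OF f c jet_K[OF i z]] B.R.seminorm_smul[OF ps, of "dd c k f z" r] dd_closed[OF f c jet_K[OF i z]] by simp
  also have "\<dots> \<le> \<bar>r\<bar> * jet_sup (c, k, K, p) f" by (rule mult_left_mono[OF jet_sup_ge[OF f i z]]) simp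
  finally show "p (dd c k (complex_of_real r \<odot>\<^sub>C f) z) \<le> \<bar>r\<bar> * jet_sup (c, k, K, p) f" .
 qed
 show ?thesis unfolding seminorm_def
 proof (intro conjI ballI allI)
  fix f g assume "f \<in> carrier (realify C)" "g \<in> carrier (realify C)"
  then have f: "f \<in> carrier C" and g: "g \<in> carrier C" by auto
  have "jet_sup (c, k, K, p) (f \<oplus>\<^sub>C g) \<le> jet_sup (c, k, K, p) f + jet_sup (c, k, K, p) g"
  proof (rule jet_sup_le)
   show "0 \<le> jet_sup (c, k, K, p) f + jet_sup (c, k, K, p) g" using jet_sup_nonneg[OF f i] jet_sup_nonneg[OF g i] by simp
   fix z assume z: "z \<in> K"
   note zt = jet_K[OF i z]
   have "p (dd c k (f \<oplus>\<^sub>C g) z) \<le> p (dd c k f z) + p (dd c k g z)"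
    using B.R.seminorm_add[OF ps, of "dd c k f z" "dd c k g z"] dd_add[OF f g c zt] dd_closed[OF f c zt] dd_closed[OF g c zt] by simp
   also have "\<dots> \<le> jet_sup (c, k, K, p) f + jet_sup (c, k, K, p) g"
    by (rule add_mono[OF jet_sup_ge[OF f i z] jet_sup_ge[OF g i z]])
   finally show "p (dd c k (f \<oplus>\<^sub>C g) z) \<le> jet_sup (c, k, K, p) f + jet_sup (c, k, K, p) g" .
  qed
  then show "jet_sup (c, k, K, p) (f \<oplus>\<^bsub>realify C\<^esub> g) \<le> jet_sup (c, k, K, p) f + jet_sup (c, k, K, p) g" by simp
 next
  fix r f assume "f \<in> carrier (realify C)"
  then have f: "f \<in> carrier C" by simp
  have "jet_sup (c, k, K, p) (complex_of_real r \<odot>\<^sub>C f) = \<bar>r\<bar> * jet_sup (c, k, K, p) f"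
  proof (cases "r = 0")
   case True
   have "jet_sup (c, k, K, p) (complex_of_real r \<odot>\<^sub>C f) \<le> 0" using smul_le[OF f, of r] True by simp
   moreover have "0 \<le> jet_sup (c, k, K, p) (complex_of_real r \<odot>\<^sub>C f)" by (rule jet_sup_nonneg[OF C_closed(5)[OF f] i])
   ultimately show ?thesis using True by simp
  next
   case False
   have "f = complex_of_real (inverse r) \<odot>\<^sub>C (complex_of_real r \<odot>\<^sub>C f)"
    using f False by (simp add: C.csmul_csmul)
   then have "jet_sup (c, k, K, p) f \<le> \<bar>inverse r\<bar> * jet_sup (c, k, K, p) (complex_of_real r \<odot>\<^sub>C f)"
    using smul_le[OF C_closed(5)[OF f, of "complex_of_real r"], of "inverse r"] by simp
   then have "\<bar>r\<bar> * jet_sup (c, k, K, p) f \<le> \<bar>r\<bar> * (\<bar>inverse r\<bar> * jet_sup (c, k, K, p) (complex_of_real r \<odot>\<^sub>C f))"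
    by (intro mult_left_mono) auto
   also have "\<dots> = jet_sup (c, k, K, p) (complex_of_real r \<odot>\<^sub>C f)" using False by (simp add: abs_inverse)
   finally show ?thesis using smul_le[OF f, of r] by simp
  qed
  then show "jet_sup (c, k, K, p) (r \<odot>\<^bsub>realify C\<^esub> f) = \<bar>r\<bar> * jet_sup (c, k, K, p) f" by simp
 qed
qed

lemma C_topspace: "topspace (topol C) = carrier C"
 unfolding Cinf_simps Cinf_topology_def topology_generated_by_topspace by blast

lemma C_subbasis:
 assumes "c \<in> atlas N" "compactin (J c k) K" "openin (topol B) W"
 shows "openin (topol C) {f \<in> carrier C. \<forall>z\<in>K. dd c k f z \<in> W}"
proof -
 have "{f \<in> Cinf_carrier N B. \<forall>(x, h)\<in>K. iter_deriv E F (f \<circ> inv_into (fst c) (snd c)) k h x \<in> W}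
   = {f \<in> carrier C. \<forall>z\<in>K. dd c k f z \<in> W}"
  by (simp add: Cinf_simps dd_def o_def case_prod_unfold)
 moreover have "openin (topol C) {f \<in> Cinf_carrier N B. \<forall>(x, h)\<in>K. iter_deriv E F (f \<circ> inv_into (fst c) (snd c)) k h x \<in> W}"
  unfolding Cinf_simps(2) Cinf_topology_def
  by (rule topology_generated_by_Basis, rule insertI2, rule CollectI, intro exI[of _ "fst c"] exI[of _ "snd c"] exI[of _ k] exI[of _ K] exI[of _ W])
   (use assms in simp)
 ultimately show ?thesis by simp
qed

text \<open>Finitely many compact pieces, on each of which the derivative of \<open>f0\<close> varies by at most
  \<open>e/8\<close>, cover \<open>K\<close>. The functions whose derivatives stay close to that of \<open>f0\<close> on each piece form a
  basic open set inside the ball.\<close>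

lemma jet_nbhd_seminorm:
 assumes i: "(c, k, K, p) \<in> jet_idx"
 shows "nbhd_seminorm C (jet_sup (c, k, K, p))"
 unfolding nbhd_seminorm_def
proof (intro conjI ballI allI impI jet_seminorm[OF i])
 have c: "c \<in> atlas N" and K: "compactin (J c k) K" and p: "cseminorm F p" using i by (auto simp: jet_idx_def)
 have ps: "seminorm F p" using p by (simp add: cseminorm_def)
 fix f0 and e :: real assume f0: "f0 \<in> carrier C" and e: "e > 0"
 define V where "V z r = {w \<in> carrier B. p (w \<ominus>\<^sub>B dd c k f0 z) < r}" for z r
 have V_open: "openin (topol B) (V z r)" if "z \<in> topspace (J c k)" for z r
  using B.R.cseminorm_ball_open[OF p, of "dd c k f0 z" r] dd_closed[OF f0 c that] by (simp add: V_def)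
 define S where "S z = {z' \<in> topspace (J c k). dd c k f0 z' \<in> V z (e/8)}" for z
 have S_open: "openin (J c k) (S z)" if "z \<in> K" for z
  unfolding S_def by (rule openin_continuous_map_preimage[OF dd_cont[OF f0 c] V_open[OF jet_K[OF i that]]])
 have "K \<subseteq> \<Union> (S ` K)"
 proof
  fix z assume z: "z \<in> K"
  then have "z \<in> S z"
   using jet_K[OF i z] dd_closed[OF f0 c jet_K[OF i z]] e B.R.seminorm_zero[OF ps] B.R.sub_self
   by (simp add: S_def V_def)
  then show "z \<in> \<Union> (S ` K)" using z by blast
 qed
 then obtain Fs where Fs: "finite Fs" "Fs \<subseteq> S ` K" "K \<subseteq> \<Union> Fs"
  using K S_open unfolding compactin_def by (metis (no_types, lifting) imageE)
 obtain Z where Z: "finite Z" "Z \<subseteq> K" "Fs = S ` Z" using finite_subset_image[OF Fs(1,2)] by blast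
 define Kz where "Kz z = K \<inter> {z' \<in> topspace (J c k). dd c k f0 z' \<in> {w \<in> carrier B. p (w \<ominus>\<^sub>B dd c k f0 z) \<le> e/8}}" for z
 have Kz: "compactin (J c k) (Kz z)" if "z \<in> K" for z
 proof -
  have "continuous_map (topol B) euclideanreal (\<lambda>w. p (w \<ominus>\<^sub>B dd c k f0 z))"
   using continuous_map_compose[OF B.R.continuous_translate[of "dd c k f0 z"], of euclideanreal p] p
    dd_closed[OF f0 c jet_K[OF i that]] by (simp add: o_def cseminorm_def)
  from closedin_continuous_map_preimage[OF this, of "{..e/8}"]
  have "closedin (topol B) {w \<in> carrier B. p (w \<ominus>\<^sub>B dd c k f0 z) \<le> e/8}" by (simp add: B.topspace_B)
  from closedin_continuous_map_preimage[OF dd_cont[OF f0 c] this] show ?thesis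
   unfolding Kz_def by (rule compact_Int_closedin[OF K])
 qed
 define T where "T = carrier C \<inter> (\<Inter>z\<in>Z. {f \<in> carrier C. \<forall>z'\<in>Kz z. dd c k f z' \<in> V z (e/4)})"
 have "openin (topol C) ((\<Inter>z\<in>Z. {f \<in> carrier C. \<forall>z'\<in>Kz z. dd c k f z' \<in> V z (e/4)}) \<inter> topspace (topol C))"
  by (rule openin_INT[OF Z(1)]) (use Z(2) in \<open>auto intro!: C_subbasis[OF c] Kz V_open jet_K[OF i]\<close>)
 then have T_open: "openin (topol C) T" by (simp add: T_def C_topspace Int_commute)
 have f0T: "f0 \<in> T" unfolding T_def using f0 e by (force simp: Kz_def V_def)
 have est: "jet_sup (c, k, K, p) (f \<ominus>\<^sub>C f0) < e" if f: "f \<in> T" for f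
 proof -
  have fC: "f \<in> carrier C" using f by (simp add: T_def)
  have "jet_sup (c, k, K, p) (f \<ominus>\<^sub>C f0) \<le> e / 2"
  proof (rule jet_sup_le)
   fix z' assume z': "z' \<in> K"
   note zt = jet_K[OF i z']
   obtain z where z: "z \<in> Z" "z' \<in> S z" using Fs(3) Z(3) z' by blast
   have zK: "z \<in> topspace (J c k)" using z(1) Z(2) jet_K[OF i] by blast
   have near: "p (dd c k f0 z' \<ominus>\<^sub>B dd c k f0 z) < e / 8" "dd c k f0 z' \<in> carrier B"
    using z(2) by (auto simp: S_def V_def)
   have "z' \<in> Kz z" using z' zt near by (simp add: Kz_def)
   then have "dd c k f z' \<in> V z (e/4)" using f z(1) by (simp add: T_def)
   then have far: "p (dd c k f z' \<ominus>\<^sub>B dd c k f0 z) < e / 4" by (simp add: V_def)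
   have "p (dd c k (f \<ominus>\<^sub>C f0) z') = p (dd c k f z' \<ominus>\<^sub>B dd c k f0 z')"
    by (simp add: dd_sub[OF fC f0 c zt])
   also have "\<dots> \<le> p (dd c k f z' \<ominus>\<^sub>B dd c k f0 z) + p (dd c k f0 z \<ominus>\<^sub>B dd c k f0 z')"
    using B.R.seminorm_triangle[OF ps, of "dd c k f z'" "dd c k f0 z" "dd c k f0 z'"]
     dd_closed[OF fC c zt] dd_closed[OF f0 c zt] dd_closed[OF f0 c zK] by simp
   also have "p (dd c k f0 z \<ominus>\<^sub>B dd c k f0 z') = p (dd c k f0 z' \<ominus>\<^sub>B dd c k f0 z)"
    using B.R.seminorm_sub_commute[OF ps, of "dd c k f0 z" "dd c k f0 z'"] dd_closed[OF f0 c zt] dd_closed[OF f0 c zK] by simp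
   finally show "p (dd c k (f \<ominus>\<^sub>C f0) z') \<le> e / 2" using near far e by simp
  qed (use e in simp)
  then show ?thesis using e by simp
 qed
 show "\<exists>T. openin (topol C) T \<and> f0 \<in> T \<and> (\<forall>f\<in>T. jet_sup (c, k, K, p) (f \<ominus>\<^sub>C f0) < e)"
  using T_open f0T est by blast
qed

lemma jet_nbhd_seminorm': "i \<in> jet_idx ==> nbhd_seminorm C (jet_sup i)"
 using jet_nbhd_seminorm by (cases i) simp

definition jet_sum :: "('p, 'v, 'b) jet_index set => ('p => 'b) => real" where
 "jet_sum I f = (\<Sum>i\<in>I. jet_sup i f)"

lemma jet_sup_nonneg': "i \<in> jet_idx ==> f \<in> carrier C ==> 0 \<le> jet_sup i f"
 by (cases i) (simp add: jet_sup_nonneg)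

lemma jet_sum_nbhd_seminorm:
 assumes "finite I" "I \<subseteq> jet_idx" shows "nbhd_seminorm C (jet_sum I)"
proof -
 have "nbhd_seminorm C (jet_sup i)" if "i \<in> I" for i
  using that assms(2) jet_nbhd_seminorm by (cases i) auto
 then show ?thesis unfolding jet_sum_def[abs_def] by (rule nbhd_seminorm_sum[OF C_alg C_topspace assms(1)])
qed

text \<open>A basic open set contains a ball, because the compact set of values of a derivative on \<open>K\<close>
  stays away from the complement of \<open>W\<close> by a fixed amount.\<close>

lemma C_nbhd:
 assumes W: "openin (topol C) W" and f0: "f0 \<in> W"
 shows "\<exists>I. finite I \<and> I \<subseteq> jet_idx \<and> (\<forall>f\<in>carrier C. jet_sum I (f \<ominus>\<^sub>C f0) < 1 --> f \<in> W)"
proof -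
 have "f0 \<in> W ==> \<exists>I. finite I \<and> I \<subseteq> jet_idx \<and> (\<forall>f\<in>carrier C. jet_sum I (f \<ominus>\<^sub>C f0) < 1 --> f \<in> W)"
  using W[unfolded Cinf_simps(2) Cinf_topology_def openin_topology_generated_by_iff]
 proof (induction W rule: generate_topology_on.induct)
  case Empty
  then show ?case by simp
 next
  case (Int a b)
  then obtain I1 I2 where I: "finite I1" "I1 \<subseteq> jet_idx" "\<forall>f\<in>carrier C. jet_sum I1 (f \<ominus>\<^sub>C f0) < 1 --> f \<in> a"
   "finite I2" "I2 \<subseteq> jet_idx" "\<forall>f\<in>carrier C. jet_sum I2 (f \<ominus>\<^sub>C f0) < 1 --> f \<in> b" by auto
  have f0C: "f0 \<in> carrier C" using openin_subset[OF W] f0 C_topspace by blast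
  have le: "jet_sum I' (f \<ominus>\<^sub>C f0) \<le> jet_sum (I1 \<union> I2) (f \<ominus>\<^sub>C f0)"
   if "I' \<subseteq> I1 \<union> I2" "f \<in> carrier C" for I' f
   unfolding jet_sum_def
   by (rule sum_mono2) (use I that f0C in \<open>auto intro!: jet_sup_nonneg'\<close>)
  have "f \<in> a \<inter> b" if f: "f \<in> carrier C" "jet_sum (I1 \<union> I2) (f \<ominus>\<^sub>C f0) < 1" for f
   using le[of I1 f] le[of I2 f] f I(3,6) by fastforce
  then show ?case using I by (intro exI[of _ "I1 \<union> I2"]) blast
 next
  case (UN \<K>)
  then obtain k where k: "k \<in> \<K>" "f0 \<in> k" by blast
  from UN.IH[OF k] show ?case using k(1) by blast
 next
  case (Basis s)
  then consider "s = Cinf_carrier N B"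
   | U \<phi> k K W where "s = {f \<in> Cinf_carrier N B. \<forall>(x, h)\<in>K. iter_deriv E F (f \<circ> inv_into U \<phi>) k h x \<in> W}"
    "(U, \<phi>) \<in> atlas N" "compactin (jet_topology E (\<phi> ` U) k) K" "openin (topol B) W" by blast
  then show ?case
  proof cases
   case 1
   then show ?thesis by (intro exI[of _ "{}"]) (simp add: Cinf_simps)
  next
   case 2
   let ?c = "(U, \<phi>)"
   have s: "s = {f \<in> carrier C. \<forall>z\<in>K. dd ?c k f z \<in> W}"
    by (simp add: 2(1) Cinf_simps dd_def o_def case_prod_unfold)
   then have f0C: "f0 \<in> carrier C" and f0K: "dd ?c k f0 ` K \<subseteq> W" using Basis.prems by auto
   have K: "compactin (J ?c k) K" using 2(3) by simp
   have "compactin (topol F) (dd ?c k f0 ` K)"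
    using image_compactin[OF K dd_cont[OF f0C 2(2)]] by simp
   then obtain p where p: "cseminorm F p"
    "\<forall>x\<in>dd ?c k f0 ` K. \<forall>y\<in>carrier F. p (y \<ominus>\<^sub>F x) < 1 --> y \<in> W"
    using B.R.compact_cseminorm[OF _ _ f0K] 2(4) by auto
   have i: "(?c, k, K, p) \<in> jet_idx" using 2(2) K p(1) by (simp add: jet_idx_def)
   have "f \<in> s" if f: "f \<in> carrier C" "jet_sum {(?c, k, K, p)} (f \<ominus>\<^sub>C f0) < 1" for f
   proof -
    have "dd ?c k f z \<in> W" if z: "z \<in> K" for z
    proof -
     note zt = jet_K[OF i z]
     have "f \<ominus>\<^sub>C f0 \<in> carrier C" using f f0C by simp
     then have "p (dd ?c k (f \<ominus>\<^sub>C f0) z) < 1"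
      using jet_sup_ge[OF _ i z, of "f \<ominus>\<^sub>C f0"] f(2) by (simp add: jet_sum_def)
     then have "p (dd ?c k f z \<ominus>\<^sub>F dd ?c k f0 z) < 1" by (simp add: dd_sub[OF f(1) f0C 2(2) zt])
     then show ?thesis using p(2) z dd_closed[OF f(1) 2(2) zt] by auto
    qed
    then show ?thesis using f(1) s by simp
   qed
   then show ?thesis using i by (intro exI[of _ "{(?c, k, K, p)}"]) auto
  qed
 qed
 then show ?thesis using f0 by blast
qed

lemma nbhd_seminorm_cong:
 assumes "nbhd_seminorm C p" "\<And>f. f \<in> carrier C ==> p f = q f"
 shows "nbhd_seminorm C q"
 unfolding nbhd_seminorm_def
proof (intro conjI ballI allI impI)
 show "seminorm (realify C) q"
  using assms unfolding nbhd_seminorm_def seminorm_def by simp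
 fix x and e :: real assume x: "x \<in> carrier C" and e: "e > 0"
 then obtain T where T: "openin (topol C) T" "x \<in> T" "\<forall>y\<in>T. p (y \<ominus>\<^sub>C x) < e"
  using assms(1) unfolding nbhd_seminorm_def by blast
 have "q (y \<ominus>\<^sub>C x) < e" if "y \<in> T" for y
 proof -
  have "y \<in> carrier C" using openin_subset[OF T(1)] C_topspace that by blast
  then show ?thesis using bspec[OF T(3) that] assms(2)[of "y \<ominus>\<^sub>C x"] x by simp
 qed
 then show "\<exists>T. openin (topol C) T \<and> x \<in> T \<and> (\<forall>y\<in>T. q (y \<ominus>\<^sub>C x) < e)" using T by blast
qed

lemma jet_sup_lin:
 assumes i: "(c, k, K, p) \<in> jet_idx" and L: "lin_map F F L" "continuous_map (topol B) (topol B) L"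
  and f: "f \<in> carrier C"
 shows "jet_sup (c, k, K, p) (\<lambda>x\<in>topspace (mtop N). L (f x)) = jet_sup (c, k, K, \<lambda>v. p (L v)) f"
proof -
 have "(\<lambda>z. p (dd c k (\<lambda>x\<in>topspace (mtop N). L (f x)) z)) ` K = (\<lambda>z. p (L (dd c k f z))) ` K"
  by (rule image_cong[OF refl]) (use i in \<open>simp add: dd_lin[OF f _ jet_K[OF i] L] jet_idx_def\<close>)
 then show ?thesis by (simp add: jet_sup_def)
qed

lemma jet_idx_lin:
 assumes "(c, k, K, p) \<in> jet_idx" "lin_map F F L" "continuous_map (topol B) (topol B) L"
 shows "(c, k, K, \<lambda>v. p (L v)) \<in> jet_idx"
 using assms cseminorm_comp[of F p F L] by (simp add: jet_idx_def)

text \<open>By the Leibniz formula, the derivatives of a product at a jet are sums of products of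
  derivatives of the factors at reindexed jets; reindexing maps compact sets to compact sets.\<close>

lemma jet_sup_mult:
 assumes i: "i \<in> jet_idx"
 shows "\<exists>q. nbhd_seminorm C q \<and> (\<forall>f\<in>carrier C. \<forall>g\<in>carrier C. jet_sup i (f \<otimes>\<^sub>C g) \<le> q f * q g)"
proof -
 obtain c k K p where i': "i = (c, k, K, p)" by (cases i)
 have c: "c \<in> atlas N" and K: "compactin (J c k) K" and p: "cseminorm F p" using i i' by (auto simp: jet_idx_def)
 have ps: "seminorm F p" using p by (simp add: cseminorm_def)
 obtain r where r: "cseminorm F r" "\<And>x y. x \<in> carrier B ==> y \<in> carrier B ==> p (x \<otimes>\<^sub>B y) \<le> r x * r y"
  using B.mult_cseminorm[OF p] by blast
 have rs: "seminorm F r" using r(1) by (simp add: cseminorm_def)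
 define L where "L = leibniz_terms k"
 define ix where "ix xs = (c, length xs, reindex xs ` K, r)" for xs :: "nat list"
 have less: "j < k" if "n < length L" "j \<in> set (fst (L ! n)) \<or> j \<in> set (snd (L ! n))" for n j
  using leibniz_terms_less[of "fst (L ! n)" "snd (L ! n)" k j] that nth_mem[OF that(1)] by (simp add: L_def)
 have ixs: "ix (fst (L ! n)) \<in> jet_idx" "ix (snd (L ! n)) \<in> jet_idx" if "n < length L" for n
  unfolding ix_def jet_idx_def
  using c r(1) image_compactin[OF K reindex_cont] less[OF that] by auto
 define q where "q f = (\<Sum>(n, b)\<in>{..<length L} \<times> (UNIV::bool set). jet_sup (ix (if b then fst (L ! n) else snd (L ! n))) f)" for f
 have q: "nbhd_seminorm C q"
  unfolding q_def case_prod_unfold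
 proof (rule nbhd_seminorm_sum[OF C_alg C_topspace], simp)
  fix nb assume "nb \<in> {..<length L} \<times> (UNIV :: bool set)"
  then have "ix (if snd nb then fst (L ! fst nb) else snd (L ! fst nb)) \<in> jet_idx" using ixs by auto
  then show "nbhd_seminorm C (jet_sup (ix (if snd nb then fst (L ! fst nb) else snd (L ! fst nb))))"
   by (rule jet_nbhd_seminorm')
 qed
 have qn: "(\<Sum>n<length L. jet_sup (ix (fst (L ! n))) f) \<le> q f" "(\<Sum>n<length L. jet_sup (ix (snd (L ! n))) f) \<le> q f"
  if f: "f \<in> carrier C" for f
  unfolding q_def sum.cartesian_product[symmetric] UNIV_bool
  by (auto intro!: sum_mono jet_sup_nonneg'[OF ixs(2) f] jet_sup_nonneg'[OF ixs(1) f])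
 have "jet_sup i (f \<otimes>\<^sub>C g) \<le> q f * q g" if f: "f \<in> carrier C" and g: "g \<in> carrier C" for f g
 proof -
  let ?a = "\<lambda>n. jet_sup (ix (fst (L ! n))) f" and ?b = "\<lambda>n. jet_sup (ix (snd (L ! n))) g"
  have a0: "0 \<le> ?a n" and b0: "0 \<le> ?b n" if "n < length L" for n
   using jet_sup_nonneg'[OF ixs(1)[OF that] f] jet_sup_nonneg'[OF ixs(2)[OF that] g] by auto
  have "jet_sup i (f \<otimes>\<^sub>C g) \<le> (\<Sum>n<length L. ?a n * ?b n)"
   unfolding i'
  proof (rule jet_sup_le)
   show "0 \<le> (\<Sum>n<length L. ?a n * ?b n)" by (intro sum_nonneg mult_nonneg_nonneg a0 b0) auto
   fix z assume z: "z \<in> K"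
   have zt: "z \<in> topspace (J c k)" using jet_K z i i' by blast
   let ?t = "\<lambda>\<tau>. dd c (length (fst \<tau>)) f (reindex (fst \<tau>) z) \<otimes>\<^sub>B dd c (length (snd \<tau>)) g (reindex (snd \<tau>) z)"
   have tn: "?t (L ! n) \<in> carrier B \<and> p (?t (L ! n)) \<le> ?a n * ?b n" if n: "n < length L" for n
   proof -
    have z1: "reindex (fst (L ! n)) z \<in> reindex (fst (L ! n)) ` K" "reindex (snd (L ! n)) z \<in> reindex (snd (L ! n)) ` K"
     using z by auto
    have c1: "dd c (length (fst (L ! n))) f (reindex (fst (L ! n)) z) \<in> carrier B"
     "dd c (length (snd (L ! n))) g (reindex (snd (L ! n)) z) \<in> carrier B"
     using dd_closed[OF f c jet_K[OF ixs(1)[OF n, unfolded ix_def] z1(1)]]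
      dd_closed[OF g c jet_K[OF ixs(2)[OF n, unfolded ix_def] z1(2)]] by auto
    have "p (?t (L ! n)) \<le> r (dd c (length (fst (L ! n))) f (reindex (fst (L ! n)) z)) *
      r (dd c (length (snd (L ! n))) g (reindex (snd (L ! n)) z))" by (rule r(2)[OF c1])
    also have "\<dots> \<le> ?a n * ?b n"
     using jet_sup_ge[OF f ixs(1)[OF n, unfolded ix_def] z1(1)] jet_sup_ge[OF g ixs(2)[OF n, unfolded ix_def] z1(2)]
      B.R.seminorm_nonneg[OF rs] c1 a0[OF n]
     by (intro mult_mono) (simp_all add: ix_def)
    finally show ?thesis using c1 by simp
   qed
   have lsum_le: "lsum F xs \<in> carrier B \<and> p (lsum F xs) \<le> (\<Sum>x\<leftarrow>xs. p x)" if "set xs \<subseteq> carrier B" for xs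
    using that
   proof (induction xs)
    case Nil then show ?case using B.R.seminorm_zero[OF ps] by simp
   next
    case (Cons x xs)
    then have IH: "lsum F xs \<in> carrier B" "p (lsum F xs) \<le> (\<Sum>x\<leftarrow>xs. p x)" "x \<in> carrier B" by auto
    then show ?case using B.R.seminorm_add[OF ps, of x "lsum F xs"] by simp
   qed
   have "p (dd c k (f \<otimes>\<^sub>C g) z) = p (lsum F (map ?t L))"
    using dd_mult[OF f g c zt] by (simp add: L_def case_prod_unfold)
   also have "\<dots> \<le> (\<Sum>x\<leftarrow>map ?t L. p x)"
   proof (rule lsum_le[THEN conjunct2], rule subsetI)
    fix v assume "v \<in> set (map ?t L)"
    then obtain \<tau> where \<tau>: "\<tau> \<in> set L" "v = ?t \<tau>" unfolding set_map by blast
    from \<tau>(1) obtain n where "n < length L" "L ! n = \<tau>" unfolding in_set_conv_nth by blast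
    then show "v \<in> carrier B" using tn[of n] \<tau>(2) by blast
   qed
   also have "\<dots> = (\<Sum>n<length L. p (?t (L ! n)))" by (simp add: sum_list_sum_nth atLeast0LessThan)
   also have "\<dots> \<le> (\<Sum>n<length L. ?a n * ?b n)" by (rule sum_mono) (use tn in auto)
   finally show "p (dd c k (f \<otimes>\<^sub>C g) z) \<le> (\<Sum>n<length L. ?a n * ?b n)" .
  qed
  also have "\<dots> \<le> (\<Sum>n<length L. ?a n * (\<Sum>m<length L. ?b m))"
   by (rule sum_mono, rule mult_left_mono, rule member_le_sum) (use a0 b0 in auto)
  also have "\<dots> = (\<Sum>n<length L. ?a n) * (\<Sum>n<length L. ?b n)" by (simp add: sum_distrib_right)
  also have "\<dots> \<le> q f * q g"
  proof (rule mult_mono[OF qn(1)[OF f] qn(2)[OF g]])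
   have "0 \<le> (\<Sum>n<length L. ?a n)" by (rule sum_nonneg) (use a0 in auto)
   then show "0 \<le> q f" using qn(1)[OF f] by simp
   show "0 \<le> (\<Sum>n<length L. ?b n)" by (rule sum_nonneg) (use b0 in auto)
  qed
  finally show ?thesis .
 qed
 then show ?thesis using q by blast
qed

theorem lc_algebra_C: "lc_algebra C"
proof (rule lc_algebraI[where P = "{jet_sum I |I. finite I \<and> I \<subseteq> jet_idx}"])
 show "complex_algebra C" by (rule C_alg)
 show "topspace (topol C) = carrier C" by (rule C_topspace)
 show "nbhd_seminorm C p" if "p \<in> {jet_sum I |I. finite I \<and> I \<subseteq> jet_idx}" for p
  using that jet_sum_nbhd_seminorm by blast
 show "\<exists>p\<in>{jet_sum I |I. finite I \<and> I \<subseteq> jet_idx}. \<forall>y\<in>carrier C. p (y \<ominus>\<^sub>C x) < 1 --> y \<in> W"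
  if "openin (topol C) W" "x \<in> W" for W x
  using C_nbhd[OF that] by blast
next
 fix f assume f: "f \<in> carrier C" "f \<noteq> \<zero>\<^sub>C"
 have "\<exists>x\<in>topspace (mtop N). f x \<noteq> \<zero>\<^sub>B"
 proof (rule ccontr)
  assume "\<not> ?thesis"
  then have "f = \<zero>\<^sub>C" using f(1)[unfolded in_C] by (intro extensionalityI[of f "topspace (mtop N)"]) (auto simp: Cinf_simps)
  then show False using f(2) by simp
 qed
 then obtain x where x: "x \<in> topspace (mtop N)" "f x \<noteq> \<zero>\<^sub>B" by blast
 obtain U \<phi> where c: "(U, \<phi>) \<in> atlas N" "x \<in> U" using N.chart_ex[OF x(1)] by blast
 obtain p where p: "cseminorm F p" "p (f x) \<noteq> 0" using B.nonzero_cseminorm[OF C_val[OF f(1) x(1)] x(2)] by blast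
 let ?z = "(\<phi> x, \<lambda>j\<in>{..<0::nat}. undefined)"
 have "?z \<in> topspace (J (U, \<phi>) 0)"
  using c openin_subset[OF N.chart_image_open[OF c(1)]] by (auto simp: topspace_jet[OF N.rlc_axioms])
 then have "compactin (J (U, \<phi>) 0) {?z}" by simp
 then have i: "((U, \<phi>), 0, {?z}, p) \<in> jet_idx" using c(1) p(1) by (simp add: jet_idx_def)
 have "dd (U, \<phi>) 0 f ?z = f x" using c by (simp add: dd_def N.chart_inverse)
 then have "0 < p (dd (U, \<phi>) 0 f ?z)"
  using p(2) B.R.seminorm_nonneg[of p "f x"] p(1) C_val[OF f(1) x(1)] by (simp add: cseminorm_def)
 then have "jet_sum {((U, \<phi>), 0, {?z}, p)} f \<noteq> 0"
  using jet_sup_ge[OF f(1) i, of ?z] by (simp add: jet_sum_def)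
 then show "\<exists>p\<in>{jet_sum I |I. finite I \<and> I \<subseteq> jet_idx}. p f \<noteq> 0"
  using i by (intro bexI[of _ "jet_sum {((U, \<phi>), 0, {?z}, p)}"]) auto
next
 fix p assume "p \<in> {jet_sum I |I. finite I \<and> I \<subseteq> jet_idx}"
 then obtain I where I: "p = jet_sum I" "finite I" "I \<subseteq> jet_idx" by blast
 let ?L = "\<lambda>v. \<i> \<odot>\<^sub>B v"
 let ?t = "\<lambda>i. case i of (c, k, K, p) => (c, k, K, \<lambda>v. p (?L v))"
 have t: "?t i \<in> jet_idx \<and> (\<forall>f\<in>carrier C. jet_sup i (\<i> \<odot>\<^sub>C f) = jet_sup (?t i) f)" if "i \<in> I" for i
 proof -
  obtain c k K p where i: "i = (c, k, K, p)" by (cases i)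
  then have i': "(c, k, K, p) \<in> jet_idx" using that I by auto
  show ?thesis
   using jet_idx_lin[OF i' B.lin_map_csmul B.continuous_csmul_const[of \<i>]]
    jet_sup_lin[OF i' B.lin_map_csmul B.continuous_csmul_const[of \<i>]]
   by (simp add: i Cinf_simps(5))
 qed
 have "nbhd_seminorm C (\<lambda>f. \<Sum>i\<in>I. jet_sup (?t i) f)"
 proof (rule nbhd_seminorm_sum[OF C_alg C_topspace I(2)])
  fix i assume "i \<in> I"
  with t have "?t i \<in> jet_idx" by blast
  then show "nbhd_seminorm C (jet_sup (?t i))" using jet_nbhd_seminorm by (cases "?t i") auto
 qed
 then show "nbhd_seminorm C (\<lambda>f. p (\<i> \<odot>\<^sub>C f))"
  by (rule nbhd_seminorm_cong) (use t in \<open>simp add: I(1) jet_sum_def\<close>)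
 have "\<exists>q. \<forall>i\<in>I. nbhd_seminorm C (q i) \<and> (\<forall>f\<in>carrier C. \<forall>g\<in>carrier C. jet_sup i (f \<otimes>\<^sub>C g) \<le> q i f * q i g)"
  using jet_sup_mult I(3) by (intro bchoice) blast
 then obtain q where q: "\<And>i. i \<in> I ==> nbhd_seminorm C (q i)"
  "\<And>i f g. i \<in> I ==> f \<in> carrier C ==> g \<in> carrier C ==> jet_sup i (f \<otimes>\<^sub>C g) \<le> q i f * q i g" by blast
 have qn: "0 \<le> q i f" if "i \<in> I" "f \<in> carrier C" for i f
  using CR.seminorm_nonneg[of "q i" f] q(1)[OF that(1)] that(2) by (simp add: nbhd_seminorm_def)
 have "p (f \<otimes>\<^sub>C g) \<le> (\<Sum>i\<in>I. q i f) * (\<Sum>i\<in>I. q i g)" if f: "f \<in> carrier C" and g: "g \<in> carrier C" for f g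
 proof -
  have "p (f \<otimes>\<^sub>C g) \<le> (\<Sum>i\<in>I. q i f * q i g)" unfolding I(1) jet_sum_def by (rule sum_mono) (rule q(2)[OF _ f g])
  also have "\<dots> \<le> (\<Sum>i\<in>I. q i f * (\<Sum>i\<in>I. q i g))"
   by (rule sum_mono, rule mult_left_mono, rule member_le_sum) (use qn f g I(2) in auto)
  also have "\<dots> = (\<Sum>i\<in>I. q i f) * (\<Sum>i\<in>I. q i g)" by (simp add: sum_distrib_right)
  finally show ?thesis .
 qed
 then show "\<exists>q. nbhd_seminorm C q \<and> (\<forall>x\<in>carrier C. \<forall>y\<in>carrier C. p (x \<otimes>\<^sub>C y) \<le> q x * q y)"
  using nbhd_seminorm_sum[OF C_alg C_topspace I(2), of q] q(1) by (intro exI[of _ "\<lambda>f. \<Sum>i\<in>I. q i f"]) blast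
qed

end

section \<open>Dynamical systems\<close>

lemma alg_homD:
 assumes "f \<in> alg_hom A B"
 shows "\<And>x. x \<in> carrier A ==> f x \<in> carrier B"
  and "\<And>x y. x \<in> carrier A ==> y \<in> carrier A ==> f (x \<oplus>\<^sub>A y) = f x \<oplus>\<^sub>B f y"
  and "\<And>x y. x \<in> carrier A ==> y \<in> carrier A ==> f (x \<otimes>\<^sub>A y) = f x \<otimes>\<^sub>B f y"
  and "\<And>c x. x \<in> carrier A ==> f (c \<odot>\<^sub>A x) = c \<odot>\<^sub>B f x"
 using assms by (auto simp: alg_hom_def)

lemma alg_hom_zero:
 assumes "calg A" "calg B" "f \<in> alg_hom A B" shows "f \<zero>\<^sub>A = \<zero>\<^sub>B"
proof -
 interpret A: calg A by fact
 interpret B: calg B by fact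
 have "f (0 \<odot>\<^sub>A \<zero>\<^sub>A) = 0 \<odot>\<^sub>B f \<zero>\<^sub>A" by (rule alg_homD(4)[OF assms(3)]) simp
 then show ?thesis using alg_homD(1)[OF assms(3), of "\<zero>\<^sub>A"] by simp
qed

lemma alg_hom_sub:
 assumes "calg A" "calg B" "f \<in> alg_hom A B" "x \<in> carrier A" "y \<in> carrier A"
 shows "f (x \<ominus>\<^sub>A y) = f x \<ominus>\<^sub>B f y"
proof -
 interpret A: calg A by fact
 interpret B: calg B by fact
 note h = alg_homD[OF assms(3)]
 show ?thesis using assms(4,5) h(1)[OF assms(4)] h(1)[OF assms(5)] by (simp add: A.csub_eq B.csub_eq h(2,4))
qed

lemma alg_iso_one:
 assumes "calg A" "calg B" "f \<in> alg_iso A B" shows "f \<one>\<^sub>A = \<one>\<^sub>B"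
proof -
 interpret A: calg A by fact
 interpret B: calg B by fact
 have h: "f \<in> alg_hom A B" and b: "bij_betw f (carrier A) (carrier B)" using assms(3) by (auto simp: alg_iso_def)
 obtain x where x: "x \<in> carrier A" "f x = \<one>\<^sub>B" using b B.one_closed by (metis bij_betw_iff_bijections)
 have "f (\<one>\<^sub>A \<otimes>\<^sub>A x) = f \<one>\<^sub>A \<otimes>\<^sub>B f x" by (rule alg_homD(3)[OF h _ x(1)]) simp
 then show ?thesis using x alg_homD(1)[OF h, of "\<one>\<^sub>A"] by simp
qed

lemma alg_hom_lin: "f \<in> alg_hom A B ==> lin_map (realify A) (realify B) f"
 by (auto simp: alg_hom_def lin_map_def)

locale compact_group =
 fixes G :: "('g, nat => real) lie_group_rec"
 assumes grp: "Group.group G" and top: "topspace (mtop (mfd_of G)) = carrier G"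
  and cpt: "compact_space (mtop (mfd_of G))"
begin

sublocale group G by (rule grp)

text \<open>Endomorphisms are enough: group inverses provide the inverse automorphisms.\<close>

lemma dynamical_systemI:
 assumes lc: "lc_algebra A" and hom: "\<And>g. g \<in> carrier G ==> \<alpha> g \<in> alg_hom A A"
  and one: "\<And>a. a \<in> carrier A ==> \<alpha> \<one>\<^sub>G a = a"
  and mul: "\<And>g h a. g \<in> carrier G ==> h \<in> carrier G ==> a \<in> carrier A ==> \<alpha> (g \<otimes>\<^sub>G h) a = \<alpha> g (\<alpha> h a)"
  and cont: "continuous_map (prod_topology (mtop (mfd_of G)) (topol A)) (topol A) (\<lambda>(g, a). \<alpha> g a)"
 shows "dynamical_system G A \<alpha>"
proof -
 interpret A: lcalg A using lc by (rule lcalg.intro)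
 have inv: "\<alpha> (inv\<^bsub>G\<^esub> g) (\<alpha> g a) = a" "\<alpha> g (\<alpha> (inv\<^bsub>G\<^esub> g) a) = a"
  if "g \<in> carrier G" "a \<in> carrier A" for g a
  using mul[of "inv\<^bsub>G\<^esub> g" g a] mul[of g "inv\<^bsub>G\<^esub> g" a] that one by simp_all
 have c: "continuous_map (topol A) (topol A) (\<alpha> g)" if "g \<in> carrier G" for g
 proof -
  have "continuous_map (topol A) (prod_topology (mtop (mfd_of G)) (topol A)) (\<lambda>a. (g, a))"
   using that top by (simp add: continuous_map_pairwise o_def)
  from continuous_map_compose[OF this cont] show ?thesis by (simp add: o_def)
 qed
 have "\<alpha> g \<in> alg_aut A" if g: "g \<in> carrier G" for g
 proof -
  have "homeomorphic_maps (topol A) (topol A) (\<alpha> g) (\<alpha> (inv\<^bsub>G\<^esub> g))"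
   unfolding homeomorphic_maps_def using c[OF g] c[OF inv_closed[OF g]] inv[OF g] by (simp add: A.topspace_B)
  then have "homeomorphic_map (topol A) (topol A) (\<alpha> g)" by (auto simp: homeomorphic_map_maps)
  moreover have "bij_betw (\<alpha> g) (carrier A) (carrier A)"
   by (rule bij_betw_byWitness[where f' = "\<alpha> (inv\<^bsub>G\<^esub> g)"])
    (use inv[OF g] alg_homD(1)[OF hom[OF g]] alg_homD(1)[OF hom[OF inv_closed[OF g]]] in auto)
  ultimately show ?thesis using hom[OF g] by (simp add: alg_aut_def alg_iso_def)
 qed
 then show ?thesis using lc one mul cont by (simp add: dynamical_system_def)
qed

end

locale dynsys = compact_group G + B: lcalg B
 for G :: "('g, nat => real) lie_group_rec" and B :: "(complex, 'b) tmodule" +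
 fixes \<beta> :: "'g => 'b => 'b"
 assumes dyn: "dynamical_system G B \<beta>"
begin

lemma iso: "g \<in> carrier G ==> \<beta> g \<in> alg_iso B B"
 using dyn by (simp add: dynamical_system_def alg_aut_def)

lemma hom: "g \<in> carrier G ==> \<beta> g \<in> alg_hom B B"
 using iso by (simp add: alg_iso_def)

lemma act_closed [simp]: "g \<in> carrier G ==> x \<in> carrier B ==> \<beta> g x \<in> carrier B"
 using alg_homD(1)[OF hom] by blast

lemma act_one: "x \<in> carrier B ==> \<beta> \<one>\<^sub>G x = x"
 and act_mult: "g \<in> carrier G ==> h \<in> carrier G ==> x \<in> carrier B ==> \<beta> (g \<otimes>\<^sub>G h) x = \<beta> g (\<beta> h x)"
 and act_cont: "continuous_map (prod_topology (mtop (mfd_of G)) (topol B)) (topol B) (\<lambda>(g, a). \<beta> g a)"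
 and act_homeo: "g \<in> carrier G ==> homeomorphic_map (topol B) (topol B) (\<beta> g)"
 using dyn by (simp_all add: dynamical_system_def alg_aut_def)

lemma act_cont_each: "g \<in> carrier G ==> continuous_map (topol B) (topol B) (\<beta> g)"
 using act_homeo homeomorphic_imp_continuous_map by blast

lemma act_box:
 assumes W: "openin (topol B) W" and g: "g \<in> carrier G" and x: "x \<in> carrier B" and gx: "\<beta> g x \<in> W"
 shows "\<exists>S T. openin (mtop (mfd_of G)) S \<and> openin (topol B) T \<and> g \<in> S \<and> x \<in> T \<and> (\<forall>h\<in>S. \<forall>y\<in>T. \<beta> h y \<in> W)"
proof -
 let ?P = "{z \<in> topspace (prod_topology (mtop (mfd_of G)) (topol B)). (case z of (g, a) => \<beta> g a) \<in> W}"
 have "openin (prod_topology (mtop (mfd_of G)) (topol B)) ?P"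
  by (rule openin_continuous_map_preimage[OF act_cont W])
 moreover have "(g, x) \<in> ?P" using g x gx by (simp add: top B.topspace_B)
 ultimately obtain S T where ST: "openin (mtop (mfd_of G)) S" "openin (topol B) T" "g \<in> S" "x \<in> T" "S \<times> T \<subseteq> ?P"
  unfolding openin_prod_topology_alt by meson
 have "\<beta> h y \<in> W" if "h \<in> S" "y \<in> T" for h y
  using subsetD[OF ST(5) SigmaI[OF that]] by simp
 then show ?thesis using ST by blast
qed

text \<open>Compactness of the group makes the action equicontinuous.\<close>

lemma equicontinuous:
 assumes p: "cseminorm (realify B) p"
 shows "\<exists>q. cseminorm (realify B) q \<and> (\<forall>g\<in>carrier G. \<forall>x\<in>carrier B. p (\<beta> g x) \<le> q x)"
proof -
 have ps: "seminorm (realify B) p" using p by (simp add: cseminorm_def)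
 let ?W = "{x \<in> carrier B. p x < 1}"
 have W: "openin (topol B) ?W"
  using B.R.cseminorm_ball_open[OF p, of "\<zero>\<^sub>B" 1] by (simp add: a_minus_def cong: conj_cong)
 have "\<exists>S T. openin (mtop (mfd_of G)) S \<and> openin (topol B) T \<and> g \<in> S \<and> \<zero>\<^sub>B \<in> T \<and> (\<forall>h\<in>S. \<forall>y\<in>T. \<beta> h y \<in> ?W)"
  if g: "g \<in> carrier G" for g
  using act_box[OF W g, of "\<zero>\<^sub>B"] alg_hom_zero[OF B.calg_axioms B.calg_axioms hom[OF g]] B.R.seminorm_zero[OF ps] by simp
 then have "\<forall>g\<in>carrier G. \<exists>S T. openin (mtop (mfd_of G)) S \<and> openin (topol B) T \<and> g \<in> S \<and> \<zero>\<^sub>B \<in> T \<and> (\<forall>h\<in>S. \<forall>y\<in>T. \<beta> h y \<in> ?W)"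
  by blast
 from bchoice[OF this] obtain S where "\<forall>g\<in>carrier G. \<exists>T. openin (mtop (mfd_of G)) (S g) \<and> openin (topol B) T \<and> g \<in> S g \<and> \<zero>\<^sub>B \<in> T \<and> (\<forall>h\<in>S g. \<forall>y\<in>T. \<beta> h y \<in> ?W)"
  by blast
 from bchoice[OF this] obtain T where ST': "\<forall>g\<in>carrier G. openin (mtop (mfd_of G)) (S g) \<and> openin (topol B) (T g) \<and> g \<in> S g \<and> \<zero>\<^sub>B \<in> T g \<and> (\<forall>h\<in>S g. \<forall>y\<in>T g. \<beta> h y \<in> ?W)"
  by blast
 have ST: "\<And>g. g \<in> carrier G ==> openin (mtop (mfd_of G)) (S g)" "\<And>g. g \<in> carrier G ==> openin (topol B) (T g)"
  "\<And>g. g \<in> carrier G ==> g \<in> S g" "\<And>g. g \<in> carrier G ==> \<zero>\<^sub>B \<in> T g"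
  "\<And>g h y. g \<in> carrier G ==> h \<in> S g ==> y \<in> T g ==> \<beta> h y \<in> ?W"
  using ST' by (blast, blast, blast, blast, blast)
 have "\<exists>Fs. finite Fs \<and> Fs \<subseteq> S ` carrier G \<and> carrier G \<subseteq> \<Union> Fs"
  using cpt[unfolded compact_space_alt top, rule_format, of "S ` carrier G"] ST(1,3) by blast
 then obtain Z where Z: "finite Z" "Z \<subseteq> carrier G" "carrier G \<subseteq> \<Union> (S ` Z)"
  by (metis finite_subset_image)
 define T' where "T' = (\<Inter>g\<in>Z. T g) \<inter> topspace (topol B)"
 have "openin (topol B) T'" unfolding T'_def by (rule openin_INT[OF Z(1)]) (use ST(2) Z(2) in blast)
 moreover have "\<zero>\<^sub>B \<in> T'" using ST(4) Z(2) by (auto simp: T'_def B.topspace_B)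
 ultimately obtain q where q: "cseminorm (realify B) q" "\<forall>x\<in>carrier B. q x < 1 --> x \<in> T'"
  using B.R.ex_cseminorm_zero[of T'] by auto
 have qs: "seminorm (realify B) q" using q(1) by (simp add: cseminorm_def)
 have "p (\<beta> g x) \<le> q x" if g: "g \<in> carrier G" and x: "x \<in> carrier B" for g x
 proof (rule field_le_epsilon)
  fix e :: real assume e: "e > 0"
  define t where "t = q x + e"
  have t: "t > 0" "q x < t" using B.R.seminorm_nonneg[OF qs, of x] x e by (auto simp: t_def)
  let ?y = "complex_of_real (inverse t) \<odot>\<^sub>B x"
  have "q ?y = inverse t * q x" using B.R.seminorm_smul[OF qs, of x "inverse t"] x t by simp
  also have "\<dots> < 1" using t by (simp add: field_simps)
  finally have "?y \<in> T'" using q(2) B.csmul_closed[OF x] by blast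
  moreover obtain h where h: "h \<in> Z" "g \<in> S h" using Z(3) g by blast
  ultimately have "\<beta> g ?y \<in> ?W" using ST(5)[of h g ?y] Z(2) by (auto simp: T'_def)
  then have "p (complex_of_real (inverse t) \<odot>\<^sub>B \<beta> g x) < 1" using alg_homD(4)[OF hom[OF g] x] by simp
  then have "inverse t * p (\<beta> g x) < 1" using B.R.seminorm_smul[OF ps, of "\<beta> g x" "inverse t"] x g t by simp
  then show "p (\<beta> g x) \<le> q x + e" using t by (simp add: field_simps t_def)
 qed
 then show ?thesis using q(1) by blast
qed

text \<open>Each point of \<open>K\<close> has a box neighbourhood on which the action is nearly constant, and
  finitely many boxes cover \<open>K\<close>.\<close>

lemma uniform_on_compact:
 assumes K: "compactin (topol B) K" and g0: "g0 \<in> carrier G" and p: "cseminorm (realify B) p" and e: "e > 0"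
 shows "\<exists>S. openin (mtop (mfd_of G)) S \<and> g0 \<in> S \<and> (\<forall>g\<in>S. \<forall>w\<in>K. p (\<beta> g w \<ominus>\<^sub>B \<beta> g0 w) < e)"
proof -
 have ps: "seminorm (realify B) p" using p by (simp add: cseminorm_def)
 have Kc: "K \<subseteq> carrier B" using compactin_subset_topspace[OF K] B.topspace_B by simp
 define W where "W w = {v \<in> carrier B. p (v \<ominus>\<^sub>B \<beta> g0 w) < e / 2}" for w
 have "\<exists>S T. openin (mtop (mfd_of G)) S \<and> openin (topol B) T \<and> g0 \<in> S \<and> w \<in> T \<and> (\<forall>h\<in>S. \<forall>y\<in>T. \<beta> h y \<in> W w)"
  if w: "w \<in> K" for w
 proof (rule act_box[OF _ g0])
  have wc: "w \<in> carrier B" using w Kc by blast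
  show "openin (topol B) (W w)"
   using B.R.cseminorm_ball_open[OF p, of "\<beta> g0 w" "e/2"] wc g0 by (simp add: W_def)
  show "\<beta> g0 w \<in> W w" using wc g0 e B.R.seminorm_zero[OF ps] B.R.sub_self[of "\<beta> g0 w"] by (simp add: W_def)
  show "w \<in> carrier B" by (rule wc)
 qed
 then have "\<forall>w\<in>K. \<exists>S T. openin (mtop (mfd_of G)) S \<and> openin (topol B) T \<and> g0 \<in> S \<and> w \<in> T \<and> (\<forall>h\<in>S. \<forall>y\<in>T. \<beta> h y \<in> W w)"
  by blast
 from bchoice[OF this] obtain S where "\<forall>w\<in>K. \<exists>T. openin (mtop (mfd_of G)) (S w) \<and> openin (topol B) T \<and> g0 \<in> S w \<and> w \<in> T \<and> (\<forall>h\<in>S w. \<forall>y\<in>T. \<beta> h y \<in> W w)"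
  by blast
 from bchoice[OF this] obtain T where ST': "\<forall>w\<in>K. openin (mtop (mfd_of G)) (S w) \<and> openin (topol B) (T w) \<and> g0 \<in> S w \<and> w \<in> T w \<and> (\<forall>h\<in>S w. \<forall>y\<in>T w. \<beta> h y \<in> W w)"
  by blast
 have ST: "\<And>w. w \<in> K ==> openin (mtop (mfd_of G)) (S w)" "\<And>w. w \<in> K ==> openin (topol B) (T w)"
  "\<And>w. w \<in> K ==> g0 \<in> S w" "\<And>w. w \<in> K ==> w \<in> T w"
  "\<And>w h y. w \<in> K ==> h \<in> S w ==> y \<in> T w ==> \<beta> h y \<in> W w"
  using ST' by blast+
 have "\<exists>Fs. finite Fs \<and> Fs \<subseteq> T ` K \<and> K \<subseteq> \<Union> Fs"
  using K ST(2,4) unfolding compactin_def by (metis (no_types, lifting) UN_I imageE subsetI)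
 then obtain Z where Z: "finite Z" "Z \<subseteq> K" "K \<subseteq> \<Union> (T ` Z)"
  by (metis finite_subset_image)
 define S' where "S' = (\<Inter>w\<in>Z. S w) \<inter> topspace (mtop (mfd_of G))"
 have o: "openin (mtop (mfd_of G)) S'" unfolding S'_def by (rule openin_INT[OF Z(1)]) (use ST(1) Z(2) in blast)
 have g0S: "g0 \<in> S'" using ST(3) Z(2) g0 by (auto simp: S'_def top)
 have "p (\<beta> g w \<ominus>\<^sub>B \<beta> g0 w) < e" if g: "g \<in> S'" and w: "w \<in> K" for g w
 proof -
  obtain v where v: "v \<in> Z" "w \<in> T v" using Z(3) w by blast
  have vK: "v \<in> K" using v(1) Z(2) by blast
  have c: "\<beta> g w \<in> carrier B" "\<beta> g0 w \<in> carrier B" "\<beta> g0 v \<in> carrier B"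
   using g g0 w vK Kc by (auto simp: S'_def top)
  have "\<beta> g w \<in> W v" "\<beta> g0 w \<in> W v" using ST(5)[OF vK _ v(2)] g v(1) ST(3)[OF vK] by (auto simp: S'_def)
  then have "p (\<beta> g w \<ominus>\<^sub>B \<beta> g0 v) < e/2" "p (\<beta> g0 w \<ominus>\<^sub>B \<beta> g0 v) < e/2" by (auto simp: W_def)
  then show ?thesis
   using B.R.seminorm_triangle[OF ps, of "\<beta> g w" "\<beta> g0 v" "\<beta> g0 w"] B.R.seminorm_sub_commute[OF ps, of "\<beta> g0 v" "\<beta> g0 w"] c by simp
 qed
 then show ?thesis using o g0S by blast
qed

end

subsection \<open>The induced action on smooth functions\<close>

lemma (in smooth_functions) C_contI:
 assumes f: "\<And>x. x \<in> topspace X ==> f x \<in> carrier C"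
  and *: "\<And>i x e. i \<in> jet_idx ==> x \<in> topspace X ==> e > 0 ==> \<exists>T. openin X T \<and> x \<in> T \<and> (\<forall>y\<in>T. jet_sup i (f y \<ominus>\<^sub>C f x) < e)"
 shows "continuous_map X (topol C) f"
 unfolding continuous_map
proof (intro conjI allI impI)
 show "f ` topspace X \<subseteq> topspace (topol C)" using f C_topspace by auto
 fix W assume W: "openin (topol C) W"
 show "openin X {x \<in> topspace X. f x \<in> W}"
 proof (subst openin_subopen, intro ballI)
  fix x assume "x \<in> {x \<in> topspace X. f x \<in> W}"
  then have x: "x \<in> topspace X" "f x \<in> W" by auto
  obtain I where I: "finite I" "I \<subseteq> jet_idx" "\<And>g. g \<in> carrier C ==> jet_sum I (g \<ominus>\<^sub>C f x) < 1 ==> g \<in> W"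
   using C_nbhd[OF W x(2)] by blast
  define e where "e = 1 / (real (card I) + 1)"
  have e: "e > 0" by (simp add: e_def add_nonneg_pos)
  have "\<forall>i\<in>I. \<exists>T. openin X T \<and> x \<in> T \<and> (\<forall>y\<in>T. jet_sup i (f y \<ominus>\<^sub>C f x) < e)"
   using *[OF _ x(1) e] I(2) by blast
  then obtain T where T: "\<And>i. i \<in> I ==> openin X (T i)" "\<And>i. i \<in> I ==> x \<in> T i"
   "\<And>i y. i \<in> I ==> y \<in> T i ==> jet_sup i (f y \<ominus>\<^sub>C f x) < e" by metis
  define T' where "T' = (\<Inter>i\<in>I. T i) \<inter> topspace X"
  have o: "openin X T'" unfolding T'_def by (rule openin_INT[OF I(1) T(1)])
  have xT: "x \<in> T'" using T(2) x(1) by (auto simp: T'_def)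
  have "f y \<in> W" if y: "y \<in> T'" for y
  proof (rule I(3))
   show "f y \<in> carrier C" using f y by (simp add: T'_def)
   have "jet_sum I (f y \<ominus>\<^sub>C f x) \<le> (\<Sum>i\<in>I. e)"
    unfolding jet_sum_def by (rule sum_mono) (use T(3) y in \<open>auto simp: T'_def intro: less_imp_le\<close>)
   also have "\<dots> < 1" by (simp add: e_def field_simps)
   finally show "jet_sum I (f y \<ominus>\<^sub>C f x) < 1" .
  qed
  then have "T' \<subseteq> {x \<in> topspace X. f x \<in> W}" by (auto simp: T'_def)
  then show "\<exists>T. openin X T \<and> x \<in> T \<and> T \<subseteq> {x \<in> topspace X. f x \<in> W}" using o xT by blast
 qed
qed

text \<open>Near \<open>(g0, f0)\<close> the difference \<open>g f - g0 f0\<close> is the sum of \<open>g (f - f0)\<close>, which is small by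
  equicontinuity, and \<open>(g - g0) f0\<close>, which is small since the derivatives of \<open>f0\<close> map a compact set of
  jets to a compact set.\<close>

lemma dynamical_system_Cinf:
 assumes ds: "dynsys G B \<beta>" and N: "charted N"
 shows "dynamical_system G (Cinf N B) (\<lambda>g f. \<lambda>x\<in>topspace (mtop N). \<beta> g (f x))"
proof -
 interpret dynsys G B \<beta> by fact
 interpret S: smooth_functions N B using N B.lca by (simp add: smooth_functions_def cmfd_def lcalg_def)
 define \<gamma> where "\<gamma> = (\<lambda>g f. \<lambda>x\<in>topspace (mtop N). \<beta> g (f x))"
 have closed: "\<gamma> g f \<in> carrier S.C" if "g \<in> carrier G" "f \<in> carrier S.C" for g f
  unfolding \<gamma>_def
  by (rule S.restrict_in_C, rule smooth_map_lin[OF N B.R.rlc_axioms B.R.rlc_axioms])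
   (use that act_cont_each[OF that(1)] alg_hom_lin[OF hom[OF that(1)]] in \<open>simp_all add: S.in_C\<close>)
 have dd_act: "S.dd c k (\<gamma> g f) z = \<beta> g (S.dd c k f z)"
  if "g \<in> carrier G" "f \<in> carrier S.C" "c \<in> atlas N" "z \<in> topspace (S.J c k)" for g f c k z
  unfolding \<gamma>_def by (rule S.dd_lin[OF that(2-4) alg_hom_lin[OF hom[OF that(1)]] act_cont_each[OF that(1)]])
 have cont: "continuous_map (prod_topology (mtop (mfd_of G)) (topol S.C)) (topol S.C) (\<lambda>(g, f). \<gamma> g f)"
 proof (rule S.C_contI)
  fix z assume "z \<in> topspace (prod_topology (mtop (mfd_of G)) (topol S.C))"
  then show "(case z of (g, f) => \<gamma> g f) \<in> carrier S.C"
   using closed by (cases z) (simp add: top S.C_topspace)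
 next
  fix i z and e :: real
  assume i: "i \<in> S.jet_idx" and "z \<in> topspace (prod_topology (mtop (mfd_of G)) (topol S.C))" and e: "e > 0"
  then obtain g0 f0 where z: "z = (g0, f0)" "g0 \<in> carrier G" "f0 \<in> carrier S.C"
   by (cases z) (simp add: top S.C_topspace)
  obtain c k K p where i': "i = (c, k, K, p)" by (cases i)
  have c: "c \<in> atlas N" and K: "compactin (S.J c k) K" and p: "cseminorm (realify B) p"
   using i by (auto simp: S.jet_idx_def i')
  have ps: "seminorm (realify B) p" using p by (simp add: cseminorm_def)
  obtain q where q: "cseminorm (realify B) q" "\<And>g x. g \<in> carrier G ==> x \<in> carrier B ==> p (\<beta> g x) \<le> q x"
   using equicontinuous[OF p] by blast
  have j: "(c, k, K, q) \<in> S.jet_idx" using c K q(1) by (simp add: S.jet_idx_def)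
  obtain T where T: "openin (topol S.C) T" "f0 \<in> T" "\<forall>f\<in>T. S.jet_sup (c, k, K, q) (f \<ominus>\<^bsub>S.C\<^esub> f0) < e / 2"
   using S.jet_nbhd_seminorm[OF j] z(3) half_gt_zero[OF e] unfolding nbhd_seminorm_def by blast
  have "compactin (topol B) (S.dd c k f0 ` K)" by (rule image_compactin[OF K S.dd_cont[OF z(3) c]])
  from uniform_on_compact[OF this z(2) p, of "e/4"] e
  obtain S where S: "openin (mtop (mfd_of G)) S" "g0 \<in> S"
   "\<forall>g\<in>S. \<forall>w\<in>S.dd c k f0 ` K. p (\<beta> g w \<ominus>\<^sub>B \<beta> g0 w) < e/4" by auto
  have "S.jet_sup i (\<gamma> g f \<ominus>\<^bsub>S.C\<^esub> \<gamma> g0 f0) < e" if gf: "g \<in> S" "f \<in> T" for g f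
  proof -
   have g: "g \<in> carrier G" using openin_subset[OF S(1)] gf(1) top by blast
   have f: "f \<in> carrier S.C" using openin_subset[OF T(1)] gf(2) S.C_topspace by blast
   have fs: "f \<ominus>\<^bsub>S.C\<^esub> f0 \<in> carrier S.C" using f z(3) by simp
   have "S.jet_sup (c, k, K, p) (\<gamma> g f \<ominus>\<^bsub>S.C\<^esub> \<gamma> g0 f0) \<le> e/2 + e/4"
   proof (rule S.jet_sup_le)
    fix y assume y: "y \<in> K"
    note yt = S.jet_K[OF j y]
    let ?a = "S.dd c k f y" and ?b = "S.dd c k f0 y"
    have ab: "?a \<in> carrier B" "?b \<in> carrier B" using S.dd_closed[OF _ c yt] f z(3) by auto
    have "p (S.dd c k (\<gamma> g f \<ominus>\<^bsub>S.C\<^esub> \<gamma> g0 f0) y) = p (\<beta> g ?a \<ominus>\<^sub>B \<beta> g0 ?b)"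
     using S.dd_sub[OF closed[OF g f] closed[OF z(2,3)] c yt] dd_act[OF g f c yt] dd_act[OF z(2,3) c yt] by simp
    also have "\<dots> \<le> p (\<beta> g ?a \<ominus>\<^sub>B \<beta> g ?b) + p (\<beta> g ?b \<ominus>\<^sub>B \<beta> g0 ?b)"
     using B.R.seminorm_triangle[OF ps, of "\<beta> g ?a" "\<beta> g ?b" "\<beta> g0 ?b"] ab g z(2) by simp
    also have "p (\<beta> g ?a \<ominus>\<^sub>B \<beta> g ?b) \<le> q (?a \<ominus>\<^sub>B ?b)"
     using q(2)[OF g, of "?a \<ominus>\<^sub>B ?b"] alg_hom_sub[OF B.calg_axioms B.calg_axioms hom[OF g] ab] ab by simp
    also have "q (?a \<ominus>\<^sub>B ?b) \<le> S.jet_sup (c, k, K, q) (f \<ominus>\<^bsub>S.C\<^esub> f0)"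
     using S.jet_sup_ge[OF fs j y] S.dd_sub[OF f z(3) c yt] by simp
    also have "\<dots> < e/2" using T(3) gf(2) by blast
    finally show "p (S.dd c k (\<gamma> g f \<ominus>\<^bsub>S.C\<^esub> \<gamma> g0 f0) y) \<le> e/2 + e/4"
     using S(3) gf(1) y by fastforce
   qed (use e in simp)
   then show ?thesis using e i' by simp
  qed
  then show "\<exists>T. openin (prod_topology (mtop (mfd_of G)) (topol S.C)) T \<and> z \<in> T \<and>
    (\<forall>y\<in>T. S.jet_sup i ((case y of (g, f) => \<gamma> g f) \<ominus>\<^bsub>S.C\<^esub> (case z of (g, f) => \<gamma> g f)) < e)"
   using S(1,2) T(1,2) z(1) by (intro exI[of _ "S \<times> T"]) (auto simp: openin_prod_Times_iff)
 qed
 have eqI: "f = h" if "f \<in> carrier S.C" "h \<in> carrier S.C" "\<And>x. x \<in> topspace (mtop N) ==> f x = h x" for f h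
  using that unfolding S.in_C by (intro extensionalityI[of f "topspace (mtop N)" h]) auto
 have "dynamical_system G S.C \<gamma>"
 proof (rule dynamical_systemI[OF S.lc_algebra_C _ _ _ cont])
  fix g assume g: "g \<in> carrier G"
  show "\<gamma> g \<in> alg_hom S.C S.C"
   unfolding alg_hom_def mem_Collect_eq
  proof (intro conjI ballI allI)
   show "\<gamma> g \<in> carrier S.C \<rightarrow> carrier S.C" using closed[OF g] by blast
   fix f assume f: "f \<in> carrier S.C"
   show "\<gamma> g (c \<odot>\<^bsub>S.C\<^esub> f) = c \<odot>\<^bsub>S.C\<^esub> \<gamma> g f" for c
    by (rule eqI[OF closed[OF g S.C_closed(5)[OF f]] S.C_closed(5)[OF closed[OF g f]]])
     (use S.C_val[OF f] alg_homD(4)[OF hom[OF g]] in \<open>auto simp: \<gamma>_def S.Cinf_simps(5)\<close>)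
   fix h assume h: "h \<in> carrier S.C"
   show "\<gamma> g (f \<oplus>\<^bsub>S.C\<^esub> h) = \<gamma> g f \<oplus>\<^bsub>S.C\<^esub> \<gamma> g h"
    by (rule eqI[OF closed[OF g S.C_closed(3)[OF f h]] S.C_closed(3)[OF closed[OF g f] closed[OF g h]]])
     (use S.C_val[OF f] S.C_val[OF h] alg_homD(2)[OF hom[OF g]] in \<open>auto simp: \<gamma>_def S.Cinf_simps(3)\<close>)
   show "\<gamma> g (f \<otimes>\<^bsub>S.C\<^esub> h) = \<gamma> g f \<otimes>\<^bsub>S.C\<^esub> \<gamma> g h"
    by (rule eqI[OF closed[OF g S.C_closed(4)[OF f h]] S.C_closed(4)[OF closed[OF g f] closed[OF g h]]])
     (use S.C_val[OF f] S.C_val[OF h] alg_homD(3)[OF hom[OF g]] in \<open>auto simp: \<gamma>_def S.Cinf_simps(4)\<close>)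
  qed
 next
  fix f assume f: "f \<in> carrier S.C"
  show "\<gamma> \<one>\<^sub>G f = f" by (rule eqI[OF closed[OF one_closed f] f]) (use S.C_val[OF f] act_one in \<open>auto simp: \<gamma>_def\<close>)
  fix g h assume gh: "g \<in> carrier G" "h \<in> carrier G"
  show "\<gamma> (g \<otimes>\<^sub>G h) f = \<gamma> g (\<gamma> h f)"
   by (rule eqI[OF closed[OF m_closed[OF gh] f] closed[OF gh(1) closed[OF gh(2) f]]]) (use S.C_val[OF f] act_mult[OF gh] in \<open>auto simp: \<gamma>_def\<close>)
 qed
 then show ?thesis unfolding \<gamma>_def .
qed

section \<open>Initial topologies\<close>

lemma continuous_map_initial:
 assumes T: "T = topology_generated_by (insert C {{s \<in> C. L i s \<in> W} |i W. i \<in> I \<and> openin (Y i) W})"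
  and L: "\<And>i s. i \<in> I ==> s \<in> C ==> L i s \<in> topspace (Y i)"
 shows "topspace T = C"
  and "continuous_map X T f \<longleftrightarrow> f \<in> topspace X \<rightarrow> C \<and> (\<forall>i\<in>I. continuous_map X (Y i) (\<lambda>x. L i (f x)))"
proof -
 show top: "topspace T = C" by (subst T, subst topology_generated_by_topspace) blast
 let ?B = "insert C {{s \<in> C. L i s \<in> W} |i W. i \<in> I \<and> openin (Y i) W}"
 have un: "\<Union> ?B = C" by blast
 show "continuous_map X T f \<longleftrightarrow> f \<in> topspace X \<rightarrow> C \<and> (\<forall>i\<in>I. continuous_map X (Y i) (\<lambda>x. L i (f x)))" (is "?l = ?r")
 proof
  assume l: ?l
  then have sub: "f \<in> topspace X \<rightarrow> C" using top by (auto simp: continuous_map_def)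
  have "continuous_map X (Y i) (\<lambda>x. L i (f x))" if i: "i \<in> I" for i
   unfolding continuous_map
  proof (intro conjI allI impI)
   show "(\<lambda>x. L i (f x)) ` topspace X \<subseteq> topspace (Y i)" using sub L[OF i] by auto
   fix W assume W: "openin (Y i) W"
   have "openin T {s \<in> C. L i s \<in> W}" unfolding T
    by (rule topology_generated_by_Basis, rule insertI2) (use i W in blast)
   from openin_continuous_map_preimage[OF l this]
   show "openin X {x \<in> topspace X. L i (f x) \<in> W}"
    by (rule back_subst[of "openin X"]) (use sub in auto)
  qed
  then show ?r using sub by blast
 next
  assume r: ?r
  show ?l unfolding T
  proof (rule continuous_on_generated_topo)
   show "f ` topspace X \<subseteq> \<Union> ?B" using r un by auto
   fix U assume "U \<in> ?B"
   then consider "U = C" | i W where "U = {s \<in> C. L i s \<in> W}" "i \<in> I" "openin (Y i) W" by blast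
   then show "openin X (f -` U \<inter> topspace X)"
   proof cases
    case 1
    then have "f -` U \<inter> topspace X = topspace X" using r by auto
    then show ?thesis by simp
   next
    case 2
    have "openin X {x \<in> topspace X. L i (f x) \<in> W}"
     by (rule openin_continuous_map_preimage) (use r 2 in auto)
    moreover have "f -` U \<inter> topspace X = {x \<in> topspace X. L i (f x) \<in> W}" using r 2(1) by auto
    ultimately show ?thesis by simp
   qed
  qed
 qed
qed

text \<open>Every axiom can be tested after composition with the maps \<open>L i\<close>; convex neighbourhoods are
  preimages of convex neighbourhoods.\<close>

lemma lc_algebra_initial:
 fixes A :: "(complex, 'a) tmodule" and D :: "'i => (complex, 'c) tmodule"
 assumes alg: "complex_algebra A" and D: "\<And>i. i \<in> I ==> lc_algebra (D i)"
  and hom: "\<And>i. i \<in> I ==> L i \<in> alg_hom A (D i)"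
  and inj: "\<And>x y. x \<in> carrier A ==> y \<in> carrier A ==> (\<And>i. i \<in> I ==> L i x = L i y) ==> x = y"
  and T: "topol A = topology_generated_by (insert (carrier A) {{s \<in> carrier A. L i s \<in> W} |i W. i \<in> I \<and> openin (topol (D i)) W})"
 shows "lc_algebra A"
proof -
 interpret A: calg A using alg by (rule calg.intro)
 have lcD: "lcalg (D i)" if "i \<in> I" for i using D[OF that] by (rule lcalg.intro)
 have Ltop: "L i s \<in> topspace (topol (D i))" if "i \<in> I" "s \<in> carrier A" for i s
  using alg_homD(1)[OF hom[OF that(1)] that(2)] lcalg.topspace_B[OF lcD[OF that(1)]] by simp
 note top = continuous_map_initial(1)[OF T Ltop]
 have contI: "continuous_map X (topol A) f"
  if "f \<in> topspace X \<rightarrow> carrier A" "\<And>i. i \<in> I ==> continuous_map X (topol (D i)) (\<lambda>x. L i (f x))"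
  for X :: "'x topology" and f
  using that continuous_map_initial(2)[OF T Ltop, of X f] by blast
 have Lc: "continuous_map (topol A) (topol (D i)) (L i)" if i: "i \<in> I" for i
 proof -
  have "continuous_map (topol A) (topol A) (\<lambda>x. x)" using continuous_map_id[of "topol A"] by (simp add: id_def)
  then show ?thesis using continuous_map_initial(2)[OF T Ltop, THEN iffD1] i by blast
 qed
 note L1 = continuous_map_compose[OF continuous_map_fst Lc, unfolded o_def]
 note L2 = continuous_map_compose[OF continuous_map_snd Lc, unfolded o_def]
 have add: "continuous_map (prod_topology (topol A) (topol A)) (topol A) (\<lambda>(x, y). x \<oplus>\<^sub>A y)"
 proof (rule contI)
  show "(\<lambda>(x, y). x \<oplus>\<^sub>A y) \<in> topspace (prod_topology (topol A) (topol A)) \<rightarrow> carrier A" using top by auto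
  fix i assume i: "i \<in> I"
  interpret D: lcalg "D i" by (rule lcD[OF i])
  have "continuous_map (prod_topology (topol A) (topol A)) (topol (D i)) (\<lambda>z. L i (fst z) \<oplus>\<^bsub>D i\<^esub> L i (snd z))"
   using D.R.continuous_add[of "prod_topology (topol A) (topol A)" "\<lambda>z. L i (fst z)" "\<lambda>z. L i (snd z)"] L1[OF i, of "topol A"] L2[OF i, of "topol A"] by simp
  then show "continuous_map (prod_topology (topol A) (topol A)) (topol (D i)) (\<lambda>z. L i (case z of (x, y) => x \<oplus>\<^sub>A y))"
   by (rule continuous_map_eq) (use alg_homD(2)[OF hom[OF i]] top in auto)
 qed
 have mul: "continuous_map (prod_topology (topol A) (topol A)) (topol A) (\<lambda>(x, y). x \<otimes>\<^sub>A y)"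
 proof (rule contI)
  show "(\<lambda>(x, y). x \<otimes>\<^sub>A y) \<in> topspace (prod_topology (topol A) (topol A)) \<rightarrow> carrier A" using top by auto
  fix i assume i: "i \<in> I"
  interpret D: lcalg "D i" by (rule lcD[OF i])
  have "continuous_map (prod_topology (topol A) (topol A)) (prod_topology (topol (D i)) (topol (D i))) (\<lambda>z. (L i (fst z), L i (snd z)))"
   using L1[OF i, of "topol A"] L2[OF i, of "topol A"] by (simp add: continuous_map_pairwise o_def)
  from continuous_map_compose[OF this D.cont_mult]
  show "continuous_map (prod_topology (topol A) (topol A)) (topol (D i)) (\<lambda>z. L i (case z of (x, y) => x \<otimes>\<^sub>A y))"
   by (rule continuous_map_eq) (use alg_homD(3)[OF hom[OF i]] top in auto)
 qed
 have smul: "continuous_map (prod_topology euclidean (topol A)) (topol A) (\<lambda>(c, x). c \<odot>\<^sub>A x)"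
 proof (rule contI)
  show "(\<lambda>(c, x). c \<odot>\<^sub>A x) \<in> topspace (prod_topology euclidean (topol A)) \<rightarrow> carrier A" using top by auto
  fix i assume i: "i \<in> I"
  interpret D: lcalg "D i" by (rule lcD[OF i])
  have "continuous_map (prod_topology euclidean (topol A)) (prod_topology euclidean (topol (D i))) (\<lambda>z. (fst z, L i (snd z)))"
   using L2[OF i, of euclidean] by (simp add: continuous_map_pairwise o_def continuous_map_fst)
  from continuous_map_compose[OF this D.cont_csmul]
  show "continuous_map (prod_topology euclidean (topol A)) (topol (D i)) (\<lambda>z. L i (case z of (c, x) => c \<odot>\<^sub>A x))"
   by (rule continuous_map_eq) (use alg_homD(4)[OF hom[OF i]] top in auto)
 qed
 have haus: "Hausdorff_space (topol A)"
  unfolding Hausdorff_space_def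
 proof (intro allI impI)
  fix x y assume "x \<in> topspace (topol A) \<and> y \<in> topspace (topol A) \<and> x \<noteq> y"
  then have xy: "x \<in> carrier A" "y \<in> carrier A" "x \<noteq> y" using top by auto
  then obtain i where i: "i \<in> I" "L i x \<noteq> L i y" using inj by blast
  interpret D: lcalg "D i" by (rule lcD[OF i(1)])
  have "Hausdorff_space (topol (D i))" using D.R.Hausdorff by simp
  then obtain U V where UV: "openin (topol (D i)) U" "openin (topol (D i)) V" "L i x \<in> U" "L i y \<in> V" "disjnt U V"
   unfolding Hausdorff_space_def using Ltop[OF i(1) xy(1)] Ltop[OF i(1) xy(2)] i(2) by blast
  let ?P = "\<lambda>U. {s \<in> topspace (topol A). L i s \<in> U}"
  have "openin (topol A) (?P U)" "openin (topol A) (?P V)"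
   by (rule openin_continuous_map_preimage[OF Lc[OF i(1)]], fact)+
  moreover have "x \<in> ?P U" "y \<in> ?P V" using UV xy top by auto
  moreover have "disjnt (?P U) (?P V)" using UV(5) by (auto simp: disjnt_iff)
  ultimately show "\<exists>U V. openin (topol A) U \<and> openin (topol A) V \<and> x \<in> U \<and> y \<in> V \<and> disjnt U V" by blast
 qed
 have conv: "\<zero>\<^sub>A \<in> W ==> \<exists>V. openin (topol A) V \<and> \<zero>\<^sub>A \<in> V \<and> V \<subseteq> W \<and>
   (\<forall>x\<in>V. \<forall>y\<in>V. \<forall>t::real. 0 \<le> t \<and> t \<le> 1 --> (of_real (1 - t) \<odot>\<^sub>A x) \<oplus>\<^sub>A (of_real t \<odot>\<^sub>A y) \<in> V)"
  if W: "openin (topol A) W" for W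
  using W[unfolded T openin_topology_generated_by_iff]
 proof (induction W rule: generate_topology_on.induct)
  case Empty then show ?case by simp
 next
  case (Int a b)
  then obtain V1 where V1: "openin (topol A) V1" "\<zero>\<^sub>A \<in> V1" "V1 \<subseteq> a"
   "\<forall>x\<in>V1. \<forall>y\<in>V1. \<forall>t::real. 0 \<le> t \<and> t \<le> 1 --> (of_real (1 - t) \<odot>\<^sub>A x) \<oplus>\<^sub>A (of_real t \<odot>\<^sub>A y) \<in> V1" by blast
  from Int obtain V2 where V2: "openin (topol A) V2" "\<zero>\<^sub>A \<in> V2" "V2 \<subseteq> b"
   "\<forall>x\<in>V2. \<forall>y\<in>V2. \<forall>t::real. 0 \<le> t \<and> t \<le> 1 --> (of_real (1 - t) \<odot>\<^sub>A x) \<oplus>\<^sub>A (of_real t \<odot>\<^sub>A y) \<in> V2" by blast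
  show ?case
   by (rule exI[of _ "V1 \<inter> V2"]) (use V1 V2 in \<open>blast intro: openin_Int\<close>)
 next
  case (UN \<K>)
  then obtain k where k: "k \<in> \<K>" "\<zero>\<^sub>A \<in> k" by blast
  from UN.IH[OF k] obtain V where "openin (topol A) V \<and> \<zero>\<^sub>A \<in> V \<and> V \<subseteq> k \<and>
   (\<forall>x\<in>V. \<forall>y\<in>V. \<forall>t::real. 0 \<le> t \<and> t \<le> 1 --> (of_real (1 - t) \<odot>\<^sub>A x) \<oplus>\<^sub>A (of_real t \<odot>\<^sub>A y) \<in> V)" by blast
  then show ?case using k(1) by (intro exI[of _ V]) blast
 next
  case (Basis s)
  then consider "s = carrier A" | i W where "s = {s \<in> carrier A. L i s \<in> W}" "i \<in> I" "openin (topol (D i)) W" by blast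
  then show ?case
  proof cases
   case 1
   show ?thesis
    by (rule exI[of _ "carrier A"]) (use 1 openin_topspace[of "topol A"] top in auto)
  next
   case 2
   interpret D: lcalg "D i" by (rule lcD[OF 2(2)])
   have z: "L i \<zero>\<^sub>A = \<zero>\<^bsub>D i\<^esub>" by (rule alg_hom_zero[OF A.calg_axioms D.calg_axioms hom[OF 2(2)]])
   have "\<zero>\<^bsub>D i\<^esub> \<in> W" using Basis.prems 2(1) z by simp
   then obtain V where V: "openin (topol (D i)) V" "\<zero>\<^bsub>D i\<^esub> \<in> V" "V \<subseteq> W"
    "\<forall>x\<in>V. \<forall>y\<in>V. \<forall>t::real. 0 \<le> t \<and> t \<le> 1 --> (of_real (1 - t) \<odot>\<^bsub>D i\<^esub> x) \<oplus>\<^bsub>D i\<^esub> (of_real t \<odot>\<^bsub>D i\<^esub> y) \<in> V"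
    using D.lca 2(3) unfolding lc_algebra_def lc_space_def by meson
   let ?V = "{s \<in> topspace (topol A). L i s \<in> V}"
   have "openin (topol A) ?V" by (rule openin_continuous_map_preimage[OF Lc[OF 2(2)] V(1)])
   moreover have "(of_real (1 - t) \<odot>\<^sub>A x) \<oplus>\<^sub>A (of_real t \<odot>\<^sub>A y) \<in> ?V"
    if "x \<in> ?V" "y \<in> ?V" "0 \<le> t \<and> t \<le> 1" for x y and t :: real
    using V(4) that top alg_homD[OF hom[OF 2(2)]] by simp
   moreover have "\<zero>\<^sub>A \<in> ?V" "?V \<subseteq> s" using z V 2(1) top by auto
   ultimately show ?thesis by (intro exI[of _ ?V]) blast
  qed
 qed
 have "lc_space A"
  unfolding lc_space_def using A.cmod top haus add smul conv by blast
 then show ?thesis unfolding lc_algebra_def using alg mul by blast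
qed


section \<open>Quotients by closed ideals\<close>

text \<open>A product of quotient maps need not be a quotient map, but open surjections are stable under
  products.\<close>

lemma continuous_map_open_quotients:
 assumes P: "open_map T1 Q1 P" "P ` topspace T1 = topspace Q1"
  and R: "open_map T2 Q2 R" "R ` topspace T2 = topspace Q2"
  and c: "continuous_map (prod_topology T1 T2) Z (\<lambda>(x, y). f (P x) (R y))"
 shows "continuous_map (prod_topology Q1 Q2) Z (\<lambda>(a, b). f a b)"
 unfolding continuous_map
proof (intro conjI allI impI)
 have fz: "f (P x) (R y) \<in> topspace Z" if "x \<in> topspace T1" "y \<in> topspace T2" for x y
  using continuous_map_image_subset_topspace[OF c] that by fastforce
 show "(\<lambda>(a, b). f a b) ` topspace (prod_topology Q1 Q2) \<subseteq> topspace Z"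
 proof clarsimp
  fix a b assume "a \<in> topspace Q1" "b \<in> topspace Q2"
  then obtain x y where "x \<in> topspace T1" "a = P x" "y \<in> topspace T2" "b = R y" using P(2) R(2) by blast
  then show "f a b \<in> topspace Z" using fz by simp
 qed
 fix W assume W: "openin Z W"
 show "openin (prod_topology Q1 Q2) {z \<in> topspace (prod_topology Q1 Q2). (case z of (a, b) => f a b) \<in> W}"
  unfolding openin_prod_topology_alt
 proof (intro allI impI)
  fix a b assume "(a, b) \<in> {z \<in> topspace (prod_topology Q1 Q2). (case z of (a, b) => f a b) \<in> W}"
  then have ab: "a \<in> topspace Q1" "b \<in> topspace Q2" "f a b \<in> W" by auto
  then obtain x y where xy: "x \<in> topspace T1" "a = P x" "y \<in> topspace T2" "b = R y" using P(2) R(2) by blast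
  let ?D = "{z \<in> topspace (prod_topology T1 T2). (case z of (x, y) => f (P x) (R y)) \<in> W}"
  have "openin (prod_topology T1 T2) ?D" by (rule openin_continuous_map_preimage[OF c W])
  moreover have "(x, y) \<in> ?D" using xy ab by simp
  ultimately obtain S T where ST: "openin T1 S" "openin T2 T" "x \<in> S" "y \<in> T" "S \<times> T \<subseteq> ?D"
   unfolding openin_prod_topology_alt by meson
  have o: "openin Q1 (P ` S)" "openin Q2 (R ` T)" using P(1) R(1) ST(1,2) by (auto simp: open_map_def)
  have "f (P u) (R v) \<in> W" if "u \<in> S" "v \<in> T" for u v using subsetD[OF ST(5) SigmaI[OF that]] by simp
  then have "P ` S \<times> R ` T \<subseteq> {z \<in> topspace (prod_topology Q1 Q2). (case z of (a, b) => f a b) \<in> W}"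
   using openin_subset[OF o(1)] openin_subset[OF o(2)] by auto
  then show "\<exists>U V. openin Q1 U \<and> openin Q2 V \<and> a \<in> U \<and> b \<in> V \<and>
    U \<times> V \<subseteq> {z \<in> topspace (prod_topology Q1 Q2). (case z of (a, b) => f a b) \<in> W}"
   using o ST(3,4) xy by blast
 qed
qed

lemma (in lcalg) closure_ideal:
 assumes "ideal J B" shows "ideal (topol B closure_of J) B"
proof -
 interpret J: ideal J B by fact
 let ?K = "topol B closure_of J"
 have Jc: "J \<subseteq> carrier B" using J.a_subset .
 have Kc: "?K \<subseteq> carrier B" using closure_of_subset_topspace[of "topol B" J] topspace_B by simp
 have JK: "J \<subseteq> ?K" using closure_of_subset[of J "topol B"] Jc topspace_B by simp
 have img: "f x \<in> ?K" if "continuous_map (topol B) (topol B) f" "\<And>a. a \<in> J ==> f a \<in> J" "x \<in> ?K" for f x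
 proof -
  have "f ` ?K \<subseteq> topol B closure_of (f ` J)" by (rule continuous_map_image_closure_subset[OF that(1)])
  also have "\<dots> \<subseteq> ?K" by (rule closure_of_mono) (use that(2) in blast)
  finally show ?thesis using that(3) by blast
 qed
 have add: "x \<oplus> y \<in> ?K" if "x \<in> ?K" "y \<in> ?K" for x y
 proof -
  have "(\<lambda>(x, y). x \<oplus> y) ` (prod_topology (topol B) (topol B) closure_of (J \<times> J)) \<subseteq> topol B closure_of ((\<lambda>(x, y). x \<oplus> y) ` (J \<times> J))"
   using continuous_map_image_closure_subset[of "prod_topology (topol B) (topol B)" "topol B"] R.cont_add by simp
  also have "\<dots> \<subseteq> ?K" by (rule closure_of_mono) auto
  finally show ?thesis using that unfolding closure_of_Times by force
 qed
 have mult: "x \<otimes> a \<in> ?K" "a \<otimes> x \<in> ?K" if "a \<in> ?K" and x: "x \<in> carrier B" for a x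
 proof -
  have "continuous_map (topol B) (prod_topology (topol B) (topol B)) (\<lambda>y. (x, y))"
   "continuous_map (topol B) (prod_topology (topol B) (topol B)) (\<lambda>y. (y, x))"
   using x by (simp_all add: continuous_map_pairwise o_def topspace_B)
  from this[THEN continuous_map_compose[OF _ cont_mult]]
  have "continuous_map (topol B) (topol B) (\<lambda>y. x \<otimes> y)" "continuous_map (topol B) (topol B) (\<lambda>y. y \<otimes> x)"
   by (simp_all add: o_def)
  then show "x \<otimes> a \<in> ?K" "a \<otimes> x \<in> ?K"
   using img[of "\<lambda>y. x \<otimes> y" a] img[of "\<lambda>y. y \<otimes> x" a] that(1) J.I_l_closed[OF _ x] J.I_r_closed[OF _ x] by blast+
 qed
 have inv: "\<ominus> x \<in> ?K" if x: "x \<in> ?K" for x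
 proof -
  have "(-1) \<odot> a \<in> J" if "a \<in> J" for a
   using that Jc J.a_inv_closed[OF that] csmul_neg_one[of a] by auto
  then have "(-1) \<odot> x \<in> ?K" using img[OF continuous_csmul_const[of "-1"] _ x] by blast
  then show ?thesis using csmul_neg_one[of x] x Kc by auto
 qed
 show ?thesis
 proof (rule idealI[OF ring_axioms])
  show "subgroup ?K (add_monoid B)"
  proof
   show "?K \<subseteq> carrier (add_monoid B)" using Kc by simp
   show "x \<otimes>\<^bsub>add_monoid B\<^esub> y \<in> ?K" if "x \<in> ?K" "y \<in> ?K" for x y using add[OF that] by simp
   show "\<one>\<^bsub>add_monoid B\<^esub> \<in> ?K" using JK J.zero_closed by auto
   show "inv\<^bsub>add_monoid B\<^esub> x \<in> ?K" if "x \<in> ?K" for x using inv[OF that] by (simp add: a_inv_def)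
  qed
 qed (use mult in auto)
qed

locale closed_ideal = lcalg A + ideal I A for A :: "(complex, 'a) tmodule" (structure) and I +
 assumes closed: "closedin (topol A) I"
begin

abbreviation Q where "Q \<equiv> quot_algebra A I"
abbreviation \<pi> where "\<pi> x \<equiv> I +> x"

lemma Q_simps: "carrier Q = \<pi> ` carrier A" "zero Q = I" "one Q = \<pi> \<one>" "topol Q = quot_topology A I"
 "smult Q = (\<lambda>c X. \<Union>x\<in>X. \<pi> (c \<odot> x))"
 by (auto simp: quot_algebra_def FactRing_simps)

lemma Q_add: "x \<in> carrier A ==> y \<in> carrier A ==> \<pi> x \<oplus>\<^sub>Q \<pi> y = \<pi> (x \<oplus> y)"
 by (simp add: quot_algebra_def FactRing_def a_rcos_sum)

lemma Q_mult: "x \<in> carrier A ==> y \<in> carrier A ==> \<pi> x \<otimes>\<^sub>Q \<pi> y = \<pi> (x \<otimes> y)"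
 by (simp add: quot_algebra_def FactRing_def rcoset_mult_add)

lemma \<pi>_eq_iff: "x \<in> carrier A ==> y \<in> carrier A ==> \<pi> x = \<pi> y \<longleftrightarrow> x \<ominus> y \<in> I"
 using a_rcos_module_minus[OF ring_axioms, of y x] a_repr_independence'[of x y] a_rcos_self[of x] by blast

lemma \<pi>_mem: "x \<in> carrier A ==> y \<in> \<pi> x ==> y \<in> carrier A \<and> y \<ominus> x \<in> I"
 using a_rcos_module_minus[OF ring_axioms, of x y] a_elemrcos_carrier[of x y] by blast

lemma union_coset:
 assumes x: "x \<in> carrier A" and L: "\<And>y. y \<in> carrier A ==> L y \<in> carrier A"
  and d: "\<And>y. y \<in> carrier A ==> y \<ominus> x \<in> I ==> L y \<ominus> L x \<in> I"
 shows "(\<Union>y\<in>\<pi> x. \<pi> (L y)) = \<pi> (L x)"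
proof -
 have "\<pi> (L y) = \<pi> (L x)" if "y \<in> \<pi> x" for y
  using \<pi>_mem[OF x that] d L x by (subst \<pi>_eq_iff) auto
 then have "(\<Union>y\<in>\<pi> x. \<pi> (L y)) = (\<Union>y\<in>\<pi> x. \<pi> (L x))" by (rule SUP_cong[OF refl])
 also have "\<dots> = \<pi> (L x)" by (rule UN_constant_eq[OF a_rcos_self[OF x]]) simp
 finally show ?thesis .
qed

lemma smul_I: "x \<in> I ==> c \<odot> x \<in> I"
 using I_l_closed[of x "c \<odot> \<one>"] csmul_mult_left[of \<one> x c] Icarr[of x] by simp

lemma Q_smul: "x \<in> carrier A ==> c \<odot>\<^sub>Q \<pi> x = \<pi> (c \<odot> x)"
 unfolding Q_simps by (rule union_coset) (simp_all add: csmul_sub[symmetric] smul_I)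

lemma Q_alg: "complex_algebra Q"
proof -
 have eq: "carrier Q = carrier (A Quot I)" "monoid.mult Q = monoid.mult (A Quot I)" "one Q = one (A Quot I)"
  "add Q = add (A Quot I)" "zero Q = zero (A Quot I)"
  by (simp_all add: quot_algebra_def)
 have "ring Q \<longleftrightarrow> ring (A Quot I)"
  unfolding ring_def abelian_group_def abelian_monoid_def abelian_group_axioms_def ring_axioms_def
   comm_group_def comm_monoid_def comm_monoid_axioms_def group_def group_axioms_def monoid_def Units_def
  by (simp only: partial_object.simps monoid.simps eq)
 then have r: "ring Q" using quotient_is_ring by blast
 then have ag: "abelian_group Q" by (simp add: ring_def)
 have "Module.module (scalars :: (complex, complex) tmodule) Q"
  by (intro moduleI cring_scalars ag)
   (auto simp: Q_simps(1) Q_smul Q_add csmul_add_left csmul_add_right csmul_csmul)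
 then show ?thesis using r
  by (auto simp: complex_algebra_def Q_simps(1) Q_smul Q_mult csmul_mult_left csmul_mult_right)
qed

lemma openin_Q: "openin (topol Q) W \<longleftrightarrow> W \<subseteq> \<pi> ` carrier A \<and> openin (topol A) {x \<in> carrier A. \<pi> x \<in> W}"
 using Q_simps(1) by (simp add: Q_simps(4) openin_quot_topology topspace_B quot_algebra_def)

lemma Q_top: "topspace (topol Q) = \<pi> ` carrier A"
proof -
 have "openin (topol Q) (\<pi> ` carrier A)"
  unfolding openin_Q using openin_topspace[of "topol A"] by (simp add: topspace_B cong: conj_cong)
 then show ?thesis using openin_subset openin_topspace[of "topol Q"] openin_Q by blast
qed

lemma \<pi>_surj: "\<pi> ` topspace (topol A) = topspace (topol Q)"
 by (simp add: Q_top topspace_B)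

lemma \<pi>_cont: "continuous_map (topol A) (topol Q) \<pi>"
 unfolding continuous_map using \<pi>_surj by (auto simp: openin_Q topspace_B)

lemma \<pi>_open: "open_map (topol A) (topol Q) \<pi>"
 unfolding open_map_def
proof (intro allI impI)
 fix S assume S: "openin (topol A) S"
 have Sc: "S \<subseteq> carrier A" using openin_subset[OF S] topspace_B by simp
 have "{x \<in> carrier A. \<pi> x \<in> \<pi> ` S} = (\<Union>i\<in>I. {x \<in> topspace (topol A). x \<ominus> i \<in> S})"
 proof (intro equalityI subsetI)
  fix x assume "x \<in> {x \<in> carrier A. \<pi> x \<in> \<pi> ` S}"
  then obtain s where s: "x \<in> carrier A" "s \<in> S" "\<pi> x = \<pi> s" by blast
  have sc: "s \<in> carrier A" using s Sc by blast
  have "x \<ominus> s \<in> I" using \<pi>_eq_iff[OF s(1) sc] s(3) by simp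
  moreover have "x \<ominus> (x \<ominus> s) = s" using s(1) sc
   by (simp add: a_minus_def minus_add r_neg r_neg2 a_ac)
  ultimately show "x \<in> (\<Union>i\<in>I. {x \<in> topspace (topol A). x \<ominus> i \<in> S})"
   using s topspace_B by (intro UN_I[of "x \<ominus> s"]) auto
 next
  fix x assume "x \<in> (\<Union>i\<in>I. {x \<in> topspace (topol A). x \<ominus> i \<in> S})"
  then obtain i where i: "i \<in> I" "x \<in> carrier A" "x \<ominus> i \<in> S" using topspace_B by auto
  have ic: "i \<in> carrier A" using i(1) by (rule Icarr)
  have "x \<ominus> (x \<ominus> i) = i" using i(2) ic by (simp add: a_minus_def minus_add r_neg r_neg2 a_ac)
  then have "\<pi> x = \<pi> (x \<ominus> i)" using \<pi>_eq_iff[of x "x \<ominus> i"] i ic by simp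
  then show "x \<in> {x \<in> carrier A. \<pi> x \<in> \<pi> ` S}" using i by auto
 qed
 moreover have "openin (topol A) {x \<in> topspace (topol A). x \<ominus> i \<in> S}" if "i \<in> I" for i
  using openin_continuous_map_preimage[of "topol A" "topol A" "\<lambda>x. x \<ominus> i" S] R.continuous_translate[of i] S Icarr[OF that] by simp
 then have "openin (topol A) (\<Union>i\<in>I. {x \<in> topspace (topol A). x \<ominus> i \<in> S})" by blast
 ultimately have "openin (topol A) {x \<in> carrier A. \<pi> x \<in> \<pi> ` S}" by simp
 then show "openin (topol Q) (\<pi> ` S)" unfolding openin_Q using Sc by blast
qed

text \<open>The projection is open, hence continuity of the operations descends to the quotient; it is
  Hausdorff because the ideal is closed.\<close>

lemma lc_algebra_Q: "lc_algebra Q"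
proof -
 interpret Q: calg Q by (rule calg.intro[OF Q_alg])
 have add: "continuous_map (prod_topology (topol Q) (topol Q)) (topol Q) (\<lambda>(x, y). x \<oplus>\<^sub>Q y)"
 proof (rule continuous_map_open_quotients[OF \<pi>_open \<pi>_surj \<pi>_open \<pi>_surj])
  have "continuous_map (prod_topology (topol A) (topol A)) (topol Q) (\<pi> \<circ> (\<lambda>(x, y). x \<oplus> y))"
   by (rule continuous_map_compose[OF _ \<pi>_cont]) (use R.cont_add in simp)
  then show "continuous_map (prod_topology (topol A) (topol A)) (topol Q) (\<lambda>(x, y). \<pi> x \<oplus>\<^sub>Q \<pi> y)"
   by (rule continuous_map_eq) (auto simp: topspace_B Q_add)
 qed
 have mul: "continuous_map (prod_topology (topol Q) (topol Q)) (topol Q) (\<lambda>(x, y). x \<otimes>\<^sub>Q y)"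
 proof (rule continuous_map_open_quotients[OF \<pi>_open \<pi>_surj \<pi>_open \<pi>_surj])
  have "continuous_map (prod_topology (topol A) (topol A)) (topol Q) (\<pi> \<circ> (\<lambda>(x, y). x \<otimes> y))"
   by (rule continuous_map_compose[OF cont_mult \<pi>_cont])
  then show "continuous_map (prod_topology (topol A) (topol A)) (topol Q) (\<lambda>(x, y). \<pi> x \<otimes>\<^sub>Q \<pi> y)"
   by (rule continuous_map_eq) (auto simp: topspace_B Q_mult)
 qed
 have smul: "continuous_map (prod_topology euclidean (topol Q)) (topol Q) (\<lambda>(c, x). c \<odot>\<^sub>Q x)"
 proof (rule continuous_map_open_quotients[where P = "\<lambda>c. c", OF _ _ \<pi>_open \<pi>_surj])
  have "continuous_map (prod_topology euclidean (topol A)) (topol Q) (\<pi> \<circ> (\<lambda>(c, x). c \<odot> x))"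
   by (rule continuous_map_compose[OF cont_csmul \<pi>_cont])
  then show "continuous_map (prod_topology euclidean (topol A)) (topol Q) (\<lambda>(c, x). c \<odot>\<^sub>Q \<pi> x)"
   by (rule continuous_map_eq) (auto simp: topspace_B Q_smul)
 qed (auto simp: open_map_def)
 have haus: "Hausdorff_space (topol Q)"
  unfolding Hausdorff_space_def
 proof (intro allI impI)
  fix X Y assume "X \<in> topspace (topol Q) \<and> Y \<in> topspace (topol Q) \<and> X \<noteq> Y"
  then obtain x y where xy: "x \<in> carrier A" "y \<in> carrier A" "X = \<pi> x" "Y = \<pi> y" "X \<noteq> Y" using Q_top by auto
  then have "x \<ominus> y \<notin> I" using \<pi>_eq_iff by blast
  have c: "continuous_map (prod_topology (topol A) (topol A)) (topol A) (\<lambda>z. fst z \<ominus> snd z)"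
   using R.continuous_sub[of "prod_topology (topol A) (topol A)" fst snd] continuous_map_fst[of "topol A" "topol A"] continuous_map_snd[of "topol A" "topol A"] by simp
  have o: "openin (topol A) (carrier A - I)" using closed topspace_B by (simp add: closedin_def)
  let ?D = "{z \<in> topspace (prod_topology (topol A) (topol A)). fst z \<ominus> snd z \<in> carrier A - I}"
  have "openin (prod_topology (topol A) (topol A)) ?D" by (rule openin_continuous_map_preimage[OF c o])
  moreover have "(x, y) \<in> ?D" using xy \<open>x \<ominus> y \<notin> I\<close> topspace_B by simp
  ultimately obtain S T where ST: "openin (topol A) S" "openin (topol A) T" "x \<in> S" "y \<in> T" "S \<times> T \<subseteq> ?D"
   unfolding openin_prod_topology_alt by meson
  have "disjnt (\<pi> ` S) (\<pi> ` T)"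
   unfolding disjnt_iff
  proof (intro allI notI, elim conjE imageE)
   fix Z s t assume st: "Z = \<pi> s" "s \<in> S" "Z = \<pi> t" "t \<in> T"
   have "s \<in> carrier A" "t \<in> carrier A" using st openin_subset ST(1,2) topspace_B by blast+
   then have "s \<ominus> t \<in> I" using st(1,3) \<pi>_eq_iff[of s t] by metis
   then show False using subsetD[OF ST(5) SigmaI[OF st(2,4)]] by simp
  qed
  moreover have "openin (topol Q) (\<pi> ` S)" "openin (topol Q) (\<pi> ` T)" using \<pi>_open ST by (auto simp: open_map_def)
  ultimately show "\<exists>U V. openin (topol Q) U \<and> openin (topol Q) V \<and> X \<in> U \<and> Y \<in> V \<and> disjnt U V"
   using ST xy by blast
 qed
 have conv: "\<exists>V. openin (topol Q) V \<and> \<zero>\<^sub>Q \<in> V \<and> V \<subseteq> W \<and>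
   (\<forall>x\<in>V. \<forall>y\<in>V. \<forall>t::real. 0 \<le> t \<and> t \<le> 1 --> (of_real (1 - t) \<odot>\<^sub>Q x) \<oplus>\<^sub>Q (of_real t \<odot>\<^sub>Q y) \<in> V)"
  if W: "openin (topol Q) W \<and> \<zero>\<^sub>Q \<in> W" for W
 proof -
  have z: "\<zero>\<^sub>Q = \<pi> \<zero>" using a_coset_join2[of \<zero>] by (simp add: Q_simps(2) a_subgroup)
  have "openin (topol A) {x \<in> carrier A. \<pi> x \<in> W}" "\<zero> \<in> {x \<in> carrier A. \<pi> x \<in> W}"
   using W z by (auto simp: openin_Q)
  then obtain V where V: "openin (topol A) V" "\<zero> \<in> V" "V \<subseteq> {x \<in> carrier A. \<pi> x \<in> W}"
   "\<forall>x\<in>V. \<forall>y\<in>V. \<forall>t::real. 0 \<le> t \<and> t \<le> 1 --> (of_real (1 - t) \<odot> x) \<oplus> (of_real t \<odot> y) \<in> V"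
   using lca unfolding lc_algebra_def lc_space_def by meson
  have "(of_real (1 - t) \<odot>\<^sub>Q X) \<oplus>\<^sub>Q (of_real t \<odot>\<^sub>Q Y) \<in> \<pi> ` V"
   if XY: "X \<in> \<pi> ` V" "Y \<in> \<pi> ` V" and t: "0 \<le> t \<and> t \<le> 1" for X Y and t :: real
  proof -
   obtain x y where xy: "x \<in> V" "y \<in> V" "X = \<pi> x" "Y = \<pi> y" using XY by blast
   have "x \<in> carrier A" "y \<in> carrier A" using xy V(3) by auto
   then have "(of_real (1 - t) \<odot>\<^sub>Q X) \<oplus>\<^sub>Q (of_real t \<odot>\<^sub>Q Y) = \<pi> ((of_real (1 - t) \<odot> x) \<oplus> (of_real t \<odot> y))"
    by (simp add: xy Q_smul Q_add)
   then show ?thesis using V(4) xy t by blast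
  qed
  moreover have "openin (topol Q) (\<pi> ` V)" using \<pi>_open V(1) by (simp add: open_map_def)
  moreover have "\<zero>\<^sub>Q \<in> \<pi> ` V" "\<pi> ` V \<subseteq> W" using z V by auto
  ultimately show ?thesis by (intro exI[of _ "\<pi> ` V"]) blast
 qed
 have top: "topspace (topol Q) = carrier Q" by (simp add: Q_top Q_simps(1))
 have "lc_space Q"
  unfolding lc_space_def using Q.cmod top haus add smul conv by blast
 then show ?thesis unfolding lc_algebra_def using Q_alg mul by blast
qed

lemma dynamical_system_Q:
 assumes ds: "dynsys G A \<gamma>" and inv: "\<And>g x. g \<in> carrier G ==> x \<in> I ==> \<gamma> g x \<in> I"
 defines "\<delta> \<equiv> (\<lambda>g X. \<Union>f\<in>X. \<pi> (\<gamma> g f))"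
 shows "dynamical_system G Q \<delta>" and "\<And>g x. g \<in> carrier G ==> x \<in> carrier A ==> \<delta> g (\<pi> x) = \<pi> (\<gamma> g x)"
proof -
 interpret D: dynsys G A \<gamma> by fact
 show \<delta>: "\<delta> g (\<pi> x) = \<pi> (\<gamma> g x)" if g: "g \<in> carrier G" and x: "x \<in> carrier A" for g x
  unfolding \<delta>_def
  by (rule union_coset) (use g x inv[OF g] alg_hom_sub[OF calg_axioms calg_axioms D.hom[OF g], symmetric] in auto)
 show "dynamical_system G Q \<delta>"
 proof (rule D.dynamical_systemI[OF lc_algebra_Q])
  show "\<delta> g \<in> alg_hom Q Q" if g: "g \<in> carrier G" for g
   using alg_homD[OF D.hom[OF g]] by (auto simp: alg_hom_def Q_simps(1) \<delta>[OF g] Q_add Q_mult Q_smul)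
  show "\<delta> \<one>\<^sub>G X = X" if "X \<in> carrier Q" for X
   using that by (auto simp: Q_simps(1) \<delta> D.act_one)
  show "\<delta> (g \<otimes>\<^sub>G h) X = \<delta> g (\<delta> h X)" if "g \<in> carrier G" "h \<in> carrier G" "X \<in> carrier Q" for g h X
   using that by (auto simp: Q_simps(1) \<delta> D.act_mult)
  show "continuous_map (prod_topology (mtop (mfd_of G)) (topol Q)) (topol Q) (\<lambda>(g, X). \<delta> g X)"
  proof (rule continuous_map_open_quotients[where P = "\<lambda>g. g", OF _ _ \<pi>_open \<pi>_surj])
   have "continuous_map (prod_topology (mtop (mfd_of G)) (topol A)) (topol Q) (\<pi> \<circ> (\<lambda>(g, x). \<gamma> g x))"
    by (rule continuous_map_compose[OF D.act_cont \<pi>_cont])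
   then show "continuous_map (prod_topology (mtop (mfd_of G)) (topol A)) (topol Q) (\<lambda>(g, x). \<delta> g (\<pi> x))"
    by (rule continuous_map_eq) (auto simp: topspace_B D.top \<delta>)
  qed (auto simp: open_map_def)
 qed
qed

end

section \<open>Sections of algebra bundles\<close>

lemma smooth_map_id: "smooth_manifold M ==> smooth_map M M (\<lambda>x. x)"
proof (rule smooth_mapI)
 assume M: "smooth_manifold M"
 show "continuous_map (mtop M) (mtop M) (\<lambda>x. x)" using continuous_map_id[of "mtop M"] by (simp add: id_def)
 fix U \<phi> V \<psi> assume "(U, \<phi>) \<in> atlas M" "(V, \<psi>) \<in> atlas M"
 then have "smooth_on (model M) (model M) (\<phi> ` (U \<inter> V)) (\<psi> \<circ> inv_into U \<phi>)"
  using M unfolding smooth_manifold_def by fast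
 then show "smooth_on (model M) (model M) (\<phi> ` {x \<in> U. x \<in> V}) (\<psi> \<circ> (\<lambda>x. x) \<circ> inv_into U \<phi>)"
  by (simp add: Int_def o_def)
qed

locale alg_bundle =
 fixes A :: "(complex, 'a) tmodule" and M :: "('p, nat => real) mfd" and I :: "'i set" and U :: "'i => 'p set"
  and E :: "('p, 'a, 'e, 'w, 'i) fibre_bundle"
 assumes lcA: "lc_algebra A" and M: "smooth_manifold M"
  and Uo: "\<And>i. i \<in> I ==> openin (mtop M) (U i)" and cov: "(\<Union>i\<in>I. U i) = topspace (mtop M)"
  and bun: "algebra_bundle A M I U E"
begin

sublocale A: lcalg A using lcA by (rule lcalg.intro)

abbreviation X where "X \<equiv> topspace (mtop M)"
abbreviation N where "N i \<equiv> open_submfd M (U i)"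
abbreviation rep where "rep \<equiv> local_rep A U E"
abbreviation \<Gamma> where "\<Gamma> \<equiv> section_algebra A M I U E"
abbreviation D where "D i \<equiv> Cinf (N i) A"

lemma charted_M: "charted M" by (rule charted_smooth_manifold[OF M])
lemma charted_E: "charted (total E)" using bun by (intro charted_smooth_manifold) (simp add: algebra_bundle_def)
lemma charted_N: "i \<in> I ==> charted (N i)" by (rule charted_open_submfd[OF charted_M Uo])
lemma charted_A: "charted (alg_mfd A)" by (rule charted_space_mfd[OF A.R.rlc_axioms])
lemma charted_NA: "i \<in> I ==> charted (prod_mfd (N i) (alg_mfd A))"
 by (rule charted_prod_mfd[OF charted_N charted_A])
lemma U_sub: "i \<in> I ==> U i \<subseteq> X" using openin_subset[OF Uo] .
lemma U_ex: "x \<in> X ==> \<exists>i\<in>I. x \<in> U i" using cov by blast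
lemma topN: "i \<in> I ==> topspace (mtop (N i)) = U i" using U_sub by auto
lemma SF: "i \<in> I ==> smooth_functions (N i) A"
 using charted_N lcA by (simp add: smooth_functions_def cmfd_def lcalg_def)

lemma fibre_alg: "x \<in> X ==> complex_algebra (fibre E x)"
 and fibre_carrier: "x \<in> X ==> carrier (fibre E x) = over E {x}"
 and proj_smooth: "smooth_map (total E) M (proj E)"
 using bun by (simp_all add: algebra_bundle_def)

lemma fibre_calg: "x \<in> X ==> calg (fibre E x)" using fibre_alg by (rule calg.intro)

lemma chart_diffeo: "i \<in> I ==> diffeomorphism (prod_mfd (N i) (alg_mfd A)) (open_submfd (total E) (over E (U i))) (chart E i)"
 and chart_proj: "i \<in> I ==> x \<in> U i ==> a \<in> carrier A ==> proj E (chart E i (x, a)) = x"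
 and chart_iso: "i \<in> I ==> x \<in> U i ==> (\<lambda>a. chart E i (x, a)) \<in> alg_iso A (fibre E x)"
 using bun by (simp_all add: algebra_bundle_def)

lemma over_sub: "over E W \<subseteq> topspace (mtop (total E))" by (auto simp: over_def)

lemma top_NA: "i \<in> I ==> topspace (mtop (prod_mfd (N i) (alg_mfd A))) = U i \<times> carrier A"
 using topN[of i] by (simp add: prod_mfd_def A.topspace_B)

lemma top_over: "topspace (mtop (open_submfd (total E) (over E W))) = over E W"
 using over_sub by auto

lemma open_over: "i \<in> I ==> openin (mtop (total E)) (over E (U i))"
 unfolding over_def by (rule openin_continuous_map_preimage[OF smooth_mapD(1)[OF proj_smooth] Uo])

lemma chart_bij: "i \<in> I ==> bij_betw (chart E i) (U i \<times> carrier A) (over E (U i))"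
 using chart_diffeo[of i] top_over[of "U i"] unfolding diffeomorphism_def by (simp only: top_NA)

lemma chart_smooth: "i \<in> I ==> smooth_map (prod_mfd (N i) (alg_mfd A)) (open_submfd (total E) (over E (U i))) (chart E i)"
 using chart_diffeo unfolding diffeomorphism_def by blast

lemma chart_inv_smooth: "i \<in> I ==> smooth_map (open_submfd (total E) (over E (U i))) (prod_mfd (N i) (alg_mfd A)) (chart_inv A U E i)"
 using chart_diffeo[of i] top_NA[of i] unfolding diffeomorphism_def chart_inv_def by simp

lemma chart_hom: "i \<in> I ==> x \<in> U i ==> (\<lambda>a. chart E i (x, a)) \<in> alg_hom A (fibre E x)"
 using chart_iso by (simp add: alg_iso_def)

lemmas chart_homD = alg_homD[OF chart_hom]

lemma chart_one: "i \<in> I ==> x \<in> U i ==> chart E i (x, \<one>\<^sub>A) = \<one>\<^bsub>fibre E x\<^esub>"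
 using alg_iso_one[OF A.calg_axioms fibre_calg chart_iso] U_sub by blast

lemma chart_zero: "i \<in> I ==> x \<in> U i ==> chart E i (x, \<zero>\<^sub>A) = \<zero>\<^bsub>fibre E x\<^esub>"
 using alg_hom_zero[OF A.calg_axioms fibre_calg chart_hom] U_sub by blast

lemma chart_inv_chart: "i \<in> I ==> x \<in> U i ==> a \<in> carrier A ==> chart_inv A U E i (chart E i (x, a)) = (x, a)"
 unfolding chart_inv_def by (rule inv_into_f_f[OF bij_betw_imp_inj_on[OF chart_bij]]) auto

lemma chart_ex:
 assumes i: "i \<in> I" and x: "x \<in> U i" and e: "e \<in> carrier (fibre E x)"
 shows "\<exists>a\<in>carrier A. e = chart E i (x, a)"
proof -
 have "e \<in> (\<lambda>a. chart E i (x, a)) ` carrier A"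
  using chart_iso[OF i x] e by (simp add: alg_iso_def bij_betw_def)
 then show ?thesis by blast
qed

lemma rep_chart: "i \<in> I ==> x \<in> U i ==> a \<in> carrier A ==> s x = chart E i (x, a) ==> rep i s x = a"
 by (simp add: local_rep_def chart_inv_chart)

lemma sections_val: "s \<in> sections M E ==> x \<in> X ==> s x \<in> carrier (fibre E x)"
 using continuous_map_image_subset_topspace[OF smooth_mapD(1)[of M "total E" s]]
 by (auto simp: sections_def fibre_carrier over_def)

lemma rep_eq:
 assumes i: "i \<in> I" and x: "x \<in> U i" and s: "s \<in> sections M E"
 shows "rep i s x \<in> carrier A" "s x = chart E i (x, rep i s x)"
proof -
 have "s x \<in> carrier (fibre E x)" using sections_val[OF s] U_sub[OF i] x by blast
 then obtain a where a: "a \<in> carrier A" "s x = chart E i (x, a)" using chart_ex[OF i x] by blast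
 show "rep i s x \<in> carrier A" "s x = chart E i (x, rep i s x)" using rep_chart[of i x a s] i x a by auto
qed

lemma sections_ext: "s \<in> sections M E ==> s \<in> extensional X"
 by (simp add: sections_def)

lemma section_rep:
 assumes s: "s \<in> sections M E" and i: "i \<in> I"
 shows "rep i s \<in> carrier (D i)"
proof -
 have sm: "smooth_map M (total E) s" using s by (simp add: sections_def)
 have 1: "smooth_map (N i) (open_submfd (total E) (over E (U i))) s"
 proof (rule smooth_map_into_submfd[OF charted_N[OF i] charted_E open_over[OF i] smooth_map_restrict[OF charted_M charted_E sm Uo[OF i]]])
  fix x assume "x \<in> topspace (mtop (N i))"
  then have x: "x \<in> U i" "x \<in> X" by auto
  then show "s x \<in> over E (U i)" using sections_val[OF s x(2)] fibre_carrier[OF x(2)] by (auto simp: over_def)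
 qed
 have 2: "smooth_map (N i) (prod_mfd (N i) (alg_mfd A)) (\<lambda>x. chart_inv A U E i (s x))"
  by (rule smooth_map_compose[OF charted_N[OF i] charted_open_submfd[OF charted_E open_over[OF i]] charted_NA[OF i] 1 chart_inv_smooth[OF i]])
 have 3: "smooth_map (N i) (alg_mfd A) (\<lambda>x. snd (chart_inv A U E i (s x)))"
  by (rule smooth_map_snd[OF charted_N[OF i] charted_N[OF i] A.R.rlc_axioms 2])
 have "rep i s = restrict (\<lambda>x. snd (chart_inv A U E i (s x))) (topspace (mtop (N i)))"
  unfolding local_rep_def topN[OF i] ..
 then show ?thesis using smooth_functions.restrict_in_C[OF SF[OF i] 3] by simp
qed

text \<open>Smoothness is tested in bundle charts on sets that may be smaller than the \<open>U i\<close>: a section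
  cut off inside \<open>U i\<close> is the zero section on open sets that overlap \<open>U i\<close>.\<close>

lemma section_localI:
 assumes ext: "s \<in> extensional X"
  and loc: "\<And>x. x \<in> X ==> \<exists>W i u. openin (mtop M) W \<and> x \<in> W \<and> i \<in> I \<and> W \<subseteq> U i \<and>
   smooth_map (open_submfd M W) (alg_mfd A) u \<and> (\<forall>y\<in>W. s y = chart E i (y, u y))"
 shows "s \<in> sections M E"
proof -
 have *: "smooth_map (open_submfd M W) (total E) s" "\<And>y. y \<in> W ==> proj E (s y) = y"
  if W: "openin (mtop M) W" and i: "i \<in> I" and sub: "W \<subseteq> U i" and u: "smooth_map (open_submfd M W) (alg_mfd A) u"
   and s: "\<forall>y\<in>W. s y = chart E i (y, u y)" for W i u
 proof -
  note cW = charted_open_submfd[OF charted_M W]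
  have tW: "topspace (mtop (open_submfd M W)) = W" using openin_subset[OF W] by auto
  have uc: "u y \<in> carrier A" if "y \<in> W" for y
   using smooth_map_spaceD(1)[OF cW A.R.rlc_axioms u, unfolded tW, OF that] by simp
  have 1: "smooth_map (open_submfd M W) (N i) (\<lambda>y. y)"
   by (rule smooth_map_into_submfd[OF cW charted_M Uo[OF i] smooth_map_restrict[OF charted_M charted_M smooth_map_id[OF M] W]])
    (use sub in auto)
  have 2: "smooth_map (open_submfd M W) (prod_mfd (N i) (alg_mfd A)) (\<lambda>y. (y, u y))"
   by (rule smooth_map_pair[OF cW charted_N[OF i] charted_A 1 u])
  have 3: "smooth_map (open_submfd M W) (open_submfd (total E) (over E (U i))) (\<lambda>y. chart E i (y, u y))"
   by (rule smooth_map_compose[OF cW charted_NA[OF i] charted_open_submfd[OF charted_E open_over[OF i]] 2 chart_smooth[OF i]])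
  have 4: "smooth_map (open_submfd M W) (total E) (\<lambda>y. chart E i (y, u y))"
   by (rule smooth_map_from_submfd[OF cW 3])
  show "smooth_map (open_submfd M W) (total E) s"
   by (rule smooth_map_cong[OF cW charted_E 4]) (use tW s in auto)
  show "proj E (s y) = y" if "y \<in> W" for y using chart_proj[OF i, of y "u y"] uc[OF that] s sub that by auto
 qed
 have "smooth_map M (total E) s"
 proof (rule smooth_map_local[OF charted_M charted_E])
  fix x assume "x \<in> X"
  from loc[OF this] obtain W i u where W: "openin (mtop M) W" "x \<in> W" "i \<in> I" "W \<subseteq> U i"
   "smooth_map (open_submfd M W) (alg_mfd A) u" "\<forall>y\<in>W. s y = chart E i (y, u y)" by blast
  then show "\<exists>W. openin (mtop M) W \<and> x \<in> W \<and> smooth_map (open_submfd M W) (total E) s" using *(1)[of W i u] by blast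
 qed
 moreover have "proj E (s x) = x" if x: "x \<in> X" for x
 proof -
  from loc[OF x] obtain W i u where W: "openin (mtop M) W" "x \<in> W" "i \<in> I" "W \<subseteq> U i"
   "smooth_map (open_submfd M W) (alg_mfd A) u" "\<forall>y\<in>W. s y = chart E i (y, u y)" by blast
  then show ?thesis using *(2)[of W i u x] by blast
 qed
 ultimately show ?thesis using ext by (simp add: sections_def)
qed

lemma sectionI:
 assumes ext: "s \<in> extensional X"
  and loc: "\<And>i. i \<in> I ==> \<exists>u\<in>carrier (D i). \<forall>x\<in>U i. s x = chart E i (x, u x)"
 shows "s \<in> sections M E"
proof (rule section_localI[OF ext])
 fix x assume "x \<in> X"
 then obtain i where i: "i \<in> I" "x \<in> U i" using U_ex by blast
 obtain u where u: "u \<in> carrier (D i)" "\<forall>x\<in>U i. s x = chart E i (x, u x)" using loc[OF i(1)] by blast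
 have "smooth_map (N i) (alg_mfd A) u" using u(1) smooth_functions.in_C[OF SF[OF i(1)]] by blast
 then show "\<exists>W i u. openin (mtop M) W \<and> x \<in> W \<and> i \<in> I \<and> W \<subseteq> U i \<and>
   smooth_map (open_submfd M W) (alg_mfd A) u \<and> (\<forall>y\<in>W. s y = chart E i (y, u y))"
  using Uo[OF i(1)] i u(2) by blast
qed

lemma section_simps:
 "carrier \<Gamma> = sections M E" "topol \<Gamma> = section_topology A M I U E"
 "s \<oplus>\<^sub>\<Gamma> t = (\<lambda>x\<in>X. s x \<oplus>\<^bsub>fibre E x\<^esub> t x)" "s \<otimes>\<^sub>\<Gamma> t = (\<lambda>x\<in>X. s x \<otimes>\<^bsub>fibre E x\<^esub> t x)"
 "c \<odot>\<^sub>\<Gamma> s = (\<lambda>x\<in>X. c \<odot>\<^bsub>fibre E x\<^esub> s x)" "\<zero>\<^sub>\<Gamma> = (\<lambda>x\<in>X. \<zero>\<^bsub>fibre E x\<^esub>)" "\<one>\<^sub>\<Gamma> = (\<lambda>x\<in>X. \<one>\<^bsub>fibre E x\<^esub>)"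
 by (simp_all add: section_algebra_def)

lemma section_eqI: "s \<in> extensional X ==> t \<in> extensional X ==> (\<And>x. x \<in> X ==> s x = t x) ==> s = t"
 by (rule extensionalityI)

lemma D_ops:
 assumes i: "i \<in> I"
 shows "x \<in> U i ==> (f \<oplus>\<^bsub>D i\<^esub> h) x = f x \<oplus>\<^sub>A h x" "x \<in> U i ==> (f \<otimes>\<^bsub>D i\<^esub> h) x = f x \<otimes>\<^sub>A h x"
  "x \<in> U i ==> (c \<odot>\<^bsub>D i\<^esub> f) x = c \<odot>\<^sub>A f x" "x \<in> U i ==> \<zero>\<^bsub>D i\<^esub> x = \<zero>\<^sub>A" "x \<in> U i ==> \<one>\<^bsub>D i\<^esub> x = \<one>\<^sub>A"
 using topN[OF i] by (simp_all add: Cinf_def)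

lemma section_ops_local:
 assumes i: "i \<in> I" and x: "x \<in> U i" and s: "s \<in> sections M E" and t: "t \<in> sections M E"
 shows "(s \<oplus>\<^sub>\<Gamma> t) x = chart E i (x, (rep i s \<oplus>\<^bsub>D i\<^esub> rep i t) x)"
  and "(s \<otimes>\<^sub>\<Gamma> t) x = chart E i (x, (rep i s \<otimes>\<^bsub>D i\<^esub> rep i t) x)"
  and "(c \<odot>\<^sub>\<Gamma> s) x = chart E i (x, (c \<odot>\<^bsub>D i\<^esub> rep i s) x)"
proof -
 have xX: "x \<in> X" using U_sub[OF i] x by blast
 note rs = rep_eq[OF i x s] and rt = rep_eq[OF i x t]
 have "chart E i (x, rep i s x \<oplus>\<^sub>A rep i t x) = s x \<oplus>\<^bsub>fibre E x\<^esub> t x"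
  using chart_homD(2)[OF i x rs(1) rt(1)] rs(2) rt(2) by simp
 then show "(s \<oplus>\<^sub>\<Gamma> t) x = chart E i (x, (rep i s \<oplus>\<^bsub>D i\<^esub> rep i t) x)"
  by (simp only: D_ops[OF i x] section_simps restrict_apply' xX)
 have "chart E i (x, rep i s x \<otimes>\<^sub>A rep i t x) = s x \<otimes>\<^bsub>fibre E x\<^esub> t x"
  using chart_homD(3)[OF i x rs(1) rt(1)] rs(2) rt(2) by simp
 then show "(s \<otimes>\<^sub>\<Gamma> t) x = chart E i (x, (rep i s \<otimes>\<^bsub>D i\<^esub> rep i t) x)"
  by (simp only: D_ops[OF i x] section_simps restrict_apply' xX)
 have "chart E i (x, c \<odot>\<^sub>A rep i s x) = c \<odot>\<^bsub>fibre E x\<^esub> s x"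
  using chart_homD(4)[OF i x rs(1)] rs(2) by simp
 then show "(c \<odot>\<^sub>\<Gamma> s) x = chart E i (x, (c \<odot>\<^bsub>D i\<^esub> rep i s) x)"
  by (simp only: D_ops[OF i x] section_simps restrict_apply' xX)
qed

lemma section_closed:
 "\<zero>\<^sub>\<Gamma> \<in> carrier \<Gamma>" "\<one>\<^sub>\<Gamma> \<in> carrier \<Gamma>"
 "s \<in> carrier \<Gamma> ==> t \<in> carrier \<Gamma> ==> s \<oplus>\<^sub>\<Gamma> t \<in> carrier \<Gamma>"
 "s \<in> carrier \<Gamma> ==> t \<in> carrier \<Gamma> ==> s \<otimes>\<^sub>\<Gamma> t \<in> carrier \<Gamma>"
 "s \<in> carrier \<Gamma> ==> c \<odot>\<^sub>\<Gamma> s \<in> carrier \<Gamma>"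
proof -
 note cl = smooth_functions.C_closed[OF SF]
 show "\<zero>\<^sub>\<Gamma> \<in> carrier \<Gamma>" unfolding section_simps(1)
 proof (rule sectionI)
  fix i assume i: "i \<in> I"
  show "\<exists>u\<in>carrier (D i). \<forall>x\<in>U i. \<zero>\<^sub>\<Gamma> x = chart E i (x, u x)"
   by (rule bexI[OF _ cl(1)[OF i]]) (use U_sub[OF i] chart_zero[OF i] in \<open>auto simp: D_ops[OF i] section_simps\<close>)
 qed (simp add: section_simps)
 show "\<one>\<^sub>\<Gamma> \<in> carrier \<Gamma>" unfolding section_simps(1)
 proof (rule sectionI)
  fix i assume i: "i \<in> I"
  show "\<exists>u\<in>carrier (D i). \<forall>x\<in>U i. \<one>\<^sub>\<Gamma> x = chart E i (x, u x)"
   by (rule bexI[OF _ cl(2)[OF i]]) (use U_sub[OF i] chart_one[OF i] in \<open>auto simp: D_ops[OF i] section_simps\<close>)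
 qed (simp add: section_simps)
 show "s \<oplus>\<^sub>\<Gamma> t \<in> carrier \<Gamma>" if "s \<in> carrier \<Gamma>" "t \<in> carrier \<Gamma>"
 proof -
  note st = that[unfolded section_simps(1)]
  show ?thesis unfolding section_simps(1)
  proof (rule sectionI)
   fix i assume i: "i \<in> I"
   show "\<exists>u\<in>carrier (D i). \<forall>x\<in>U i. (s \<oplus>\<^sub>\<Gamma> t) x = chart E i (x, u x)"
    by (rule bexI[OF _ cl(3)[OF i section_rep[OF st(1) i] section_rep[OF st(2) i]]]) (rule ballI, rule section_ops_local(1)[OF i _ st])
  qed (simp add: section_simps)
 qed
 show "s \<otimes>\<^sub>\<Gamma> t \<in> carrier \<Gamma>" if "s \<in> carrier \<Gamma>" "t \<in> carrier \<Gamma>"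
 proof -
  note st = that[unfolded section_simps(1)]
  show ?thesis unfolding section_simps(1)
  proof (rule sectionI)
   fix i assume i: "i \<in> I"
   show "\<exists>u\<in>carrier (D i). \<forall>x\<in>U i. (s \<otimes>\<^sub>\<Gamma> t) x = chart E i (x, u x)"
    by (rule bexI[OF _ cl(4)[OF i section_rep[OF st(1) i] section_rep[OF st(2) i]]]) (rule ballI, rule section_ops_local(2)[OF i _ st])
  qed (simp add: section_simps)
 qed
 show "c \<odot>\<^sub>\<Gamma> s \<in> carrier \<Gamma>" if "s \<in> carrier \<Gamma>"
 proof -
  note st = that[unfolded section_simps(1)]
  show ?thesis unfolding section_simps(1)
  proof (rule sectionI)
   fix i assume i: "i \<in> I"
   show "\<exists>u\<in>carrier (D i). \<forall>x\<in>U i. (c \<odot>\<^sub>\<Gamma> s) x = chart E i (x, u x)"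
    by (rule bexI[OF _ cl(5)[OF i section_rep[OF st i]]]) (rule ballI, rule section_ops_local(3)[OF i _ st st])
  qed (simp add: section_simps)
 qed
qed

lemma \<Gamma>_alg: "complex_algebra \<Gamma>"
proof (rule complex_algebra_pointwise[where S = X and F = "fibre E"])
 fix f assume "f \<in> carrier \<Gamma>"
 then have f: "f \<in> sections M E" by (simp only: section_simps(1))
 show "f \<in> extensional X" by (rule sections_ext[OF f])
 show "f x \<in> carrier (fibre E x)" if "x \<in> X" for x by (rule sections_val[OF f that])
qed (fact fibre_alg section_simps section_closed | rule section_closed; assumption)+

lemma rep_hom:
 assumes i: "i \<in> I" shows "rep i \<in> alg_hom \<Gamma> (D i)"
proof -
 note cl = smooth_functions.C_closed[OF SF[OF i]]
 have eqI: "rep i s = u" if u: "u \<in> carrier (D i)" and eq: "\<And>x. x \<in> U i ==> s x = chart E i (x, u x)" for s u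
 proof (rule extensionalityI[of _ "U i"])
  show "rep i s \<in> extensional (U i)" by (simp add: local_rep_def)
  show "u \<in> extensional (U i)" using u smooth_functions.in_C[OF SF[OF i]] topN[OF i] by simp
  fix x assume x: "x \<in> U i"
  then have "u x \<in> carrier A" using smooth_functions.C_val[OF SF[OF i] u, unfolded topN[OF i], OF x] by simp
  then show "rep i s x = u x" using rep_chart[of i x "u x" s] i x eq[OF x] by simp
 qed
 show ?thesis unfolding alg_hom_def mem_Collect_eq section_simps(1)
 proof (intro conjI ballI allI)
  show "rep i \<in> sections M E \<rightarrow> carrier (D i)" using section_rep[OF _ i] by blast
  fix s assume s: "s \<in> sections M E"
  show "rep i (c \<odot>\<^sub>\<Gamma> s) = c \<odot>\<^bsub>D i\<^esub> rep i s" for c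
   by (rule eqI[OF cl(5)[OF section_rep[OF s i]]]) (rule section_ops_local(3)[OF i _ s s])
  fix t assume t: "t \<in> sections M E"
  show "rep i (s \<oplus>\<^sub>\<Gamma> t) = rep i s \<oplus>\<^bsub>D i\<^esub> rep i t"
   by (rule eqI[OF cl(3)[OF section_rep[OF s i] section_rep[OF t i]]]) (rule section_ops_local(1)[OF i _ s t])
  show "rep i (s \<otimes>\<^sub>\<Gamma> t) = rep i s \<otimes>\<^bsub>D i\<^esub> rep i t"
   by (rule eqI[OF cl(4)[OF section_rep[OF s i] section_rep[OF t i]]]) (rule section_ops_local(2)[OF i _ s t])
 qed
qed

lemma rep_inj:
 assumes s: "s \<in> carrier \<Gamma>" and t: "t \<in> carrier \<Gamma>" and eq: "\<And>i. i \<in> I ==> rep i s = rep i t"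
 shows "s = t"
proof (rule section_eqI)
 note st = s[unfolded section_simps(1)] t[unfolded section_simps(1)]
 show "s \<in> extensional X" "t \<in> extensional X" using st by (simp_all add: sections_ext)
 fix x assume x: "x \<in> X"
 then obtain i where i: "i \<in> I" "x \<in> U i" using U_ex by blast
 show "s x = t x"
  using rep_eq(2)[OF i st(1)] rep_eq(2)[OF i st(2)] eq[OF i(1)] by simp
qed

lemma \<Gamma>_topol: "topol \<Gamma> = topology_generated_by (insert (carrier \<Gamma>) {{s \<in> carrier \<Gamma>. rep i s \<in> W} |i W. i \<in> I \<and> openin (topol (D i)) W})"
 by (simp add: section_simps(1,2) section_topology_def)

lemma lc_algebra_\<Gamma>: "lc_algebra \<Gamma>"
 by (rule lc_algebra_initial[where D = D and L = rep and I = I, OF \<Gamma>_alg _ rep_hom rep_inj \<Gamma>_topol])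
  (rule smooth_functions.lc_algebra_C[OF SF])

end

subsection \<open>The induced action on sections\<close>

locale alg_bundle_action = alg_bundle A M I U E + dynsys G A \<alpha>
 for A :: "(complex, 'a) tmodule" and M :: "('p, nat => real) mfd" and I :: "'i set" and U :: "'i => 'p set"
  and E :: "('p, 'a, 'e, 'w, 'i) fibre_bundle" and G :: "('g, nat => real) lie_group_rec" and \<alpha> +
 fixes \<sigma> :: "'g => 'e => 'e"
 assumes assoc: "associated_action G A \<alpha> M I U E \<sigma>"
begin

abbreviation \<beta> where "\<beta> \<equiv> section_action M \<sigma>"

lemma \<sigma>_iso: "g \<in> carrier G ==> x \<in> X ==> \<sigma> g \<in> alg_iso (fibre E x) (fibre E x)"
 and \<sigma>_chart: "g \<in> carrier G ==> i \<in> I ==> x \<in> U i ==> a \<in> carrier A ==> \<sigma> g (chart E i (x, a)) = chart E i (x, \<alpha> g a)"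
 and \<sigma>_one: "e \<in> topspace (mtop (total E)) ==> \<sigma> \<one>\<^sub>G e = e"
 and \<sigma>_mult: "e \<in> topspace (mtop (total E)) ==> g \<in> carrier G ==> h \<in> carrier G ==> \<sigma> (g \<otimes>\<^sub>G h) e = \<sigma> g (\<sigma> h e)"
 using assoc by (simp_all add: associated_action_def)

lemma \<sigma>_hom: "g \<in> carrier G ==> x \<in> X ==> \<sigma> g \<in> alg_hom (fibre E x) (fibre E x)"
 using \<sigma>_iso by (simp add: alg_iso_def)

abbreviation \<gamma> where "\<gamma> i g f \<equiv> (\<lambda>x\<in>topspace (mtop (N i)). \<alpha> g (f x))"

lemma dyn_D: "i \<in> I ==> dynamical_system G (D i) (\<gamma> i)"
 by (rule dynamical_system_Cinf[OF dynsys_axioms charted_N])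

lemma \<gamma>_closed: "i \<in> I ==> g \<in> carrier G ==> f \<in> carrier (D i) ==> \<gamma> i g f \<in> carrier (D i)"
 using dyn_D[of i] alg_homD(1)[of "\<gamma> i g" "D i" "D i" f] by (simp only: dynamical_system_def alg_aut_def alg_iso_def mem_Collect_eq)

lemma \<beta>_local:
 assumes i: "i \<in> I" and x: "x \<in> U i" and g: "g \<in> carrier G" and s: "s \<in> sections M E"
 shows "\<beta> g s x = chart E i (x, \<gamma> i g (rep i s) x)"
proof -
 have xX: "x \<in> X" using U_sub[OF i] x by blast
 note rs = rep_eq[OF i x s]
 have "\<beta> g s x = \<sigma> g (s x)" using xX by (simp add: section_action_def)
 also have "\<dots> = chart E i (x, \<alpha> g (rep i s x))" using \<sigma>_chart[OF g i x rs(1)] rs(2) by simp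
 also have "\<alpha> g (rep i s x) = \<gamma> i g (rep i s) x" using x xX by simp
 finally show ?thesis .
qed

lemma \<beta>_closed: "g \<in> carrier G ==> s \<in> sections M E ==> \<beta> g s \<in> sections M E"
proof (rule sectionI)
 show "\<beta> g s \<in> extensional X" by (simp add: section_action_def)
 fix i assume i: "i \<in> I" and g: "g \<in> carrier G" and s: "s \<in> sections M E"
 show "\<exists>u\<in>carrier (D i). \<forall>x\<in>U i. \<beta> g s x = chart E i (x, u x)"
  by (rule bexI[OF _ \<gamma>_closed[OF i g section_rep[OF s i]]]) (rule ballI, rule \<beta>_local[OF i _ g s])
qed

lemma rep_\<beta>:
 assumes i: "i \<in> I" and g: "g \<in> carrier G" and s: "s \<in> sections M E"
 shows "rep i (\<beta> g s) = \<gamma> i g (rep i s)"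
proof (rule extensionalityI[of _ "U i"])
 show "rep i (\<beta> g s) \<in> extensional (U i)" by (simp add: local_rep_def)
 show "\<gamma> i g (rep i s) \<in> extensional (U i)" unfolding topN[OF i] by simp
 fix x assume x: "x \<in> U i"
 have "\<gamma> i g (rep i s) x \<in> carrier A"
  by (rule smooth_functions.C_val[OF SF[OF i] \<gamma>_closed[OF i g section_rep[OF s i]]]) (use x topN[OF i] in blast)
 then show "rep i (\<beta> g s) x = \<gamma> i g (rep i s) x" using rep_chart[of i x _ "\<beta> g s"] i x \<beta>_local[OF i x g s] by blast
qed

lemma \<beta>_hom:
 assumes g: "g \<in> carrier G" shows "\<beta> g \<in> alg_hom \<Gamma> \<Gamma>"
 unfolding alg_hom_def mem_Collect_eq section_simps(1)
proof (intro conjI ballI allI)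
 show "\<beta> g \<in> sections M E \<rightarrow> sections M E" using \<beta>_closed[OF g] by blast
 note h = alg_homD[OF \<sigma>_hom[OF g]]
 fix s assume s: "s \<in> sections M E"
 show "\<beta> g (c \<odot>\<^sub>\<Gamma> s) = c \<odot>\<^sub>\<Gamma> \<beta> g s" for c
  by (rule section_eqI) (use h(4)[OF _ sections_val[OF s]] in \<open>simp_all add: section_simps section_action_def\<close>)
 fix t assume t: "t \<in> sections M E"
 show "\<beta> g (s \<oplus>\<^sub>\<Gamma> t) = \<beta> g s \<oplus>\<^sub>\<Gamma> \<beta> g t"
  by (rule section_eqI) (use h(2)[OF _ sections_val[OF s] sections_val[OF t]] in \<open>simp_all add: section_simps section_action_def\<close>)
 show "\<beta> g (s \<otimes>\<^sub>\<Gamma> t) = \<beta> g s \<otimes>\<^sub>\<Gamma> \<beta> g t"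
  by (rule section_eqI) (use h(3)[OF _ sections_val[OF s] sections_val[OF t]] in \<open>simp_all add: section_simps section_action_def\<close>)
qed

lemma sections_total: "s \<in> sections M E ==> x \<in> X ==> s x \<in> topspace (mtop (total E))"
 using sections_val[of s x] fibre_carrier[of x] by (auto simp: over_def)

lemma rep_in_top: "i \<in> I ==> s \<in> carrier \<Gamma> ==> rep i s \<in> topspace (topol (D i))"
 using section_rep[of s i] lcalg.topspace_B[OF lcalg.intro[OF smooth_functions.lc_algebra_C[OF SF]]] by (simp add: section_simps(1))

lemma \<Gamma>_topspace: "topspace (topol \<Gamma>) = carrier \<Gamma>"
 using lc_algebra_\<Gamma> by (simp add: lc_algebra_def lc_space_def)

lemma \<Gamma>_cont_iff: "continuous_map Y (topol \<Gamma>) f \<longleftrightarrow> f \<in> topspace Y \<rightarrow> carrier \<Gamma> \<and> (\<forall>i\<in>I. continuous_map Y (topol (D i)) (\<lambda>x. rep i (f x)))"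
 by (rule continuous_map_initial(2)[where Y = "\<lambda>i. topol (D i)" and L = rep, OF \<Gamma>_topol rep_in_top])

lemma \<beta>_cont: "continuous_map (prod_topology (mtop (mfd_of G)) (topol \<Gamma>)) (topol \<Gamma>) (\<lambda>(g, s). \<beta> g s)"
proof (rule \<Gamma>_cont_iff[THEN iffD2], intro conjI ballI)
 note tops = \<Gamma>_topspace
 show "(\<lambda>(g, s). \<beta> g s) \<in> topspace (prod_topology (mtop (mfd_of G)) (topol \<Gamma>)) \<rightarrow> carrier \<Gamma>"
  using \<beta>_closed tops by (auto simp: top section_simps(1))
 fix i assume i: "i \<in> I"
 have "continuous_map (topol \<Gamma>) (topol \<Gamma>) (\<lambda>x. x)" using continuous_map_id[of "topol \<Gamma>"] by (simp add: id_def)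
 then have c: "continuous_map (topol \<Gamma>) (topol (D i)) (rep i)"
  using \<Gamma>_cont_iff[THEN iffD1] i by blast
 have "continuous_map (prod_topology (mtop (mfd_of G)) (topol \<Gamma>)) (prod_topology (mtop (mfd_of G)) (topol (D i))) (\<lambda>z. (fst z, rep i (snd z)))"
  using continuous_map_compose[OF continuous_map_snd c, unfolded o_def, of "mtop (mfd_of G)"]
  by (simp add: continuous_map_pairwise o_def continuous_map_fst)
 moreover have "continuous_map (prod_topology (mtop (mfd_of G)) (topol (D i))) (topol (D i)) (\<lambda>(g, f). \<gamma> i g f)"
  using dyn_D[OF i] unfolding dynamical_system_def by blast
 ultimately have "continuous_map (prod_topology (mtop (mfd_of G)) (topol \<Gamma>)) (topol (D i)) ((\<lambda>(g, f). \<gamma> i g f) \<circ> (\<lambda>z. (fst z, rep i (snd z))))"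
  by (rule continuous_map_compose)
 then show "continuous_map (prod_topology (mtop (mfd_of G)) (topol \<Gamma>)) (topol (D i)) (\<lambda>z. rep i (case z of (g, s) => \<beta> g s))"
 proof (rule continuous_map_eq)
  fix z assume "z \<in> topspace (prod_topology (mtop (mfd_of G)) (topol \<Gamma>))"
  then obtain g s where "z = (g, s)" "g \<in> carrier G" "s \<in> sections M E" using tops by (cases z) (simp add: top section_simps(1))
  then show "((\<lambda>(g, f). \<gamma> i g f) \<circ> (\<lambda>z. (fst z, rep i (snd z)))) z = rep i (case z of (g, s) => \<beta> g s)"
   using rep_\<beta>[OF i] by (simp only: o_def prod.case fst_conv snd_conv)
 qed
qed

lemma dyn_\<Gamma>: "dynamical_system G \<Gamma> \<beta>"
proof (rule dynamical_systemI[OF lc_algebra_\<Gamma> \<beta>_hom _ _ \<beta>_cont]; (unfold section_simps(1))?)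
 show "\<beta> \<one>\<^sub>G s = s" if s: "s \<in> sections M E" for s
  by (rule section_eqI) (use sections_ext[OF s] \<sigma>_one sections_total[OF s] in \<open>simp_all add: section_action_def\<close>)
 show "\<beta> (g \<otimes>\<^sub>G h) s = \<beta> g (\<beta> h s)" if "g \<in> carrier G" "h \<in> carrier G" and s: "s \<in> sections M E" for g h s
  by (rule section_eqI) (use \<sigma>_mult that sections_total[OF s] in \<open>simp_all add: section_action_def\<close>)
qed

sublocale \<Gamma>: dynsys G \<Gamma> \<beta>
 by (intro dynsys.intro dynsys_axioms.intro dyn_\<Gamma> compact_group_axioms lcalg.intro lc_algebra_\<Gamma>)

end

section \<open>Smooth real functions\<close>

subsection \<open>A flat function\<close>

definition flat :: "real => real" where
 "flat t = (if t \<le> 0 then 0 else exp (- inverse t))"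

text \<open>The \<open>n\<close>-th derivative of \<open>exp (- 1/t)\<close> is a polynomial in \<open>1/t\<close> times \<open>exp (- 1/t)\<close>.\<close>

primrec flat_poly :: "nat => real poly" where
 "flat_poly 0 = 1"
| "flat_poly (Suc n) = [:0, 0, 1:] * (flat_poly n - pderiv (flat_poly n))"

definition flat_deriv :: "nat => real => real" where
 "flat_deriv n t = (if t \<le> 0 then 0 else poly (flat_poly n) (inverse t) * exp (- inverse t))"

lemma poly_exp_decay: "((\<lambda>s::real. poly p s * exp (- s)) \<longlongrightarrow> 0) at_top"
proof -
 have "((\<lambda>s::real. \<Sum>i\<le>degree p. coeff p i * (s ^ i / exp s)) \<longlongrightarrow> (\<Sum>i\<le>degree p. coeff p i * 0)) at_top"
  by (intro tendsto_sum tendsto_mult tendsto_const tendsto_power_div_exp_0)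
 then show ?thesis by (simp add: poly_altdef exp_minus sum_distrib_right field_simps sum_divide_distrib)
qed

lemma flat_deriv_step: "(flat_deriv n has_real_derivative flat_deriv (Suc n) x) (at x)"
proof -
 consider "x < 0" | "x = 0" | "x > 0" by linarith
 then show ?thesis
 proof cases
  case 1
  have "((\<lambda>_. 0) has_real_derivative 0) (at x)" by simp
  then have "(flat_deriv n has_real_derivative 0) (at x)"
   by (rule has_field_derivative_transform_within_open[where S = "{..<0}"]) (use 1 in \<open>auto simp: flat_deriv_def\<close>)
  then show ?thesis using 1 by (simp add: flat_deriv_def)
 next
  case 2
  have right: "((\<lambda>h. flat_deriv n h / h) \<longlongrightarrow> 0) (at_right 0)"
  proof (rule Lim_transform_eventually)
   show "((\<lambda>h. poly (pCons 0 (flat_poly n)) (inverse h) * exp (- inverse h)) \<longlongrightarrow> 0) (at_right 0)"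
    by (rule filterlim_compose[OF poly_exp_decay filterlim_inverse_at_top_right])
   show "\<forall>\<^sub>F h in at_right 0. poly (pCons 0 (flat_poly n)) (inverse h) * exp (- inverse h) = flat_deriv n h / h"
    by (rule eventually_at_rightI[of 0 1]) (auto simp: flat_deriv_def field_simps)
  qed
  have left: "((\<lambda>h. flat_deriv n h / h) \<longlongrightarrow> 0) (at_left 0)"
  proof (rule Lim_transform_eventually[OF tendsto_const])
   show "\<forall>\<^sub>F h in at_left 0. 0 = flat_deriv n h / h"
    by (rule eventually_at_leftI[of "-1" 0]) (auto simp: flat_deriv_def)
  qed
  have "((\<lambda>h. flat_deriv n h / h) \<longlongrightarrow> 0) (at 0)" by (rule filterlim_split_at[OF left right])
  then show ?thesis using 2 by (simp add: has_field_derivative_iff flat_deriv_def)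
 next
  case 3
  have i: "((\<lambda>t. inverse t) has_real_derivative - (inverse x ^ Suc (Suc 0))) (at x)"
   by (rule DERIV_inverse) (use 3 in simp)
  note p = DERIV_chain2[OF poly_DERIV[of "flat_poly n"] i] and e = DERIV_chain2[OF DERIV_exp DERIV_minus[OF i]]
  have "((\<lambda>t. poly (flat_poly n) (inverse t) * exp (- inverse t)) has_real_derivative flat_deriv (Suc n) x) (at x)"
   by (rule DERIV_cong[OF DERIV_mult[OF p e]])
    (use 3 in \<open>simp add: flat_deriv_def algebra_simps\<close>)
  then show ?thesis
   by (rule has_field_derivative_transform_within_open[where S = "{0<..}"]) (use 3 in \<open>auto simp: flat_deriv_def\<close>)
 qed
qed

lemma smooth_on_flat: "smooth_on (scalars :: (real, real) tmodule) (scalars :: (real, real) tmodule) UNIV flat"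
proof -
 have "flat_deriv 0 = flat" by (auto simp: flat_deriv_def flat_def)
 then show ?thesis using smooth_real[of UNIV flat_deriv] flat_deriv_step by simp
qed

lemma smooth_on_inverse: "smooth_on (scalars :: (real, real) tmodule) (scalars :: (real, real) tmodule) (- {0}) inverse"
proof -
 define \<phi> :: "nat => real => real" where "\<phi> = (\<lambda>n t. (-1) ^ n * fact n * inverse t ^ Suc n)"
 have "(\<phi> n has_real_derivative \<phi> (Suc n) x) (at x)" if "x \<in> - {0}" for n x
 proof -
  have "((\<lambda>t. (-1) ^ n * fact n * inverse t ^ Suc n) has_real_derivative
    (-1) ^ n * fact n * (real (Suc n) * inverse x ^ n * (- (inverse x ^ Suc (Suc 0))))) (at x)"
   using that by (intro derivative_eq_intros refl) auto
  then show ?thesis unfolding \<phi>_def by (rule DERIV_cong) (simp add: algebra_simps)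
 qed
 from smooth_real[of "- {0}" \<phi>, OF _ this] have "smooth_on (scalars :: (real, real) tmodule) (scalars :: (real, real) tmodule) (- {0}) (\<phi> 0)"
  by auto
 moreover have "\<phi> 0 = inverse" by (auto simp: \<phi>_def)
 ultimately show ?thesis by simp
qed

lemma flat_nonneg: "0 \<le> flat t" and flat_pos: "0 < t ==> 0 < flat t" and flat_zero: "t \<le> 0 ==> flat t = 0"
 by (simp_all add: flat_def)

subsection \<open>Closure properties\<close>

abbreviation smooth_fn :: "('p, 'v) mfd => ('p => real) => bool" where
 "smooth_fn M f \<equiv> smooth_map M (space_mfd (scalars :: (real, real) tmodule)) f"

lemma bilin_scalars: "bilin (scalars :: (real, real) tmodule) (scalars :: (real, real) tmodule) (scalars :: (real, real) tmodule) (*)"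
 by (simp add: bilin_def lin_map_def algebra_simps prod_topology_euclidean_eq case_prod_beta)
  (intro continuous_intros)

context
 fixes M :: "('p, 'v) mfd" assumes M: "charted M"
begin

lemma smooth_fn_const: "smooth_fn M (\<lambda>x. c)"
 by (rule smooth_map_const[OF M rlc_scalars]) simp

lemma smooth_fn_add: "smooth_fn M f ==> smooth_fn M g ==> smooth_fn M (\<lambda>x. f x + g x)"
 using smooth_map_add[OF M rlc_scalars] by simp

lemma smooth_fn_mult: "smooth_fn M f ==> smooth_fn M g ==> smooth_fn M (\<lambda>x. f x * g x)"
 by (rule smooth_map_bilin[OF M rlc_scalars rlc_scalars rlc_scalars _ _ bilin_scalars])

lemma smooth_fn_diff: "smooth_fn M f ==> smooth_fn M g ==> smooth_fn M (\<lambda>x. f x - g x)"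
 using smooth_fn_add[OF _ smooth_fn_mult[OF smooth_fn_const[of "-1"]], of f g] by simp

lemma smooth_fn_sum: "finite S ==> (\<And>k. k \<in> S ==> smooth_fn M (f k)) ==> smooth_fn M (\<lambda>x. \<Sum>k\<in>S. f k x)"
 by (induction S rule: finite_induct) (simp_all add: smooth_fn_const smooth_fn_add)

lemma smooth_fn_prod: "finite S ==> (\<And>k. k \<in> S ==> smooth_fn M (f k)) ==> smooth_fn M (\<lambda>x. \<Prod>k\<in>S. f k x)"
 by (induction S rule: finite_induct) (simp_all add: smooth_fn_const smooth_fn_mult)

lemma smooth_fn_flat: "smooth_fn M f ==> smooth_fn M (\<lambda>x. flat (f x))"
 by (rule smooth_map_post[OF M rlc_scalars rlc_scalars _ _ _ smooth_on_flat]) simp_all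

lemma smooth_fn_inverse:
 "smooth_fn M f ==> (\<And>x. x \<in> topspace (mtop M) ==> f x \<noteq> 0) ==> smooth_fn M (\<lambda>x. inverse (f x))"
 by (rule smooth_map_post[OF M rlc_scalars rlc_scalars _ _ _ smooth_on_inverse]) (auto simp: open_Compl)

lemma smooth_fn_series:
 assumes \<theta>: "\<And>k::nat. smooth_fn M (\<theta> k)"
  and lf: "\<And>x. x \<in> topspace (mtop M) ==> \<exists>W n. openin (mtop M) W \<and> x \<in> W \<and> (\<forall>k\<ge>n. \<forall>y\<in>W. \<theta> k y = 0)"
 shows "smooth_fn M (\<lambda>x. \<Sum>k | \<theta> k x \<noteq> 0. c k * \<theta> k x)"
proof (rule smooth_map_local[OF M charted_space_mfd[OF rlc_scalars]])
 fix x assume "x \<in> topspace (mtop M)"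
 from lf[OF this] obtain W n where W: "openin (mtop M) W" "x \<in> W" and n: "\<forall>k\<ge>n. \<forall>y\<in>W. \<theta> k y = 0" by blast
 have "smooth_fn M (\<lambda>y. \<Sum>k<n. c k * \<theta> k y)"
  by (rule smooth_fn_sum) (simp_all add: smooth_fn_mult smooth_fn_const \<theta>)
 from smooth_map_restrict[OF M charted_space_mfd[OF rlc_scalars] this W(1)]
 have 1: "smooth_fn (open_submfd M W) (\<lambda>y. \<Sum>k<n. c k * \<theta> k y)" .
 have "smooth_fn (open_submfd M W) (\<lambda>x. \<Sum>k | \<theta> k x \<noteq> 0. c k * \<theta> k x)"
 proof (rule smooth_map_cong[OF charted_open_submfd[OF M W(1)] charted_space_mfd[OF rlc_scalars] 1])
  fix y assume "y \<in> topspace (mtop (open_submfd M W))"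
  then have y: "y \<in> W" by simp
  show "(\<Sum>k<n. c k * \<theta> k y) = (\<Sum>k | \<theta> k y \<noteq> 0. c k * \<theta> k y)"
  proof (rule sum.mono_neutral_right)
   have "k < n" if "\<theta> k y \<noteq> 0" for k using n y that by (meson not_le)
   then show "{k. \<theta> k y \<noteq> 0} \<subseteq> {..<n}" by blast
  qed auto
 qed
 then show "\<exists>W. openin (mtop M) W \<and> x \<in> W \<and> smooth_fn (open_submfd M W) (\<lambda>x. \<Sum>k | \<theta> k x \<noteq> 0. c k * \<theta> k x)"
  using W by blast
qed

end

subsection \<open>Bump functions\<close>

lemma euclid_simps [simp]:
 "carrier (euclid d) = {x. \<forall>i\<ge>d. x i = 0}" "topol (euclid d) = Euclidean_space d"
 "x \<oplus>\<^bsub>euclid d\<^esub> y = (\<lambda>i. x i + y i)" "r \<odot>\<^bsub>euclid d\<^esub> x = (\<lambda>i. r * x i)"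
 by (simp_all add: euclid_def)

lemma box_nbhd:
 assumes T: "openin (Euclidean_space d) T" and c: "c \<in> T"
 shows "\<exists>e>0. {y. (\<forall>j<d. \<bar>y j - c j\<bar> \<le> e) \<and> (\<forall>j\<ge>d. y j = 0)} \<subseteq> T"
proof -
 obtain T' where T': "openin (powertop_real UNIV) T'" "T = T' \<inter> {x. \<forall>i\<ge>d. x i = 0}"
  using T unfolding Euclidean_space_def openin_subtopology by blast
 obtain Y where Y: "c \<in> (\<Pi>\<^sub>E i\<in>UNIV. Y i)" "\<forall>i. openin euclideanreal (Y i)" "(\<Pi>\<^sub>E i\<in>UNIV. Y i) \<subseteq> T'"
  using product_topology_open_contains_basis[OF T'(1), of c] c T'(2) by blast
 have "\<exists>e>0. \<forall>t. \<bar>t - c j\<bar> \<le> e --> t \<in> Y j" for j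
 proof -
  have "open (Y j)" "c j \<in> Y j" using Y(1,2) by auto
  then obtain e where "e > 0" "cball (c j) e \<subseteq> Y j" using open_contains_cball by blast
  then show ?thesis by (intro exI[of _ e]) (auto simp: subset_iff dist_real_def abs_minus_commute)
 qed
 then obtain e where e: "\<And>j. e j > 0" "\<And>j t. \<bar>t - c j\<bar> \<le> e j ==> t \<in> Y j" by metis
 define r where "r = Min (insert 1 (e ` {..<d}))"
 have r: "r > 0" "\<And>j. j < d ==> r \<le> e j" using e(1) by (auto simp: r_def)
 have "y \<in> T" if y: "\<forall>j<d. \<bar>y j - c j\<bar> \<le> r" "\<forall>j\<ge>d. y j = 0" for y
 proof -
  have "y j \<in> Y j" for j
  proof (cases "j < d")
   case True
   have "\<bar>y j - c j\<bar> \<le> e j" using y(1) r(2) True by force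
   then show ?thesis by (rule e(2))
  next
   case False
   then have "y j = c j" using y(2) c T'(2) by auto
   then show ?thesis using e(1)[of j] by (intro e(2)) simp
  qed
  then have "y \<in> T'" using Y(3) by auto
  then show ?thesis using T'(2) y(2) by simp
 qed
 then show ?thesis using r(1) by blast
qed

lemma box_compact:
 "compactin (Euclidean_space d) {y. (\<forall>j<d. \<bar>y j - c j\<bar> \<le> e) \<and> (\<forall>j\<ge>d. y j = 0)}"
proof -
 have eq: "{y. (\<forall>j<d. \<bar>y j - c j\<bar> \<le> e) \<and> (\<forall>j\<ge>d. y j = 0)} = PiE UNIV (\<lambda>j. if j < d then {c j - e..c j + e} else {0})"
 proof (rule Set.set_eqI)
  fix y
  have "(j < d --> \<bar>y j - c j\<bar> \<le> e) \<and> (j \<ge> d --> y j = 0) \<longleftrightarrow> y j \<in> (if j < d then {c j - e..c j + e} else {0})" for j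
   by (auto simp: abs_le_iff)
  then show "y \<in> {y. (\<forall>j<d. \<bar>y j - c j\<bar> \<le> e) \<and> (\<forall>j\<ge>d. y j = 0)} \<longleftrightarrow> y \<in> PiE UNIV (\<lambda>j. if j < d then {c j - e..c j + e} else {0})"
   unfolding PiE_UNIV_domain mem_Collect_eq Pi_iff by blast
 qed
 have "compactin (powertop_real UNIV) (PiE UNIV (\<lambda>j. if j < d then {c j - e..c j + e} else {0}))"
  unfolding compactin_PiE by simp
 then show ?thesis unfolding Euclidean_space_def compactin_subtopology eq[symmetric] by auto
qed

text \<open>A product of flat functions of the coordinates lives on a compact box inside the chart. The box
  is closed in the Hausdorff space \<open>M\<close>, so that the extension by zero is smooth.\<close>

lemma ex_bump:
 assumes fd: "fd_manifold M" and W: "openin (mtop M) W" and x: "x \<in> W"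
 shows "\<exists>\<rho> S. smooth_fn M \<rho> \<and> (\<forall>y. 0 \<le> \<rho> y) \<and> 0 < \<rho> x \<and> closedin (mtop M) S \<and> S \<subseteq> W \<and>
  (\<forall>y\<in>topspace (mtop M) - S. \<rho> y = 0)"
proof -
 have sm: "smooth_manifold M" using fd by (simp add: fd_manifold_def)
 then have ch: "charted M" by (rule charted_smooth_manifold)
 interpret cmfd M by (rule cmfd.intro[OF ch])
 obtain d where d: "model M = euclid d" using fd by (auto simp: fd_manifold_def)
 have xX: "x \<in> topspace (mtop M)" using openin_subset[OF W] x by blast
 then obtain V \<phi> where V: "(V, \<phi>) \<in> atlas M" "x \<in> V" using chart_ex by blast
 have oV: "openin (mtop M) V" by (rule chart_open[OF V(1)])
 note cV = charted_open_submfd[OF ch oV]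
 have "openin (Euclidean_space d) (\<phi> ` (V \<inter> W))"
  using chart_sub_image_open[OF V(1) openin_Int[OF oV W]] d by simp
 from box_nbhd[OF this, of "\<phi> x"] V(2) x obtain e where
  e: "e > 0" "{y. (\<forall>j<d. \<bar>y j - \<phi> x j\<bar> \<le> e) \<and> (\<forall>j\<ge>d. y j = 0)} \<subseteq> \<phi> ` (V \<inter> W)" by blast
 define K where "K = {y. (\<forall>j<d. \<bar>y j - \<phi> x j\<bar> \<le> e) \<and> (\<forall>j\<ge>d. y j = 0)}"
 have K: "compactin (topol (model M)) K" unfolding K_def d using box_compact by simp
 have KW: "K \<subseteq> \<phi> ` (V \<inter> W)" using e(2) by (simp add: K_def)
 define S where "S = {y \<in> V. \<phi> y \<in> K}"
 have SW: "S \<subseteq> W"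
 proof
  fix y assume y: "y \<in> S"
  then obtain w where "w \<in> V" "w \<in> W" "\<phi> y = \<phi> w" using KW by (auto simp: S_def)
  then show "y \<in> W" using inj_onD[OF chart_inj[OF V(1)]] y by (auto simp: S_def)
 qed
 have "\<phi> ` S = K" using KW by (auto simp: S_def)
 moreover have "compactin (subtopology (topol (model M)) (\<phi> ` V)) K"
  using K KW by (auto simp: compactin_subtopology)
 ultimately have "compactin (subtopology (mtop M) V) S"
  using homeomorphic_map_compactness[OF chart_homeo[OF V(1)], of S] chart_topspace[OF V(1)] by (auto simp: S_def)
 then have "compactin (mtop M) S" by (simp add: compactin_subtopology)
 then have S: "closedin (mtop M) S"
  using sm by (intro compactin_imp_closedin) (simp_all add: smooth_manifold_def)
 define \<rho> where "\<rho> y = (if y \<in> V then \<Prod>j<d. flat (e\<^sup>2 - (\<phi> y j - \<phi> x j)\<^sup>2) else 0)" for y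
 have zero: "\<rho> y = 0" if y: "y \<in> topspace (mtop M) - S" for y
 proof (cases "y \<in> V")
  case True
  have "\<phi> y \<in> topspace (topol (model M))"
   using openin_subset[OF chart_image_open[OF V(1)]] True by blast
  then have "\<phi> y \<in> carrier (euclid d)" by (simp add: d topspace_Euclidean_space)
  moreover have "\<phi> y \<notin> K" using y True by (simp add: S_def)
  ultimately obtain j where j: "j < d" "\<bar>\<phi> y j - \<phi> x j\<bar> > e" by (auto simp: K_def not_le)
  have "e\<^sup>2 \<le> (\<phi> y j - \<phi> x j)\<^sup>2" using j(2) e(1) by (intro abs_le_square_iff[THEN iffD1]) simp
  then have "flat (e\<^sup>2 - (\<phi> y j - \<phi> x j)\<^sup>2) = 0" by (intro flat_zero) simp
  then have "(\<Prod>j<d. flat (e\<^sup>2 - (\<phi> y j - \<phi> x j)\<^sup>2)) = 0" using j(1) by (intro prod_zero) auto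
  then show ?thesis by (simp add: \<rho>_def)
 qed (simp add: \<rho>_def)
 have coord: "smooth_fn (open_submfd M V) (\<lambda>y. \<phi> y j)" for j
 proof (rule smooth_map_lin[OF cV _ rlc_scalars, where L = "\<lambda>v. v j" and F = "euclid d"])
  show "rlc (euclid d)" using ch d by (simp add: charted_def)
  show "smooth_map (open_submfd M V) (space_mfd (euclid d)) \<phi>" using smooth_map_chart_map[OF sm V(1)] d by simp
  show "lin_map (euclid d) scalars (\<lambda>v. v j)" by (simp add: lin_map_def)
  show "continuous_map (topol (euclid d)) (topol scalars) (\<lambda>v. v j)"
   using continuous_map_product_projection[of j UNIV "\<lambda>_. euclideanreal"]
   by (simp add: Euclidean_space_def continuous_map_from_subtopology)
 qed
 have "smooth_fn (open_submfd M V) (\<lambda>y. \<Prod>j<d. flat (e\<^sup>2 - (\<phi> y j - \<phi> x j)\<^sup>2))"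
  unfolding power2_eq_square
  by (intro smooth_fn_prod smooth_fn_flat smooth_fn_diff smooth_fn_mult smooth_fn_const coord cV finite_lessThan)
 then have onV: "smooth_fn (open_submfd M V) \<rho>"
  by (rule smooth_map_cong[OF cV charted_space_mfd[OF rlc_scalars]]) (simp add: \<rho>_def)
 have "smooth_fn M \<rho>"
 proof (rule smooth_map_local[OF ch charted_space_mfd[OF rlc_scalars]])
  fix y assume y: "y \<in> topspace (mtop M)"
  show "\<exists>W. openin (mtop M) W \<and> y \<in> W \<and> smooth_fn (open_submfd M W) \<rho>"
  proof (cases "y \<in> V")
   case True then show ?thesis using oV onV by blast
  next
   case False
   let ?W = "topspace (mtop M) - S"
   have o: "openin (mtop M) ?W" using S by (simp add: closedin_def)
   have "smooth_fn (open_submfd M ?W) \<rho>"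
    by (rule smooth_map_cong[OF charted_open_submfd[OF ch o] charted_space_mfd[OF rlc_scalars] smooth_fn_const[OF charted_open_submfd[OF ch o], of 0]])
     (use zero in simp)
   moreover have "y \<in> ?W" using y False by (simp add: S_def)
   ultimately show ?thesis using o by blast
  qed
 qed
 moreover have "0 < \<rho> x" using V(2) e(1) by (simp add: \<rho>_def flat_pos prod_pos)
 moreover have "0 \<le> \<rho> y" for y by (simp add: \<rho>_def flat_nonneg prod_nonneg)
 ultimately show ?thesis using S SW zero by blast
qed

text \<open>Countably many bump functions \<open>\<rho> k\<close> suffice by the Lindelof property. The factors
  \<open>flat (1 - k * \<rho> j)\<close> with \<open>j < k\<close> make the family locally finite, as they vanish where
  \<open>\<rho> j \<ge> 1/k\<close>; they are positive where \<open>\<rho> j = 0\<close>, so the first \<open>\<rho> k\<close> that does not vanish at a point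
  leaves a positive value there.\<close>

lemma ex_bump_family:
 assumes fd: "fd_manifold M" and ne: "topspace (mtop M) \<noteq> {}"
  and U: "\<And>i. i \<in> I ==> openin (mtop M) (U i)" and cov: "(\<Union>i\<in>I. U i) = topspace (mtop M)"
 shows "\<exists>\<theta> :: nat => 'p => real. (\<forall>k. smooth_fn M (\<theta> k)) \<and> (\<forall>k y. 0 \<le> \<theta> k y) \<and>
  (\<forall>k. \<exists>i\<in>I. \<exists>S. closedin (mtop M) S \<and> S \<subseteq> U i \<and> (\<forall>y\<in>topspace (mtop M) - S. \<theta> k y = 0)) \<and>
  (\<forall>x\<in>topspace (mtop M). \<exists>k. 0 < \<theta> k x) \<and>
  (\<forall>x\<in>topspace (mtop M). \<exists>W n. openin (mtop M) W \<and> x \<in> W \<and> (\<forall>k\<ge>n. \<forall>y\<in>W. \<theta> k y = 0))"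
proof -
 let ?X = "topspace (mtop M)"
 have ch: "charted M" using fd by (intro charted_smooth_manifold) (simp add: fd_manifold_def)
 define P where "P x \<rho> \<longleftrightarrow> smooth_fn M \<rho> \<and> (\<forall>y. 0 \<le> \<rho> y) \<and> 0 < \<rho> x \<and>
   (\<exists>i\<in>I. \<exists>S. closedin (mtop M) S \<and> S \<subseteq> U i \<and> (\<forall>y\<in>?X - S. \<rho> y = 0))" for x \<rho>
 have "\<exists>\<rho>. P x \<rho>" if x: "x \<in> ?X" for x
 proof -
  have "x \<in> (\<Union>i\<in>I. U i)" using x cov by simp
  then obtain i where i: "i \<in> I" "x \<in> U i" by (elim UN_E)
  obtain \<rho> S where \<rho>: "smooth_fn M \<rho>" "\<forall>y. 0 \<le> \<rho> y" "0 < \<rho> x"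
   and S: "closedin (mtop M) S" "S \<subseteq> U i" "\<forall>y\<in>?X - S. \<rho> y = 0"
   using ex_bump[OF fd U[OF i(1)] i(2)] by (elim exE conjE)
  have "P x \<rho>" unfolding P_def
   by (intro conjI bexI[OF _ i(1)] exI[of _ S]) (fact \<rho> S)+
  then show ?thesis by (rule exI[of "P x"])
 qed
 then have "\<forall>x\<in>?X. \<exists>\<rho>. P x \<rho>" by blast
 from bchoice[OF this] obtain r where r: "\<forall>x\<in>?X. P x (r x)" by blast
 have rc: "continuous_map (mtop M) euclideanreal (r x)" if "x \<in> ?X" for x
  using r that smooth_mapD(1)[of M "space_mfd scalars" "r x"] by (simp add: P_def)
 have ro: "openin (mtop M) {y \<in> ?X. a < r x y}" if "x \<in> ?X" for x a
  using openin_continuous_map_preimage[OF rc[OF that], of "{a<..}"] by simp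
 have "second_countable (mtop M)" using fd by (simp add: fd_manifold_def)
 then have L: "Lindelof_space (mtop M)" by (rule second_countable_imp_Lindelof_space)
 let ?\<V> = "(\<lambda>x. {y \<in> ?X. 0 < r x y}) ` ?X"
 have "\<forall>W\<in>?\<V>. openin (mtop M) W" using ro by blast
 moreover have "\<Union> ?\<V> = ?X" using r by (auto simp: P_def)
 ultimately have "(\<forall>W\<in>?\<V>. openin (mtop M) W) \<and> \<Union> ?\<V> = ?X" by (rule conjI)
 from L[unfolded Lindelof_space_def, THEN spec, THEN mp, OF this] obtain Vs where Vs: "countable Vs" "Vs \<subseteq> ?\<V>" "\<Union> Vs = ?X" by (elim exE conjE)
 obtain Y where Y: "countable Y" "Y \<subseteq> ?X" "Vs = (\<lambda>x. {y \<in> ?X. 0 < r x y}) ` Y"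
  using countable_subset_image[of Vs "\<lambda>x. {y \<in> ?X. 0 < r x y}" ?X, THEN iffD1, OF conjI[OF Vs(1,2)]] by (elim exE conjE)
 have Yne: "Y \<noteq> {}" using Vs(3) Y(3) ne by (metis Union_empty image_empty)
 define \<rho> where "\<rho> k = r (from_nat_into Y k)" for k
 have YX: "from_nat_into Y k \<in> ?X" for k using from_nat_into[OF Yne] Y(2) by blast
 have \<rho>: "smooth_fn M (\<rho> k)" "0 \<le> \<rho> k y" "\<exists>i\<in>I. \<exists>S. closedin (mtop M) S \<and> S \<subseteq> U i \<and> (\<forall>y\<in>?X - S. \<rho> k y = 0)" for k y
  using r YX[of k] by (simp_all add: \<rho>_def P_def)
 have \<rho>ex: "\<exists>k. 0 < \<rho> k x" if x: "x \<in> ?X" for x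
 proof -
  have "x \<in> \<Union> ((\<lambda>x. {y \<in> ?X. 0 < r x y}) ` Y)" using x Vs(3) Y(3) by simp
  then obtain y where "y \<in> Y" "0 < r y x" by blast
  then show ?thesis using from_nat_into_surj[OF Y(1)] unfolding \<rho>_def by metis
 qed
 define \<theta> where "\<theta> k y = \<rho> k y * (\<Prod>j<k. flat (1 - real k * \<rho> j y))" for k y
 have 1: "smooth_fn M (\<theta> k)" for k
  unfolding \<theta>_def
  by (intro smooth_fn_prod smooth_fn_flat smooth_fn_diff smooth_fn_mult smooth_fn_const ch \<rho>(1) finite_lessThan)
 have 2: "0 \<le> \<theta> k y" for k y by (simp add: \<theta>_def \<rho>(2) flat_nonneg prod_nonneg)
 have 3: "\<exists>i\<in>I. \<exists>S. closedin (mtop M) S \<and> S \<subseteq> U i \<and> (\<forall>y\<in>?X - S. \<theta> k y = 0)" for k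
  using \<rho>(3)[of k] unfolding \<theta>_def by fastforce
 have 4: "\<exists>k. 0 < \<theta> k x" if x: "x \<in> ?X" for x
 proof -
  define k where "k = (LEAST k. 0 < \<rho> k x)"
  have k: "0 < \<rho> k x" using \<rho>ex[OF x] unfolding k_def by (metis LeastI_ex)
  have "\<rho> j x = 0" if "j < k" for j
   using not_less_Least[of j "\<lambda>k. 0 < \<rho> k x"] that \<rho>(2)[of j x] unfolding k_def by linarith
  then have "0 < (\<Prod>j<k. flat (1 - real k * \<rho> j x))" by (intro prod_pos) (simp add: flat_pos)
  then show ?thesis using k by (auto simp: \<theta>_def intro!: exI[of _ k])
 qed
 have 5: "\<exists>W n. openin (mtop M) W \<and> x \<in> W \<and> (\<forall>k\<ge>n. \<forall>y\<in>W. \<theta> k y = 0)" if x: "x \<in> ?X" for x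
 proof -
  obtain m where m: "0 < \<rho> m x" using \<rho>ex[OF x] by blast
  define e where "e = \<rho> m x / 2"
  have e: "e > 0" "e < \<rho> m x" using m by (simp_all add: e_def)
  obtain n0 :: nat where n0: "inverse e < real n0" using reals_Archimedean2 by blast
  let ?W = "{y \<in> ?X. e < \<rho> m y}"
  have "\<theta> k y = 0" if k: "k \<ge> Suc (max m n0)" and y: "y \<in> ?W" for k y
  proof -
   have "1 = inverse e * e" using e(1) by simp
   also have "\<dots> \<le> real k * \<rho> m y" using n0 k y e(1) by (intro mult_mono) auto
   finally have "flat (1 - real k * \<rho> m y) = 0" by (intro flat_zero) simp
   then have "(\<Prod>j<k. flat (1 - real k * \<rho> j y)) = 0" using k by (intro prod_zero) auto
   then show ?thesis by (simp add: \<theta>_def)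
  qed
  moreover have "openin (mtop M) ?W" using ro[OF YX[of m], of e] by (simp add: \<rho>_def)
  ultimately show ?thesis using x e(2) by (intro exI[of _ ?W] exI[of _ "Suc (max m n0)"]) blast
 qed
 show ?thesis by (rule exI[of _ \<theta>]) (intro conjI allI ballI 1 2 3 4 5)
qed

section \<open>Characters on smooth functions\<close>

text \<open>A value \<open>\<omega> f\<close> is a value of \<open>f\<close>, hence \<open>\<omega>\<close> is positive. Let \<open>F c\<close> be the sum of all \<open>c k * \<theta> k\<close>. If \<open>\<omega>\<close>
  vanished on every \<open>\<theta> k\<close>, then \<open>\<omega> (F real) \<ge> N * \<omega> (F (\<lambda>_. 1)) > 0\<close> would hold for all \<open>N\<close>, since
  \<open>F real - N * F (\<lambda>_. 1)\<close> becomes nonnegative after adding multiples of the \<open>\<theta> k\<close> with \<open>k < N\<close>.\<close>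

lemma character_detects:
 fixes \<omega> :: "('p => real) => complex" and \<theta> :: "nat => 'p => real"
 assumes M: "charted M"
  and const: "\<And>c. \<omega> (\<lambda>x. c) = of_real c"
  and add: "\<And>f g. smooth_fn M f ==> smooth_fn M g ==> \<omega> (\<lambda>x. f x + g x) = \<omega> f + \<omega> g"
  and mult: "\<And>f g. smooth_fn M f ==> smooth_fn M g ==> \<omega> (\<lambda>x. f x * g x) = \<omega> f * \<omega> g"
  and unit: "\<And>f. smooth_fn M f ==> (\<And>x. x \<in> topspace (mtop M) ==> f x \<noteq> 0) ==> \<omega> f \<noteq> 0"
  and \<theta>: "\<And>k. smooth_fn M (\<theta> k)" "\<And>k y. 0 \<le> \<theta> k y" "\<And>x. x \<in> topspace (mtop M) ==> \<exists>k. 0 < \<theta> k x"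
  and lf: "\<And>x. x \<in> topspace (mtop M) ==> \<exists>W n. openin (mtop M) W \<and> x \<in> W \<and> (\<forall>k\<ge>n. \<forall>y\<in>W. \<theta> k y = 0)"
 shows "\<exists>k. \<omega> (\<theta> k) \<noteq> 0"
proof (rule ccontr)
 assume "\<nexists>k. \<omega> (\<theta> k) \<noteq> 0"
 then have zero: "\<And>k. \<omega> (\<theta> k) = 0" by blast
 note sm = smooth_fn_const[OF M] smooth_fn_add[OF M] smooth_fn_mult[OF M]
 have val: "\<exists>x\<in>topspace (mtop M). \<omega> f = of_real (f x)" if f: "smooth_fn M f" for f
 proof -
  define a b where "a = Re (\<omega> f)" and "b = Im (\<omega> f)"
  have w: "\<omega> f = of_real a + \<i> * of_real b" unfolding a_def b_def by (rule complex_eq)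
  let ?g = "\<lambda>x. f x + - a" and ?h = "\<lambda>x. (f x + - a) * (f x + - a) + b * b"
  have g: "smooth_fn M ?g" by (intro sm f)
  have "\<omega> ?g = \<i> * of_real b" using add[OF f sm(1)[of "-a"]] const[of "-a"] w by simp
  then have "\<omega> ?h = 0"
   using add[OF sm(3)[OF g g] sm(1)[of "b * b"]] mult[OF g g] const[of "b * b"] by (simp add: algebra_simps)
  then obtain x where x: "x \<in> topspace (mtop M)" "?h x = 0"
   using unit[of ?h] sm(2)[OF sm(3)[OF g g] sm(1)[of "b * b"]] by blast
  then have "f x = a" "b = 0" using sum_squares_eq_zero_iff[of "f x + - a" b] by auto
  then show ?thesis using x(1) w by auto
 qed
 have cm: "\<omega> (\<lambda>x. c * f x) = of_real c * \<omega> f" if "smooth_fn M f" for c f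
  using mult[OF sm(1)[of c] that] const by simp
 have fin: "finite {k. \<theta> k x \<noteq> 0}" if x: "x \<in> topspace (mtop M)" for x
 proof -
  obtain W n where "x \<in> W" "\<forall>k\<ge>n. \<forall>y\<in>W. \<theta> k y = 0" using lf[OF x] by blast
  then have "{k. \<theta> k x \<noteq> 0} \<subseteq> {..<n}" by (auto simp: not_less[symmetric])
  then show ?thesis by (rule finite_subset) simp
 qed
 define F where "F c x = (\<Sum>k | \<theta> k x \<noteq> 0. c k * \<theta> k x)" for c :: "nat => real" and x
 have F: "smooth_fn M (F c)" for c unfolding F_def by (rule smooth_fn_series[OF M \<theta>(1) lf])
 obtain x1 where x1: "x1 \<in> topspace (mtop M)" "\<omega> (F (\<lambda>_. 1)) = of_real (F (\<lambda>_. 1) x1)" using val[OF F] by blast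
 define r1 where "r1 = F (\<lambda>_. 1) x1"
 obtain k where k: "0 < \<theta> k x1" using \<theta>(3)[OF x1(1)] by blast
 have "0 < r1" unfolding r1_def F_def
  by (rule sum_pos2[OF fin[OF x1(1)], of k]) (use k \<theta>(2) in auto)
 obtain x2 where x2: "\<omega> (F real) = of_real (F real x2)" using val[OF F] by blast
 define r2 where "r2 = F real x2"
 have "real N * r1 \<le> r2" for N
 proof -
  define p where "p n x = (\<Sum>k<n. (real N - real k) * \<theta> k x)" for n x
  have p: "smooth_fn M (p n)" for n
   unfolding p_def by (intro smooth_fn_sum[OF M] sm \<theta>(1)) simp
  have p0: "\<omega> (p n) = 0" for n
  proof (induction n)
   case 0 show ?case using const[of 0] by (simp add: p_def)
  next
   case (Suc n)
   have "\<omega> (\<lambda>x. p n x + (real N - real n) * \<theta> n x) = 0"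
    using add[OF p[of n] sm(3)[OF sm(1)[of "real N - real n"] \<theta>(1)[of n]]] cm[OF \<theta>(1)[of n]] zero[of n] Suc by simp
   then show ?case by (simp add: p_def)
  qed
  let ?g = "\<lambda>x. F real x + (- real N) * F (\<lambda>_. 1) x" and ?h = "\<lambda>x. F real x + (- real N) * F (\<lambda>_. 1) x + p N x"
  have g: "smooth_fn M ?g" by (intro sm F)
  have "\<omega> ?h = of_real (r2 - real N * r1)"
   using add[OF g p[of N]] p0 add[OF F[of real] sm(3)[OF sm(1)[of "- real N"] F[of "\<lambda>_. 1"]]]
    cm[OF F[of "\<lambda>_. 1"], of "- real N"] x1(2) x2 by (simp add: r1_def r2_def)
  moreover obtain x where x: "x \<in> topspace (mtop M)" "\<omega> ?h = of_real (?h x)" using val[OF sm(2)[OF g p[of N]]] by blast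
  moreover have "0 \<le> ?h x"
  proof -
   let ?G = "{k. \<theta> k x \<noteq> 0} \<union> {..<N}"
   have fG: "finite ?G" using fin[OF x(1)] by simp
   have FG: "F c x = (\<Sum>k\<in>?G. c k * \<theta> k x)" for c
    unfolding F_def by (rule sum.mono_neutral_left[OF fG]) auto
   have pG: "p N x = (\<Sum>k\<in>?G. if k < N then (real N - real k) * \<theta> k x else 0)"
    unfolding p_def sum.If_cases[OF fG] by (simp add: Int_def) (rule sum.cong, auto)
   have "?h x = (\<Sum>k\<in>?G. real k * \<theta> k x + (- real N) * \<theta> k x + (if k < N then (real N - real k) * \<theta> k x else 0))"
    unfolding FG pG by (simp only: sum.distrib sum_distrib_left mult_1)
   also have "\<dots> \<ge> 0"
   proof (rule sum_nonneg)
    fix k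
    show "0 \<le> real k * \<theta> k x + (- real N) * \<theta> k x + (if k < N then (real N - real k) * \<theta> k x else 0)"
     using mult_nonneg_nonneg[of "real k - real N" "\<theta> k x"] \<theta>(2)[of k x] by (simp add: algebra_simps)
   qed
   finally show ?thesis .
  qed
  ultimately show ?thesis by (metis diff_ge_0_iff_ge of_real_eq_iff)
 qed
 then show False using ex_less_of_nat_mult[OF \<open>0 < r1\<close>, of r2] by (metis not_less)
qed

section \<open>Localization\<close>

lemma ideal_preimage:
 assumes A: "calg A" and B: "calg B" and f: "f \<in> alg_hom A B" and J: "ideal J B"
 shows "ideal {x \<in> carrier A. f x \<in> J} A"
proof -
 interpret A: calg A by fact
 interpret B: calg B by fact
 interpret J: ideal J B by fact
 note h = alg_homD[OF f]
 have neg: "f (\<ominus>\<^sub>A x) = \<ominus>\<^sub>B f x" if "x \<in> carrier A" for x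
  using h(4)[OF that, of "-1"] A.csmul_neg_one[OF that] B.csmul_neg_one[OF h(1)[OF that]] by simp
 show ?thesis
 proof (rule idealI[OF A.ring_axioms])
  show "subgroup {x \<in> carrier A. f x \<in> J} (add_monoid A)"
  proof
   show "x \<otimes>\<^bsub>add_monoid A\<^esub> y \<in> {x \<in> carrier A. f x \<in> J}"
    if "x \<in> {x \<in> carrier A. f x \<in> J}" "y \<in> {x \<in> carrier A. f x \<in> J}" for x y
    using that by (simp add: h(2))
   show "\<one>\<^bsub>add_monoid A\<^esub> \<in> {x \<in> carrier A. f x \<in> J}"
    using alg_hom_zero[OF A B f] J.zero_closed by simp
   show "inv\<^bsub>add_monoid A\<^esub> x \<in> {x \<in> carrier A. f x \<in> J}" if "x \<in> {x \<in> carrier A. f x \<in> J}" for x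
    using that neg[of x] J.a_inv_closed[of "f x"] by (simp add: a_inv_def[symmetric])
  qed auto
 qed (auto simp: h(1,3) J.I_l_closed J.I_r_closed)
qed

lemma charted_real_line: "charted real_line"
 unfolding real_line_def by (rule charted_space_mfd[OF rlc_scalars])

lemma real_line_simps [simp]: "topspace (mtop real_line) = UNIV"
 by (simp add: real_line_def)

lemma smooth_fn_id: "smooth_fn real_line (\<lambda>t. t)"
proof (rule smooth_map_spaceI[OF charted_real_line rlc_scalars])
 fix V \<phi> assume "(V, \<phi>) \<in> atlas real_line"
 then have V: "V = UNIV" "\<phi> = (\<lambda>x. x)" by (auto simp: real_line_def)
 have "inv_into UNIV (\<lambda>x::real. x) y = y" for y using inv_into_f_f[of "\<lambda>x::real. x" UNIV y] by simp
 then show "smooth_on (model real_line) scalars (\<phi> ` V) (\<lambda>y. inv_into V \<phi> y)"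
  using smooth_id[OF rlc_scalars, of UNIV] by (simp add: V real_line_def)
qed simp

lemma (in lcalg) smooth_map_scale:
 assumes N: "charted N" and f: "smooth_fn N f" and a: "a \<in> carrier B"
 shows "smooth_map N (alg_mfd B) (\<lambda>x. complex_of_real (f x) \<odot> a)"
proof (rule smooth_map_lin[OF N rlc_scalars R.rlc_axioms f])
 show "lin_map scalars (realify B) (\<lambda>r. complex_of_real r \<odot> a)"
  using a by (auto simp: lin_map_def csmul_add_left csmul_csmul)
 have "continuous_map euclideanreal (prod_topology euclidean (topol B)) (\<lambda>r. (complex_of_real r, a))"
  using a by (simp add: continuous_map_pairwise o_def topspace_B continuous_on_of_real)
 from continuous_map_compose[OF this cont_csmul]
 show "continuous_map (topol scalars) (topol (realify B)) (\<lambda>r. complex_of_real r \<odot> a)" by (simp add: o_def)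
qed

text \<open>The ideal is generated by \<open>1 - \<tau> z\<close> with \<open>\<tau> t = t \<cdot> 1\<close>, so the class of \<open>\<tau>\<close> becomes inverse to that
  of \<open>z\<close>. If \<open>s s' = s' s = z z\<close>, then the class of \<open>s\<close> is a unit with inverse the class of \<open>s' \<tau> \<tau>\<close>.\<close>

lemma (in dynsys) trivial_localization:
 assumes z: "z \<in> carrier B" "\<And>a. a \<in> carrier B ==> z \<otimes>\<^sub>B a = a \<otimes>\<^sub>B z" "\<And>g. g \<in> carrier G ==> \<beta> g z = z"
 defines "good \<equiv> \<lambda>s. \<exists>s'\<in>carrier B. s \<otimes>\<^sub>B s' = z \<otimes>\<^sub>B z \<and> s' \<otimes>\<^sub>B s = z \<otimes>\<^sub>B z"
 assumes g1: "\<And>m. \<exists>s\<in>isotypic G B \<beta> (torus_character n \<theta> m). good s"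
  and g2: "\<And>j. j < length ns ==> \<exists>s\<in>isotypic G B \<beta> (root_character \<theta> j). good s \<and>
   (\<exists>b\<in>fixed_points G B \<beta>. b [^]\<^sub>B (ns ! j) = s [^]\<^sub>B (ns ! j))"
 shows "trivial_ncp_bundle G n ns \<theta> (localization B z) (loc_action B z \<beta>)"
proof -
 interpret S: smooth_functions real_line B
  by (simp add: smooth_functions_def cmfd_def charted_real_line B.lcalg_axioms)
 note op = S.Cinf_simps(3-7)
 interpret C: lcalg S.C by (rule lcalg.intro[OF S.lc_algebra_C])
 define cst :: "'b => real => 'b" where "cst = (\<lambda>b t. b)"
 define \<tau> where "\<tau> = (\<lambda>t. complex_of_real t \<odot>\<^sub>B \<one>\<^sub>B)"
 define u where "u = (\<lambda>t. \<one>\<^sub>B \<ominus>\<^sub>B (complex_of_real t \<odot>\<^sub>B z))"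
 define L where "L = loc_ideal B z"
 define \<gamma> where "\<gamma> = (\<lambda>g f. \<lambda>x\<in>topspace (mtop real_line). \<beta> g (f x))"
 have \<gamma>: "\<gamma> g f = (\<lambda>t. \<beta> g (f t))" for g f by (simp add: \<gamma>_def restrict_def)
 have cst: "cst b \<in> carrier S.C" if "b \<in> carrier B" for b
  using S.restrict_in_C[OF smooth_map_const[OF charted_real_line B.R.rlc_axioms, of b]] that by (simp add: cst_def restrict_def)
 have \<tau>: "\<tau> \<in> carrier S.C"
  using S.restrict_in_C[OF B.smooth_map_scale[OF charted_real_line smooth_fn_id B.one_closed]] by (simp add: \<tau>_def restrict_def)
 let ?w = "\<tau> \<otimes>\<^bsub>S.C\<^esub> cst z"
 have w: "?w \<in> carrier S.C" using \<tau> cst[OF z(1)] by simp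
 have u_eq: "u = \<one>\<^bsub>S.C\<^esub> \<ominus>\<^bsub>S.C\<^esub> ?w"
  using z(1) unfolding S.C.csub_eq[OF S.C.one_closed w]
  by (simp add: fun_eq_iff op u_def \<tau>_def cst_def B.csub_eq B.csmul_mult_left)
 have u: "u \<in> carrier S.C" unfolding u_eq using w by simp
 let ?J = "genideal S.C {u}"
 have J: "ideal ?J S.C" by (rule S.C.genideal_ideal) (use u in simp)
 have L_eq: "L = topol S.C closure_of ?J" by (simp only: L_def loc_ideal_def u_def)
 have L: "ideal L S.C" unfolding L_eq by (rule C.closure_ideal[OF J])
 interpret Q: closed_ideal S.C L
  by (intro closed_ideal.intro C.lcalg_axioms L closed_ideal_axioms.intro) (simp add: L_eq)
 have JL: "?J \<subseteq> L"
  unfolding L_eq by (rule closure_of_subset) (use ideal.Icarr[OF J] C.topspace_B in blast)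
 have uL: "u \<in> L" using S.C.genideal_self'[OF u] JL by blast
 have dsC: "dynamical_system G S.C \<gamma>"
  unfolding \<gamma>_def by (rule dynamical_system_Cinf[OF dynsys_axioms charted_real_line])
 interpret D: dynsys G S.C \<gamma>
  by (intro dynsys.intro dynsys_axioms.intro dsC compact_group_axioms C.lcalg_axioms)
 \<comment> \<open>The generator is fixed, so the action preserves the ideal and its closure.\<close>
 have \<gamma>u: "\<gamma> g u = u" if g: "g \<in> carrier G" for g
 proof
  fix t
  have "\<beta> g (u t) = \<beta> g \<one>\<^sub>B \<ominus>\<^sub>B \<beta> g (complex_of_real t \<odot>\<^sub>B z)"
   unfolding u_def by (rule alg_hom_sub[OF B.calg_axioms B.calg_axioms hom[OF g]]) (use z in simp_all)
  then show "\<gamma> g u t = u t"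
   using alg_iso_one[OF B.calg_axioms B.calg_axioms iso[OF g]] alg_homD(4)[OF hom[OF g] z(1)] z(3)[OF g]
   by (simp add: \<gamma> u_def)
 qed
 have inv: "\<gamma> g x \<in> L" if g: "g \<in> carrier G" and x: "x \<in> L" for g x
 proof -
  have "?J \<subseteq> {x \<in> carrier S.C. \<gamma> g x \<in> ?J}"
   by (rule S.C.genideal_minimal[OF ideal_preimage[OF S.C.calg_axioms S.C.calg_axioms D.hom[OF g] J]])
    (use u \<gamma>u[OF g] S.C.genideal_self'[OF u] in simp)
  then have "\<gamma> g ` ?J \<subseteq> ?J" by blast
  moreover have "\<gamma> g ` L \<subseteq> topol S.C closure_of (\<gamma> g ` ?J)"
   unfolding L_eq by (rule continuous_map_image_closure_subset[OF D.act_cont_each[OF g]])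
  ultimately have "\<gamma> g ` L \<subseteq> L" unfolding L_eq by (meson closure_of_mono order_trans)
  then show ?thesis using x by blast
 qed
 define \<delta> where "\<delta> = (\<lambda>g X. \<Union>f\<in>X. Q.\<pi> (\<gamma> g f))"
 have ds: "dynamical_system G Q.Q \<delta>" and \<delta>: "\<And>g x. g \<in> carrier G ==> x \<in> carrier S.C ==> \<delta> g (Q.\<pi> x) = Q.\<pi> (\<gamma> g x)"
  using Q.dynamical_system_Q[OF D.dynsys_axioms inv] unfolding \<delta>_def by blast+
 interpret Q': calg Q.Q by (rule calg.intro[OF Q.Q_alg])
 have \<pi>c: "Q.\<pi> x \<in> carrier Q.Q" if "x \<in> carrier S.C" for x using that by (simp add: Q.Q_simps(1))
 have "\<one>\<^bsub>S.C\<^esub> \<ominus>\<^bsub>S.C\<^esub> ?w \<in> L" using uL u_eq by simp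
 then have \<pi>w: "Q.\<pi> ?w = \<one>\<^bsub>Q.Q\<^esub>" using Q.\<pi>_eq_iff[OF S.C.one_closed w] Q.Q_simps(3) by simp
 have \<pi>ww: "Q.\<pi> (?w \<otimes>\<^bsub>S.C\<^esub> ?w) = \<one>\<^bsub>Q.Q\<^esub>"
  using Q.Q_mult[OF w w] \<pi>w by simp
 have unit: "Q.\<pi> (cst s) \<in> Units Q.Q" if s: "s \<in> carrier B" and gs: "good s" for s
 proof -
  obtain s' where s': "s' \<in> carrier B" "s \<otimes>\<^sub>B s' = z \<otimes>\<^sub>B z" "s' \<otimes>\<^sub>B s = z \<otimes>\<^sub>B z"
   using gs by (auto simp: good_def)
  let ?v = "cst s' \<otimes>\<^bsub>S.C\<^esub> (\<tau> \<otimes>\<^bsub>S.C\<^esub> \<tau>)"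
  have v: "?v \<in> carrier S.C" using cst[OF s'(1)] \<tau> by simp
  have "cst s \<otimes>\<^bsub>S.C\<^esub> ?v = ?w \<otimes>\<^bsub>S.C\<^esub> ?w" "?v \<otimes>\<^bsub>S.C\<^esub> cst s = ?w \<otimes>\<^bsub>S.C\<^esub> ?w"
   using s s' z(1) by (simp_all add: op \<tau>_def cst_def B.csmul_mult_left B.csmul_mult_right B.csmul_csmul)
  then have "Q.\<pi> (cst s) \<otimes>\<^bsub>Q.Q\<^esub> Q.\<pi> ?v = \<one>\<^bsub>Q.Q\<^esub>" "Q.\<pi> ?v \<otimes>\<^bsub>Q.Q\<^esub> Q.\<pi> (cst s) = \<one>\<^bsub>Q.Q\<^esub>"
   using Q.Q_mult[OF cst[OF s] v] Q.Q_mult[OF v cst[OF s]] \<pi>ww by simp_all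
  then show ?thesis using \<pi>c[OF v] \<pi>c[OF cst[OF s]] unfolding Units_def by blast
 qed
 have iso: "Q.\<pi> (cst s) \<in> isotypic G Q.Q \<delta> \<phi>" if s: "s \<in> isotypic G B \<beta> \<phi>" for s \<phi>
 proof -
  have sc: "s \<in> carrier B" and sg: "\<And>g. g \<in> carrier G ==> \<beta> g s = \<phi> g \<odot>\<^sub>B s" using s by (auto simp: isotypic_def)
  have "\<delta> g (Q.\<pi> (cst s)) = \<phi> g \<odot>\<^bsub>Q.Q\<^esub> Q.\<pi> (cst s)" if g: "g \<in> carrier G" for g
  proof -
   have "\<gamma> g (cst s) = \<phi> g \<odot>\<^bsub>S.C\<^esub> cst s" using sg[OF g] by (simp add: \<gamma> cst_def op restrict_def)
   then show ?thesis using \<delta>[OF g cst[OF sc]] Q.Q_smul[OF cst[OF sc]] by simp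
  qed
  then show ?thesis using \<pi>c[OF cst[OF sc]] by (simp add: isotypic_def)
 qed
 have pow: "Q.\<pi> (cst b) [^]\<^bsub>Q.Q\<^esub> (k::nat) = Q.\<pi> (cst (b [^]\<^sub>B k))" if b: "b \<in> carrier B" for b k
 proof (induction k)
  case 0
  have "cst \<one>\<^sub>B = \<one>\<^bsub>S.C\<^esub>" by (simp add: op cst_def restrict_def)
  then show ?case using Q.Q_simps(3) by simp
 next
  case (Suc k)
  have "cst (b [^]\<^sub>B k) \<otimes>\<^bsub>S.C\<^esub> cst b = cst (b [^]\<^sub>B k \<otimes>\<^sub>B b)" by (simp add: op cst_def restrict_def)
  then show ?case using Q.Q_mult[OF cst[OF B.nat_pow_closed[OF b]] cst[OF b], of k] Suc by simp
 qed
 have "ncp_G1 G n \<theta> Q.Q \<delta>"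
  unfolding ncp_G1_def
 proof
  fix m
  obtain s where s: "s \<in> isotypic G B \<beta> (torus_character n \<theta> m)" "good s" using g1 by blast
  then have "s \<in> carrier B" by (simp add: isotypic_def)
  then show "isotypic G Q.Q \<delta> (torus_character n \<theta> m) \<inter> Units Q.Q \<noteq> {}" using iso[OF s(1)] unit[OF _ s(2)] by blast
 qed
 moreover have "ncp_G2 G ns \<theta> Q.Q \<delta>"
  unfolding ncp_G2_def
 proof (intro allI impI)
  fix j assume "j < length ns"
  from g2[OF this] obtain s b where s: "s \<in> isotypic G B \<beta> (root_character \<theta> j)" "good s"
   and b: "b \<in> fixed_points G B \<beta>" "b [^]\<^sub>B (ns ! j) = s [^]\<^sub>B (ns ! j)" by blast
  have sc: "s \<in> carrier B" using s(1) by (simp add: isotypic_def)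
  have bc: "b \<in> carrier B" and bg: "\<And>g. g \<in> carrier G ==> \<beta> g b = b" using b(1) by (auto simp: fixed_points_def)
  have "\<delta> g (Q.\<pi> (cst b)) = Q.\<pi> (cst b)" if g: "g \<in> carrier G" for g
   using \<delta>[OF g cst[OF bc]] bg[OF g] by (simp add: \<gamma> cst_def)
  then have "Q.\<pi> (cst b) \<in> fixed_points G Q.Q \<delta>" using \<pi>c[OF cst[OF bc]] by (simp add: fixed_points_def)
  moreover have "Q.\<pi> (cst b) [^]\<^bsub>Q.Q\<^esub> (ns ! j) = Q.\<pi> (cst s) [^]\<^bsub>Q.Q\<^esub> (ns ! j)"
   using pow[OF bc] pow[OF sc] b(2) by simp
  ultimately show "\<exists>a\<in>isotypic G Q.Q \<delta> (root_character \<theta> j) \<inter> Units Q.Q.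
    \<exists>b\<in>fixed_points G Q.Q \<delta>. b [^]\<^bsub>Q.Q\<^esub> (ns ! j) = a [^]\<^bsub>Q.Q\<^esub> (ns ! j)"
   using iso[OF s(1)] unit[OF sc s(2)] by blast
 qed
 ultimately have "trivial_ncp_bundle G n ns \<theta> Q.Q \<delta>" using ds by (simp add: trivial_ncp_bundle_def)
 moreover have "\<delta> = loc_action B z \<beta>"
  by (intro ext) (simp add: \<delta>_def loc_action_def \<gamma> L_def)
 ultimately show ?thesis by (simp add: localization_def L_def)
qed

section \<open>Scalar functions and supported sections\<close>

context alg_bundle
begin

definition lift :: "('p => real) => 'p => 'e" where
 "lift f = (\<lambda>x\<in>X. complex_of_real (f x) \<odot>\<^bsub>fibre E x\<^esub> \<one>\<^bsub>fibre E x\<^esub>)"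

text \<open>The local section \<open>f a\<close> over \<open>U i\<close>, extended by zero.\<close>

definition spread :: "'i => ('p => real) => 'a => 'p => 'e" where
 "spread i f a = (\<lambda>x\<in>X. if x \<in> U i then chart E i (x, complex_of_real (f x) \<odot>\<^sub>A a) else \<zero>\<^bsub>fibre E x\<^esub>)"

lemma lift_chart:
 assumes "i \<in> I" "x \<in> U i"
 shows "lift f x = chart E i (x, complex_of_real (f x) \<odot>\<^sub>A \<one>\<^sub>A)"
 using chart_homD(4)[OF assms A.one_closed, of "complex_of_real (f x)"] chart_one[OF assms] subsetD[OF U_sub[OF assms(1)] assms(2)]
 by (simp add: lift_def)

lemma lift_section:
 assumes f: "smooth_fn M f" shows "lift f \<in> sections M E"
proof (rule section_localI)
 show "lift f \<in> extensional X" by (simp add: lift_def)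
 fix x assume "x \<in> X"
 then obtain i where i: "i \<in> I" "x \<in> U i" using U_ex by blast
 have "smooth_map (N i) (alg_mfd A) (\<lambda>x. complex_of_real (f x) \<odot>\<^sub>A \<one>\<^sub>A)"
  by (rule A.smooth_map_scale[OF charted_N[OF i(1)] smooth_map_restrict[OF charted_M charted_space_mfd[OF rlc_scalars] f Uo[OF i(1)]]]) simp
 then show "\<exists>W i u. openin (mtop M) W \<and> x \<in> W \<and> i \<in> I \<and> W \<subseteq> U i \<and>
   smooth_map (open_submfd M W) (alg_mfd A) u \<and> (\<forall>y\<in>W. lift f y = chart E i (y, u y))"
  using i Uo[OF i(1)] lift_chart[OF i(1)] by (intro exI[of _ "U i"] exI[of _ i] exI conjI) auto
qed

lemma spread_section:
 assumes f: "smooth_fn M f" and i: "i \<in> I" and S: "closedin (mtop M) S" "S \<subseteq> U i" "\<And>y. y \<in> X - S ==> f y = 0"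
  and a: "a \<in> carrier A"
 shows "spread i f a \<in> sections M E"
proof (rule section_localI)
 show "spread i f a \<in> extensional X" by (simp add: spread_def)
 fix x assume x: "x \<in> X"
 show "\<exists>W j u. openin (mtop M) W \<and> x \<in> W \<and> j \<in> I \<and> W \<subseteq> U j \<and>
   smooth_map (open_submfd M W) (alg_mfd A) u \<and> (\<forall>y\<in>W. spread i f a y = chart E j (y, u y))"
 proof (cases "x \<in> U i")
  case True
  have "smooth_map (N i) (alg_mfd A) (\<lambda>x. complex_of_real (f x) \<odot>\<^sub>A a)"
   by (rule A.smooth_map_scale[OF charted_N[OF i] smooth_map_restrict[OF charted_M charted_space_mfd[OF rlc_scalars] f Uo[OF i]] a])
  moreover have "\<forall>y\<in>U i. spread i f a y = chart E i (y, complex_of_real (f y) \<odot>\<^sub>A a)"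
   using U_sub[OF i] by (auto simp: spread_def)
  ultimately show ?thesis using i Uo[OF i] True by blast
 next
  case False
  obtain j where j: "j \<in> I" "x \<in> U j" using U_ex[OF x] by blast
  let ?W = "U j \<inter> (X - S)"
  have o: "openin (mtop M) ?W" using Uo[OF j(1)] S(1) by (simp add: closedin_def openin_Int)
  have "spread i f a y = chart E j (y, \<zero>\<^sub>A)" if y: "y \<in> ?W" for y
  proof (cases "y \<in> U i")
   case True
   then have "spread i f a y = \<zero>\<^bsub>fibre E y\<^esub>"
    using y S(3)[of y] a chart_zero[OF i True] by (simp add: spread_def)
   then show ?thesis using chart_zero[OF j(1), of y] y by simp
  qed (use y chart_zero[OF j(1), of y] in \<open>simp add: spread_def\<close>)
  moreover have "smooth_map (open_submfd M ?W) (alg_mfd A) (\<lambda>y. \<zero>\<^sub>A)"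
   by (rule smooth_map_const[OF charted_open_submfd[OF charted_M o] A.R.rlc_axioms]) simp
  moreover have "x \<in> ?W" using x j(2) False S(2) by blast
  ultimately show ?thesis using o j(1) by (intro exI[of _ ?W] exI[of _ j] exI[of _ "\<lambda>y. \<zero>\<^sub>A"]) blast
 qed
qed

lemma lift_add: "lift (\<lambda>x. f x + g x) = lift f \<oplus>\<^sub>\<Gamma> lift g"
proof (rule section_eqI)
 fix x assume x: "x \<in> X"
 interpret F: calg "fibre E x" by (rule fibre_calg[OF x])
 show "lift (\<lambda>x. f x + g x) x = (lift f \<oplus>\<^sub>\<Gamma> lift g) x" using x by (simp add: lift_def section_simps F.csmul_add_left)
qed (simp_all add: lift_def section_simps)

lemma lift_mult: "lift (\<lambda>x. f x * g x) = lift f \<otimes>\<^sub>\<Gamma> lift g"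
proof (rule section_eqI)
 fix x assume x: "x \<in> X"
 interpret F: calg "fibre E x" by (rule fibre_calg[OF x])
 show "lift (\<lambda>x. f x * g x) x = (lift f \<otimes>\<^sub>\<Gamma> lift g) x"
  using x by (simp add: lift_def section_simps F.csmul_mult_left F.csmul_csmul)
qed (simp_all add: lift_def section_simps)

lemma lift_const: "lift (\<lambda>x. c) = complex_of_real c \<odot>\<^sub>\<Gamma> \<one>\<^sub>\<Gamma>"
 by (rule section_eqI) (simp_all add: lift_def section_simps)

lemma lift_inverse:
 assumes "\<And>x. x \<in> X ==> f x \<noteq> 0" shows "lift f \<otimes>\<^sub>\<Gamma> lift (\<lambda>x. inverse (f x)) = \<one>\<^sub>\<Gamma>"
 unfolding lift_mult[symmetric]
proof (rule section_eqI)
 fix x assume x: "x \<in> X"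
 interpret F: calg "fibre E x" by (rule fibre_calg[OF x])
 show "lift (\<lambda>x. f x * inverse (f x)) x = \<one>\<^sub>\<Gamma> x"
  using x assms[OF x] by (simp add: lift_def section_simps)
qed (simp_all add: lift_def section_simps)

lemma lift_central:
 assumes s: "s \<in> sections M E" shows "lift f \<otimes>\<^sub>\<Gamma> s = s \<otimes>\<^sub>\<Gamma> lift f"
proof (rule section_eqI)
 fix x assume x: "x \<in> X"
 interpret F: calg "fibre E x" by (rule fibre_calg[OF x])
 show "(lift f \<otimes>\<^sub>\<Gamma> s) x = (s \<otimes>\<^sub>\<Gamma> lift f) x"
  using x sections_val[OF s x] by (simp add: lift_def section_simps F.csmul_mult_left F.csmul_mult_right)
qed (simp_all add: section_simps)

lemma spread_mult:
 assumes i: "i \<in> I" and f: "\<And>y. y \<in> X - U i ==> f y = 0" and a: "a \<in> carrier A" and b: "b \<in> carrier A"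
  and ab: "a \<otimes>\<^sub>A b = \<one>\<^sub>A"
 shows "spread i f a \<otimes>\<^sub>\<Gamma> spread i f b = lift f \<otimes>\<^sub>\<Gamma> lift f"
proof (rule section_eqI)
 fix x assume x: "x \<in> X"
 interpret F: calg "fibre E x" by (rule fibre_calg[OF x])
 show "(spread i f a \<otimes>\<^sub>\<Gamma> spread i f b) x = (lift f \<otimes>\<^sub>\<Gamma> lift f) x"
 proof (cases "x \<in> U i")
  case True
  let ?c = "complex_of_real (f x)"
  have "chart E i (x, ?c \<odot>\<^sub>A a) \<otimes>\<^bsub>fibre E x\<^esub> chart E i (x, ?c \<odot>\<^sub>A b) =
    chart E i (x, (?c \<odot>\<^sub>A a) \<otimes>\<^sub>A (?c \<odot>\<^sub>A b))"
   by (rule chart_homD(3)[OF i True, symmetric]) (use a b in auto)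
  also have "(?c \<odot>\<^sub>A a) \<otimes>\<^sub>A (?c \<odot>\<^sub>A b) = (?c \<odot>\<^sub>A \<one>\<^sub>A) \<otimes>\<^sub>A (?c \<odot>\<^sub>A \<one>\<^sub>A)"
   using a b ab by (simp add: A.csmul_mult_left A.csmul_mult_right)
  also have "chart E i (x, \<dots>) = lift f x \<otimes>\<^bsub>fibre E x\<^esub> lift f x"
   unfolding lift_chart[OF i True] by (rule chart_homD(3)[OF i True]) auto
  finally show ?thesis using x True by (simp add: section_simps spread_def)
 next
  case False
  then show ?thesis using x f[of x] by (simp add: section_simps spread_def lift_def)
 qed
qed (simp_all add: section_simps)

text \<open>For the exponent 0 the power is the unit section, which is not an extension by zero.\<close>

lemma spread_pow:
 fixes k :: nat
 assumes i: "i \<in> I" and a: "a \<in> carrier A" and s: "spread i f a \<in> sections M E"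
 shows "spread i f a [^]\<^sub>\<Gamma> k = (\<lambda>x\<in>X. if x \<in> U i then chart E i (x, complex_of_real (f x ^ k) \<odot>\<^sub>A (a [^]\<^sub>A k))
   else if k = 0 then \<one>\<^bsub>fibre E x\<^esub> else \<zero>\<^bsub>fibre E x\<^esub>)" (is "_ = ?r k")
proof -
 interpret \<Gamma>: calg \<Gamma> by (rule calg.intro[OF \<Gamma>_alg])
 show ?thesis
 proof (induction k)
  case 0
  have "\<one>\<^sub>\<Gamma> = ?r 0"
  proof (rule section_eqI)
   show "\<one>\<^sub>\<Gamma> \<in> extensional X" unfolding section_simps by (rule restrict_extensional)
   show "?r 0 \<in> extensional X" by (rule restrict_extensional)
   show "\<one>\<^sub>\<Gamma> x = ?r 0 x" if "x \<in> X" for x using that chart_one[OF i, of x] by (simp add: section_simps)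
  qed
  then show ?case by simp
 next
  case (Suc k)
  have "?r k \<otimes>\<^sub>\<Gamma> spread i f a = ?r (Suc k)"
  proof (rule section_eqI)
   fix x assume x: "x \<in> X"
   interpret F: calg "fibre E x" by (rule fibre_calg[OF x])
   show "(?r k \<otimes>\<^sub>\<Gamma> spread i f a) x = ?r (Suc k) x"
   proof (cases "x \<in> U i")
    case True
    let ?c = "complex_of_real (f x ^ k) \<odot>\<^sub>A (a [^]\<^sub>A k)" and ?d = "complex_of_real (f x) \<odot>\<^sub>A a"
    have "chart E i (x, ?c) \<otimes>\<^bsub>fibre E x\<^esub> chart E i (x, ?d) = chart E i (x, ?c \<otimes>\<^sub>A ?d)"
     by (rule chart_homD(3)[OF i True, symmetric]) (use a in auto)
    also have "?c \<otimes>\<^sub>A ?d = complex_of_real (f x ^ Suc k) \<odot>\<^sub>A (a [^]\<^sub>A Suc k)"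
     using a by (simp add: A.csmul_mult_left A.csmul_mult_right A.csmul_csmul mult.commute)
    finally show ?thesis using x True by (simp add: section_simps spread_def)
   next
    case False
    then show ?thesis using x by (simp add: section_simps spread_def)
   qed
  next
   show "?r k \<otimes>\<^sub>\<Gamma> spread i f a \<in> extensional X" unfolding section_simps by (rule restrict_extensional)
   show "?r (Suc k) \<in> extensional X" by (rule restrict_extensional)
  qed
  then show ?case using Suc by simp
 qed
qed

end

context alg_bundle_action
begin

lemma spread_isotypic:
 assumes i: "i \<in> I" and a: "a \<in> isotypic G A \<alpha> \<phi>" and s: "spread i f a \<in> sections M E"
 shows "spread i f a \<in> isotypic G \<Gamma> \<beta> \<phi>"
proof -
 have ac: "a \<in> carrier A" and ag: "\<And>g. g \<in> carrier G ==> \<alpha> g a = \<phi> g \<odot>\<^sub>A a" using a by (auto simp: isotypic_def)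
 have "\<beta> g (spread i f a) = \<phi> g \<odot>\<^sub>\<Gamma> spread i f a" if g: "g \<in> carrier G" for g
 proof (rule section_eqI)
  fix x assume x: "x \<in> X"
  interpret F: calg "fibre E x" by (rule fibre_calg[OF x])
  show "\<beta> g (spread i f a) x = (\<phi> g \<odot>\<^sub>\<Gamma> spread i f a) x"
  proof (cases "x \<in> U i")
   case True
   let ?c = "complex_of_real (f x)"
   have "\<sigma> g (chart E i (x, ?c \<odot>\<^sub>A a)) = chart E i (x, \<alpha> g (?c \<odot>\<^sub>A a))"
    using \<sigma>_chart[OF g i True] ac by simp
   also have "\<alpha> g (?c \<odot>\<^sub>A a) = \<phi> g \<odot>\<^sub>A (?c \<odot>\<^sub>A a)"
    using alg_homD(4)[OF hom[OF g] ac] ag[OF g] ac by (simp add: A.csmul_csmul mult.commute)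
   also have "chart E i (x, \<dots>) = \<phi> g \<odot>\<^bsub>fibre E x\<^esub> chart E i (x, ?c \<odot>\<^sub>A a)"
    by (rule chart_homD(4)[OF i True]) (use ac in simp)
   finally show ?thesis using x True by (simp add: section_action_def section_simps spread_def)
  next
   case False
   have "\<sigma> g \<zero>\<^bsub>fibre E x\<^esub> = \<zero>\<^bsub>fibre E x\<^esub>" by (rule alg_hom_zero[OF F.calg_axioms F.calg_axioms \<sigma>_hom[OF g x]])
   then show ?thesis using x False by (simp add: section_action_def section_simps spread_def)
  qed
 qed (simp_all add: section_action_def section_simps)
 then show ?thesis using s by (simp add: isotypic_def section_simps(1))
qed

lemma lift_fixed: "g \<in> carrier G ==> \<beta> g (lift f) = lift f"
proof (rule section_eqI)
 fix x assume g: "g \<in> carrier G" and x: "x \<in> X"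
 interpret F: calg "fibre E x" by (rule fibre_calg[OF x])
 show "\<beta> g (lift f) x = lift f x"
  using x alg_homD(4)[OF \<sigma>_hom[OF g x] F.one_closed] alg_iso_one[OF F.calg_axioms F.calg_axioms \<sigma>_iso[OF g x]]
  by (simp add: section_action_def lift_def)
qed (simp_all add: section_action_def lift_def)

lemma lift_fixed_center: "smooth_fn M f ==> lift f \<in> carrier (fixed_center G \<Gamma> \<beta>)"
 using lift_section[of f] lift_central[of _ f] lift_fixed[of _ f]
 by (simp add: fixed_center_def alg_center_def fixed_points_def section_simps(1))

lemma fixed_center_simps:
 "add (fixed_center G \<Gamma> \<beta>) = add \<Gamma>" "monoid.mult (fixed_center G \<Gamma> \<beta>) = monoid.mult \<Gamma>"
 "smult (fixed_center G \<Gamma> \<beta>) = smult \<Gamma>" "one (fixed_center G \<Gamma> \<beta>) = one \<Gamma>"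
 by (simp_all add: fixed_center_def)

theorem ncp_bundle_sections:
 assumes fd: "fd_manifold M" and G1: "ncp_G1 G n \<theta> A \<alpha>" and G2: "ncp_G2 G ns \<theta> A \<alpha>"
 shows "ncp_bundle G n ns \<theta> \<Gamma> \<beta>"
 unfolding ncp_bundle_def
proof (intro conjI ballI dyn_\<Gamma>)
 let ?Z = "fixed_center G \<Gamma> \<beta>"
 fix \<omega> assume \<omega>: "\<omega> \<in> characters ?Z"
 have h: "\<omega> \<in> alg_hom ?Z (scalars :: (complex, complex) tmodule)" using \<omega> by (simp add: characters_def)
 note hD = alg_homD[OF h, unfolded fixed_center_simps scalars_simps]
 note lf = lift_fixed_center
 interpret \<Gamma>': calg \<Gamma> by (rule calg.intro[OF \<Gamma>_alg])
 have "smooth_fn M (\<lambda>x. 1)" by (rule smooth_fn_const[OF charted_M])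
 from lf[OF this] have oneZ: "\<one>\<^sub>\<Gamma> \<in> carrier ?Z" unfolding lift_const by simp
 have one: "\<omega> \<one>\<^sub>\<Gamma> = 1"
 proof -
  obtain w where w: "w \<in> carrier ?Z" "\<omega> w \<noteq> 0" using \<omega> by (auto simp: characters_def)
  then have "w \<in> carrier \<Gamma>" by (simp add: fixed_center_def alg_center_def)
  then have "\<omega> w = \<omega> \<one>\<^sub>\<Gamma> * \<omega> w" using hD(3)[OF oneZ w(1)] by simp
  then show ?thesis using w(2) by simp
 qed
 have const: "\<omega> (lift (\<lambda>x. c)) = of_real c" for c
  unfolding lift_const using hD(4)[OF oneZ] one by simp
 have add: "\<omega> (lift (\<lambda>x. f x + g x)) = \<omega> (lift f) + \<omega> (lift g)" if "smooth_fn M f" "smooth_fn M g" for f g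
  unfolding lift_add by (rule hD(2)[OF lf[OF that(1)] lf[OF that(2)]])
 have mult: "\<omega> (lift (\<lambda>x. f x * g x)) = \<omega> (lift f) * \<omega> (lift g)" if "smooth_fn M f" "smooth_fn M g" for f g
  unfolding lift_mult by (rule hD(3)[OF lf[OF that(1)] lf[OF that(2)]])
 have unit: "\<omega> (lift f) \<noteq> 0" if f: "smooth_fn M f" "\<And>x. x \<in> X ==> f x \<noteq> 0" for f
 proof -
  have "smooth_fn M (\<lambda>x. inverse (f x))" by (rule smooth_fn_inverse[OF charted_M f])
  moreover have "lift f \<otimes>\<^sub>\<Gamma> lift (\<lambda>x. inverse (f x)) = \<one>\<^sub>\<Gamma>" by (rule lift_inverse[OF f(2)])
  ultimately have "\<omega> (lift f) * \<omega> (lift (\<lambda>x. inverse (f x))) = 1"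
   using hD(3)[OF lf[OF f(1)] lf] one by metis
  then show ?thesis by auto
 qed
 \<comment> \<open>On the empty manifold even the function 0 would be mapped to a nonzero number.\<close>
 have ne: "X \<noteq> {}"
 proof
  assume "X = {}"
  then have "\<omega> (lift (\<lambda>x. 0)) \<noteq> 0" by (intro unit smooth_fn_const[OF charted_M]) simp
  then show False using const[of 0] by simp
 qed
 have "\<exists>\<rho> :: nat => 'p => real. (\<forall>k. smooth_fn M (\<rho> k)) \<and> (\<forall>k y. 0 \<le> \<rho> k y) \<and>
  (\<forall>k. \<exists>i\<in>I. \<exists>S. closedin (mtop M) S \<and> S \<subseteq> U i \<and> (\<forall>y\<in>X - S. \<rho> k y = 0)) \<and>
  (\<forall>x\<in>X. \<exists>k. 0 < \<rho> k x) \<and>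
  (\<forall>x\<in>X. \<exists>W n. openin (mtop M) W \<and> x \<in> W \<and> (\<forall>k\<ge>n. \<forall>y\<in>W. \<rho> k y = 0))"
  by (rule ex_bump_family[OF fd ne _ cov]) (rule Uo)
 then obtain \<rho> :: "nat => 'p => real" where \<rho>: "\<forall>k. smooth_fn M (\<rho> k)" "\<forall>k y. 0 \<le> \<rho> k y"
  "\<forall>k. \<exists>i\<in>I. \<exists>S. closedin (mtop M) S \<and> S \<subseteq> U i \<and> (\<forall>y\<in>X - S. \<rho> k y = 0)"
  "\<forall>x\<in>X. \<exists>k. 0 < \<rho> k x"
  "\<forall>x\<in>X. \<exists>W n. openin (mtop M) W \<and> x \<in> W \<and> (\<forall>k\<ge>n. \<forall>y\<in>W. \<rho> k y = 0)"
  by (elim exE conjE)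
 have "\<exists>k. \<omega> (lift (\<rho> k)) \<noteq> 0"
  by (rule character_detects[OF charted_M const add mult unit \<rho>(1)[rule_format] \<rho>(2)[rule_format] \<rho>(4)[rule_format] \<rho>(5)[rule_format]])
 then obtain k where k: "\<omega> (lift (\<rho> k)) \<noteq> 0" by (elim exE)
 define f where "f = \<rho> k"
 have f: "smooth_fn M f" using \<rho>(1) by (simp add: f_def)
 obtain i S where i: "i \<in> I" and S: "closedin (mtop M) S" "S \<subseteq> U i" "\<And>y. y \<in> X - S ==> f y = 0"
  using \<rho>(3)[rule_format, of k] unfolding f_def by (elim bexE exE conjE) simp
 have off: "f y = 0" if "y \<in> X - U i" for y using S(2,3) that by blast
 have sec: "spread i f a \<in> sections M E" if "a \<in> carrier A" for a
  by (rule spread_section[OF f i S(1,2) _ that]) (rule S(3))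
 have mul: "spread i f a \<otimes>\<^sub>\<Gamma> spread i f b = lift f \<otimes>\<^sub>\<Gamma> lift f"
  if "a \<in> carrier A" "b \<in> carrier A" "a \<otimes>\<^sub>A b = \<one>\<^sub>A" for a b
  by (rule spread_mult[OF i _ that]) (rule off)
 show "\<exists>z\<in>carrier ?Z. \<omega> z \<noteq> 0 \<and> trivial_ncp_bundle G n ns \<theta> (localization \<Gamma> z) (loc_action \<Gamma> z \<beta>)"
 proof (intro bexI[OF _ lf[OF f]] conjI)
  show "\<omega> (lift f) \<noteq> 0" using k by (simp add: f_def)
  have good: "\<exists>s'\<in>carrier \<Gamma>. spread i f a \<otimes>\<^sub>\<Gamma> s' = lift f \<otimes>\<^sub>\<Gamma> lift f \<and> s' \<otimes>\<^sub>\<Gamma> spread i f a = lift f \<otimes>\<^sub>\<Gamma> lift f"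
   if u: "a \<in> Units A" for a
  proof -
   obtain b where b: "a \<in> carrier A" "b \<in> carrier A" "a \<otimes>\<^sub>A b = \<one>\<^sub>A" "b \<otimes>\<^sub>A a = \<one>\<^sub>A"
    using u by (auto simp: Units_def)
   show ?thesis
    using mul[OF b(1,2,3)] mul[OF b(2,1,4)] sec[OF b(2)] unfolding section_simps(1) by blast
  qed
  show "trivial_ncp_bundle G n ns \<theta> (localization \<Gamma> (lift f)) (loc_action \<Gamma> (lift f) \<beta>)"
  proof (rule \<Gamma>.trivial_localization)
   show "lift f \<in> carrier \<Gamma>" using lift_section[OF f] by (simp only: section_simps(1))
   show "lift f \<otimes>\<^sub>\<Gamma> a = a \<otimes>\<^sub>\<Gamma> lift f" if "a \<in> carrier \<Gamma>" for a
    using lift_central[of a f] that by (simp only: section_simps(1))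
   show "\<beta> g (lift f) = lift f" if "g \<in> carrier G" for g by (rule lift_fixed[OF that])
  next
   fix m
   obtain a where a: "a \<in> isotypic G A \<alpha> (torus_character n \<theta> m)" "a \<in> Units A" using G1 by (auto simp: ncp_G1_def)
   have ac: "a \<in> carrier A" using a(1) by (simp add: isotypic_def)
   show "\<exists>s\<in>isotypic G \<Gamma> \<beta> (torus_character n \<theta> m). \<exists>s'\<in>carrier \<Gamma>. s \<otimes>\<^sub>\<Gamma> s' = lift f \<otimes>\<^sub>\<Gamma> lift f \<and> s' \<otimes>\<^sub>\<Gamma> s = lift f \<otimes>\<^sub>\<Gamma> lift f"
    by (rule bexI[OF _ spread_isotypic[OF i a(1) sec[OF ac]]]) (rule good[OF a(2)])
  next
   fix j assume "j < length ns"
   then obtain a b where a: "a \<in> isotypic G A \<alpha> (root_character \<theta> j)" "a \<in> Units A"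
    and b: "b \<in> fixed_points G A \<alpha>" "b [^]\<^sub>A (ns ! j) = a [^]\<^sub>A (ns ! j)"
    using G2 by (fastforce simp: ncp_G2_def)
   have ac: "a \<in> carrier A" using a(1) by (simp add: isotypic_def)
   have bc: "b \<in> carrier A" using b(1) by (simp add: fixed_points_def)
   have "b \<in> isotypic G A \<alpha> (\<lambda>_. 1)" using b(1) bc by (simp add: fixed_points_def isotypic_def)
   from spread_isotypic[OF i this sec[OF bc]]
   have bi: "spread i f b \<in> isotypic G \<Gamma> \<beta> (\<lambda>_. 1)" .
   then have bf: "spread i f b \<in> fixed_points G \<Gamma> \<beta>" by (auto simp: fixed_points_def isotypic_def)
   have bp: "spread i f b [^]\<^sub>\<Gamma> (ns ! j) = spread i f a [^]\<^sub>\<Gamma> (ns ! j)"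
    unfolding spread_pow[OF i bc sec[OF bc]] spread_pow[OF i ac sec[OF ac]] b(2) ..
   show "\<exists>s\<in>isotypic G \<Gamma> \<beta> (root_character \<theta> j).
     (\<exists>s'\<in>carrier \<Gamma>. s \<otimes>\<^sub>\<Gamma> s' = lift f \<otimes>\<^sub>\<Gamma> lift f \<and> s' \<otimes>\<^sub>\<Gamma> s = lift f \<otimes>\<^sub>\<Gamma> lift f) \<and>
     (\<exists>b\<in>fixed_points G \<Gamma> \<beta>. b [^]\<^sub>\<Gamma> (ns ! j) = s [^]\<^sub>\<Gamma> (ns ! j))"
    by (intro bexI[OF _ spread_isotypic[OF i a(1) sec[OF ac]]] conjI good[OF a(2)]) (rule bexI[OF _ bf], rule bp)
  qed
 qed
qed

end

theorem theorem9p2p10: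
  fixes G :: "('g, nat \<Rightarrow> real) lie_group_rec"
    and n :: nat and ns :: "nat list"
    and \<theta> :: "'g \<Rightarrow> (nat \<Rightarrow> complex) \<times> (nat \<Rightarrow> complex)"
    and A :: "(complex, 'a) tmodule" and \<alpha> :: "'g \<Rightarrow> 'a \<Rightarrow> 'a"
    and M :: "('p, nat \<Rightarrow> real) mfd"
    and I :: "'i set" and U :: "'i \<Rightarrow> 'p set"
    and g :: "'i \<Rightarrow> 'i \<Rightarrow> 'p \<Rightarrow> 'a \<Rightarrow> 'a"
    and E :: "('p, 'a, 'e, 'w, 'i) fibre_bundle" and \<sigma> :: "'g \<Rightarrow> 'e \<Rightarrow> 'e"
  assumes "compact_abelian_lie_group G"
    and "std_identification G n ns \<theta>"
    and "frechet_algebra A"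
    and "smooth_trivial_ncp_bundle G n ns \<theta> A \<alpha>"
    and "alg_iso (fixed_center G A \<alpha>) (scalars :: (complex, complex) tmodule) \<noteq> {}"
    and "fd_manifold M"
    and "\<forall>i\<in>I. openin (mtop M) (U i)"
    and "(\<Union>i\<in>I. U i) = topspace (mtop M)"
    and "equivariant_cocycle G A \<alpha> M I U g"
    and "associated_bundle A M I U g E"
    and "associated_action G A \<alpha> M I U E \<sigma>"
  shows "ncp_bundle G n ns \<theta> (section_algebra A M I U E) (section_action M \<sigma>)"
proof -
  have dyn: "dynamical_system G A \<alpha>" and G12: "ncp_G1 G n \<theta> A \<alpha>" "ncp_G2 G ns \<theta> A \<alpha>"
    using assms(4) by (simp_all add: smooth_trivial_ncp_bundle_def smooth_dynamical_system_def)
  have lc: "lc_algebra A" using dyn by (simp add: dynamical_system_def)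
  have "compact_group G"
    using assms(1) by (simp add: compact_group_def compact_abelian_lie_group_def lie_group_def)
  then have ds: "dynsys G A \<alpha>" using dyn lc by (simp add: dynsys_def dynsys_axioms_def lcalg_def)
  have "alg_bundle A M I U E"
    using lc assms(6,7,8,10) by (intro alg_bundle.intro) (auto simp: fd_manifold_def associated_bundle_def)
  then interpret alg_bundle_action A M I U E G \<alpha> \<sigma>
    using ds assms(11) by (intro alg_bundle_action.intro alg_bundle_action_axioms.intro)
  show ?thesis by (rule ncp_bundle_sections[OF assms(6) G12])
qed

end
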